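(* Let $n$ be a positive integer and let $f_0,\dots,f_n$ be linearly independent functions in $H^1_n$. Then there is an inner function $J$ with the following property: whenever $\lambda_0,\dots,\lambda_n$ are complex numbers with $\sum_{j=0}^n|\lambda_j|>0$ and $I$ is the inner factor of $\sum_{j=0}^n\lambda_jf_j$, the inner function $I_{>n}$ divides $J$.
   Context: $\mathbb{D}$ is the open unit disk and $H^1$ is the usual holomorphic Hardy space on $\mathbb{D}$. $H^1_n$ is the set of holomorphic functions $f$ on $\mathbb{D}$ with $f^{(n)}\in H^1$ (one then has $f\in H^1$). Every non-null $f\in H^1$ factors canonically as $f=I\mathcal{O}$ with $I$ inner (the inner factor of $f$, unique up to a unimodular constant) and $\mathcal{O}$ outer, and $I=BS$ up to a unimodular constant, where $B$ is a Blaschke product (possibly finite or trivial) and $S$ is a singular inner function $S(z)=\exp\left\{-\int_{\mathbb{T}}\frac{\zeta+z}{\zeta-z}\,d\mu(\zeta)\right\}$ with $\mu$ a nonnegative (possibly zero) finite singular measure on the circle $\mathbb{T}$. For an inner function $I=BS$, $B_{>n}$ denotes the Blaschke product obtained from $B$ by removing the zeros of multiplicity $\le n$ (the remaining zeros are kept with their multiplicities unchanged), and $I_{>n}:=B_{>n}S$. An inner function $I_1$ divides an inner function $I_2$ if $I_2/I_1$ is an inner function. *)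

theory Defs
  imports "HOL-Complex_Analysis.Complex_Analysis"
begin

text \<open>
  Functions on the unit disk are represented by total functions on the complex numbers; only
  their restriction to \<open>ball 0 1\<close> matters in every definition below.
\<close>

definition hardy1 :: "(complex \<Rightarrow> complex) set" where
  "hardy1 = {f. f holomorphic_on ball 0 1 \<and>
     bdd_above ((\<lambda>r. LBINT t:{0..2*pi}. norm (f (complex_of_real r * cis t))) ` {0..<1})}"

definition hardy1_deriv :: "nat \<Rightarrow> (complex \<Rightarrow> complex) set" where
  "hardy1_deriv n = {f. f holomorphic_on ball 0 1 \<and> (deriv ^^ n) f \<in> hardy1}"

definition lin_indep_on_disk :: "nat \<Rightarrow> (nat \<Rightarrow> complex \<Rightarrow> complex) \<Rightarrow> bool" where
  "lin_indep_on_disk n f \<longleftrightarrow>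
     (\<forall>c :: nat \<Rightarrow> complex. (\<forall>z\<in>ball 0 1. (\<Sum>j\<le>n. c j * f j z) = 0) \<longrightarrow> (\<forall>j\<le>n. c j = 0))"

definition inner_function :: "(complex \<Rightarrow> complex) \<Rightarrow> bool" where
  "inner_function I \<longleftrightarrow> I holomorphic_on ball 0 1 \<and> (\<forall>z\<in>ball 0 1. norm (I z) \<le> 1) \<and>
     (AE t in lborel. \<exists>w. norm w = 1 \<and>
        ((\<lambda>r. I (complex_of_real r * cis t)) \<longlongrightarrow> w) (at_left 1))"

definition outer_function :: "(complex \<Rightarrow> complex) \<Rightarrow> bool" where
  "outer_function F \<longleftrightarrow> (\<exists>(c::complex) (\<phi>::real \<Rightarrow> real). norm c = 1 \<and>
     (\<forall>t\<in>{0..2*pi}. \<phi> t > 0) \<and> set_integrable lborel {0..2*pi} (\<lambda>t. ln (\<phi> t)) \<and>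
     (\<forall>z\<in>ball 0 1. F z = c * exp (1 / (2 * pi) *
        (LBINT t:{0..2*pi}. (cis t + z) / (cis t - z) * complex_of_real (ln (\<phi> t))))))"

definition is_inner_factor :: "(complex \<Rightarrow> complex) \<Rightarrow> (complex \<Rightarrow> complex) \<Rightarrow> bool" where
  "is_inner_factor I f \<longleftrightarrow> inner_function I \<and>
     (\<exists>F. outer_function F \<and> (\<forall>z\<in>ball 0 1. f z = I z * F z))"

text \<open>
  The quotient of the two inner functions has removable singularities at the zeros of the
  divisor, so it is expressed as a cofactor instead of by pointwise division.
\<close>

definition inner_divides :: "(complex \<Rightarrow> complex) \<Rightarrow> (complex \<Rightarrow> complex) \<Rightarrow> bool" where
  "inner_divides I1 I2 \<longleftrightarrow> (\<exists>Q. inner_function Q \<and> (\<forall>z\<in>ball 0 1. I2 z = I1 z * Q z))"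

text \<open>
  The zeros of a Blaschke product are given by a multiplicity function \<open>m\<close>: the point \<open>a\<close> is a
  zero of order \<open>m a\<close>. Summability (the Blaschke condition) makes the support countable and the
  product over it unconditionally convergent, so its value is the limit of the net of finite
  partial products. Empty and finite supports are included.
\<close>

definition blaschke_zeros :: "(complex \<Rightarrow> nat) \<Rightarrow> bool" where
  "blaschke_zeros m \<longleftrightarrow> {a. m a > 0} \<subseteq> ball 0 1 \<and>
     (\<lambda>a. real (m a) * (1 - norm a)) summable_on {a. m a > 0}"

definition blaschke_factor :: "complex \<Rightarrow> complex \<Rightarrow> complex" where
  "blaschke_factor a z =
     (if a = 0 then z else (complex_of_real (norm a) / a) * ((a - z) / (1 - cnj a * z)))"

definition blaschke_product :: "(complex \<Rightarrow> nat) \<Rightarrow> complex \<Rightarrow> complex" where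
  "blaschke_product m z =
     Lim (finite_subsets_at_top {a. m a > 0}) (\<lambda>A. \<Prod>a\<in>A. blaschke_factor a z ^ m a)"

definition arc_length :: "complex measure" where
  "arc_length = distr (restrict_space lborel {0..2*pi}) borel cis"

definition singular_circle_measure :: "complex measure \<Rightarrow> bool" where
  "singular_circle_measure \<mu> \<longleftrightarrow> finite_measure \<mu> \<and> sets \<mu> = sets borel \<and>
     emeasure \<mu> (- sphere 0 1) = 0 \<and>
     (\<exists>N\<in>sets borel. emeasure arc_length N = 0 \<and> emeasure \<mu> (- N) = 0)"

definition singular_inner :: "complex measure \<Rightarrow> complex \<Rightarrow> complex" where
  "singular_inner \<mu> z = exp (- (LINT \<zeta>|\<mu>. (\<zeta> + z) / (\<zeta> - z)))"

text \<open>
  \<open>is_inner_gt n I K\<close> says that \<open>K\<close> is the function \<open>I\<^sub>>\<^sub>n\<close>: writing \<open>I\<close> as a unimodular constant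
  times a Blaschke product \<open>B\<close> times a singular inner function \<open>S\<close>, \<open>K\<close> is \<open>B\<^sub>>\<^sub>n * S\<close>, where \<open>B\<^sub>>\<^sub>n\<close>
  keeps the zeros of \<open>B\<close> of multiplicity greater than \<open>n\<close> with unchanged multiplicities. It is a
  relation because \<open>B\<close>, \<open>S\<close> come from the canonical factorization, which determines them uniquely.
\<close>

definition is_inner_gt :: "nat \<Rightarrow> (complex \<Rightarrow> complex) \<Rightarrow> (complex \<Rightarrow> complex) \<Rightarrow> bool" where
  "is_inner_gt n I K \<longleftrightarrow> (\<exists>c m \<mu>. norm (c::complex) = 1 \<and> blaschke_zeros m \<and>
     singular_circle_measure \<mu> \<and>
     (\<forall>z\<in>ball 0 1. I z = c * blaschke_product m z * singular_inner \<mu> z) \<and>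
     (\<forall>z\<in>ball 0 1. K z =
        blaschke_product (\<lambda>a. if m a > n then m a else 0) z * singular_inner \<mu> z))"

end

theory Submission imports Defs begin

text \<open>
  Let \<open>g = \<Sum>j\<le>n. l j * f j\<close> be a nontrivial combination, with inner factor \<open>I = c * B * S\<close>, where \<open>S\<close> is the singular
  inner function of \<open>\<mu>\<close>. The (iterated) Wronskian \<open>W\<close> of \<open>f 0, \<dots>, f n\<close> does not depend on \<open>l\<close>, but for every \<open>l\<close> it is a combination of
  \<open>g, g', \<dots>\<close> up to the derivative of order \<open>n\<close>, with holomorphic coefficients of polynomial growth
  (\<open>iter_wronskian_combo\<close>). Hence it inherits, to a smaller degree, the zeros of \<open>g\<close> of multiplicity above \<open>n\<close> and
  the decay caused by \<open>S\<close>. A suitable power of \<open>W\<close> makes up for the smaller degree, and \<open>J\<close> is its inner part.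

  The derivatives of \<open>f j\<close> up to order \<open>n\<close> have a common majorant \<open>Re A\<close> with \<open>A\<close> holomorphic, so a zero-free factor \<open>E\<close>
  makes \<open>W * E\<close> bounded by 1 (\<open>bounded_wronskian_multiple\<close>). Put \<open>h = (W * E)^N\<close> with \<open>N = n + 12\<close>. As a bounded function
  \<open>h\<close> has integrable \<open>\<psi> = - ln |h|\<close> on the circle, and \<open>J = h * exp H\<close> is inner, where \<open>H\<close> is the Herglotz integral of \<open>\<psi>\<close>
  (\<open>inner_part\<close>; it rests on Fatou's theorem, which is proved from an \<open>L\<^sup>2\<close> maximal inequality).

  It remains to see that \<open>J\<close> is divisible by \<open>K = B' * S\<close>, where \<open>B'\<close> keeps the zeros of multiplicity above \<open>n\<close>. The zeros
  are a matter of counting. For \<open>S\<close>, write \<open>u = - ln |S|\<close> and let \<open>v\<close> be a positive Poisson integral with \<open>|g| \<le> exp (v - u)\<close>.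
  Cauchy's estimate and Harnack's inequality give

    \<open>|h z| \<le> C * (1 - |z|)^(-M) * exp (144 * v z - u z)\<close>.

  The factor \<open>(1 - |z|)^(-M)\<close> is the difficulty. It matters only near the support of \<open>\<mu>\<close>, where \<open>g\<close> has boundary zeros. There
  the bound \<open>|g'| \<le> Re A\<close> forces \<open>|g|\<close> to decay like \<open>1 - r\<close> (\<open>boundary_zero_decay\<close>). As \<open>ln |g|\<close> is integrable, the
  set of points of the circle within \<open>K * (1 - r)\<close> of the support must be so small that its measure times \<open>ln (1 / (1 - r))\<close>
  tends to 0 (\<open>carleson_condition\<close>, in the spirit of Carleson's condition on zero sets of smooth functions). So the factor is
  invisible to Jensen's inequality on circles of radius \<open>r\<close> tending to 1, and away from the support \<open>u\<close> is negligible. The result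
  is \<open>key_estimate\<close>: if \<open>h = b * q\<close> with a finite Blaschke product \<open>b\<close>, then \<open>|q| \<le> |S| * exp (- Re H)\<close>. It says that
  \<open>J / (b * S)\<close> is bounded by 1. Exhausting the zeros of \<open>B'\<close> by finite sets and applying Montel's theorem yields \<open>J = K * Q\<close> with
  \<open>|Q| \<le> 1\<close>, and \<open>Q\<close> is inner because \<open>|J| \<le> |Q|\<close>.
\<close>

section \<open>The Poisson kernel\<close>

text \<open>
  Normalised arc length, carried by the angle, so that boundary functions are functions of a real
  variable.
\<close>

definition circ :: "real measure" where
  "circ = density lborel (\<lambda>t. ennreal (indicator {0..2*pi} t / (2*pi)))"

abbreviation polar :: "real \<Rightarrow> real \<Rightarrow> complex" where
  "polar r t \<equiv> complex_of_real r * cis t"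

definition poisson :: "complex \<Rightarrow> complex \<Rightarrow> real" where
  "poisson z w = (1 - (norm z)^2) / (norm (w - z))^2"

lemma sets_circ [simp, measurable_cong]: "sets circ = sets borel"
  by (simp add: circ_def)

lemma space_circ [simp]: "space circ = UNIV"
  by (simp add: circ_def)

lemma emeasure_circ:
  assumes "A \<in> sets borel"
  shows "emeasure circ A = emeasure lborel (A \<inter> {0..2*pi}) / ennreal (2*pi)"
proof -
  have eq: "ennreal (indicator {0..2*pi} t / (2*pi)) * indicator A t
      = ennreal (1/(2*pi)) * indicator (A \<inter> {0..2*pi}) t" for t
    by (auto simp: indicator_def)
  have "emeasure circ A = (\<integral>\<^sup>+t. ennreal (1/(2*pi)) * indicator (A \<inter> {0..2*pi}) t \<partial>lborel)"
    using assms by (simp add: circ_def emeasure_density eq)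
  also have "\<dots> = ennreal (1/(2*pi)) * emeasure lborel (A \<inter> {0..2*pi})"
    using assms by (subst nn_integral_cmult_indicator) auto
  also have "ennreal (1/(2*pi)) = inverse (ennreal (2*pi))"
    by (simp add: inverse_ennreal inverse_eq_divide)
  finally show ?thesis by (simp add: divide_ennreal_def mult.commute)
qed

lemma emeasure_circ_UNIV [simp]: "emeasure circ UNIV = 1"
  by (subst emeasure_circ) auto

lemma finite_measure_circ [simp]: "finite_measure circ"
  by (rule finite_measureI) simp

interpretation circ: finite_measure circ by (rule finite_measure_circ)

lemma measure_circ_UNIV [simp]: "measure circ UNIV = 1"
  by (simp add: measure_def)

lemma AE_circ_iff: "(AE t in circ. P t) \<longleftrightarrow> (AE t in lborel. t \<in> {0..2*pi} \<longrightarrow> P t)"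
proof -
  have "0 < ennreal (indicator {0..2*pi} t / (2*pi)) \<longleftrightarrow> t \<in> {0..2*pi}" for t
    by (auto simp: indicator_def)
  then show ?thesis unfolding circ_def by (subst AE_density) auto
qed

lemma integral_circ:
  fixes f :: "real \<Rightarrow> 'a::{banach,second_countable_topology}"
  assumes [measurable]: "f \<in> borel_measurable borel"
  shows "(LINT t|circ. f t) = (LBINT t:{0..2*pi}. f t) /\<^sub>R (2*pi)"
proof -
  have "(LINT t|circ. f t) = (LINT t|lborel. (indicator {0..2*pi} t / (2*pi)) *\<^sub>R f t)"
    unfolding circ_def by (rule integral_density) (auto simp: indicator_def)
  also have "\<dots> = (LINT t|lborel. (1/(2*pi)) *\<^sub>R (indicator {0..2*pi} t *\<^sub>R f t))"
    by (intro Bochner_Integration.integral_cong) auto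
  also have "\<dots> = (1/(2*pi)) *\<^sub>R (LINT t|lborel. (indicator {0..2*pi} t *\<^sub>R f t))"
    by (rule integral_scaleR_right)
  finally show ?thesis by (simp add: set_lebesgue_integral_def inverse_eq_divide)
qed

lemma integrable_circ_iff:
  fixes f :: "real \<Rightarrow> 'a::{banach,second_countable_topology}"
  assumes [measurable]: "f \<in> borel_measurable borel"
  shows "integrable circ f \<longleftrightarrow> set_integrable lborel {0..2*pi} f"
proof -
  have "integrable circ f \<longleftrightarrow> integrable lborel (\<lambda>t. (indicator {0..2*pi} t / (2*pi)) *\<^sub>R f t)"
    unfolding circ_def by (rule integrable_density) (auto simp: indicator_def)
  also have "(\<lambda>t. (indicator {0..2*pi} t / (2*pi)) *\<^sub>R f t) = (\<lambda>t. (1/(2*pi)) *\<^sub>R (indicator {0..2*pi} t *\<^sub>R f t))"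
    by auto
  also have "integrable lborel \<dots> \<longleftrightarrow> integrable lborel (\<lambda>t. indicator {0..2*pi} t *\<^sub>R f t)"
    (is "integrable _ (\<lambda>t. (1/(2*pi)) *\<^sub>R ?g t) \<longleftrightarrow> _")
    using integrable_scaleR_right[of "1/(2*pi)" lborel ?g]
      integrable_scaleR_right[of "2*pi" lborel "\<lambda>t. (1/(2*pi)) *\<^sub>R ?g t"] by auto
  finally show ?thesis by (simp add: set_integrable_def)
qed

lemma borel_measurable_cis [measurable]: "cis \<in> borel_measurable borel"
  by (intro borel_measurable_continuous_onI continuous_intros)

lemma integrable_circ_bounded:
  fixes f :: "real \<Rightarrow> 'a::{banach,second_countable_topology}"
  assumes "f \<in> borel_measurable borel" "\<And>t. norm (f t) \<le> B"
  shows "integrable circ f"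
  using assms by (intro circ.integrable_const_bound[where B=B]) auto

lemma integrable_circ_continuous:
  fixes f :: "complex \<Rightarrow> 'a::{banach,second_countable_topology}"
  assumes "continuous_on (sphere 0 1) f"
  shows "integrable circ (\<lambda>t. f (cis t))"
proof -
  have c: "continuous_on UNIV (\<lambda>t. f (cis t))"
    by (rule continuous_on_compose2[OF assms]) (auto intro!: continuous_intros)
  have "bounded (f ` sphere 0 1)"
    by (intro compact_imp_bounded compact_continuous_image assms compact_sphere)
  then obtain B where "\<And>w. w \<in> sphere 0 1 \<Longrightarrow> norm (f w) \<le> B"
    unfolding bounded_iff by blast
  then show ?thesis
    by (intro integrable_circ_bounded[where B=B] borel_measurable_continuous_onI c) auto
qed

text \<open>The bridge from Cauchy's formula to means over the circle.\<close>

lemma circ_mean_contour: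
  assumes f: "(f has_contour_integral X) (circlepath 0 1)" and c: "continuous_on (sphere 0 1) f"
  shows "(LINT t|circ. f (cis t) * cis t) = X / (2 * pi * \<i>)"
proof -
  have "((\<lambda>t. f (cis t) * \<i> * cis t) has_integral X) {0..2*pi}"
    using f unfolding circlepath_def
    by (simp add: has_contour_integral_part_circlepath_iff cis_conv_exp mult_ac)
  then have "((\<lambda>t. f (cis t) * cis t * \<i>) has_integral X) {0..2*pi}" by (simp add: mult_ac)
  from has_integral_mult_left[OF this, of "-\<i>"]
  have hi: "((\<lambda>t. f (cis t) * cis t) has_integral X * (-\<i>)) {0..2*pi}"
    by (simp only: mult.assoc mult_minus_right complex_i_mult_minus i_squared minus_minus mult_1_right)
  have ct: "continuous_on UNIV (\<lambda>t. f (cis t) * cis t)"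
    by (intro continuous_intros continuous_on_compose2[OF c]) auto
  have m: "(\<lambda>t. f (cis t) * cis t) \<in> borel_measurable borel"
    by (rule borel_measurable_continuous_onI[OF ct])
  have si: "set_integrable lborel {0..2*pi} (\<lambda>t. f (cis t) * cis t)"
    by (rule borel_integrable_atLeastAtMost') (rule continuous_on_subset[OF ct], simp)
  have "(LBINT t:{0..2*pi}. f (cis t) * cis t) = X * (-\<i>)"
    using set_borel_integral_eq_integral(2)[OF si] hi by (simp add: integral_unique)
  moreover have "X / (2 * pi * \<i>) = X * (-\<i>) / (2 * pi)"
    by (simp add: field_simps)
  ultimately show ?thesis using integral_circ[OF m]
    by (simp add: scaleR_conv_of_real inverse_eq_divide)
qed

lemma poisson_nonneg: "norm z \<le> 1 \<Longrightarrow> 0 \<le> poisson z w"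
  by (simp add: poisson_def power_le_one)

lemma poisson_pos: "norm z < 1 \<Longrightarrow> norm w = 1 \<Longrightarrow> 0 < poisson z w"
  unfolding poisson_def by (intro divide_pos_pos) (auto simp: power_less_one_iff abs_square_less_1)

text \<open>
  On the circle \<open>cnj w = 1 / w\<close>. The Poisson kernel therefore splits into a Cauchy kernel and a
  factor that is holomorphic in \<open>w\<close> across the closed disc.
\<close>

lemma poisson_factor:
  assumes "norm z < 1" "norm w = 1"
  shows "complex_of_real (poisson z w) = w / (w - z) * ((1 - (norm z)^2) / (1 - cnj z * w))"
proof -
  have w: "w * cnj w = 1" using assms by (simp add: complex_norm_square[symmetric])
  have "w \<noteq> z" using assms by auto
  have e: "1 - cnj z * w = w * cnj (w - z)" using w by (simp add: algebra_simps)
  have "w \<noteq> 0" using assms by auto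
  have "complex_of_real ((norm (w - z))^2) = (w - z) * cnj (w - z)"
    by (simp only: complex_norm_square)
  then have "complex_of_real (poisson z w) = (1 - (norm z)^2) / ((w - z) * cnj (w - z))"
    unfolding poisson_def by (simp only: of_real_divide of_real_diff of_real_1)
  then show ?thesis unfolding e using \<open>w \<noteq> 0\<close> by simp
qed

text \<open>
  By \<open>poisson_factor\<close> this is Cauchy's formula for \<open>f w * (1 - |z|^2) / (1 - cnj z * w)\<close>, whose
  value at \<open>w = z\<close> is \<open>f z\<close>.
\<close>

lemma poisson_formula:
  assumes f: "f holomorphic_on ball 0 R" and R: "R > 1" and z: "norm z < 1"
  shows "(LINT t|circ. complex_of_real (poisson z (cis t)) * f (cis t)) = f z"
proof -
  have sub: "cball 0 1 \<subseteq> ball (0::complex) R" using R by auto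
  define g where "g = (\<lambda>u. f u * ((1 - (norm z)^2) / (1 - cnj z * u)))"
  have nz: "1 - cnj z * u \<noteq> 0" if "norm u \<le> 1" for u
  proof
    assume "1 - cnj z * u = 0"
    then have "norm (cnj z * u) = 1" by (metis eq_iff_diff_eq_0 norm_one)
    moreover have "norm (cnj z * u) \<le> norm z * 1"
      unfolding norm_mult complex_mod_cnj using that by (intro mult_left_mono) auto
    ultimately show False using z by simp
  qed
  have g: "g holomorphic_on cball 0 1"
    unfolding g_def using nz by (intro holomorphic_intros holomorphic_on_subset[OF f sub]) auto
  have gz: "g z = f z"
  proof -
    have "1 - cnj z * z = complex_of_real (1 - (norm z)^2)"
      by (simp only: complex_norm_square of_real_diff of_real_1 mult.commute)
    moreover have "1 - (norm z)^2 \<noteq> 0" using z by (metis abs_norm_cancel abs_square_less_1 less_irrefl right_minus_eq)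
    ultimately show ?thesis unfolding g_def
      by (metis (no_types, lifting) divide_self_if mult.right_neutral of_real_eq_0_iff of_real_1 of_real_diff of_real_power)
  qed
  have ci: "((\<lambda>u. g u / (u - z)) has_contour_integral (2 * of_real pi * \<i> * g z)) (circlepath 0 1)"
    by (rule Cauchy_integral_circlepath_simple) (use g z in auto)
  have "(LINT t|circ. g (cis t) / (cis t - z) * cis t) = 2 * of_real pi * \<i> * g z / (2 * pi * \<i>)"
    using z holomorphic_on_imp_continuous_on[OF g]
    by (intro circ_mean_contour[OF ci] continuous_intros) (auto elim: continuous_on_subset)
  also have "\<dots> = f z" using gz by simp
  also have "(\<lambda>t. g (cis t) / (cis t - z) * cis t) = (\<lambda>t. complex_of_real (poisson z (cis t)) * f (cis t))"
    using z by (simp add: poisson_factor g_def fun_eq_iff mult_ac)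
  finally show ?thesis .
qed

lemma continuous_on_poisson:
  assumes "norm z < 1" shows "continuous_on (sphere 0 1) (poisson z)"
  unfolding poisson_def[abs_def] using assms by (intro continuous_intros) auto

lemma measurable_poisson [measurable]: "(\<lambda>t. poisson z (cis t)) \<in> borel_measurable borel"
  unfolding poisson_def by measurable

lemma measurable_poisson_comp [measurable (raw)]:
  assumes "f \<in> borel_measurable M" "g \<in> borel_measurable M"
  shows "(\<lambda>x. poisson (f x) (g x)) \<in> borel_measurable M"
  using assms unfolding poisson_def by measurable

lemma integrable_poisson: "norm z < 1 \<Longrightarrow> integrable circ (\<lambda>t. poisson z (cis t))"
  by (rule integrable_circ_continuous[OF continuous_on_poisson])

lemma integral_poisson:
  assumes "norm z < 1" shows "(LINT t|circ. poisson z (cis t)) = 1"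
proof -
  have "complex_of_real (LINT t|circ. poisson z (cis t)) = (LINT t|circ. complex_of_real (poisson z (cis t)))"
    by (rule integral_complex_of_real[symmetric])
  also have "\<dots> = 1" using poisson_formula[of "\<lambda>_. 1" 2 z] assms by simp
  finally show ?thesis by (simp add: of_real_eq_1_iff)
qed

lemma poisson_formula_Re:
  assumes f: "f holomorphic_on ball 0 R" and R: "R > 1" and z: "norm z < 1"
  shows "(LINT t|circ. poisson z (cis t) * Re (f (cis t))) = Re (f z)"
proof -
  have "continuous_on (sphere 0 1) f"
    by (rule continuous_on_subset[OF holomorphic_on_imp_continuous_on[OF f]]) (use R in auto)
  then have "integrable circ (\<lambda>t. complex_of_real (poisson z (cis t)) * f (cis t))"
    using z by (intro integrable_circ_continuous[of "\<lambda>w. complex_of_real (poisson z w) * f w"] continuous_intros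
        continuous_on_of_real continuous_on_poisson) auto
  from integral_Re[OF this] show ?thesis using poisson_formula[OF assms] by simp
qed

lemma poisson_swap:
  assumes "norm a = 1" "norm b = 1"
  shows "poisson (complex_of_real r * a) b = poisson (complex_of_real r * b) a"
proof -
  have "(norm (b - r * a))^2 = (norm b)^2 + r^2 * (norm a)^2 - 2 * r * (Re a * Re b + Im a * Im b)"
    unfolding cmod_power2 by (simp add: power2_eq_square algebra_simps)
  moreover have "(norm (a - r * b))^2 = (norm a)^2 + r^2 * (norm b)^2 - 2 * r * (Re a * Re b + Im a * Im b)"
    unfolding cmod_power2 by (simp add: power2_eq_square algebra_simps)
  ultimately show ?thesis using assms by (simp add: poisson_def norm_mult)
qed

lemma poisson_Re:
  assumes z: "norm z < 1" and w: "norm w = 1"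
  shows "Re ((w + z) / (w - z)) = poisson z w"
proof -
  have "w \<noteq> z" using assms by auto
  have "(w + z) / (w - z) = (w + z) * cnj (w - z) / complex_of_real ((norm (w - z))^2)"
    using \<open>w \<noteq> z\<close> unfolding complex_norm_square by simp
  also have "Re \<dots> = Re ((w + z) * cnj (w - z)) / (norm (w - z))^2"
    by (metis Re_divide_of_real)
  also have "Re ((w + z) * cnj (w - z)) = (norm w)^2 - (norm z)^2"
    unfolding cmod_power2 by (simp add: power2_eq_square algebra_simps)
  finally show ?thesis using w by (simp add: poisson_def)
qed

text \<open>
  For fixed \<open>b\<close> the function \<open>poisson (s * b)\<close> is, up to \<open>poisson_swap\<close>, the real part of a
  function holomorphic beyond the closed disc, which the Poisson formula reproduces at \<open>r * a\<close>.
\<close>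

lemma poisson_semigroup:
  assumes a: "norm a = 1" and b: "norm b = 1" and r: "0 \<le> r" "r < 1" and s: "0 \<le> s" "s < 1"
  shows "(LINT t|circ. poisson (complex_of_real r * a) (cis t) * poisson (complex_of_real s * b) (cis t))
      = poisson (complex_of_real (r * s) * a) b"
proof -
  define f where "f = (\<lambda>z::complex. (b + s * z) / (b - s * z))"
  obtain R where R: "R > 1" "s * R < 1"
  proof (cases "s = 0")
    case True then show ?thesis using that[of 2] by auto
  next
    case False
    define R where "R = (1 + 1/s)/2"
    have "1 < 1/s" using False s by simp
    then have "R > 1" by (simp add: R_def)
    moreover have "s * R = (s + 1)/2" using False by (simp add: R_def field_simps)
    ultimately show ?thesis using that s by auto
  qed
  have sz: "norm (complex_of_real s * z) < 1" if "norm z < R" for z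
  proof -
    have "norm (complex_of_real s * z) \<le> s * R" using s that by (auto simp: norm_mult intro!: mult_left_mono)
    then show ?thesis using R by simp
  qed
  have "f holomorphic_on ball 0 R"
    unfolding f_def using sz b by (intro holomorphic_intros) fastforce
  from poisson_formula_Re[OF this \<open>R > 1\<close>, of "r * a"]
  have "(LINT t|circ. poisson (r * a) (cis t) * Re (f (cis t))) = Re (f (r * a))"
    using r a by (simp add: norm_mult)
  moreover have "Re (f (cis t)) = poisson (s * b) (cis t)" for t
  proof -
    have "Re (f (cis t)) = poisson (s * cis t) b"
      unfolding f_def using b sz[of "cis t"] R by (intro poisson_Re) auto
    then show ?thesis using poisson_swap[of "cis t" b s] b by simp
  qed
  moreover have "Re (f (r * a)) = poisson (complex_of_real (r * s) * a) b"
  proof -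
    have "norm (complex_of_real r * a) < R" using a r R by (simp add: norm_mult)
    from sz[OF this] have "Re (f (r * a)) = poisson (s * (r * a)) b"
      unfolding f_def using b by (intro poisson_Re) auto
    then show ?thesis by (simp add: mult_ac)
  qed
  ultimately show ?thesis by simp
qed

lemma poisson_upper:
  assumes "norm z < 1" "norm w = 1"
  shows "poisson z w \<le> 2 / (1 - norm z)"
proof -
  have d: "1 - norm z \<le> norm (w - z)" using norm_triangle_ineq2[of w z] assms by simp
  have "poisson z w \<le> (1 - (norm z)^2) / (1 - norm z)^2"
    unfolding poisson_def using assms d
    by (intro divide_left_mono power_mono mult_pos_pos zero_less_power)
       (auto simp: power_le_one)
  also have "\<dots> = (1 + norm z) / (1 - norm z)"
  proof -
    have "1 - (norm z)^2 = (1 + norm z) * (1 - norm z)" by (simp add: power2_eq_square algebra_simps)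
    then show ?thesis using assms by (simp add: power2_eq_square)
  qed
  also have "\<dots> \<le> 2 / (1 - norm z)" using assms by (intro divide_right_mono) auto
  finally show ?thesis .
qed

text \<open>Moving \<open>a\<close> to \<open>r * a\<close> costs at most \<open>d / 2\<close>, so \<open>b\<close> stays at distance \<open>d / 2\<close> from the pole.\<close>

lemma poisson_far:
  assumes r: "0 \<le> r" "r < 1" and a: "norm a = 1" and b: "norm b = 1" and d: "d > 0" "norm (b - a) \<ge> d" "1 - r \<le> d/2"
  shows "poisson (complex_of_real r * a) b \<le> 8 * (1 - r) / d^2"
proof -
  have "norm (b - a) \<le> norm (b - r * a) + norm (r * a - a)"
    using norm_triangle_ineq[of "b - r * a" "r * a - a"] by simp
  also have "norm (r * a - a) = 1 - r"
  proof -
    have "r * a - a = complex_of_real (r - 1) * a" by (simp add: algebra_simps)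
    then show ?thesis using a r by (simp only: norm_mult norm_of_real) auto
  qed
  finally have "norm (b - r * a) \<ge> d/2" using d by linarith
  then have "(norm (b - r*a))^2 \<ge> (d/2)^2" using d by (intro power_mono) auto
  moreover have "1 - (norm (r * a))^2 \<le> 2 * (1 - r)"
  proof -
    have "0 \<le> (1 - r)^2" by simp
    then show ?thesis using a r by (simp add: norm_mult power2_eq_square algebra_simps)
  qed
  ultimately have "poisson (r * a) b \<le> (2 * (1 - r)) / (d/2)^2"
    unfolding poisson_def using d r by (intro frac_le) auto
  then show ?thesis by (simp add: power2_eq_square)
qed

text \<open>
  The Poisson kernel is an approximate identity: uniform continuity of \<open>\<psi>\<close> handles the points near
  \<open>a\<close>, \<open>poisson_far\<close> the others.
\<close>

lemma poisson_approx:
  fixes \<psi> :: "complex \<Rightarrow> real"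
  assumes c: "continuous_on (sphere 0 1) \<psi>" and e: "e > 0"
  obtains r0 where "0 \<le> r0" "r0 < 1"
    "\<And>r a. r0 \<le> r \<Longrightarrow> r < 1 \<Longrightarrow> norm a = 1 \<Longrightarrow>
       \<bar>(LINT t|circ. poisson (complex_of_real r * a) (cis t) * \<psi> (cis t)) - \<psi> a\<bar> \<le> e"
proof -
  have "bounded (\<psi> ` sphere 0 1)"
    by (intro compact_imp_bounded compact_continuous_image c compact_sphere)
  then obtain B where B: "B > 0" "\<And>w. w \<in> sphere 0 1 \<Longrightarrow> \<bar>\<psi> w\<bar> \<le> B"
    unfolding bounded_pos by auto
  have "uniformly_continuous_on (sphere 0 1) \<psi>"
    by (intro compact_uniformly_continuous c compact_sphere)
  then obtain d where d: "d > 0" "\<And>x y. norm x = 1 \<Longrightarrow> norm y = 1 \<Longrightarrow> norm (y - x) < d \<Longrightarrow> \<bar>\<psi> y - \<psi> x\<bar> < e/2"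
    unfolding uniformly_continuous_on_def using e
    by (metis dist_norm dist_real_def half_gt_zero mem_sphere_0)
  define r0 where "r0 = max 0 (1 - min (d/2) (e * d^2 / (32 * B)))"
  have r0: "0 \<le> r0" "r0 < 1" using d e B by (auto simp: r0_def)
  show ?thesis
  proof (rule that[OF r0])
    fix r a assume r: "r0 \<le> r" "r < 1" and a: "norm (a::complex) = 1"
    have r': "0 \<le> r" "1 - r \<le> d/2" "1 - r \<le> e * d^2 / (32 * B)" using r r0 by (auto simp: r0_def)
    let ?P = "\<lambda>t. poisson (complex_of_real r * a) (cis t)"
    have nz: "norm (complex_of_real r * a) < 1" using a r r' by (simp add: norm_mult)
    have i1: "integrable circ (\<lambda>t. ?P t * \<psi> (cis t))"
      by (intro integrable_circ_continuous[of "\<lambda>w. poisson (r*a) w * \<psi> w"] continuous_intros continuous_on_poisson nz c)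
    have "(LINT t|circ. ?P t * \<psi> (cis t)) - \<psi> a = (LINT t|circ. ?P t * \<psi> (cis t)) - (LINT t|circ. ?P t * \<psi> a)"
      using integral_poisson[OF nz] by simp
    also have "\<dots> = (LINT t|circ. ?P t * \<psi> (cis t) - ?P t * \<psi> a)"
      using i1 integrable_poisson[OF nz] by simp
    also have "\<bar>\<dots>\<bar> \<le> (LINT t|circ. ?P t * (e/2) + 8 * (1 - r) / d^2 * (2 * B))"
    proof (rule integral_abs_bound_integral)
      show "integrable circ (\<lambda>t. ?P t * \<psi> (cis t) - ?P t * \<psi> a)"
        using i1 integrable_poisson[OF nz] by simp
      show "integrable circ (\<lambda>t. ?P t * (e/2) + 8 * (1 - r) / d^2 * (2 * B))"
        using integrable_poisson[OF nz] by (intro Bochner_Integration.integrable_add) auto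
      fix t
      have P0: "?P t \<ge> 0" using nz by (intro poisson_nonneg) auto
      have eq: "\<bar>?P t * \<psi> (cis t) - ?P t * \<psi> a\<bar> = ?P t * \<bar>\<psi> (cis t) - \<psi> a\<bar>"
        using P0 by (simp add: right_diff_distrib[symmetric] abs_mult)
      show "\<bar>?P t * \<psi> (cis t) - ?P t * \<psi> a\<bar> \<le> ?P t * (e/2) + 8 * (1 - r) / d^2 * (2 * B)"
      proof (cases "norm (cis t - a) < d")
        case True
        then have "\<bar>\<psi> (cis t) - \<psi> a\<bar> \<le> e/2" using d(2)[of a "cis t"] a by auto
        then have "?P t * \<bar>\<psi> (cis t) - \<psi> a\<bar> \<le> ?P t * (e/2)" using P0 by (rule mult_left_mono)
        moreover have "0 \<le> 8 * (1 - r) / d^2 * (2 * B)" using r B by auto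
        ultimately show ?thesis unfolding eq by linarith
      next
        case False
        then have P1: "?P t \<le> 8 * (1 - r) / d^2" using r r' a d by (intro poisson_far) auto
        have "\<bar>\<psi> (cis t) - \<psi> a\<bar> \<le> 2 * B" using B(2)[of "cis t"] B(2)[of a] a by auto
        then have "?P t * \<bar>\<psi> (cis t) - \<psi> a\<bar> \<le> 8 * (1 - r) / d^2 * (2 * B)"
          using P1 P0 r by (intro mult_mono) auto
        moreover have "0 \<le> ?P t * (e/2)" using P0 e by auto
        ultimately show ?thesis unfolding eq by linarith
      qed
    qed
    also have "\<dots> = e/2 + 16 * (1 - r) * B / d^2"
      using integrable_poisson[OF nz] integral_poisson[OF nz] by (simp add: field_simps)
    also have "16 * (1 - r) * B / d^2 \<le> e/2"
      using r' B d by (simp add: field_simps)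
    finally show "\<bar>(LINT t|circ. ?P t * \<psi> (cis t)) - \<psi> a\<bar> \<le> e" by simp
  qed
qed

text \<open>
  Harnack's inequality on the disc that reaches half way to the circle. The constant 12 is what
  fixes the power of the Wronskian in the final inner function.
\<close>

lemma poisson_harnack:
  assumes z: "norm z < 1" and w: "norm (w - z) \<le> (1 - norm z)/2" and u: "norm u = 1"
  shows "poisson w u \<le> 12 * poisson z u" "poisson z u \<le> 12 * poisson w u"
proof -
  have w: "2 * norm (w - z) \<le> 1 - norm z" using w by simp
  have nw1: "2 * norm w \<le> norm z + 1" using norm_triangle_sub[of w z] w by linarith
  have nw2: "3 * norm z \<le> 2 * norm w + 1" using norm_triangle_sub[of z w] w norm_minus_commute[of z w] by linarith
  have w1: "norm w < 1" using nw1 z by linarith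
  have dz: "1 - norm z \<le> norm (u - z)" "1 - norm w \<le> norm (u - w)"
    using norm_triangle_ineq2[of u z] norm_triangle_ineq2[of u w] u by auto
  have "norm (u - w) \<le> norm (u - z) + norm (w - z)"
    by (metis norm_triangle_ineq4 diff_diff_eq2 add_diff_cancel diff_add_cancel)
  then have a1: "norm (u - w) \<le> 3/2 * norm (u - z)" using dz w by linarith
  have "norm (u - z) \<le> norm (u - w) + norm (w - z)"
    using norm_triangle_ineq[of "u - w" "w - z"] by simp
  then have a2: "norm (u - z) \<le> 2 * norm (u - w)" using dz w nw1 by linarith
  have pz: "norm (u - z) > 0" "norm (u - w) > 0" using dz z w1 by linarith+
  have b1: "1 - (norm w)^2 \<le> 3 * (1 - (norm z)^2)"
  proof -
    have "(2 * (1 - norm w)) * (1 + norm w) \<le> (3 * (1 - norm z)) * (2 * (1 + norm z))"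
      using nw1 nw2 z w1 norm_ge_zero[of z] norm_ge_zero[of w] by - (rule mult_mono; smt (verit))
    then show ?thesis by (simp add: power2_eq_square algebra_simps)
  qed
  have b2: "1 - (norm z)^2 \<le> 4 * (1 - (norm w)^2)"
  proof -
    have "(1 - norm z) * (1 + norm z) \<le> (2 * (1 - norm w)) * (2 * (1 + norm w))"
      using nw1 nw2 z w1 norm_ge_zero[of z] norm_ge_zero[of w] by - (rule mult_mono; smt (verit))
    then show ?thesis by (simp add: power2_eq_square algebra_simps)
  qed
  have n0: "0 \<le> 1 - (norm z)^2" "0 \<le> 1 - (norm w)^2" using z w1 by (auto simp: power_le_one)
  have s1: "(norm (u - z))^2 \<le> 4 * (norm (u - w))^2"
    using power_mono[OF a2, of 2] by (simp add: power_mult_distrib)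
  have "(norm (u - w))^2 \<le> (3/2 * norm (u - z))^2" by (rule power_mono[OF a1]) simp
  also have "\<dots> = 9/4 * (norm (u - z))^2" by (simp add: power2_eq_square)
  also have "\<dots> \<le> 3 * (norm (u - z))^2" by (rule mult_right_mono) auto
  finally have s2: "(norm (u - w))^2 \<le> 3 * (norm (u - z))^2" .
  have p: "(norm (u - z))^2 > 0" "(norm (u - w))^2 > 0" using pz by auto
  have fr: "a / b \<le> 12 * (c / d)" if "0 < b" "0 < d" "a * d \<le> (12 * c) * b" for a b c d :: real
    using that by (simp add: divide_le_eq) (simp add: field_simps)
  have "(1 - (norm w)^2) * (norm (u - z))^2 \<le> (3 * (1 - (norm z)^2)) * (4 * (norm (u - w))^2)"
    using b1 s1 n0 by (intro mult_mono) auto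
  also have "\<dots> = (12 * (1 - (norm z)^2)) * (norm (u - w))^2" by simp
  finally show "poisson w u \<le> 12 * poisson z u"
    unfolding poisson_def by (rule fr[OF p(2) p(1)])
  have "(1 - (norm z)^2) * (norm (u - w))^2 \<le> (4 * (1 - (norm w)^2)) * (3 * (norm (u - z))^2)"
    using b2 s2 n0 by (intro mult_mono) auto
  also have "\<dots> = (12 * (1 - (norm w)^2)) * (norm (u - z))^2" by simp
  finally show "poisson z u \<le> 12 * poisson w u"
    unfolding poisson_def by (rule fr[OF p(1) p(2)])
qed

section \<open>Herglotz integrals and Jensen's inequality\<close>

text \<open>
  The Herglotz transform of the measure \<open>\<rho> dM\<close> transported to the circle by \<open>\<kappa>\<close>. Leaving \<open>M\<close> and
  \<open>\<kappa>\<close> open lets one set of facts serve both a density with respect to arc length (\<open>M = circ\<close>, \<open>\<kappa> =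
  cis\<close>) and a singular measure (\<open>\<kappa>\<close> the identity, \<open>\<rho> = 1\<close>).
\<close>

definition herglotz :: "'a measure \<Rightarrow> ('a \<Rightarrow> complex) \<Rightarrow> ('a \<Rightarrow> real) \<Rightarrow> complex \<Rightarrow> complex" where
  "herglotz M \<kappa> \<rho> z = (LINT x|M. complex_of_real (\<rho> x) * ((\<kappa> x + z) / (\<kappa> x - z)))"

locale circle_density =
  fixes M :: "'a measure" and \<kappa> :: "'a \<Rightarrow> complex" and \<rho> :: "'a \<Rightarrow> real"
  assumes kappa_measurable [measurable]: "\<kappa> \<in> borel_measurable M"
    and kappa_norm: "AE x in M. norm (\<kappa> x) = 1"
    and rho_integrable: "integrable M \<rho>"
begin

lemma rho_measurable [measurable]: "\<rho> \<in> borel_measurable M"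
  using rho_integrable by auto

lemma integrable_rho_mult:
  assumes [measurable]: "f \<in> borel_measurable M" and "AE x in M. norm (f x :: complex) \<le> B"
  shows "integrable M (\<lambda>x. complex_of_real (\<rho> x) * f x)"
proof (rule Bochner_Integration.integrable_bound)
  show "integrable M (\<lambda>x. B * \<rho> x)" using rho_integrable by simp
  show "AE x in M. norm (complex_of_real (\<rho> x) * f x) \<le> norm (B * \<rho> x)"
    using assms(2)
  proof eventually_elim
    case (elim x)
    then have "norm (f x) \<le> \<bar>B\<bar>" by linarith
    then have "\<bar>\<rho> x\<bar> * norm (f x) \<le> \<bar>\<rho> x\<bar> * \<bar>B\<bar>" by (rule mult_left_mono) auto
    then show ?case by (simp add: norm_mult abs_mult mult.commute)
  qed
qed measurable

lemma norm_diff_ge: "norm w = 1 \<Longrightarrow> 1 - norm z \<le> norm (w - z)" for w z :: complex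
  using norm_triangle_ineq2[of w z] by simp

lemma kernel_bound:
  fixes z w :: complex
  assumes "norm z < 1" "norm w = 1" shows "norm ((w + z) / (w - z)) \<le> 2 / (1 - norm z)"
proof -
  have "norm (w + z) \<le> 2" using norm_triangle_ineq[of w z] assms by simp
  then show ?thesis unfolding norm_divide using norm_diff_ge[OF assms(2), of z] assms
    by (intro frac_le) auto
qed

lemma integrable_kernel:
  assumes "norm z < 1"
  shows "integrable M (\<lambda>x. complex_of_real (\<rho> x) * ((\<kappa> x + z) / (\<kappa> x - z)))"
  using kappa_norm kernel_bound[OF assms]
  by (intro integrable_rho_mult[where B="2 / (1 - norm z)"]) (auto elim!: eventually_mono)

lemma integrable_rho_poisson:
  assumes "norm z < 1"
  shows "integrable M (\<lambda>x. \<rho> x * poisson z (\<kappa> x))"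
  and Re_herglotz: "Re (herglotz M \<kappa> \<rho> z) = (LINT x|M. \<rho> x * poisson z (\<kappa> x))"
proof -
  have eq: "AE x in M. Re (complex_of_real (\<rho> x) * ((\<kappa> x + z) / (\<kappa> x - z))) = \<rho> x * poisson z (\<kappa> x)"
    using kappa_norm
  proof eventually_elim
    case (elim x)
    have "Re (complex_of_real (\<rho> x) * ((\<kappa> x + z) / (\<kappa> x - z))) = \<rho> x * Re ((\<kappa> x + z) / (\<kappa> x - z))"
      by (simp only: times_complex.sel Re_complex_of_real Im_complex_of_real)
    then show ?case using poisson_Re[OF assms elim] by simp
  qed
  have i: "integrable M (\<lambda>x. Re (complex_of_real (\<rho> x) * ((\<kappa> x + z) / (\<kappa> x - z))))"
    by (intro integrable_Re integrable_kernel assms)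
  show "integrable M (\<lambda>x. \<rho> x * poisson z (\<kappa> x))"
    by (rule integrable_cong_AE_imp[OF i]) (use eq in \<open>auto elim!: eventually_mono\<close>)
  have "Re (herglotz M \<kappa> \<rho> z) = (LINT x|M. Re (complex_of_real (\<rho> x) * ((\<kappa> x + z) / (\<kappa> x - z))))"
    unfolding herglotz_def by (rule integral_Re[symmetric]) (rule integrable_kernel[OF assms])
  also have "\<dots> = (LINT x|M. \<rho> x * poisson z (\<kappa> x))"
    by (rule integral_cong_AE) (use eq in auto)
  finally show "Re (herglotz M \<kappa> \<rho> z) = (LINT x|M. \<rho> x * poisson z (\<kappa> x))" .
qed

text \<open>Differentiation under the integral sign, by a direct bound on the difference quotients.\<close>

lemma herglotz_has_derivative:
  assumes w: "norm w < 1"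
  shows "(herglotz M \<kappa> \<rho> has_field_derivative
     (LINT x|M. complex_of_real (\<rho> x) * (2 * \<kappa> x / (\<kappa> x - w)^2))) (at w)"
proof -
  let ?H = "herglotz M \<kappa> \<rho>"
  let ?D = "LINT x|M. complex_of_real (\<rho> x) * (2 * \<kappa> x / (\<kappa> x - w)^2)"
  define d where "d = (1 - norm w)/2"
  have d: "d > 0" using w by (simp add: d_def)
  define K where "K = 2 / (d * d^2) * (LINT x|M. \<bar>\<rho> x\<bar>)"
  have iD: "integrable M (\<lambda>x. complex_of_real (\<rho> x) * (2 * \<kappa> x / (\<kappa> x - w)^2))"
  proof (rule integrable_rho_mult[where B="2 / (2*d)^2"])
    show "AE x in M. norm (2 * \<kappa> x / (\<kappa> x - w)^2) \<le> 2 / (2*d)^2" using kappa_norm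
    proof eventually_elim
      case (elim x)
      then have "2*d \<le> norm (\<kappa> x - w)" using norm_diff_ge[of "\<kappa> x" w] by (simp add: d_def)
      then show ?case using d elim unfolding norm_divide norm_power norm_mult
        by (intro frac_le power_mono) auto
    qed
  qed measurable
  have key: "norm ((?H z - ?H w) / (z - w) - ?D) \<le> K * norm (z - w)" if z: "norm (z - w) < d" "z \<noteq> w" for z
  proof -
    have nz: "norm z < 1" using z norm_triangle_sub[of z w] w unfolding d_def by (simp add: field_simps)
    have nz2: "d \<le> 1 - norm z" using z norm_triangle_sub[of z w] w unfolding d_def by (simp add: field_simps)
    let ?F = "\<lambda>x. (complex_of_real (\<rho> x) * ((\<kappa> x + z) / (\<kappa> x - z))
          - complex_of_real (\<rho> x) * ((\<kappa> x + w) / (\<kappa> x - w))) / (z - w)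
          - complex_of_real (\<rho> x) * (2 * \<kappa> x / (\<kappa> x - w)^2)"
    have eq1: "(?H z - ?H w) / (z - w) - ?D
      = (LINT x|M. (complex_of_real (\<rho> x) * ((\<kappa> x + z) / (\<kappa> x - z))
          - complex_of_real (\<rho> x) * ((\<kappa> x + w) / (\<kappa> x - w))) / (z - w)
          - complex_of_real (\<rho> x) * (2 * \<kappa> x / (\<kappa> x - w)^2))"
      unfolding herglotz_def
      by (subst Bochner_Integration.integral_diff[OF _ iD], intro integrable_divide_zero Bochner_Integration.integrable_diff
          integrable_kernel nz w, subst integral_divide_zero,
          subst Bochner_Integration.integral_diff[OF integrable_kernel[OF nz] integrable_kernel[OF w]], rule refl)
    have "norm ((?H z - ?H w) / (z - w) - ?D) \<le> (LINT x|M. norm (?F x))"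
      unfolding eq1 by (rule integral_norm_bound)
    also have "\<dots> \<le> (LINT x|M. 2 / (d * d^2) * norm (z - w) * \<bar>\<rho> x\<bar>)"
    proof (rule integral_mono_AE)
      show "integrable M (\<lambda>x. 2 / (d * d^2) * norm (z - w) * \<bar>\<rho> x\<bar>)"
        by (intro integrable_mult_right integrable_abs rho_integrable)
      show "integrable M (\<lambda>x. norm (?F x))"
        by (intro integrable_norm Bochner_Integration.integrable_diff integrable_divide_zero integrable_kernel nz w iD)
      show "AE x in M. norm (?F x) \<le> 2 / (d * d^2) * norm (z - w) * \<bar>\<rho> x\<bar>"
        using kappa_norm
      proof eventually_elim
        case (elim x)
        let ?k = "\<kappa> x"
        have a: "d \<le> norm (?k - z)" "d \<le> norm (?k - w)"
          using norm_diff_ge[OF elim, of z] norm_diff_ge[OF elim, of w] nz2 w by (auto simp: d_def)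
        have ne: "?k - z \<noteq> 0" "?k - w \<noteq> 0" "z - w \<noteq> 0" using a d z by auto
        have "((?k + z) / (?k - z) - (?k + w) / (?k - w)) / (z - w) - 2 * ?k / (?k - w)^2
           = 2 * ?k * (z - w) / ((?k - z) * (?k - w)^2)"
        proof -
          have "(?k + z) / (?k - z) - (?k + w) / (?k - w) = 2 * ?k * (z - w) / ((?k - z) * (?k - w))"
            using ne by (simp add: diff_frac_eq) (simp add: algebra_simps)
          then have "((?k + z) / (?k - z) - (?k + w) / (?k - w)) / (z - w) = 2 * ?k / (?k - w) * (1 / (?k - z))"
            using ne by simp
          moreover have "2 * ?k / (?k - w)^2 = 2 * ?k / (?k - w) * (1 / (?k - w))"
            by (simp add: power2_eq_square)
          moreover have "1 / (?k - z) - 1 / (?k - w) = (z - w) / ((?k - z) * (?k - w))"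
            using ne by (simp add: diff_frac_eq)
          ultimately have "((?k + z) / (?k - z) - (?k + w) / (?k - w)) / (z - w) - 2 * ?k / (?k - w)^2
              = 2 * ?k / (?k - w) * ((z - w) / ((?k - z) * (?k - w)))"
            by (metis right_diff_distrib)
          then show ?thesis by (simp add: power2_eq_square mult_ac)
        qed
        then have "(complex_of_real (\<rho> x) * ((\<kappa> x + z) / (\<kappa> x - z))
          - complex_of_real (\<rho> x) * ((\<kappa> x + w) / (\<kappa> x - w))) / (z - w)
          - complex_of_real (\<rho> x) * (2 * \<kappa> x / (\<kappa> x - w)^2)
          = complex_of_real (\<rho> x) * (2 * ?k * (z - w) / ((?k - z) * (?k - w)^2))"
          by (metis (no_types, lifting) right_diff_distrib times_divide_eq_right)
        then show ?case
        proof -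
          assume e: "(complex_of_real (\<rho> x) * ((\<kappa> x + z) / (\<kappa> x - z))
          - complex_of_real (\<rho> x) * ((\<kappa> x + w) / (\<kappa> x - w))) / (z - w)
          - complex_of_real (\<rho> x) * (2 * \<kappa> x / (\<kappa> x - w)^2)
          = complex_of_real (\<rho> x) * (2 * ?k * (z - w) / ((?k - z) * (?k - w)^2))"
          have "norm (2 * ?k * (z - w) / ((?k - z) * (?k - w)^2)) \<le> 2 * norm (z - w) / (d * d^2)"
            unfolding norm_divide norm_mult norm_power using a d elim
            by (intro frac_le mult_mono power_mono) auto
          then have "\<bar>\<rho> x\<bar> * norm (2 * ?k * (z - w) / ((?k - z) * (?k - w)^2)) \<le> \<bar>\<rho> x\<bar> * (2 * norm (z - w) / (d * d^2))"
            by (rule mult_left_mono) auto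
          then show ?thesis unfolding e norm_mult[of "complex_of_real _"] by (simp add: mult_ac)
        qed
      qed
    qed
    also have "\<dots> = K * norm (z - w)" by (simp add: K_def)
    finally show ?thesis .
  qed
  show ?thesis unfolding has_field_derivative_iff
  proof (rule LIM_zero_cancel, rule Lim_null_comparison)
    show "eventually (\<lambda>z. norm ((?H z - ?H w) / (z - w) - ?D) \<le> K * norm (z - w)) (at w)"
      unfolding eventually_at using d key by (auto simp: dist_norm)
    show "((\<lambda>z. K * norm (z - w)) \<longlongrightarrow> 0) (at w)"
      by (auto intro!: tendsto_eq_intros)
  qed
qed

lemma herglotz_holomorphic: "herglotz M \<kappa> \<rho> holomorphic_on ball 0 1"
  unfolding holomorphic_on_open[OF open_ball] by (intro ballI exI, rule herglotz_has_derivative) simp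

lemma Re_herglotz_nonneg:
  assumes "norm z < 1" and "\<And>x. \<rho> x \<ge> 0"
  shows "Re (herglotz M \<kappa> \<rho> z) \<ge> 0"
  unfolding Re_herglotz[OF assms(1)] using assms by (intro Bochner_Integration.integral_nonneg)
    (auto intro!: mult_nonneg_nonneg poisson_nonneg)

lemma herglotz_harnack:
  assumes z: "norm z < 1" and w: "norm (w - z) \<le> (1 - norm z)/2" and pos: "\<And>x. \<rho> x \<ge> 0"
  shows "Re (herglotz M \<kappa> \<rho> w) \<le> 12 * Re (herglotz M \<kappa> \<rho> z)"
    "Re (herglotz M \<kappa> \<rho> z) \<le> 12 * Re (herglotz M \<kappa> \<rho> w)"
proof -
  have w1: "norm w < 1" using norm_triangle_sub[of w z] w z by (simp add: field_simps)
  have "(LINT x|M. \<rho> x * poisson w (\<kappa> x)) \<le> (LINT x|M. 12 * (\<rho> x * poisson z (\<kappa> x)))"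
    using integrable_rho_poisson[OF z] integrable_rho_poisson[OF w1]
  proof (intro integral_mono_AE)
    show "AE x in M. \<rho> x * poisson w (\<kappa> x) \<le> 12 * (\<rho> x * poisson z (\<kappa> x))"
      using kappa_norm
    proof eventually_elim
      case (elim x)
      show ?case using mult_left_mono[OF poisson_harnack(1)[OF z w elim] pos[of x]] by simp
    qed
  qed auto
  then show "Re (herglotz M \<kappa> \<rho> w) \<le> 12 * Re (herglotz M \<kappa> \<rho> z)"
    by (simp add: Re_herglotz[OF z] Re_herglotz[OF w1])
  have "(LINT x|M. \<rho> x * poisson z (\<kappa> x)) \<le> (LINT x|M. 12 * (\<rho> x * poisson w (\<kappa> x)))"
    using integrable_rho_poisson[OF z] integrable_rho_poisson[OF w1]
  proof (intro integral_mono_AE)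
    show "AE x in M. \<rho> x * poisson z (\<kappa> x) \<le> 12 * (\<rho> x * poisson w (\<kappa> x))"
      using kappa_norm
    proof eventually_elim
      case (elim x)
      show ?case using mult_left_mono[OF poisson_harnack(2)[OF z w elim] pos[of x]] by simp
    qed
  qed auto
  then show "Re (herglotz M \<kappa> \<rho> z) \<le> 12 * Re (herglotz M \<kappa> \<rho> w)"
    by (simp add: Re_herglotz[OF z] Re_herglotz[OF w1])
qed

end

lemma circle_density_circ: "integrable circ \<rho> \<Longrightarrow> circle_density circ cis \<rho>"
  by unfold_locales auto

text \<open>
  Subharmonicity of \<open>ln |q|\<close>. If \<open>H\<close> is the Herglotz integral of \<open>\<psi>\<close>, then \<open>q * exp (- H)\<close>, with
  \<open>H\<close> dilated slightly to make it continuous up to the circle, has modulus at most \<open>exp e\<close> there;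
  the maximum principle finishes.
\<close>

lemma jensen_continuous:
  fixes \<psi> :: "complex \<Rightarrow> real"
  assumes q: "q holomorphic_on ball 0 R" and R: "R > 1" and z: "norm z < 1"
    and c: "continuous_on (sphere 0 1) \<psi>" and le: "\<And>w. norm w = 1 \<Longrightarrow> norm (q w) \<le> exp (\<psi> w)"
  shows "norm (q z) \<le> exp (LINT t|circ. poisson z (cis t) * \<psi> (cis t))"
proof -
  interpret cd: circle_density circ cis "\<lambda>t. \<psi> (cis t)"
    by (intro circle_density_circ integrable_circ_continuous c)
  define H where "H = herglotz circ cis (\<lambda>t. \<psi> (cis t))"
  have H: "H holomorphic_on ball 0 1" unfolding H_def by (rule cd.herglotz_holomorphic)
  have ReH: "Re (H w) = (LINT t|circ. poisson w (cis t) * \<psi> (cis t))" if "norm w < 1" for w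
    unfolding H_def cd.Re_herglotz[OF that] by (simp add: mult.commute)
  have main: "norm (q z) \<le> exp (e + Re (H z))" if e: "e > 0" for e
  proof -
    obtain r0 where r0: "0 \<le> r0" "r0 < 1"
      "\<And>r a. r0 \<le> r \<Longrightarrow> r < 1 \<Longrightarrow> norm a = 1 \<Longrightarrow>
       \<bar>(LINT t|circ. poisson (complex_of_real r * a) (cis t) * \<psi> (cis t)) - \<psi> a\<bar> \<le> e"
      using poisson_approx[OF c e] by blast
    have step: "norm (q z) \<le> exp (e + Re (H (complex_of_real r * z)))" if r: "r0 \<le> r" "r < 1" for r
    proof -
      have nr: "norm (complex_of_real r * w) < 1" if "norm w \<le> 1" for w
      proof -
        have "r * norm w \<le> r * 1" using that r r0 by (intro mult_left_mono) auto
        then have "norm (complex_of_real r * w) \<le> r" using r r0 by (simp add: norm_mult)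
        then show ?thesis using r by simp
      qed
      define f where "f = (\<lambda>w. q w * exp (- H (complex_of_real r * w)))"
      have im: "(\<lambda>w. complex_of_real r * w) ` cball 0 1 \<subseteq> ball 0 1" using nr by auto
      have Hr: "(\<lambda>w. H (complex_of_real r * w)) holomorphic_on cball 0 1"
        using holomorphic_on_compose_gen[of "\<lambda>w. complex_of_real r * w" "cball 0 1" H "ball 0 1"] im H
        by (auto simp: o_def intro!: holomorphic_intros)
      have "f holomorphic_on cball 0 1" unfolding f_def
        by (intro holomorphic_intros Hr holomorphic_on_subset[OF q]) (use R in auto)
      then have hf: "f holomorphic_on interior (cball 0 1)" "continuous_on (closure (cball 0 1)) f"
        by (auto intro: holomorphic_on_imp_continuous_on elim: holomorphic_on_subset)
      have "norm (f z) \<le> exp e"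
      proof (rule maximum_modulus_frontier[OF hf])
        fix w :: complex assume "w \<in> frontier (cball 0 1)"
        then have w: "norm w = 1" by (simp add: frontier_cball)
        have "\<psi> w - e \<le> Re (H (r * w))" using r0(3)[OF r w] ReH[OF nr[of w]] w by auto
        then have "norm (q w) * exp (- Re (H (r * w))) \<le> exp (\<psi> w) * exp (e - \<psi> w)"
          using le[OF w] by (intro mult_mono) auto
        then show "norm (f w) \<le> exp e" by (simp add: f_def norm_mult exp_add[symmetric])
      qed (use z in auto)
      then have "norm (q z) * exp (- Re (H (r * z))) * exp (Re (H (r * z))) \<le> exp e * exp (Re (H (r * z)))"
        by (simp add: f_def norm_mult)
      then show ?thesis by (simp add: exp_add exp_minus mult.assoc)
    qed
    have "((\<lambda>r. exp (e + Re (H (complex_of_real r * z)))) \<longlongrightarrow> exp (e + Re (H (complex_of_real 1 * z)))) (at_left 1)"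
    proof (intro tendsto_intros)
      have "isCont H z" using H z
        by (metis continuous_on_interior holomorphic_on_imp_continuous_on interior_ball mem_ball_0)
      then show "((\<lambda>r. H (complex_of_real r * z)) \<longlongrightarrow> H (complex_of_real 1 * z)) (at_left 1)"
        by (intro isCont_tendsto_compose[where g=H]) (auto intro!: tendsto_eq_intros)
    qed
    moreover have "eventually (\<lambda>r. norm (q z) \<le> exp (e + Re (H (complex_of_real r * z)))) (at_left 1)"
      unfolding eventually_at_left[OF \<open>r0 < 1\<close>] using step r0 by (intro exI[of _ r0]) auto
    ultimately have "norm (q z) \<le> exp (e + Re (H (complex_of_real 1 * z)))"
      by (rule tendsto_lowerbound) simp
    then show ?thesis by simp
  qed
  have "((\<lambda>e. exp (e + Re (H z))) \<longlongrightarrow> exp (0 + Re (H z))) (at_right 0)"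
    by (intro tendsto_intros)
  moreover have "eventually (\<lambda>e. norm (q z) \<le> exp (e + Re (H z))) (at_right 0)"
    by (rule eventually_mono[OF eventually_at_right_less[of 0]]) (rule main)
  ultimately have "norm (q z) \<le> exp (0 + Re (H z))"
    by (rule tendsto_lowerbound) simp
  then show ?thesis using ReH[OF z] by simp
qed

text \<open>
  The bound \<open>\<phi>\<close> may take arbitrarily negative values, so the continuous case is applied to \<open>ln
  |q|\<close> itself, cut off below at \<open>- L\<close>, and \<open>L\<close> tends to infinity.
\<close>

lemma jensen_majorant:
  assumes q: "q holomorphic_on ball 0 R" and R: "R > 1" and z: "norm z < 1"
    and \<phi>: "integrable circ \<phi>" and le: "AE t in circ. norm (q (cis t)) \<le> exp (\<phi> t)"
  shows "norm (q z) \<le> exp (LINT t|circ. poisson z (cis t) * \<phi> t)"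
proof -
  have [measurable]: "\<phi> \<in> borel_measurable borel" using \<phi> by (simp add: borel_measurable_integrable cong: measurable_cong_sets)
  define C where "C = 2 / (1 - norm z)"
  have P: "0 \<le> poisson z (cis t)" "poisson z (cis t) \<le> C" for t
    using z by (auto simp: C_def intro!: poisson_nonneg poisson_upper)
  have C0: "0 \<le> C" using P(1)[of 0] P(2)[of 0] by linarith
  have qc: "continuous_on (sphere 0 1) q"
    by (rule continuous_on_subset[OF holomorphic_on_imp_continuous_on[OF q]]) (use R in auto)
  have iP: "integrable circ (\<lambda>t. poisson z (cis t) * max (\<phi> t) (- real L))" for L
  proof (rule Bochner_Integration.integrable_bound)
    show "integrable circ (\<lambda>t. C * (\<bar>\<phi> t\<bar> + real L))" using \<phi> by auto
    show "AE t in circ. norm (poisson z (cis t) * max (\<phi> t) (- real L)) \<le> norm (C * (\<bar>\<phi> t\<bar> + real L))"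
      using P C0 by (intro AE_I2) (auto simp: abs_mult intro!: mult_mono)
  qed measurable
  have bound: "norm (q z) \<le> exp (LINT t|circ. poisson z (cis t) * max (\<phi> t) (- real L))" for L :: nat
  proof -
    define \<psi> where "\<psi> = (\<lambda>w. ln (max (norm (q w)) (exp (- real L))))"
    have m: "max (norm (q w)) (exp (- real L)) > 0" for w by (simp add: less_max_iff_disj)
    have c: "continuous_on (sphere 0 1) \<psi>" unfolding \<psi>_def
      by (intro continuous_intros continuous_on_ln continuous_on_max qc) (use m in \<open>auto simp: less_imp_neq[symmetric]\<close>)
    have "norm (q z) \<le> exp (LINT t|circ. poisson z (cis t) * \<psi> (cis t))"
      by (rule jensen_continuous[OF q R z c]) (use m in \<open>simp add: \<psi>_def\<close>)
    also have "\<dots> \<le> exp (LINT t|circ. poisson z (cis t) * max (\<phi> t) (- real L))"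
    proof (subst exp_le_cancel_iff, rule integral_mono_AE[OF _ iP])
      show "integrable circ (\<lambda>t. poisson z (cis t) * \<psi> (cis t))"
        by (intro integrable_circ_continuous[of "\<lambda>w. poisson z w * \<psi> w"] continuous_intros continuous_on_poisson z c)
      show "AE t in circ. poisson z (cis t) * \<psi> (cis t) \<le> poisson z (cis t) * max (\<phi> t) (- real L)"
        using le
      proof eventually_elim
        case (elim t)
        have "max (norm (q (cis t))) (exp (- real L)) \<le> exp (max (\<phi> t) (- real L))"
          by (rule max.boundedI, rule order_trans[OF elim]) auto
        then have "\<psi> (cis t) \<le> ln (exp (max (\<phi> t) (- real L)))"
          unfolding \<psi>_def using m[of "cis t"] by (subst ln_le_cancel_iff) auto
        then show ?case using P by (intro mult_left_mono) auto
      qed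
    qed
    finally show ?thesis .
  qed
  have "(\<lambda>L. LINT t|circ. poisson z (cis t) * max (\<phi> t) (- real L)) \<longlonglongrightarrow> (LINT t|circ. poisson z (cis t) * \<phi> t)"
  proof (rule integral_dominated_convergence[where w="\<lambda>t. C * \<bar>\<phi> t\<bar>"])
    show "integrable circ (\<lambda>t. C * \<bar>\<phi> t\<bar>)" using \<phi> by auto
    show "AE t in circ. (\<lambda>L. poisson z (cis t) * max (\<phi> t) (- real L)) \<longlonglongrightarrow> poisson z (cis t) * \<phi> t"
    proof (rule AE_I2, rule tendsto_mult_left, rule tendsto_eventually)
      fix t
      obtain k :: nat where "- \<phi> t \<le> real k" using real_arch_simple by blast
      then show "\<forall>\<^sub>F L in sequentially. max (\<phi> t) (- real L) = \<phi> t"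
        by (intro eventually_sequentiallyI[of k]) (auto simp: max_def)
    qed
    show "AE t in circ. norm (poisson z (cis t) * max (\<phi> t) (- real L)) \<le> C * \<bar>\<phi> t\<bar>" for L
      using P C0 by (intro AE_I2) (auto simp: abs_mult intro!: mult_mono)
  qed measurable
  then have "(\<lambda>L. exp (LINT t|circ. poisson z (cis t) * max (\<phi> t) (- real L))) \<longlonglongrightarrow> exp (LINT t|circ. poisson z (cis t) * \<phi> t)"
    by (rule tendsto_exp)
  then show ?thesis by (rule LIMSEQ_le_const) (use bound in auto)
qed

section \<open>An \<open>L\<^sup>2\<close> maximal inequality for radial means\<close>

text \<open>
  With \<open>\<rho> = r * s\<close> and \<open>r \<le> s\<close> one has \<open>r^2 \<le> \<rho> \<le> r\<close>: the points \<open>r * a\<close> and \<open>\<rho> * a\<close> have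
  comparable distances to the circle, and the kernels with these poles are comparable.
\<close>

lemma poisson_product_le_aux:
  assumes a: "norm a = 1" and b: "norm b = 1" and r: "0 \<le> r" "r \<le> s" "s < 1"
  shows "poisson (complex_of_real (r * s) * a) b \<le> 8 * poisson (complex_of_real r * a) b"
proof -
  define \<rho> where "\<rho> = r * s"
  have rho: "0 \<le> \<rho>" "\<rho> < 1" "r * r \<le> \<rho>" "\<rho> \<le> s" "r - \<rho> \<le> 1 - s" "\<rho> \<le> r"
  proof -
    show "0 \<le> \<rho>" using r by (simp add: \<rho>_def)
    show "\<rho> \<le> s" using r mult_right_mono[of r 1 s] by (simp add: \<rho>_def)
    then show "\<rho> < 1" using r by simp
    show "r * r \<le> \<rho>" using r by (simp add: \<rho>_def mult_left_mono)
    show "\<rho> \<le> r" using r mult_left_mono[of s 1 r] by (simp add: \<rho>_def)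
    have "r * (1 - s) \<le> 1 * (1 - s)" using r by (intro mult_right_mono) auto
    then show "r - \<rho> \<le> 1 - s" by (simp add: \<rho>_def algebra_simps)
  qed
  have n1: "norm (b - complex_of_real \<rho> * a) \<ge> 1 - \<rho>"
    using norm_triangle_ineq2[of b "complex_of_real \<rho> * a"] a b rho by (simp add: norm_mult)
  have "norm (b - complex_of_real r * a) \<le> norm (b - complex_of_real \<rho> * a) + norm (complex_of_real \<rho> * a - complex_of_real r * a)"
    using norm_triangle_ineq[of "b - complex_of_real \<rho> * a" "complex_of_real \<rho> * a - complex_of_real r * a"] by simp
  also have "complex_of_real \<rho> * a - complex_of_real r * a = complex_of_real (\<rho> - r) * a"
    by (simp add: algebra_simps)
  also have "norm (complex_of_real (\<rho> - r) * a) = r - \<rho>" unfolding norm_mult norm_of_real using a rho by simp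
  finally have n2: "norm (b - complex_of_real r * a) \<le> 2 * norm (b - complex_of_real \<rho> * a)"
    using n1 rho by linarith
  have sq: "(norm (b - complex_of_real r * a))^2 \<le> 4 * (norm (b - complex_of_real \<rho> * a))^2"
    using power_mono[OF n2, of 2] by (simp add: power_mult_distrib)
  have pos: "norm (b - complex_of_real \<rho> * a) > 0" using n1 rho by linarith
  have "norm (b - complex_of_real r * a) \<ge> 1 - r"
    using norm_triangle_ineq2[of b "complex_of_real r * a"] a b r by (simp add: norm_mult)
  then have pos2: "norm (b - complex_of_real r * a) > 0" using r by linarith
  have num: "1 - \<rho>^2 \<le> 2 * (1 - r^2)"
  proof -
    have "(r*r) * (r*r) \<le> \<rho> * \<rho>" using rho r by (intro mult_mono) auto
    moreover have "r * r \<le> 1" using rho by linarith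
    moreover have "0 \<le> (1 - r*r) * (1 - r*r)" by simp
    ultimately show ?thesis by (simp add: power2_eq_square algebra_simps)
  qed
  have r1: "0 \<le> 1 - r^2" using rho by (simp add: power2_eq_square)
  have "(1 - \<rho>^2) * (norm (b - complex_of_real r * a))^2 \<le> (2 * (1 - r^2)) * (4 * (norm (b - complex_of_real \<rho> * a))^2)"
    using num sq r1 by (intro mult_mono) auto
  also have "\<dots> = (8 * (1 - r^2)) * (norm (b - complex_of_real \<rho> * a))^2" by simp
  finally have "(1 - \<rho>^2) / (norm (b - complex_of_real \<rho> * a))^2 \<le> 8 * ((1 - r^2) / (norm (b - complex_of_real r * a))^2)"
    using pos pos2 by (simp add: divide_le_eq) (simp add: field_simps)
  then show ?thesis unfolding \<rho>_def[symmetric] poisson_def using a r rho by (simp add: norm_mult)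
qed

lemma poisson_product_le:
  assumes a: "norm a = 1" and b: "norm b = 1" and r: "0 \<le> r" "r < 1" and s: "0 \<le> s" "s < 1"
  shows "poisson (complex_of_real (r * s) * a) b \<le> 8 * (poisson (complex_of_real r * a) b + poisson (complex_of_real s * b) a)"
proof (cases "r \<le> s")
  case True
  have "0 \<le> poisson (complex_of_real s * b) a" using s b by (intro poisson_nonneg) (simp add: norm_mult)
  then show ?thesis using poisson_product_le_aux[OF a b r(1) True s(2)] by simp
next
  case False
  have "0 \<le> poisson (complex_of_real r * a) b" using r a by (intro poisson_nonneg) (simp add: norm_mult)
  moreover have "poisson (complex_of_real (s * r) * b) a \<le> 8 * poisson (complex_of_real s * b) a"
    using False by (intro poisson_product_le_aux b a s r) auto
  moreover have "poisson (complex_of_real (s * r) * b) a = poisson (complex_of_real (r * s) * a) b"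
    using poisson_swap[OF b a, of "s * r"] by (simp only: mult.commute[of r s])
  ultimately show ?thesis by simp
qed

lemma ennreal_sq_le: "a^2 \<le> (b::ennreal)^2 \<Longrightarrow> a \<le> b"
proof (rule ccontr)
  assume le: "a^2 \<le> b^2" and "\<not> a \<le> b"
  then have lt: "b < a" by simp
  then obtain x where x: "b = ennreal x" "x \<ge> 0" by (cases b) auto
  show False
  proof (cases a)
    case (real y)
    then have "x < y" using lt x by (simp add: ennreal_less_iff)
    then show False using le real x power_strict_mono[of x y 2] by (simp add: ennreal_power top_unique)
  next
    case top then show False using le x by (simp add: ennreal_power top_unique)
  qed
qed

lemma ennreal_cancel_square:
  assumes "(X::ennreal)^2 \<le> Y * (ennreal c * X)" "X < \<infinity>" "c \<ge> 0"
  shows "X \<le> ennreal c * Y"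
proof (cases Y)
  case (real y)
  obtain x where x: "X = ennreal x" "x \<ge> 0" using assms(2) by (cases X) auto
  show ?thesis
  proof (cases "x = 0")
    case False
    have "x^2 \<le> y * (c * x)" using assms(1,3) x real
      by (simp add: ennreal_power ennreal_mult[symmetric])
    then have "x * x \<le> (c * y) * x" by (simp add: power2_eq_square mult_ac)
    then have "x \<le> c * y" using False x by simp
    then show ?thesis using x real assms(3) by (simp add: ennreal_mult[symmetric])
  qed (simp add: x)
next
  case top
  then show ?thesis using assms by (cases "c = 0") (auto simp: ennreal_mult_top)
qed

interpretation cc: pair_sigma_finite circ circ
  by unfold_locales

text \<open>
  The maximal function over radii is linearised: \<open>r t\<close> stands for a radius, chosen measurably, at
  which the supremum at angle \<open>t\<close> is attained. A bound for the resulting operator that is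
  independent of the choice and of \<open>\<rho>0\<close> bounds the maximal function.
\<close>

locale radial_selection =
  fixes r :: "real \<Rightarrow> real" and \<rho>0 :: real
  assumes r_measurable [measurable]: "r \<in> borel_measurable borel"
    and r_range: "\<And>t. 0 \<le> r t" "\<And>t. r t \<le> \<rho>0" and rho0: "\<rho>0 < 1"
begin

definition k :: "real \<Rightarrow> real \<Rightarrow> ennreal" where
  "k t s = ennreal (poisson (polar (r t) t) (cis s))"

definition T :: "(real \<Rightarrow> ennreal) \<Rightarrow> real \<Rightarrow> ennreal" where
  "T \<phi> t = (\<integral>\<^sup>+ s. k t s * \<phi> s \<partial>circ)"

lemma r_lt: "r t < 1" using r_range(2)[of t] rho0 by linarith

lemma selected_in_disc: "norm (polar (r t) u) < 1"
  using r_range(1)[of t] r_lt[of t] by (simp add: norm_mult)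

lemma k_measurable [measurable]: "(\<lambda>p. k (fst p) (snd p)) \<in> borel_measurable (borel \<Otimes>\<^sub>M borel)"
  unfolding k_def by measurable

lemma k_measurable1 [measurable]: "k t \<in> borel_measurable borel" and k_measurable2 [measurable]: "(\<lambda>t. k t s) \<in> borel_measurable borel"
  unfolding k_def[abs_def] by measurable

lemma k_comp [measurable (raw)]:
  assumes "f \<in> borel_measurable M" "g \<in> borel_measurable M"
  shows "(\<lambda>x. k (f x) (g x)) \<in> borel_measurable M"
  unfolding k_def using assms by measurable

lemma k_upper: "k t s \<le> ennreal (2 / (1 - \<rho>0))"
proof -
  have "poisson (polar (r t) t) (cis s) \<le> 2 / (1 - norm (polar (r t) t))"
    using selected_in_disc by (intro poisson_upper) auto
  also have "\<dots> \<le> 2 / (1 - \<rho>0)"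
    using r_range[of t] rho0 by (intro divide_left_mono mult_pos_pos) (auto simp: norm_mult)
  finally show ?thesis unfolding k_def by (intro ennreal_leI)
qed

lemma T_measurable [measurable]:
  assumes [measurable]: "\<phi> \<in> borel_measurable borel"
  shows "T \<phi> \<in> borel_measurable borel"
  unfolding T_def[abs_def] by (intro circ.borel_measurable_nn_integral) simp

text \<open>
  The left-hand side is the kernel of \<open>T T*\<close>. The semigroup property of the Poisson kernel turns
  it into a single Poisson kernel, which is dominated by the kernels of \<open>T\<close> and of \<open>T*\<close>.
\<close>

lemma k_semigroup: "(\<integral>\<^sup>+ s. k t s * k u s \<partial>circ) \<le> ennreal 8 * (k t u + k u t)"
proof -
  let ?P = "\<lambda>s. poisson (polar (r t) t) (cis s)"
  let ?Q = "\<lambda>s. poisson (polar (r u) u) (cis s)"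
  have P0: "?P s \<ge> 0" "?Q s \<ge> 0" for s by (intro poisson_nonneg less_imp_le[OF selected_in_disc])+
  have i: "integrable circ (\<lambda>s. ?P s * ?Q s)"
    by (intro integrable_circ_continuous[of "\<lambda>w. poisson (polar (r t) t) w * poisson (polar (r u) u) w"]
        continuous_intros continuous_on_poisson selected_in_disc)
  have "(\<integral>\<^sup>+ s. k t s * k u s \<partial>circ) = (\<integral>\<^sup>+ s. ennreal (?P s * ?Q s) \<partial>circ)"
    unfolding k_def using P0 by (simp add: ennreal_mult)
  also have "\<dots> = ennreal (LINT s|circ. ?P s * ?Q s)"
    by (rule nn_integral_eq_integral[OF i]) (use P0 in auto)
  also have "(LINT s|circ. ?P s * ?Q s) = poisson (polar (r t * r u) t) (cis u)"
    using r_range r_lt by (intro poisson_semigroup) auto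
  finally have "(\<integral>\<^sup>+ s. k t s * k u s \<partial>circ) = ennreal (poisson (polar (r t * r u) t) (cis u))" .
  also have "\<dots> \<le> ennreal (8 * (?P u + ?Q t))" using r_range r_lt by (intro ennreal_leI poisson_product_le) auto
  also have "\<dots> = ennreal 8 * (ennreal (?P u) + ennreal (?Q t))"
    using P0 by (subst ennreal_mult) (auto simp del: ennreal_numeral)
  finally show ?thesis unfolding k_def .
qed

text \<open>The square of the \<open>L\<^sup>2\<close> norm.\<close>

definition L2 :: "(real \<Rightarrow> ennreal) \<Rightarrow> ennreal" where
  "L2 \<phi> = (\<integral>\<^sup>+ t. (\<phi> t)^2 \<partial>circ)"

definition bounded_by :: "real \<Rightarrow> bool" where
  "bounded_by \<kappa> \<longleftrightarrow> \<kappa> > 0 \<and> (\<forall>\<phi>\<in>borel_measurable borel. L2 (T \<phi>) \<le> ennreal (\<kappa>^2) * L2 \<phi>)"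

lemma cauchy_schwarz_circ:
  assumes [measurable]: "f \<in> borel_measurable borel" "g \<in> borel_measurable borel"
  shows "(\<integral>\<^sup>+ t. f t * g t \<partial>circ)^2 \<le> L2 f * L2 g"
  unfolding L2_def by (rule Cauchy_Schwarz_nn_integral) auto

text \<open>
  A bound that depends on \<open>\<rho>0\<close>. It makes all norms finite, so that they may be cancelled, and is
  the starting point of the improvement below.
\<close>

lemma crude_bound: "bounded_by (2 / (1 - \<rho>0))"
  unfolding bounded_by_def
proof (intro conjI ballI)
  define c where "c = 2 / (1 - \<rho>0)"
  show c: "c > 0" using rho0 by (simp add: c_def)
  fix \<phi> :: "real \<Rightarrow> ennreal" assume [measurable]: "\<phi> \<in> borel_measurable borel"
  have T: "T \<phi> t \<le> ennreal c * (\<integral>\<^sup>+ s. \<phi> s \<partial>circ)" for t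
  proof -
    have "T \<phi> t \<le> (\<integral>\<^sup>+ s. ennreal c * \<phi> s \<partial>circ)"
      unfolding T_def c_def by (intro nn_integral_mono mult_right_mono k_upper) auto
    then show ?thesis by (simp add: nn_integral_cmult)
  qed
  have "(\<integral>\<^sup>+ s. \<phi> s \<partial>circ)^2 \<le> L2 \<phi>"
    using cauchy_schwarz_circ[of "\<lambda>_. 1" \<phi>] by (simp add: L2_def)
  moreover have "L2 (T \<phi>) \<le> (\<integral>\<^sup>+ t. (ennreal c * (\<integral>\<^sup>+ s. \<phi> s \<partial>circ))^2 \<partial>circ)"
    unfolding L2_def by (intro nn_integral_mono power_mono T) auto
  moreover have "\<dots> = ennreal (c^2) * (\<integral>\<^sup>+ s. \<phi> s \<partial>circ)^2"
    using c by (simp add: power_mult_distrib ennreal_power)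
  ultimately show "L2 (T \<phi>) \<le> ennreal (c^2) * L2 \<phi>"
    by (metis mult_left_mono order_trans zero_le)
qed

text \<open>
  The \<open>T T*\<close> argument. With \<open>\<omega> = T \<phi>\<close>, Cauchy-Schwarz gives \<open>|\<omega>|^4 \<le> |\<phi>|^2 |T* \<omega>|^2\<close>, while
  \<open>k_semigroup\<close> gives \<open>|T* \<omega>|^2 = (\<omega>, T T* \<omega>) \<le> 8 (\<omega>, T \<omega>) + 8 (\<omega>, T* \<omega>) = 16 (\<omega>, T \<omega>) \<le> 16 \<kappa>
  |\<omega>|^2\<close>.
\<close>

lemma bound_improve:
  assumes b: "bounded_by \<kappa>" shows "bounded_by (4 * sqrt \<kappa>)"
  unfolding bounded_by_def
proof (intro conjI ballI)
  have kp: "\<kappa> > 0" using b by (simp add: bounded_by_def)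
  then show "4 * sqrt \<kappa> > 0" by simp
  fix \<phi> :: "real \<Rightarrow> ennreal" assume [measurable]: "\<phi> \<in> borel_measurable borel"
  define \<omega> where "\<omega> = T \<phi>"
  have [measurable]: "\<omega> \<in> borel_measurable borel" by (simp add: \<omega>_def)
  define S where "S s = (\<integral>\<^sup>+ t. k t s * \<omega> t \<partial>circ)" for s
  have [measurable]: "S \<in> borel_measurable borel"
    unfolding S_def[abs_def] by (intro circ.borel_measurable_nn_integral) simp
  have w1: "L2 \<omega> = (\<integral>\<^sup>+ s. \<phi> s * S s \<partial>circ)"
  proof -
    have "L2 \<omega> = (\<integral>\<^sup>+ t. (\<integral>\<^sup>+ s. \<phi> s * (k t s * \<omega> t) \<partial>circ) \<partial>circ)"
      unfolding L2_def power2_eq_square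
    proof (intro nn_integral_cong)
      fix t
      have "\<omega> t * \<omega> t = T \<phi> t * \<omega> t" by (simp add: \<omega>_def)
      also have "\<dots> = (\<integral>\<^sup>+ s. k t s * \<phi> s * \<omega> t \<partial>circ)" unfolding T_def by (subst nn_integral_multc) auto
      finally show "\<omega> t * \<omega> t = (\<integral>\<^sup>+ s. \<phi> s * (k t s * \<omega> t) \<partial>circ)" by (simp add: mult_ac)
    qed
    also have "\<dots> = (\<integral>\<^sup>+ s. (\<integral>\<^sup>+ t. \<phi> s * (k t s * \<omega> t) \<partial>circ) \<partial>circ)"
      by (rule cc.Fubini') measurable
    also have "\<dots> = (\<integral>\<^sup>+ s. \<phi> s * S s \<partial>circ)"
      unfolding S_def by (intro nn_integral_cong nn_integral_cmult) measurable
    finally show ?thesis .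
  qed
  (* Here S is the adjoint of T applied to \<omega>. *)
  have w2: "(L2 \<omega>)^2 \<le> L2 \<phi> * L2 S" unfolding w1 by (rule cauchy_schwarz_circ) measurable
  have w3: "L2 S \<le> ennreal 16 * (\<integral>\<^sup>+ t. \<omega> t * T \<omega> t \<partial>circ)"
  proof -
    have "L2 S = (\<integral>\<^sup>+ s. (\<integral>\<^sup>+ t. \<omega> t * (k t s * S s) \<partial>circ) \<partial>circ)"
      unfolding L2_def power2_eq_square
    proof (intro nn_integral_cong)
      fix s
      have "S s * S s = (\<integral>\<^sup>+ t. k t s * \<omega> t \<partial>circ) * S s" by (simp add: S_def)
      also have "\<dots> = (\<integral>\<^sup>+ t. k t s * \<omega> t * S s \<partial>circ)" by (subst nn_integral_multc) auto
      finally show "S s * S s = (\<integral>\<^sup>+ t. \<omega> t * (k t s * S s) \<partial>circ)" by (simp add: mult_ac)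
    qed
    also have "\<dots> = (\<integral>\<^sup>+ t. (\<integral>\<^sup>+ s. \<omega> t * (k t s * S s) \<partial>circ) \<partial>circ)"
      by (rule cc.Fubini') measurable
    also have "\<dots> = (\<integral>\<^sup>+ t. \<omega> t * (\<integral>\<^sup>+ s. k t s * S s \<partial>circ) \<partial>circ)"
      by (intro nn_integral_cong nn_integral_cmult) measurable
    also have "\<dots> \<le> (\<integral>\<^sup>+ t. \<omega> t * (\<integral>\<^sup>+ u. \<omega> u * (ennreal 8 * (k t u + k u t)) \<partial>circ) \<partial>circ)"
    proof (rule nn_integral_mono, rule mult_left_mono)
      fix t
      have "(\<integral>\<^sup>+ s. k t s * S s \<partial>circ) = (\<integral>\<^sup>+ s. (\<integral>\<^sup>+ u. \<omega> u * (k t s * k u s) \<partial>circ) \<partial>circ)"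
      proof (intro nn_integral_cong)
        fix s
        have "k t s * S s = (\<integral>\<^sup>+ u. k t s * (k u s * \<omega> u) \<partial>circ)"
          unfolding S_def by (subst nn_integral_cmult) auto
        then show "k t s * S s = (\<integral>\<^sup>+ u. \<omega> u * (k t s * k u s) \<partial>circ)" by (simp add: mult_ac)
      qed
      also have "\<dots> = (\<integral>\<^sup>+ u. (\<integral>\<^sup>+ s. \<omega> u * (k t s * k u s) \<partial>circ) \<partial>circ)"
        by (rule cc.Fubini') measurable
      also have "\<dots> = (\<integral>\<^sup>+ u. \<omega> u * (\<integral>\<^sup>+ s. k t s * k u s \<partial>circ) \<partial>circ)"
        by (intro nn_integral_cong nn_integral_cmult) measurable
      also have "\<dots> \<le> (\<integral>\<^sup>+ u. \<omega> u * (ennreal 8 * (k t u + k u t)) \<partial>circ)"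
        by (intro nn_integral_mono mult_left_mono k_semigroup) auto
      finally show "(\<integral>\<^sup>+ s. k t s * S s \<partial>circ) \<le> (\<integral>\<^sup>+ u. \<omega> u * (ennreal 8 * (k t u + k u t)) \<partial>circ)" .
    qed auto
    also have "\<dots> = (\<integral>\<^sup>+ t. (ennreal 8 * (\<omega> t * T \<omega> t) + ennreal 8 * (\<omega> t * S t)) \<partial>circ)"
    proof (intro nn_integral_cong)
      fix t
      have "(\<integral>\<^sup>+ u. \<omega> u * (ennreal 8 * (k t u + k u t)) \<partial>circ)
         = (\<integral>\<^sup>+ u. ennreal 8 * (k t u * \<omega> u) + ennreal 8 * (k u t * \<omega> u) \<partial>circ)"
        by (intro nn_integral_cong) (simp add: distrib_left mult_ac)
      also have "\<dots> = ennreal 8 * T \<omega> t + ennreal 8 * S t"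
        unfolding T_def S_def by (subst nn_integral_add) (auto simp: nn_integral_cmult)
      finally show "\<omega> t * (\<integral>\<^sup>+ u. \<omega> u * (ennreal 8 * (k t u + k u t)) \<partial>circ)
         = ennreal 8 * (\<omega> t * T \<omega> t) + ennreal 8 * (\<omega> t * S t)"
        by (simp add: distrib_left mult_ac)
    qed
    also have "\<dots> = ennreal 8 * (\<integral>\<^sup>+ t. \<omega> t * T \<omega> t \<partial>circ) + ennreal 8 * (\<integral>\<^sup>+ t. \<omega> t * S t \<partial>circ)"
      by (subst nn_integral_add) (auto simp: nn_integral_cmult)
    also have "(\<integral>\<^sup>+ t. \<omega> t * S t \<partial>circ) = (\<integral>\<^sup>+ t. \<omega> t * T \<omega> t \<partial>circ)"
    proof -
      have "(\<integral>\<^sup>+ t. \<omega> t * S t \<partial>circ) = (\<integral>\<^sup>+ t. (\<integral>\<^sup>+ u. \<omega> t * (k u t * \<omega> u) \<partial>circ) \<partial>circ)"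
        unfolding S_def by (intro nn_integral_cong nn_integral_cmult[symmetric]) measurable
      also have "\<dots> = (\<integral>\<^sup>+ u. (\<integral>\<^sup>+ t. \<omega> t * (k u t * \<omega> u) \<partial>circ) \<partial>circ)"
        by (rule cc.Fubini') measurable
      also have "\<dots> = (\<integral>\<^sup>+ u. \<omega> u * T \<omega> u \<partial>circ)"
      proof (intro nn_integral_cong)
        fix u
        have "\<omega> u * T \<omega> u = (\<integral>\<^sup>+ t. \<omega> u * (k u t * \<omega> t) \<partial>circ)"
          unfolding T_def by (subst nn_integral_cmult) auto
        then show "(\<integral>\<^sup>+ t. \<omega> t * (k u t * \<omega> u) \<partial>circ) = \<omega> u * T \<omega> u" by (simp add: mult_ac)
      qed
      finally show ?thesis .
    qed
    also have "ennreal 8 * (\<integral>\<^sup>+ t. \<omega> t * T \<omega> t \<partial>circ) + ennreal 8 * (\<integral>\<^sup>+ t. \<omega> t * T \<omega> t \<partial>circ)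
       = ennreal 16 * (\<integral>\<^sup>+ t. \<omega> t * T \<omega> t \<partial>circ)"
      by (simp add: distrib_right[symmetric] ennreal_plus[symmetric] del: ennreal_plus ennreal_numeral)
    finally show ?thesis .
  qed
  have w4: "(\<integral>\<^sup>+ t. \<omega> t * T \<omega> t \<partial>circ) \<le> ennreal \<kappa> * L2 \<omega>"
  proof (rule ennreal_sq_le)
    have "(\<integral>\<^sup>+ t. \<omega> t * T \<omega> t \<partial>circ)^2 \<le> L2 \<omega> * L2 (T \<omega>)" by (rule cauchy_schwarz_circ) measurable
    also have "\<dots> \<le> L2 \<omega> * (ennreal (\<kappa>^2) * L2 \<omega>)"
      using b by (intro mult_left_mono) (auto simp: bounded_by_def)
    also have "\<dots> = (ennreal \<kappa> * L2 \<omega>)^2"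
      using kp by (simp add: power2_eq_square ennreal_mult mult_ac)
    finally show "(\<integral>\<^sup>+ t. \<omega> t * T \<omega> t \<partial>circ)^2 \<le> (ennreal \<kappa> * L2 \<omega>)^2" .
  qed
  have "L2 S \<le> ennreal 16 * (ennreal \<kappa> * L2 \<omega>)"
    using w3 w4 by (metis mult_left_mono order_trans zero_le)
  also have "\<dots> = ennreal (16 * \<kappa>) * L2 \<omega>" using kp by (simp add: ennreal_mult mult_ac)
  finally have w5: "(L2 \<omega>)^2 \<le> L2 \<phi> * (ennreal (16 * \<kappa>) * L2 \<omega>)"
    using w2 by (metis mult_left_mono order_trans zero_le)
  show "L2 (T \<phi>) \<le> ennreal ((4 * sqrt \<kappa>)^2) * L2 \<phi>"
  proof (cases "L2 \<phi> = \<infinity>")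
    case True
    then show ?thesis using kp by (simp add: ennreal_mult_top power_mult_distrib)
  next
    case False
    have "L2 \<omega> \<le> ennreal ((2 / (1 - \<rho>0))^2) * L2 \<phi>"
      using crude_bound by (simp add: bounded_by_def \<omega>_def)
    also have "\<dots> < \<infinity>" using False by (simp add: ennreal_mult_less_top top.not_eq_extremum)
    finally have "L2 \<omega> \<le> ennreal (16 * \<kappa>) * L2 \<phi>"
      using w5 kp by (intro ennreal_cancel_square) auto
    then show ?thesis using kp by (simp add: power_mult_distrib \<omega>_def)
  qed
qed

text \<open>
  The infimum \<open>s\<close> of all bounds for \<open>T\<close> satisfies \<open>s \<le> 4 * sqrt s\<close>, that is \<open>s \<le> 16\<close>. So some
  bound lies below 17, and \<open>289 = 17^2\<close>.
\<close>

lemma maximal_bound: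
  assumes "\<phi> \<in> borel_measurable borel" shows "L2 (T \<phi>) \<le> ennreal 289 * L2 \<phi>"
proof -
  define s where "s = Inf (Collect bounded_by)"
  have ne: "Collect bounded_by \<noteq> {}" using crude_bound by auto
  have bd: "bdd_below (Collect bounded_by)" by (intro bdd_belowI[of _ 0]) (auto simp: bounded_by_def)
  have s0: "s \<ge> 0" unfolding s_def by (intro cInf_greatest ne) (auto simp: bounded_by_def)
  have "s^2 / 16 \<le> \<kappa>" if "bounded_by \<kappa>" for \<kappa>
  proof -
    have "s \<le> 4 * sqrt \<kappa>" unfolding s_def by (rule cInf_lower[OF _ bd]) (use bound_improve[OF that] in simp)
    then have "s^2 \<le> (4 * sqrt \<kappa>)^2" using s0 by (intro power_mono) auto
    then show ?thesis using that by (simp add: bounded_by_def power_mult_distrib)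
  qed
  then have "s^2 / 16 \<le> s" unfolding s_def by (intro cInf_greatest ne) auto
  then have "s * s \<le> 16 * s" by (simp add: power2_eq_square)
  then have "s \<le> 16" using s0 by (cases "s = 0") auto
  then obtain \<kappa> where k: "bounded_by \<kappa>" "\<kappa> < 17"
    using cInf_lessD[OF ne, of 17] by (auto simp: s_def)
  then have "\<kappa>^2 \<le> 17^2" by (intro power_mono) (auto simp: bounded_by_def)
  then have "ennreal (\<kappa>^2) \<le> ennreal 289" by (intro ennreal_leI) simp
  then have "ennreal (\<kappa>^2) * L2 \<phi> \<le> ennreal 289 * L2 \<phi>" by (rule mult_right_mono) simp
  moreover have "L2 (T \<phi>) \<le> ennreal (\<kappa>^2) * L2 \<phi>" using k assms unfolding bounded_by_def by blast
  ultimately show ?thesis by (rule order_trans[rotated])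
qed

end

section \<open>Fatou's theorem on radial limits\<close>

text \<open>
  Radial limits are taken along this sequence of radii wherever measurability or dominated
  convergence asks for countably many of them.
\<close>

definition rseq :: "nat \<Rightarrow> real" where
  "rseq n = 1 - 1 / real (n + 2)"

lemma rseq_range [simp]: "0 < rseq n" "rseq n < 1"
  by (auto simp: rseq_def)

lemma rseq_lim: "rseq \<longlonglongrightarrow> 1"
  using tendsto_diff[OF tendsto_const[of 1] LIMSEQ_ignore_initial_segment[OF lim_1_over_n[where 'a=real], of 2]]
  unfolding rseq_def[abs_def] by simp

lemma rseq_at_left: "filterlim rseq (at_left 1) sequentially"
  by (rule tendsto_imp_filterlim_at_left[OF rseq_lim]) auto

lemma integral_cis_power: "(LINT t|circ. cis t ^ m) = (if m = 0 then 1 else 0)"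
proof -
  have "(LINT t|circ. complex_of_real (poisson 0 (cis t)) * cis t ^ m) = 0 ^ m"
    by (rule poisson_formula[of "\<lambda>z. z^m" 2 0]) (auto intro!: holomorphic_intros)
  then show ?thesis by (simp add: poisson_def power_0_left)
qed

lemma integral_cis_orthogonal:
  "(LINT t|circ. cis t ^ j * cnj (cis t) ^ k) = (if j = k then 1 else 0)"
proof -
  have one: "cis t * cnj (cis t) = 1" for t by (simp add: complex_norm_square[symmetric])
  show ?thesis
  proof (cases "k \<le> j")
    case True
    have "cis t ^ j * cnj (cis t) ^ k = cis t ^ (j - k)" for t
    proof -
      have "cis t ^ j = cis t ^ (j - k) * cis t ^ k" using True by (simp add: power_add[symmetric])
      then have "cis t ^ j * cnj (cis t) ^ k = cis t ^ (j - k) * (cis t * cnj (cis t)) ^ k"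
        by (simp only: power_mult_distrib mult.assoc)
      then show ?thesis unfolding one by simp
    qed
    then show ?thesis using True by (simp add: integral_cis_power)
  next
    case False
    have "cis t ^ j * cnj (cis t) ^ k = cnj (cis t ^ (k - j))" for t
    proof -
      have "cnj (cis t) ^ k = cnj (cis t) ^ j * cnj (cis t) ^ (k - j)" using False by (simp add: power_add[symmetric])
      then have "cis t ^ j * cnj (cis t) ^ k = (cis t * cnj (cis t)) ^ j * cnj (cis t) ^ (k - j)"
        by (simp only: power_mult_distrib mult.assoc)
      then show ?thesis unfolding one by simp
    qed
    then have "(LINT t|circ. cis t ^ j * cnj (cis t) ^ k) = (LINT t|circ. cnj (cis t ^ (k - j)))" by simp
    also have "\<dots> = cnj (LINT t|circ. cis t ^ (k - j))" by (rule Bochner_Integration.integral_cnj)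
    also have "\<dots> = 0" using False by (simp add: integral_cis_power)
    finally show ?thesis using False by simp
  qed
qed

lemma parseval_finite:
  "(LINT t|circ. (norm (\<Sum>j<n. b j * cis t ^ j))^2) = (\<Sum>j<n. (norm (b j))^2)"
proof -
  have int: "integrable circ (\<lambda>t. b j * cnj (b k) * (cis t ^ j * cnj (cis t) ^ k))" for j k
    by (intro integrable_circ_continuous[of "\<lambda>w. b j * cnj (b k) * (w ^ j * cnj w ^ k)"] continuous_intros)
  have eq: "complex_of_real ((norm (\<Sum>j<n. b j * cis t ^ j))^2) = (\<Sum>j<n. \<Sum>k<n. b j * cnj (b k) * (cis t ^ j * cnj (cis t) ^ k))" for t
    unfolding complex_norm_square cnj_sum sum_product by (intro sum.cong refl) (simp add: mult_ac)
  have "complex_of_real (LINT t|circ. (norm (\<Sum>j<n. b j * cis t ^ j))^2)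
     = (LINT t|circ. complex_of_real ((norm (\<Sum>j<n. b j * cis t ^ j))^2))"
    by (rule integral_complex_of_real[symmetric])
  also have "\<dots> = (\<Sum>j<n. \<Sum>k<n. (LINT t|circ. b j * cnj (b k) * (cis t ^ j * cnj (cis t) ^ k)))"
    unfolding eq by (subst Bochner_Integration.integral_sum, intro Bochner_Integration.integrable_sum int,
        intro sum.cong refl, subst Bochner_Integration.integral_sum, rule int, rule refl)
  also have "\<dots> = (\<Sum>j<n. \<Sum>k<n. b j * cnj (b k) * (if j = k then 1 else 0))"
    by (simp only: integral_mult_right_zero integral_cis_orthogonal)
  also have "\<dots> = (\<Sum>j<n. b j * cnj (b j))"
    by (simp add: sum.delta if_distrib[of "\<lambda>x. _ * x"] cong: if_cong)
  also have "\<dots> = complex_of_real (\<Sum>j<n. (norm (b j))^2)"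
    by (simp only: of_real_sum complex_norm_square)
  finally show ?thesis by (simp only: of_real_eq_iff)
qed

lemma disc_measurable:
  assumes p: "continuous_on (ball 0 1) (p :: complex \<Rightarrow> complex)" and g: "g \<in> borel_measurable M"
    and lt: "\<And>x. x \<in> space M \<Longrightarrow> norm (g x) < 1"
  shows "(\<lambda>x. p (g x)) \<in> borel_measurable M"
proof -
  have "(\<lambda>z. if z \<in> ball 0 1 then p z else 0) \<in> borel_measurable borel"
    by (rule borel_measurable_continuous_on_if) (auto intro: p)
  from measurable_compose[OF g this] show ?thesis
    using lt by (subst measurable_cong[where g="\<lambda>x. if g x \<in> ball 0 1 then p (g x) else 0"]) auto
qed

lemma circle_measurable:
  assumes p: "p holomorphic_on ball 0 1" and R: "0 \<le> R" "R < 1"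
  shows "(\<lambda>t. p (polar R t)) \<in> borel_measurable borel"
  by (rule disc_measurable[OF holomorphic_on_imp_continuous_on[OF p]]) (use R in \<open>auto simp: norm_mult\<close>)

text \<open>
  On the circle of radius \<open>R < 1\<close> the partial sums are uniformly bounded, so the finite Parseval
  identity passes to the limit by dominated convergence.
\<close>

lemma parseval:
  assumes a: "\<And>z. norm z < 1 \<Longrightarrow> (\<lambda>j. a j * z ^ j) sums f z" and R: "0 \<le> R" "R < 1"
  shows "(\<lambda>j. (norm (a j))^2 * R^(2*j)) sums (LINT t|circ. (norm (f (polar R t)))^2)"
proof -
  define b where "b = (\<lambda>j. a j * complex_of_real R ^ j)"
  define F where "F = (\<lambda>n t. \<Sum>j<n. b j * cis t ^ j)"
  have "summable (\<lambda>j. a j * complex_of_real ((1 + R)/2) ^ j)"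
    using R by (intro sums_summable[OF a]) (simp only: norm_of_real, simp)
  then have sb: "summable (\<lambda>j. norm (b j))"
    unfolding b_def by (rule powser_insidea) (use R in \<open>simp only: norm_of_real, simp\<close>)
  define B where "B = (\<Sum>j. norm (b j))"
  have FB: "norm (F n t) \<le> B" for n t
  proof -
    have "norm (F n t) \<le> (\<Sum>j<n. norm (b j))"
      unfolding F_def by (rule sum_norm_le) (simp add: norm_mult norm_power)
    also have "\<dots> \<le> B" unfolding B_def by (rule sum_le_suminf[OF sb]) auto
    finally show ?thesis .
  qed
  have lim: "(\<lambda>n. F n t) \<longlonglongrightarrow> f (polar R t)" for t
    using a[of "polar R t"] R
    by (simp add: sums_def F_def b_def norm_mult power_mult_distrib mult_ac)
  have [measurable]: "F n \<in> borel_measurable borel" for n unfolding F_def by measurable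
  have "(\<lambda>n. LINT t|circ. (norm (F n t))^2) \<longlonglongrightarrow> (LINT t|circ. (norm (f (polar R t)))^2)"
  proof (rule integral_dominated_convergence[where w="\<lambda>_. B^2"])
    have "(\<lambda>t. f (polar R t)) \<in> borel_measurable borel"
      by (rule borel_measurable_LIMSEQ_metric[of F]) (use lim in auto)
    then show "(\<lambda>t. (norm (f (polar R t)))^2) \<in> borel_measurable circ" by measurable
    show "AE t in circ. (\<lambda>n. (norm (F n t))^2) \<longlonglongrightarrow> (norm (f (polar R t)))^2"
      by (intro AE_I2 tendsto_intros lim)
    show "AE t in circ. norm ((norm (F n t))^2) \<le> B^2" for n
      using FB by (intro AE_I2) (simp add: power_mono)
  qed auto
  then show ?thesis unfolding F_def parseval_finite sums_def
    using R by (simp add: b_def norm_mult norm_power power_mult_distrib power_mult mult.commute)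
qed

text \<open>
  Among the first radii of the list, \<open>sel n\<close> picks at each angle one that maximises \<open>|p|\<close>. By the
  Poisson formula on a slightly larger circle, the selected value is bounded by the operator of a
  radial selection, to which \<open>maximal_bound\<close> applies; then \<open>n\<close> tends to infinity by monotone
  convergence.
\<close>

lemma radial_maximal:
  fixes rs :: "nat \<Rightarrow> real"
  assumes p: "p holomorphic_on ball 0 1"
    and e: "\<And>R. 0 \<le> R \<Longrightarrow> R < 1 \<Longrightarrow> (\<integral>\<^sup>+ t. ennreal ((norm (p (polar R t)))^2) \<partial>circ) \<le> ennreal \<epsilon>"
    and rs: "\<And>n. 0 \<le> rs n" "\<And>n. rs n < (1::real)"
  shows "(\<integral>\<^sup>+ t. (SUP n. ennreal ((norm (p (polar (rs n) t)))^2)) \<partial>circ) \<le> ennreal 289 * ennreal \<epsilon>"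
proof -
  define v where "v = (\<lambda>r t. norm (p (polar r t)))"
  (* A running maximum over the first radii: sel n t is one of rs 0, ..., rs n. *)
  define sel where "sel = rec_nat (\<lambda>t. rs 0) (\<lambda>n g t. if v (rs (Suc n)) t > v (g t) t then rs (Suc n) else g t)"
  have sel0: "sel 0 t = rs 0" for t by (simp add: sel_def)
  have selS: "sel (Suc n) t = (if v (rs (Suc n)) t > v (sel n t) t then rs (Suc n) else sel n t)" for n t
    by (simp add: sel_def)
  have pc: "continuous_on (ball 0 1) p" by (rule holomorphic_on_imp_continuous_on[OF p])
  have selrange: "sel n t \<in> rs ` {..n}" for n t
    by (induction n) (auto simp: sel0 selS)
  have sel01: "0 \<le> sel n t" "sel n t < 1" for n t using selrange[of n t] rs by auto
  have vmeas: "(\<lambda>t. v (g t) t) \<in> borel_measurable borel"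
    if "g \<in> borel_measurable borel" "\<And>t. 0 \<le> g t" "\<And>t. g t < 1" for g
  proof -
    have [measurable]: "g \<in> borel_measurable borel" by (rule that)
    have [measurable]: "(\<lambda>t. p (polar (g t) t)) \<in> borel_measurable borel"
      by (rule disc_measurable[OF pc]) (use that in \<open>auto simp: norm_mult\<close>)
    show ?thesis unfolding v_def by measurable
  qed
  have selm [measurable]: "sel n \<in> borel_measurable borel" for n
  proof (induction n)
    case 0 show ?case by (simp add: sel0[abs_def])
  next
    case (Suc n)
    have [measurable]: "(\<lambda>t. v (sel n t) t) \<in> borel_measurable borel" "(\<lambda>t. v (rs (Suc n)) t) \<in> borel_measurable borel"
      using vmeas[OF Suc sel01] vmeas[of "\<lambda>_. rs (Suc n)"] rs by auto
    show ?case unfolding selS[abs_def] using Suc by measurable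
  qed
  have mono: "v (sel n t) t \<le> v (sel (Suc n) t) t" for n t by (simp add: selS)
  have ge: "v (rs n) t \<le> v (sel n t) t" for n t by (cases n) (auto simp: sel0 selS)
  have bound: "(\<integral>\<^sup>+ t. ennreal ((v (sel n t) t)^2) \<partial>circ) \<le> ennreal 289 * ennreal \<epsilon>" for n
  proof -
    define \<rho> where "\<rho> = Max (rs ` {..n})"
    have "\<rho> \<in> rs ` {..n}" unfolding \<rho>_def by (rule Max_in) auto
    then have rho: "0 \<le> \<rho>" "\<rho> < 1" using rs by auto
    have le: "sel n t \<le> \<rho>" for t unfolding \<rho>_def by (rule Max_ge) (use selrange in auto)
    define R where "R = (1 + \<rho>)/2"
    have R: "0 < R" "R < 1" "\<rho> < R" using rho by (auto simp: R_def)
    interpret rsel: radial_selection "\<lambda>t. sel n t / R" "\<rho> / R"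
      by unfold_locales (use R sel01 le in \<open>auto intro!: divide_right_mono\<close>)
    define \<phi> where "\<phi> = (\<lambda>s. ennreal (norm (p (polar R s))))"
    have [measurable]: "(\<lambda>s. p (polar R s)) \<in> borel_measurable borel"
      using R by (intro circle_measurable p) auto
    have "ennreal (v (sel n t) t) \<le> rsel.T \<phi> t" for t
    proof -
      let ?z = "polar (sel n t / R) t"
      have hol: "(\<lambda>z. p (complex_of_real R * z)) holomorphic_on ball 0 (1/R)"
      proof -
        have "(\<lambda>z. complex_of_real R * z) ` ball 0 (1/R) \<subseteq> ball 0 1"
          using R by (auto simp: norm_mult field_simps)
        then show ?thesis using holomorphic_on_compose_gen[of "\<lambda>z. complex_of_real R * z" "ball 0 (1/R)" p "ball 0 1"] p
          by (auto simp: o_def intro!: holomorphic_intros)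
      qed
      have nz: "norm ?z < 1" by (rule rsel.selected_in_disc)
      have P0: "0 \<le> poisson ?z w" for w by (intro poisson_nonneg less_imp_le[OF nz])
      have "p (polar (sel n t) t) = (LINT s|circ. complex_of_real (poisson ?z (cis s)) * p (polar R s))"
        using poisson_formula[OF hol _ nz] R by simp
      also have "norm \<dots> \<le> (LINT s|circ. norm (complex_of_real (poisson ?z (cis s)) * p (polar R s)))"
        by (rule integral_norm_bound)
      finally have *: "v (sel n t) t \<le> (LINT s|circ. poisson ?z (cis s) * norm (p (polar R s)))"
        unfolding v_def norm_mult norm_of_real abs_of_nonneg[OF P0] .
      have cR: "continuous_on (sphere 0 1) (\<lambda>w. p (complex_of_real R * w))"
        by (rule continuous_on_compose2[OF pc]) (use R in \<open>auto intro!: continuous_intros simp: norm_mult\<close>)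
      have i: "integrable circ (\<lambda>s. poisson ?z (cis s) * norm (p (polar R s)))"
        by (intro integrable_circ_continuous[of "\<lambda>w. poisson ?z w * norm (p (complex_of_real R * w))"]
            continuous_intros continuous_on_poisson nz cR)
      have "ennreal (LINT s|circ. poisson ?z (cis s) * norm (p (polar R s)))
         = (\<integral>\<^sup>+ s. ennreal (poisson ?z (cis s) * norm (p (polar R s))) \<partial>circ)"
        by (rule nn_integral_eq_integral[OF i, symmetric]) (intro AE_I2 mult_nonneg_nonneg P0 norm_ge_zero)
      also have "\<dots> = rsel.T \<phi> t" unfolding rsel.T_def rsel.k_def \<phi>_def
        by (intro nn_integral_cong ennreal_mult P0 norm_ge_zero)
      finally show ?thesis using * by (metis ennreal_leI)
    qed
    then have "(\<integral>\<^sup>+ t. ennreal ((v (sel n t) t)^2) \<partial>circ) \<le> rsel.L2 (rsel.T \<phi>)"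
      unfolding rsel.L2_def by (intro nn_integral_mono) (simp add: ennreal_power[symmetric] v_def power_mono)
    also have "\<dots> \<le> ennreal 289 * rsel.L2 \<phi>"
      by (rule rsel.maximal_bound) (simp add: \<phi>_def)
    also have "rsel.L2 \<phi> \<le> ennreal \<epsilon>"
      using e[of R] R unfolding rsel.L2_def \<phi>_def by (simp add: ennreal_power)
    finally show ?thesis by (simp add: mult_left_mono)
  qed
  have m: "(\<lambda>t. ennreal ((v (sel n t) t)^2)) \<in> borel_measurable circ" for n
    using vmeas[OF selm sel01] by measurable
  have "(\<integral>\<^sup>+ t. (SUP n. ennreal ((v (rs n) t)^2)) \<partial>circ) \<le> (\<integral>\<^sup>+ t. (SUP n. ennreal ((v (sel n t) t)^2)) \<partial>circ)"
    by (intro nn_integral_mono SUP_mono' ennreal_leI power_mono ge) (simp add: v_def)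
  also have "\<dots> = (SUP n. \<integral>\<^sup>+ t. ennreal ((v (sel n t) t)^2) \<partial>circ)"
    by (rule nn_integral_monotone_convergence_SUP[OF _ m])
       (auto simp: incseq_Suc_iff le_fun_def v_def intro!: ennreal_leI power_mono mono[unfolded v_def])
  also have "\<dots> \<le> ennreal 289 * ennreal \<epsilon>" by (rule SUP_least) (rule bound)
  finally show ?thesis by (simp add: v_def)
qed

lemma left_limit_exists:
  fixes \<phi> :: "real \<Rightarrow> complex"
  assumes "\<And>e. e > 0 \<Longrightarrow> \<exists>c. eventually (\<lambda>r. norm (\<phi> r - c) \<le> e) (at_left 1)"
  shows "\<exists>l. (\<phi> \<longlongrightarrow> l) (at_left 1)"
proof -
  note fx = rseq_at_left
  have "Cauchy (\<lambda>n. \<phi> (rseq n))"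
  proof (rule metric_CauchyI)
    fix e :: real assume e: "e > 0"
    obtain c where "eventually (\<lambda>r. norm (\<phi> r - c) \<le> e/3) (at_left 1)" using assms[of "e/3"] e by auto
    then have "eventually (\<lambda>n. norm (\<phi> (rseq n) - c) \<le> e/3) sequentially" using fx by (rule eventually_compose_filterlim)
    then obtain N where N: "\<And>n. n \<ge> N \<Longrightarrow> norm (\<phi> (rseq n) - c) \<le> e/3" by (auto simp: eventually_sequentially)
    show "\<exists>M. \<forall>m\<ge>M. \<forall>n\<ge>M. dist (\<phi> (rseq m)) (\<phi> (rseq n)) < e"
    proof (intro exI[of _ N] allI impI)
      fix m n assume "m \<ge> N" "n \<ge> N"
      then have "norm (\<phi> (rseq m) - c) \<le> e/3" "norm (\<phi> (rseq n) - c) \<le> e/3" using N by auto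
      moreover have "dist (\<phi> (rseq m)) (\<phi> (rseq n)) \<le> norm (\<phi> (rseq m) - c) + norm (\<phi> (rseq n) - c)"
        unfolding dist_norm using norm_triangle_ineq4[of "\<phi> (rseq m) - c" "\<phi> (rseq n) - c"] by simp
      ultimately show "dist (\<phi> (rseq m)) (\<phi> (rseq n)) < e" using e by linarith
    qed
  qed
  then obtain l where l: "(\<lambda>n. \<phi> (rseq n)) \<longlonglongrightarrow> l" by (metis Cauchy_convergent_iff convergent_def)
  have "(\<phi> \<longlongrightarrow> l) (at_left 1)"
  proof (rule tendstoI)
    fix e :: real assume e: "e > 0"
    obtain c where c: "eventually (\<lambda>r. norm (\<phi> r - c) \<le> e/3) (at_left 1)" using assms[of "e/3"] e by auto
    then have "eventually (\<lambda>n. norm (\<phi> (rseq n) - c) \<le> e/3) sequentially" using fx by (rule eventually_compose_filterlim)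
    moreover have "(\<lambda>n. norm (\<phi> (rseq n) - c)) \<longlonglongrightarrow> norm (l - c)" by (intro tendsto_intros l)
    ultimately have "norm (l - c) \<le> e/3" by (intro tendsto_upperbound) auto
    then show "eventually (\<lambda>r. dist (\<phi> r) l < e) (at_left 1)"
    proof (intro eventually_mono[OF c])
      fix r assume "norm (\<phi> r - c) \<le> e/3" "norm (l - c) \<le> e/3"
      then show "dist (\<phi> r) l < e"
        unfolding dist_norm using norm_triangle_ineq4[of "\<phi> r - c" "l - c"] e by simp
    qed
  qed
  then show ?thesis by blast
qed

text \<open>
  Let \<open>f_s\<close> be the dilate \<open>f (s * z)\<close>. By Parseval the \<open>L\<^sup>2\<close> norms of \<open>f - f_s\<close> on circles tend to
  0 as \<open>s\<close> tends to 1, and by the maximal inequality so does \<open>sup |f - f_s|\<close> over rational radii,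
  in \<open>L\<^sup>2\<close>. Hence at almost every angle \<open>f\<close> is within any given error of some dilate along the
  whole radius, and dilates are continuous up to the circle.
\<close>

theorem fatou_radial_limits:
  assumes f: "f holomorphic_on ball 0 1" and B: "\<And>z. norm z < 1 \<Longrightarrow> norm (f z) \<le> B"
  shows "AE t in circ. \<exists>l. ((\<lambda>r. f (polar r t)) \<longlongrightarrow> l) (at_left 1)"
proof -
  define a where "a = (\<lambda>j. (deriv ^^ j) f 0 / fact j)"
  have a: "(\<lambda>j. a j * z ^ j) sums f z" if "norm z < 1" for z
    using holomorphic_power_series[OF f, of z] that by (simp add: a_def)
  have fc: "continuous_on (ball 0 1) f" by (rule holomorphic_on_imp_continuous_on[OF f])
  have B0: "B \<ge> 0" using B[of 0] norm_ge_zero[of "f 0"] by (simp add: order_trans[OF norm_ge_zero])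
  have part: "(\<Sum>j<n. (norm (a j))^2) \<le> B^2" for n
  proof -
    have le: "(\<Sum>j<n. (norm (a j))^2 * R^(2*j)) \<le> B^2" if R: "0 \<le> R" "R < 1" for R :: real
    proof -
      have par: "(\<lambda>j. (norm (a j))^2 * R^(2*j)) sums (LINT t|circ. (norm (f (polar R t)))^2)"
        by (rule parseval[OF a R])
      have "(\<Sum>j<n. (norm (a j))^2 * R^(2*j)) \<le> (\<Sum>j. (norm (a j))^2 * R^(2*j))"
        by (rule sum_le_suminf[OF sums_summable[OF par]]) (use R in auto)
      also have "\<dots> = (LINT t|circ. (norm (f (polar R t)))^2)"
        by (rule sums_unique[OF par, symmetric])
      also have "\<dots> \<le> (LINT t|circ. B^2)"
      proof (rule integral_mono)
        have [measurable]: "(\<lambda>t. f (polar R t)) \<in> borel_measurable borel"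
          using R by (intro circle_measurable f)
        have le: "(norm (f (polar R t)))^2 \<le> B^2" for t
          using R by (intro power_mono B) (auto simp: norm_mult)
        then show "integrable circ (\<lambda>t. (norm (f (polar R t)))^2)"
          by (intro integrable_circ_bounded[where B="B^2"]) auto
        show "(norm (f (polar R t)))^2 \<le> B^2" for t by (rule le)
      qed auto
      also have "\<dots> = B^2" by simp
      finally show ?thesis .
    qed
    have "((\<lambda>R. \<Sum>j<n. (norm (a j))^2 * R^(2*j)) \<longlongrightarrow> (\<Sum>j<n. (norm (a j))^2 * 1^(2*j))) (at_left 1)"
      by (intro tendsto_intros)
    moreover have "eventually (\<lambda>R. (\<Sum>j<n. (norm (a j))^2 * R^(2*j)) \<le> B^2) (at_left (1::real))"
      by (rule eventually_mono[OF eventually_at_left_real[OF zero_less_one]]) (auto intro!: le)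
    ultimately have "(\<Sum>j<n. (norm (a j))^2 * 1^(2*j)) \<le> B^2" by (rule tendsto_upperbound) simp
    then show ?thesis by simp
  qed
  have sa: "summable (\<lambda>j. (norm (a j))^2)"
    by (rule summableI_nonneg_bounded[OF _ part]) auto
  define s where "s = rseq"
  have s01: "0 < s k" "s k < 1" for k by (auto simp: s_def)
  have slim: "s \<longlonglongrightarrow> 1" unfolding s_def by (rule rseq_lim)
  define p where "p = (\<lambda>k z. f z - f (complex_of_real (s k) * z))"
  have ns: "norm (complex_of_real (s k) * z) < 1" if "norm z < 1" for k z
  proof -
    have "s k * norm z \<le> 1 * norm z" using s01[of k] by (intro mult_right_mono) auto
    then show ?thesis using that s01[of k] by (simp add: norm_mult)
  qed
  have ph: "p k holomorphic_on ball 0 1" for k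
  proof -
    have "(\<lambda>z. complex_of_real (s k) * z) ` ball 0 1 \<subseteq> ball 0 1" using ns by auto
    then have "(\<lambda>z. f (complex_of_real (s k) * z)) holomorphic_on ball 0 1"
      using holomorphic_on_compose_gen[of "\<lambda>z. complex_of_real (s k) * z" "ball 0 1" f "ball 0 1"] f
      by (auto simp: o_def intro!: holomorphic_intros)
    then show ?thesis unfolding p_def by (intro holomorphic_intros f)
  qed
  have ps: "(\<lambda>j. (a j * (1 - complex_of_real (s k) ^ j)) * z ^ j) sums p k z" if "norm z < 1" for k z
    using sums_diff[OF a[OF that] a[OF ns[OF that]]] unfolding p_def
    by (simp add: algebra_simps power_mult_distrib)
  have n1: "norm (1 - complex_of_real (s k) ^ j) = 1 - s k ^ j" for k j
  proof -
    have "1 - complex_of_real (s k) ^ j = complex_of_real (1 - s k ^ j)" by simp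
    moreover have "s k ^ j \<le> 1" using s01[of k] by (intro power_le_one) auto
    ultimately show ?thesis by (simp only: norm_of_real abs_of_nonneg diff_ge_0_iff_ge)
  qed
  have c1: "0 \<le> 1 - s k ^ j" "1 - s k ^ j \<le> 1" for k j using s01[of k] by (auto intro!: power_le_one)
  define \<epsilon> where "\<epsilon> = (\<lambda>k. \<Sum>j. (norm (a j))^2 * (1 - s k ^ j)^2)"
  have le1: "(norm (a j))^2 * (1 - s k ^ j)^2 \<le> (norm (a j))^2" for j k
    using mult_left_mono[of "(1 - s k ^ j)^2" 1 "(norm (a j))^2"] c1[of k j] by (simp add: power_le_one)
  have se: "summable (\<lambda>j. (norm (a j))^2 * (1 - s k ^ j)^2)" for k
    by (rule summable_comparison_test'[OF sa, of 0]) (use le1 in auto)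
  have e0: "\<epsilon> \<longlonglongrightarrow> 0"
  proof -
    have "(\<lambda>k. \<Sum>j. (norm (a j))^2 * (1 - s k ^ j)^2) \<longlonglongrightarrow> (\<Sum>j. (norm (a j))^2 * (1 - 1 ^ j)^2)"
    proof (rule conjunct2[OF conjunct2[OF tannerys_theorem[where M="\<lambda>j. (norm (a j))^2"]]])
      show "(\<lambda>k. (norm (a j))^2 * (1 - s k ^ j)^2) \<longlonglongrightarrow> (norm (a j))^2 * (1 - 1 ^ j)^2" for j
        by (intro tendsto_intros slim)
      show "\<forall>\<^sub>F (j, k) in at_top \<times>\<^sub>F sequentially. norm ((norm (a j))^2 * (1 - s k ^ j)^2) \<le> (norm (a j))^2"
        using le1 by (intro always_eventually) auto
    qed (auto intro: sa)
    then show ?thesis by (simp add: \<epsilon>_def)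
  qed
  have pe: "(\<integral>\<^sup>+ t. ennreal ((norm (p k (polar R t)))^2) \<partial>circ) \<le> ennreal (\<epsilon> k)"
    if R: "0 \<le> R" "R < 1" for R k
  proof -
    have [measurable]: "(\<lambda>t. p k (polar R t)) \<in> borel_measurable borel"
      using R by (intro circle_measurable ph)
    have nb: "norm (p k z) \<le> B + B" if "norm z < 1" for z
      unfolding p_def using norm_triangle_ineq4[of "f z" "f (complex_of_real (s k) * z)"] B[OF that] B[OF ns[OF that, of k]]
      by linarith
    have i: "integrable circ (\<lambda>t. (norm (p k (polar R t)))^2)"
    proof (intro integrable_circ_bounded[where B="(B+B)^2"])
      show "norm ((norm (p k (polar R t)))^2) \<le> (B + B)^2" for t
        using power_mono[OF nb[of "polar R t"], of 2] R by (simp add: norm_mult)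
    qed measurable
    have sm: "(\<lambda>j. (norm (a j * (1 - complex_of_real (s k) ^ j)))^2 * R^(2*j)) sums (LINT t|circ. (norm (p k (polar R t)))^2)"
      by (rule parseval[OF ps R])
    have "(LINT t|circ. (norm (p k (polar R t)))^2) \<le> \<epsilon> k"
      unfolding \<epsilon>_def
    proof (subst sums_unique[OF sm], rule suminf_le[OF _ sums_summable[OF sm] se])
      fix j
      have "R^(2*j) \<le> 1" using R by (intro power_le_one) auto
      then have "(norm (a j))^2 * (1 - s k ^ j)^2 * R^(2*j) \<le> (norm (a j))^2 * (1 - s k ^ j)^2 * 1"
        by (intro mult_left_mono) auto
      then show "(norm (a j * (1 - complex_of_real (s k) ^ j)))^2 * R^(2*j) \<le> (norm (a j))^2 * (1 - s k ^ j)^2"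
        by (simp add: norm_mult n1 power_mult_distrib)
    qed
    then show ?thesis by (subst nn_integral_eq_integral[OF i]) (auto intro!: ennreal_leI)
  qed
  define rs where "rs = from_nat_into (\<rat> \<inter> {0<..<1::real})"
  have rrange: "range rs = \<rat> \<inter> {0<..<1}"
  proof -
    have "1/2 \<in> \<rat> \<inter> {0<..<1::real}" by auto
    then have "\<rat> \<inter> {0<..<1::real} \<noteq> {}" by blast
    moreover have "countable (\<rat> \<inter> {0<..<1::real})" by (intro countable_Int1 countable_rat)
    ultimately show ?thesis unfolding rs_def by (intro range_from_nat_into) auto
  qed
  have rs01: "0 < rs n" "rs n < 1" for n using rrange by auto
  define S where "S = (\<lambda>k t. SUP n. ennreal ((norm (p k (polar (rs n) t)))^2))"
  have Sm [measurable]: "S k \<in> borel_measurable borel" for k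
  proof -
    have [measurable]: "(\<lambda>t. p k (polar (rs n) t)) \<in> borel_measurable borel" for n
      using rs01[of n] by (intro circle_measurable ph) auto
    show ?thesis unfolding S_def by measurable
  qed
  have SE: "(\<integral>\<^sup>+ t. S k t \<partial>circ) \<le> ennreal 289 * ennreal (\<epsilon> k)" for k
    unfolding S_def using rs01 by (intro radial_maximal ph pe) (auto intro: less_imp_le)
  have "(\<integral>\<^sup>+ t. (INF k. S k t) \<partial>circ) \<le> ennreal (289 * \<epsilon> k)" for k
  proof -
    have "(\<integral>\<^sup>+ t. (INF k. S k t) \<partial>circ) \<le> (\<integral>\<^sup>+ t. S k t \<partial>circ)"
      by (intro nn_integral_mono INF_lower) auto
    also have "\<dots> \<le> ennreal (289 * \<epsilon> k)" using SE[of k] by (subst ennreal_mult') auto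
    finally show ?thesis .
  qed
  moreover have "(\<lambda>k. ennreal (289 * \<epsilon> k)) \<longlonglongrightarrow> ennreal (289 * 0)"
    by (intro tendsto_ennrealI tendsto_intros e0)
  ultimately have "(\<integral>\<^sup>+ t. (INF k. S k t) \<partial>circ) \<le> ennreal (289 * 0)"
    by (intro LIMSEQ_le_const) auto
  then have "(\<integral>\<^sup>+ t. (INF k. S k t) \<partial>circ) = 0" by simp
  then have "AE t in circ. (INF k. S k t) = 0"
    by (subst (asm) nn_integral_0_iff_AE) auto
  then show ?thesis
  proof eventually_elim
    case (elim t)
    show ?case
    proof (rule left_limit_exists)
      fix e :: real assume e: "e > 0"
      have "(INF k. S k t) < ennreal ((e/2)^2)" using elim e by simp
      then obtain k where k: "S k t < ennreal ((e/2)^2)" by (auto simp: INF_less_iff)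
      have rat: "norm (p k (polar (rs n) t)) \<le> e/2" for n
      proof -
        have "ennreal ((norm (p k (polar (rs n) t)))^2) \<le> S k t"
          unfolding S_def by (rule SUP_upper) simp
        then have "ennreal ((norm (p k (polar (rs n) t)))^2) < ennreal ((e/2)^2)" using k by (rule le_less_trans)
        then have "(norm (p k (polar (rs n) t)))^2 < (e/2)^2" by (simp add: ennreal_less_iff)
        then show ?thesis by (rule power2_le_imp_le[OF less_imp_le]) (use e in auto)
      qed
      have all: "norm (p k (polar r t)) \<le> e/2" if r: "0 < r" "r < 1" for r
      proof (rule ccontr)
        assume "\<not> norm (p k (polar r t)) \<le> e/2"
        then have gt: "norm (p k (polar r t)) > e/2" by simp
        have ic: "isCont (p k) (polar r t)"
          using ph[of k] r by (intro continuous_on_interior[OF holomorphic_on_imp_continuous_on]) (auto simp: norm_mult)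
        have "((\<lambda>x. norm (p k (polar x t))) \<longlongrightarrow> norm (p k (polar r t))) (at r)"
          by (rule tendsto_norm, rule isCont_tendsto_compose[OF ic], intro tendsto_intros)
        from order_tendstoD(1)[OF this gt] obtain d where d: "d > 0" "\<And>x. x \<noteq> r \<Longrightarrow> dist x r < d \<Longrightarrow> norm (p k (polar x t)) > e/2"
          by (auto simp: eventually_at)
        obtain q where q: "q \<in> \<rat>" "max 0 (r - d) < q" "q < r"
          using Rats_dense_in_real[of "max 0 (r - d)" r] d r by auto
        then have "q \<in> range rs" unfolding rrange using r by auto
        then obtain n where "q = rs n" by auto
        then have "norm (p k (polar q t)) \<le> e/2" using rat by simp
        moreover have "norm (p k (polar q t)) > e/2" using q by (intro d) (auto simp: dist_real_def)
        ultimately show False by simp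
      qed
      let ?c = "f (polar (s k * 1) t)"
      have "isCont f (polar (s k * 1) t)"
        using s01[of k] by (intro continuous_on_interior[OF fc]) (auto simp: norm_mult)
      then have "((\<lambda>r. f (polar (s k * r) t)) \<longlongrightarrow> ?c) (at_left 1)"
        by (rule isCont_tendsto_compose) (intro tendsto_intros)
      from tendstoD[OF this, of "e/2"] e
      have "eventually (\<lambda>r. dist (f (polar (s k * r) t)) ?c < e/2) (at_left 1)" by simp
      then have "eventually (\<lambda>r. norm (f (polar r t) - ?c) \<le> e) (at_left 1)"
        using eventually_at_left_real[of 0 "1::real", OF zero_less_one]
      proof eventually_elim
        case (elim r)
        have "norm (f (polar r t) - ?c) \<le> norm (p k (polar r t)) + dist (f (polar (s k * r) t)) ?c"
          unfolding p_def dist_norm using norm_triangle_ineq[of "f (polar r t) - f (polar (s k * r) t)" "f (polar (s k * r) t) - ?c"]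
          by (simp add: mult_ac)
        then show ?case using all[of r] elim by simp
      qed
      then show "\<exists>c. eventually (\<lambda>r. norm (f (polar r t) - c) \<le> e) (at_left 1)" by blast
    qed
  qed
qed

section \<open>The inner part of a bounded function\<close>

lemma abs_rseq [simp]: "\<bar>rseq n\<bar> = rseq n"
  by (simp add: less_imp_le)

lemma rseq_nonneg [simp]: "0 \<le> rseq n"
  by (simp add: less_imp_le)

lemma norm_mult_le_nonneg: "0 \<le> a \<Longrightarrow> a \<le> A \<Longrightarrow> 0 \<le> b \<Longrightarrow> b \<le> B \<Longrightarrow> norm (a * b :: real) \<le> A * B"
  by (simp add: abs_mult mult_mono')

text \<open>
  Inner functions are defined through almost every real angle. By periodicity the exceptional set
  is covered by countably many translates of the one in a single period.
\<close>

lemma AE_circ_imp_AE_lborel: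
  assumes "AE t in circ. Q (cis t)" shows "AE t in lborel. Q (cis t)"
proof -
  have "AE t in lborel. t \<in> {0..2*pi} \<longrightarrow> Q (cis t)" using assms by (simp add: AE_circ_iff)
  then obtain N where N: "N \<in> null_sets lborel" "{t \<in> space lborel. \<not> (t \<in> {0..2*pi} \<longrightarrow> Q (cis t))} \<subseteq> N"
    by (auto elim!: AE_E simp: null_sets_def)
  have tr: "(\<lambda>t. t - c) -` N \<in> null_sets lborel" for c :: real
  proof -
    have [measurable]: "N \<in> sets borel" using N by auto
    have m: "(\<lambda>t. t - c) \<in> borel_measurable borel" by simp
    have s: "(\<lambda>t. t - c) -` N \<in> sets borel" using measurable_sets[OF m, of N] by simp
    have "emeasure lborel N = emeasure (distr lborel borel ((+) (-c))) N" by (simp add: lborel_distr_plus)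
    also have "\<dots> = emeasure lborel ((\<lambda>t. t - c) -` N)"
      by (subst emeasure_distr) (auto intro!: arg_cong[where f="emeasure lborel"])
    finally show ?thesis using N s by (auto simp: null_sets_def)
  qed
  have "(\<Union>k::int. (\<lambda>t. t - 2*pi*k) -` N) \<in> null_sets lborel"
    by (intro null_sets_UN tr)
  then show ?thesis
  proof (rule AE_I')
    show "{t \<in> space lborel. \<not> Q (cis t)} \<subseteq> (\<Union>k::int. (\<lambda>t. t - 2*pi*k) -` N)"
    proof
      fix t assume "t \<in> {t \<in> space lborel. \<not> Q (cis t)}"
      then have nq: "\<not> Q (cis t)" by simp
      define k where "k = \<lfloor>t / (2*pi)\<rfloor>"
      have k: "of_int k \<le> t / (2*pi)" "t / (2*pi) < of_int k + 1" unfolding k_def by linarith+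
      have r: "0 \<le> t - 2*pi*k" "t - 2*pi*k \<le> 2*pi"
        using k by (auto simp: field_simps)
      have "cis (t - 2*pi*k) = cis t"
        by (simp add: cis_divide[symmetric] cis_multiple_2pi)
      then have "t - 2*pi*k \<in> N" using N(2) nq r by auto
      then show "t \<in> (\<Union>k::int. (\<lambda>t. t - 2*pi*k) -` N)" by auto
    qed
  qed
qed

lemma AE_lborel_imp_AE_circ: "AE t in lborel. Q t \<Longrightarrow> AE t in circ. Q t"
  by (simp add: AE_circ_iff) (auto elim: eventually_mono)

lemma inner_functionI:
  assumes "I holomorphic_on ball 0 1" "\<And>z. norm z < 1 \<Longrightarrow> norm (I z) \<le> 1"
    and "AE t in circ. \<exists>w. norm w = 1 \<and> ((\<lambda>r. I (polar r t)) \<longlongrightarrow> w) (at_left 1)"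
  shows "inner_function I"
  unfolding inner_function_def
  using assms AE_circ_imp_AE_lborel[of "\<lambda>c. \<exists>w. norm w = 1 \<and> ((\<lambda>r. I (complex_of_real r * c)) \<longlongrightarrow> w) (at_left 1)"]
  by auto

lemma dilate_holomorphic:
  assumes "f holomorphic_on ball 0 1" "0 < R"
  shows "(\<lambda>z. f (complex_of_real R * z)) holomorphic_on ball 0 (1/R)"
proof -
  have "(\<lambda>z. complex_of_real R * z) ` ball 0 (1/R) \<subseteq> ball 0 1"
    using assms by (auto simp: norm_mult field_simps)
  then show ?thesis using holomorphic_on_compose_gen[of "\<lambda>z. complex_of_real R * z" "ball 0 (1/R)" f "ball 0 1"] assms
    by (auto simp: o_def intro!: holomorphic_intros)
qed

text \<open>
  Total by taking the limit along a fixed sequence; almost everywhere it is the full radial limit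
  of a bounded function by \<open>AE_radial_limit\<close>.
\<close>

definition radial_limit :: "(complex \<Rightarrow> complex) \<Rightarrow> real \<Rightarrow> complex" where
  "radial_limit f t = lim (\<lambda>n. f (polar (rseq n) t))"

lemma radial_limit_measurable [measurable]:
  assumes "f holomorphic_on ball 0 1"
  shows "radial_limit f \<in> borel_measurable borel"
  unfolding radial_limit_def[abs_def]
  by (rule borel_measurable_lim_metric, rule circle_measurable[OF assms]) (auto intro: less_imp_le)

lemma radial_limit_eq:
  assumes "((\<lambda>r. f (polar r t)) \<longlongrightarrow> l) (at_left 1)"
  shows "radial_limit f t = l"
  unfolding radial_limit_def using filterlim_compose[OF assms rseq_at_left] by (rule limI)

lemma AE_radial_limit:
  assumes f: "f holomorphic_on ball 0 1" and B: "\<And>z. norm z < 1 \<Longrightarrow> norm (f z) \<le> B"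
  shows "AE t in circ. ((\<lambda>r. f (polar r t)) \<longlongrightarrow> radial_limit f t) (at_left 1)"
proof -
  have "AE t in circ. \<exists>l. ((\<lambda>r. f (polar r t)) \<longlongrightarrow> l) (at_left 1)"
    by (rule fatou_radial_limits[OF f B])
  then show ?thesis by eventually_elim (auto simp: radial_limit_eq)
qed

lemma radial_limit_norm_le:
  assumes l: "((\<lambda>r. f (polar r t)) \<longlongrightarrow> l) (at_left 1)" and B: "\<And>z. norm z < 1 \<Longrightarrow> norm (f z) \<le> B"
  shows "norm l \<le> B"
proof (rule tendsto_upperbound[OF tendsto_norm[OF l]])
  show "eventually (\<lambda>r. norm (f (polar r t)) \<le> B) (at_left 1)"
    by (rule eventually_mono[OF eventually_at_left_real[OF zero_less_one]]) (auto intro!: B simp: norm_mult)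
qed simp

text \<open>
  Minus the logarithm, cut off at height \<open>L\<close>: a bounded continuous stand-in for \<open>- ln x\<close> on \<open>[0,
  1]\<close>.
\<close>

definition tlog :: "real \<Rightarrow> real \<Rightarrow> real" where
  "tlog L x = - ln (max x (exp (- L)))"

lemma tlog_continuous: "isCont (tlog L) x"
proof -
  have "max x (exp (- L)) \<noteq> 0" by (simp add: max_def) (metis exp_not_eq_zero less_le_not_le exp_gt_zero not_le)
  then show ?thesis unfolding tlog_def[abs_def] by (intro continuous_intros) auto
qed

lemma tlog_measurable [measurable]: "tlog L \<in> borel_measurable borel"
  by (intro borel_measurable_continuous_onI continuous_at_imp_continuous_on) (auto intro: tlog_continuous)

lemma tlog_bounds:
  assumes "0 \<le> L" "0 \<le> x" "x \<le> 1" shows "0 \<le> tlog L x" "tlog L x \<le> L" "exp (- tlog L x) \<ge> x"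
proof -
  have m: "max x (exp (- L)) > 0" by (simp add: less_max_iff_disj)
  have "max x (exp (- L)) \<le> 1" using assms by simp
  then show "0 \<le> tlog L x" unfolding tlog_def using m by simp
  have "ln (exp (- L)) \<le> ln (max x (exp (- L)))" by (subst ln_le_cancel_iff) (use m in auto)
  then show "tlog L x \<le> L" by (simp add: tlog_def)
  show "exp (- tlog L x) \<ge> x" using m by (simp add: tlog_def)
qed

lemma tlog_le_ln: "0 < x \<Longrightarrow> tlog L x \<le> - ln x"
  unfolding tlog_def by (simp add: ln_le_cancel_iff less_max_iff_disj)

lemma tlog_eq_ln: "0 < x \<Longrightarrow> - ln x \<le> L \<Longrightarrow> tlog L x = - ln x"
proof -
  assume "0 < x" "- ln x \<le> L"
  then have "exp (- L) \<le> exp (ln x)" by (subst exp_le_cancel_iff) auto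
  then show ?thesis using \<open>0 < x\<close> by (simp add: tlog_def max_def)
qed

lemma tlog_mono: "L \<le> L' \<Longrightarrow> tlog L x \<le> tlog L' x"
proof -
  assume "L \<le> L'"
  then have "max x (exp (- L')) \<le> max x (exp (- L))" by (intro max.mono) auto
  moreover have "0 < max x (exp (- L'))" by (simp add: less_max_iff_disj)
  ultimately show ?thesis unfolding tlog_def by (simp add: ln_le_cancel_iff)
qed

lemma poisson_lower:
  assumes "norm z < 1" "norm w = 1" shows "(1 - (norm z)^2) / 4 \<le> poisson z w"
proof -
  have n: "norm (w - z) \<le> 2" using norm_triangle_ineq4[of w z] assms by simp
  have "w \<noteq> z" using assms by auto
  moreover have "(norm (w - z))^2 \<le> 2^2" using n by (intro power_mono) auto
  ultimately show ?thesis unfolding poisson_def using assms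
    by (intro divide_left_mono) (auto simp: power_le_one)
qed

text \<open>
  Jensen's inequality on the circles of radius \<open>rseq n\<close> is applied with the cut-off logarithm,
  which is bounded, so \<open>n\<close> may tend to infinity by dominated convergence. At the point \<open>z1\<close> the
  result bounds the integrals of the cut-off logarithms uniformly in \<open>L\<close>, hence \<open>ln |h|\<close> is
  integrable on the circle and \<open>L\<close> may tend to infinity.
\<close>

lemma boundary_log:
  assumes h: "h holomorphic_on ball 0 1" and b: "\<And>z. norm z < 1 \<Longrightarrow> norm (h z) \<le> 1"
    and z1: "norm z1 < 1" "h z1 \<noteq> 0"
  obtains \<psi> where "integrable circ \<psi>" "\<And>t. \<psi> t \<ge> 0"
    "AE t in circ. norm (radial_limit h t) = exp (- \<psi> t)"
    "\<And>z. norm z < 1 \<Longrightarrow> norm (h z) \<le> exp (- (LINT t|circ. poisson z (cis t) * \<psi> t))"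
proof -
  define hb where "hb = radial_limit h"
  have [measurable]: "hb \<in> borel_measurable borel" unfolding hb_def using h by measurable
  have lim: "AE t in circ. ((\<lambda>r. h (polar r t)) \<longlongrightarrow> hb t) (at_left 1)"
    unfolding hb_def by (rule AE_radial_limit[OF h b])
  have hb1: "AE t in circ. norm (hb t) \<le> 1"
    using lim by eventually_elim (rule radial_limit_norm_le[OF _ b])
  have limn: "AE t in circ. (\<lambda>n. norm (h (polar (rseq n) t))) \<longlonglongrightarrow> norm (hb t)"
    using lim by eventually_elim (rule tendsto_norm, rule filterlim_compose[OF _ rseq_at_left])
  have P: "0 \<le> poisson z (cis t)" "poisson z (cis t) \<le> 2 / (1 - norm z)" if "norm z < 1" for z t
    using that by (auto intro!: poisson_nonneg poisson_upper)
  have rn: "norm (complex_of_real (rseq n) * z) < 1" if "norm z \<le> 1" for z n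
  proof -
    have "rseq n * norm z \<le> rseq n * 1" using that by (intro mult_left_mono) (auto intro: less_imp_le)
    then have "norm (complex_of_real (rseq n) * z) \<le> rseq n" using rseq_range[of n] by (simp add: norm_mult)
    then show ?thesis using rseq_range(2)[of n] by linarith
  qed
  have step: "norm (h z) \<le> exp (- (LINT t|circ. poisson z (cis t) * tlog (real L) (norm (hb t))))"
    if z: "norm z < 1" for z L
  proof -
    let ?g = "\<lambda>n t. tlog (real L) (norm (h (polar (rseq n) t)))"
    have m [measurable]: "(\<lambda>t. h (polar (rseq n) t)) \<in> borel_measurable borel" for n
      by (rule circle_measurable[OF h]) (auto intro: less_imp_le)
    have g: "0 \<le> ?g n t" "?g n t \<le> real L" for n t by (intro tlog_bounds b rn; simp)+
    have "norm (h (complex_of_real (rseq n) * z)) \<le> exp (LINT t|circ. poisson z (cis t) * (- ?g n t))" for n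
    proof (rule jensen_majorant[of "\<lambda>z. h (complex_of_real (rseq n) * z)" "1 / rseq n" z])
      show "integrable circ (\<lambda>t. - ?g n t)"
        by (rule integrable_circ_bounded[where B="real L"]) (use g in auto)
      show "AE t in circ. norm (h (polar (rseq n) t)) \<le> exp (- ?g n t)"
        by (intro AE_I2 tlog_bounds b rn) auto
    qed (auto intro!: dilate_holomorphic h z)
    then have le: "norm (h (complex_of_real (rseq n) * z)) \<le> exp (- (LINT t|circ. poisson z (cis t) * ?g n t))" for n
      by simp
    have l1: "(\<lambda>n. LINT t|circ. poisson z (cis t) * ?g n t) \<longlonglongrightarrow> (LINT t|circ. poisson z (cis t) * tlog (real L) (norm (hb t)))"
    proof (rule integral_dominated_convergence[where w="\<lambda>_. 2 / (1 - norm z) * real L"])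
      show "AE t in circ. (\<lambda>n. poisson z (cis t) * ?g n t) \<longlonglongrightarrow> poisson z (cis t) * tlog (real L) (norm (hb t))"
        using limn by eventually_elim (rule tendsto_mult_left, rule isCont_tendsto_compose[OF tlog_continuous])
      show "AE t in circ. norm (poisson z (cis t) * ?g n t) \<le> 2 / (1 - norm z) * real L" for n
        by (intro AE_I2 norm_mult_le_nonneg P[OF z] g)
    qed auto
    have "isCont h z" using h z by (intro continuous_on_interior[OF holomorphic_on_imp_continuous_on]) auto
    moreover have "(\<lambda>n. complex_of_real (rseq n) * z) \<longlonglongrightarrow> complex_of_real 1 * z" by (intro tendsto_intros rseq_lim)
    ultimately have l2: "(\<lambda>n. norm (h (complex_of_real (rseq n) * z))) \<longlonglongrightarrow> norm (h z)"
      by (intro tendsto_norm isCont_tendsto_compose[where g=h]) auto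
    show ?thesis
      by (rule LIMSEQ_le[OF l2 tendsto_exp[OF tendsto_minus[OF l1]]]) (use le in auto)
  qed
  (* A lower bound for the Poisson kernel with pole z1. *)
  define c where "c = (1 - (norm z1)^2) / 4"
  have c: "c > 0" using z1 by (simp add: c_def abs_square_less_1)
  have cl: "c \<le> poisson z1 (cis t)" for t unfolding c_def by (rule poisson_lower[OF z1(1)]) simp
  define C where "C = - ln (norm (h z1)) / c"
  have tb: "AE t in circ. 0 \<le> tlog (real L) (norm (hb t)) \<and> tlog (real L) (norm (hb t)) \<le> real L" for L
    using hb1 by eventually_elim (auto intro!: tlog_bounds)
  have it: "integrable circ (\<lambda>t. tlog (real L) (norm (hb t)))" for L
  proof (rule circ.integrable_const_bound[where B="real L"])
    show "AE t in circ. norm (tlog (real L) (norm (hb t))) \<le> real L"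
      using tb[of L] by eventually_elim auto
  qed measurable
  have iPt: "integrable circ (\<lambda>t. poisson z (cis t) * tlog (real L) (norm (hb t)))" if z: "norm z < 1" for L z
  proof (rule circ.integrable_const_bound[where B="2 / (1 - norm z) * real L"])
    show "AE t in circ. norm (poisson z (cis t) * tlog (real L) (norm (hb t))) \<le> 2 / (1 - norm z) * real L"
      using tb[of L] by eventually_elim (intro norm_mult_le_nonneg P[OF z]; simp)
  qed measurable
  have bd: "(LINT t|circ. tlog (real L) (norm (hb t))) \<le> C" for L
  proof -
    have "(LINT t|circ. c * tlog (real L) (norm (hb t))) \<le> (LINT t|circ. poisson z1 (cis t) * tlog (real L) (norm (hb t)))"
    proof (rule integral_mono_AE[OF _ iPt[OF z1(1)]])
      show "AE t in circ. c * tlog (real L) (norm (hb t)) \<le> poisson z1 (cis t) * tlog (real L) (norm (hb t))"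
        using tb[of L] by eventually_elim (intro mult_right_mono cl; simp)
    qed (use it in auto)
    also have "\<dots> \<le> - ln (norm (h z1))"
    proof -
      have "ln (norm (h z1)) \<le> ln (exp (- (LINT t|circ. poisson z1 (cis t) * tlog (real L) (norm (hb t)))))"
        using step[OF z1(1)] z1 by (subst ln_le_cancel_iff) auto
      then show ?thesis by simp
    qed
    finally show ?thesis using c by (simp add: C_def field_simps)
  qed
  have "(\<integral>\<^sup>+ t. (SUP L. ennreal (tlog (real L) (norm (hb t)))) \<partial>circ) = (SUP L. \<integral>\<^sup>+ t. ennreal (tlog (real L) (norm (hb t))) \<partial>circ)"
    by (rule nn_integral_monotone_convergence_SUP) (auto simp: incseq_Suc_iff le_fun_def intro!: ennreal_leI tlog_mono)
  also have "\<dots> \<le> ennreal C"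
  proof (rule SUP_least)
    fix L
    show "(\<integral>\<^sup>+ t. ennreal (tlog (real L) (norm (hb t))) \<partial>circ) \<le> ennreal C"
    proof (subst nn_integral_eq_integral[OF it])
      show "AE t in circ. 0 \<le> tlog (real L) (norm (hb t))" using tb[of L] by eventually_elim auto
    qed (intro ennreal_leI bd)
  qed
  finally have fin: "(\<integral>\<^sup>+ t. (SUP L. ennreal (tlog (real L) (norm (hb t)))) \<partial>circ) \<le> ennreal C" .
  have "AE t in circ. (SUP L. ennreal (tlog (real L) (norm (hb t)))) \<noteq> \<infinity>"
  proof (rule nn_integral_PInf_AE)
    show "(\<integral>\<^sup>+ t. (SUP L. ennreal (tlog (real L) (norm (hb t)))) \<partial>circ) \<noteq> \<infinity>"
      using fin by (metis ennreal_less_top infinity_ennreal_def leD)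
  qed measurable
  then have nz: "AE t in circ. hb t \<noteq> 0"
  proof eventually_elim
    case (elim t)
    show ?case
    proof
      assume "hb t = 0"
      then have "(SUP L. ennreal (tlog (real L) (norm (hb t)))) = (SUP L. ennreal (real L))"
        by (simp add: tlog_def)
      also have "\<dots> = \<infinity>" using ennreal_SUP_of_nat_eq_top by (simp add: ennreal_of_nat_eq_real_of_nat)
      finally show False using elim by simp
    qed
  qed
  define \<psi> where "\<psi> = (\<lambda>t. max 0 (- ln (norm (hb t))))"
  have [measurable]: "\<psi> \<in> borel_measurable borel" unfolding \<psi>_def by measurable
  have psi: "AE t in circ. hb t \<noteq> 0 \<and> \<psi> t = - ln (norm (hb t))"
    using nz hb1 by eventually_elim (auto simp: \<psi>_def max_def)
  have sup_eq: "AE t in circ. ennreal (\<psi> t) \<le> (SUP L. ennreal (tlog (real L) (norm (hb t))))"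
    using psi
  proof eventually_elim
    case (elim t)
    obtain L :: nat where "- ln (norm (hb t)) \<le> real L" using real_arch_simple by blast
    then have "tlog (real L) (norm (hb t)) = \<psi> t" using elim by (subst tlog_eq_ln) auto
    then show ?case by (metis SUP_upper UNIV_I)
  qed
  have ipsi: "integrable circ \<psi>"
  proof (rule integrableI_nn_integral_finite[where x="enn2real (\<integral>\<^sup>+ t. ennreal (\<psi> t) \<partial>circ)"])
    have "(\<integral>\<^sup>+ t. ennreal (\<psi> t) \<partial>circ) \<le> ennreal C"
      using nn_integral_mono_AE[OF sup_eq] fin by (rule order_trans)
    then have "(\<integral>\<^sup>+ t. ennreal (\<psi> t) \<partial>circ) < \<infinity>" by (metis ennreal_less_top infinity_ennreal_def le_less_trans)
    then show "(\<integral>\<^sup>+ t. ennreal (\<psi> t) \<partial>circ) = ennreal (enn2real (\<integral>\<^sup>+ t. ennreal (\<psi> t) \<partial>circ))" by simp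
  qed (auto simp: \<psi>_def)
  show ?thesis
  proof (rule that[OF ipsi])
    show "\<psi> t \<ge> 0" for t by (simp add: \<psi>_def)
    show "AE t in circ. norm (radial_limit h t) = exp (- \<psi> t)"
      using psi by eventually_elim (simp add: hb_def[symmetric])
    fix z :: complex assume z: "norm z < 1"
    have l: "(\<lambda>L. LINT t|circ. poisson z (cis t) * tlog (real L) (norm (hb t))) \<longlonglongrightarrow> (LINT t|circ. poisson z (cis t) * \<psi> t)"
    proof (rule integral_dominated_convergence[where w="\<lambda>t. 2 / (1 - norm z) * \<psi> t"])
      show "integrable circ (\<lambda>t. 2 / (1 - norm z) * \<psi> t)" using ipsi by simp
      show "AE t in circ. (\<lambda>L. poisson z (cis t) * tlog (real L) (norm (hb t))) \<longlonglongrightarrow> poisson z (cis t) * \<psi> t"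
        using psi
      proof eventually_elim
        case (elim t)
        obtain k :: nat where k: "- ln (norm (hb t)) \<le> real k" using real_arch_simple by blast
        have "eventually (\<lambda>L. tlog (real L) (norm (hb t)) = \<psi> t) sequentially"
          using k elim by (intro eventually_sequentiallyI[of k]) (simp add: tlog_eq_ln)
        then show ?case by (intro tendsto_mult_left tendsto_eventually)
      qed
      show "AE t in circ. norm (poisson z (cis t) * tlog (real L) (norm (hb t))) \<le> 2 / (1 - norm z) * \<psi> t" for L
        using psi tb[of L]
      proof eventually_elim
        case (elim t)
        then have "tlog (real L) (norm (hb t)) \<le> \<psi> t" using tlog_le_ln[of "norm (hb t)" "real L"] by simp
        then show ?case using elim by (intro norm_mult_le_nonneg P[OF z]) auto
      qed
    qed auto
    show "norm (h z) \<le> exp (- (LINT t|circ. poisson z (cis t) * \<psi> t))"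
      by (rule LIMSEQ_le_const[OF tendsto_exp[OF tendsto_minus[OF l]]]) (use step[OF z] in auto)
  qed
qed

text \<open>
  Jensen's inequality for the convex function \<open>exp\<close> and the probability density \<open>poisson z\<close>,
  proved with the tangent line at the mean.
\<close>

lemma exp_poisson_le:
  assumes i: "integrable circ \<psi>" and pos: "\<And>t. \<psi> t \<ge> 0" and z: "norm z < 1"
  shows "exp (- (LINT t|circ. poisson z (cis t) * \<psi> t)) \<le> (LINT t|circ. poisson z (cis t) * exp (- \<psi> t))"
proof -
  interpret cd: circle_density circ cis \<psi> by (rule circle_density_circ[OF i])
  define a where "a = (LINT t|circ. poisson z (cis t) * \<psi> t)"
  have [measurable]: "\<psi> \<in> borel_measurable borel" using borel_measurable_integrable[OF i] by simp
  have ip: "integrable circ (\<lambda>t. poisson z (cis t) * \<psi> t)"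
    using cd.integrable_rho_poisson[OF z] by (simp add: mult.commute)
  have i2: "integrable circ (\<lambda>t. poisson z (cis t) * exp (- \<psi> t))"
  proof (rule integrable_circ_bounded[where B="2 / (1 - norm z)"])
    fix t
    have "poisson z (cis t) * exp (- \<psi> t) \<le> (2 / (1 - norm z)) * 1"
      using z pos[of t] by (intro mult_mono poisson_upper) auto
    then show "norm (poisson z (cis t) * exp (- \<psi> t)) \<le> 2 / (1 - norm z)"
      using poisson_nonneg[of z "cis t"] z by (simp add: abs_mult)
  qed measurable
  have e1: "(LINT t|circ. exp (- a) * (1 + a) * poisson z (cis t) - exp (- a) * (poisson z (cis t) * \<psi> t)) = exp (- a)"
  proof -
    have "(LINT t|circ. exp (- a) * (1 + a) * poisson z (cis t) - exp (- a) * (poisson z (cis t) * \<psi> t))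
        = exp (- a) * (1 + a) * (LINT t|circ. poisson z (cis t)) - exp (- a) * (LINT t|circ. poisson z (cis t) * \<psi> t)"
      by (subst Bochner_Integration.integral_diff) (use integrable_poisson[OF z] ip in auto)
    also have "\<dots> = exp (- a)"
      unfolding integral_poisson[OF z] a_def[symmetric] by (simp add: algebra_simps)
    finally show ?thesis .
  qed
  have "(LINT t|circ. exp (- a) * (1 + a) * poisson z (cis t) - exp (- a) * (poisson z (cis t) * \<psi> t))
     \<le> (LINT t|circ. poisson z (cis t) * exp (- \<psi> t))"
  proof (rule integral_mono[OF _ i2])
    show "integrable circ (\<lambda>t. exp (- a) * (1 + a) * poisson z (cis t) - exp (- a) * (poisson z (cis t) * \<psi> t))"
      using integrable_poisson[OF z] ip by auto
    fix t
    have "exp (- a) * (1 + (a - \<psi> t)) \<le> exp (- a) * exp (a - \<psi> t)"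
      by (intro mult_left_mono exp_ge_add_one_self) auto
    also have "\<dots> = exp (- \<psi> t)" by (simp add: exp_add[symmetric])
    finally have "poisson z (cis t) * (exp (- a) * (1 + (a - \<psi> t))) \<le> poisson z (cis t) * exp (- \<psi> t)"
      using z by (intro mult_left_mono poisson_nonneg) auto
    then show "exp (- a) * (1 + a) * poisson z (cis t) - exp (- a) * (poisson z (cis t) * \<psi> t) \<le> poisson z (cis t) * exp (- \<psi> t)"
      by (simp add: algebra_simps)
  qed
  then show ?thesis unfolding e1 a_def[symmetric] .
qed

lemma nn_integral_poisson_mean:
  assumes [measurable]: "g \<in> borel_measurable borel" and r: "0 \<le> r" "r < 1"
  shows "(\<integral>\<^sup>+ t. (\<integral>\<^sup>+ s. ennreal (poisson (polar r t) (cis s)) * g s \<partial>circ) \<partial>circ) = (\<integral>\<^sup>+ s. g s \<partial>circ)"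
proof -
  have nz: "norm (polar r t) < 1" for t using r by (simp add: norm_mult)
  have "(\<integral>\<^sup>+ t. (\<integral>\<^sup>+ s. ennreal (poisson (polar r t) (cis s)) * g s \<partial>circ) \<partial>circ)
     = (\<integral>\<^sup>+ s. (\<integral>\<^sup>+ t. ennreal (poisson (polar r t) (cis s)) * g s \<partial>circ) \<partial>circ)"
    by (rule cc.Fubini') measurable
  also have "\<dots> = (\<integral>\<^sup>+ s. g s \<partial>circ)"
  proof (intro nn_integral_cong)
    fix s
    have "(\<integral>\<^sup>+ t. ennreal (poisson (polar r t) (cis s)) \<partial>circ) = (\<integral>\<^sup>+ t. ennreal (poisson (polar r s) (cis t)) \<partial>circ)"
      by (intro nn_integral_cong) (simp add: poisson_swap[of "cis _" "cis s"])
    also have "\<dots> = ennreal (LINT t|circ. poisson (polar r s) (cis t))"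
      by (rule nn_integral_eq_integral[OF integrable_poisson[OF nz]]) (intro AE_I2 poisson_nonneg less_imp_le[OF nz])
    finally have "(\<integral>\<^sup>+ t. ennreal (poisson (polar r t) (cis s)) \<partial>circ) = 1"
      using integral_poisson[OF nz] by simp
    then show "(\<integral>\<^sup>+ t. ennreal (poisson (polar r t) (cis s)) * g s \<partial>circ) = g s"
      by (subst nn_integral_multc) auto
  qed
  finally show ?thesis .
qed

text \<open>
  The factor \<open>F = exp (- H)\<close>, with \<open>H\<close> the Herglotz integral of \<open>\<psi>\<close>, takes the boundary modulus of
  \<open>h\<close> off, and \<open>J = h / F\<close> is bounded by 1 by \<open>boundary_log\<close>. From \<open>h = J * F\<close> the radial limits
  satisfy \<open>|F| \<ge> exp (- \<psi>)\<close>, and Jensen's inequality \<open>exp_poisson_le\<close> gives \<open>\<integral> |F| \<le> \<integral> exp (- \<psi>)\<close>.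
  So \<open>|F| = exp (- \<psi>)\<close> and \<open>|J| = 1\<close> almost everywhere.
\<close>

theorem inner_part:
  assumes h: "h holomorphic_on ball 0 1" and b: "\<And>z. norm z < 1 \<Longrightarrow> norm (h z) \<le> 1"
    and z1: "norm z1 < 1" "h z1 \<noteq> 0"
  obtains \<psi> where "integrable circ \<psi>" "\<And>t. \<psi> t \<ge> 0"
    "AE t in circ. norm (radial_limit h t) = exp (- \<psi> t)"
    "inner_function (\<lambda>z. h z * exp (herglotz circ cis \<psi> z))"
proof -
  obtain \<psi> where ipsi: "integrable circ \<psi>" and pos: "\<And>t. \<psi> t \<ge> 0"
    and hb: "AE t in circ. norm (radial_limit h t) = exp (- \<psi> t)"
    and le: "\<And>z. norm z < 1 \<Longrightarrow> norm (h z) \<le> exp (- (LINT t|circ. poisson z (cis t) * \<psi> t))"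
    using boundary_log[OF assms] by blast
  interpret cd: circle_density circ cis \<psi> by (rule circle_density_circ[OF ipsi])
  have [measurable]: "\<psi> \<in> borel_measurable borel" using borel_measurable_integrable[OF ipsi] by simp
  define H where "H = herglotz circ cis \<psi>"
  have Hh: "H holomorphic_on ball 0 1" unfolding H_def by (rule cd.herglotz_holomorphic)
  have ReH: "Re (H z) = (LINT t|circ. poisson z (cis t) * \<psi> t)" if "norm z < 1" for z
    unfolding H_def cd.Re_herglotz[OF that] by (simp add: mult.commute)
  define J where "J = (\<lambda>z. h z * exp (H z))"
  define F where "F = (\<lambda>z. exp (- H z))"
  have hol: "J holomorphic_on ball 0 1" "F holomorphic_on ball 0 1"
    unfolding J_def F_def by (intro holomorphic_intros h Hh)+
  have J1: "norm (J z) \<le> 1" if z: "norm z < 1" for z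
  proof -
    have "norm (J z) \<le> exp (- Re (H z)) * exp (Re (H z))"
      unfolding J_def norm_mult norm_exp_eq_Re using le[OF z] ReH[OF z] by (intro mult_right_mono) auto
    then show ?thesis by (simp add: exp_add[symmetric])
  qed
  have F1: "norm (F z) \<le> 1" if z: "norm z < 1" for z
    using cd.Re_herglotz_nonneg[OF z pos] by (simp add: F_def H_def)
  have JF: "h z = J z * F z" for z by (simp add: J_def F_def exp_minus)
  have limJ: "AE t in circ. ((\<lambda>r. J (polar r t)) \<longlongrightarrow> radial_limit J t) (at_left 1)"
    by (rule AE_radial_limit[OF hol(1) J1])
  have limF: "AE t in circ. ((\<lambda>r. F (polar r t)) \<longlongrightarrow> radial_limit F t) (at_left 1)"
    by (rule AE_radial_limit[OF hol(2) F1])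
  have [measurable]: "radial_limit F \<in> borel_measurable borel" using hol by measurable
  have rel: "AE t in circ. norm (radial_limit J t) \<le> 1 \<and> norm (radial_limit F t) \<le> 1 \<and>
      exp (- \<psi> t) = norm (radial_limit J t) * norm (radial_limit F t)"
    using limJ limF hb
  proof eventually_elim
    case (elim t)
    have "((\<lambda>r. h (polar r t)) \<longlongrightarrow> radial_limit J t * radial_limit F t) (at_left 1)"
      unfolding JF by (intro tendsto_mult elim)
    then have "radial_limit h t = radial_limit J t * radial_limit F t" by (rule radial_limit_eq)
    moreover have "norm (radial_limit J t) \<le> 1" by (rule radial_limit_norm_le[OF elim(1) J1])
    moreover have "norm (radial_limit F t) \<le> 1" by (rule radial_limit_norm_le[OF elim(2) F1])
    ultimately show ?case using elim by (simp add: norm_mult)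
  qed
  have iF: "integrable circ (\<lambda>t. norm (radial_limit F t))"
  proof (rule circ.integrable_const_bound[where B=1])
    show "AE t in circ. norm (norm (radial_limit F t)) \<le> 1" using rel by eventually_elim auto
  qed measurable
  have ie: "integrable circ (\<lambda>t. exp (- \<psi> t))"
    by (rule integrable_circ_bounded[where B=1]) (use pos in auto)
  have "(LINT t|circ. norm (radial_limit F t)) \<le> (LINT t|circ. exp (- \<psi> t))"
  proof (rule LIMSEQ_le_const2)
    show "(\<lambda>n. LINT t|circ. norm (F (polar (rseq n) t))) \<longlonglongrightarrow> (LINT t|circ. norm (radial_limit F t))"
    proof (rule integral_dominated_convergence[where w="\<lambda>_. 1"])
      show "AE t in circ. (\<lambda>n. norm (F (polar (rseq n) t))) \<longlonglongrightarrow> norm (radial_limit F t)"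
        using limF by eventually_elim (rule tendsto_norm, rule filterlim_compose[OF _ rseq_at_left])
      show "(\<lambda>t. norm (F (polar (rseq n) t))) \<in> borel_measurable circ" for n
        using circle_measurable[OF hol(2), of "rseq n"] rseq_range[of n] by (simp add: less_imp_le)
      show "AE t in circ. norm (norm (F (polar (rseq n) t))) \<le> 1" for n
        using rseq_range[of n] by (intro AE_I2) (simp add: F1 norm_mult)
    qed auto
    have "(LINT t|circ. norm (F (polar (rseq n) t))) \<le> (LINT t|circ. exp (- \<psi> t))" for n
    proof -
      define r where "r = rseq n"
      have r: "0 \<le> r" "r < 1" using rseq_range[of n] by (auto simp: r_def)
      have nz: "norm (polar r t) < 1" for t using r by (simp add: norm_mult)
      have [measurable]: "(\<lambda>t. F (polar r t)) \<in> borel_measurable borel"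
        by (rule circle_measurable[OF hol(2) r])
      have ir: "integrable circ (\<lambda>t. norm (F (polar r t)))"
        by (rule integrable_circ_bounded[where B=1]) (auto intro: F1 nz)
      have "ennreal (LINT t|circ. norm (F (polar r t))) = (\<integral>\<^sup>+ t. ennreal (norm (F (polar r t))) \<partial>circ)"
        by (rule nn_integral_eq_integral[OF ir, symmetric]) auto
      also have "\<dots> \<le> (\<integral>\<^sup>+ t. (\<integral>\<^sup>+ s. ennreal (poisson (polar r t) (cis s)) * ennreal (exp (- \<psi> s)) \<partial>circ) \<partial>circ)"
      proof (rule nn_integral_mono)
        fix t
        let ?z = "polar r t"
        have P0: "0 \<le> poisson ?z w" for w by (intro poisson_nonneg less_imp_le[OF nz])
        have i2: "integrable circ (\<lambda>s. poisson ?z (cis s) * exp (- \<psi> s))"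
        proof (rule integrable_circ_bounded[where B="2 / (1 - norm ?z)"])
          fix s
          have "poisson ?z (cis s) * exp (- \<psi> s) \<le> (2 / (1 - norm ?z)) * 1"
            using nz[of t] pos[of s] by (intro mult_mono poisson_upper) auto
          then show "norm (poisson ?z (cis s) * exp (- \<psi> s)) \<le> 2 / (1 - norm ?z)"
            using P0[of "cis s"] by (simp only: real_norm_def abs_mult abs_of_nonneg abs_exp_cancel mult_1_right)
        qed measurable
        have "norm (F ?z) = exp (- (LINT s|circ. poisson ?z (cis s) * \<psi> s))"
          unfolding F_def norm_exp_eq_Re using ReH[OF nz] by simp
        also have "\<dots> \<le> (LINT s|circ. poisson ?z (cis s) * exp (- \<psi> s))"
          by (rule exp_poisson_le[OF ipsi pos nz])
        finally have "ennreal (norm (F ?z)) \<le> ennreal (LINT s|circ. poisson ?z (cis s) * exp (- \<psi> s))"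
          by (rule ennreal_leI)
        also have "\<dots> = (\<integral>\<^sup>+ s. ennreal (poisson ?z (cis s) * exp (- \<psi> s)) \<partial>circ)"
          by (rule nn_integral_eq_integral[OF i2, symmetric]) (intro AE_I2 mult_nonneg_nonneg P0 exp_ge_zero)
        also have "\<dots> = (\<integral>\<^sup>+ s. ennreal (poisson ?z (cis s)) * ennreal (exp (- \<psi> s)) \<partial>circ)"
          by (intro nn_integral_cong ennreal_mult P0 exp_ge_zero)
        finally show "ennreal (norm (F ?z)) \<le> (\<integral>\<^sup>+ s. ennreal (poisson ?z (cis s)) * ennreal (exp (- \<psi> s)) \<partial>circ)" .
      qed
      also have "\<dots> = (\<integral>\<^sup>+ s. ennreal (exp (- \<psi> s)) \<partial>circ)"
        by (rule nn_integral_poisson_mean[OF _ r]) measurable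
      also have "\<dots> = ennreal (LINT s|circ. exp (- \<psi> s))"
        by (rule nn_integral_eq_integral[OF ie]) auto
      finally show ?thesis unfolding r_def by (subst (asm) ennreal_le_iff) auto
    qed
    then show "\<exists>N. \<forall>n\<ge>N. (LINT t|circ. norm (F (polar (rseq n) t))) \<le> (LINT t|circ. exp (- \<psi> t))" by auto
  qed
  then have z: "(LINT t|circ. norm (radial_limit F t) - exp (- \<psi> t)) \<le> 0" using iF ie by simp
  have ge: "AE t in circ. 0 \<le> norm (radial_limit F t) - exp (- \<psi> t)"
    using rel
  proof eventually_elim
    case (elim t)
    then have "norm (radial_limit J t) * norm (radial_limit F t) \<le> 1 * norm (radial_limit F t)"
      by (intro mult_right_mono) auto
    then show ?case using elim by simp
  qed
  have "(LINT t|circ. norm (radial_limit F t) - exp (- \<psi> t)) = 0"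
    using z integral_nonneg_AE[OF ge] by linarith
  then have "AE t in circ. norm (radial_limit F t) - exp (- \<psi> t) = 0"
    using integral_nonneg_eq_0_iff_AE[OF _ ge] iF ie by auto
  then have "AE t in circ. \<exists>w. norm w = 1 \<and> ((\<lambda>r. J (polar r t)) \<longlongrightarrow> w) (at_left 1)"
    using rel limJ
  proof eventually_elim
    case (elim t)
    have "norm (radial_limit F t) = exp (- \<psi> t)" using elim by simp
    then have "exp (- \<psi> t) = norm (radial_limit J t) * exp (- \<psi> t)" using elim by simp
    then have "norm (radial_limit J t) = 1" by simp
    then show ?case using elim by blast
  qed
  then have "inner_function J" by (intro inner_functionI hol J1)
  then show ?thesis using that[OF ipsi pos hb] unfolding J_def H_def by blast
qed

section \<open>Harmonic majorants for functions with derivatives in \<open>H\<^sup>1\<close>\<close>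

text \<open>
  The Herglotz integrals of \<open>|f|\<close> on the circles of radius \<open>rseq n\<close> majorise the dilates of \<open>f\<close>,
  and they are locally bounded because \<open>f \<in> H\<^sup>1\<close>. Montel's theorem provides a limit.
\<close>

lemma hardy1_majorant:
  assumes "f \<in> hardy1"
  obtains A where "A holomorphic_on ball 0 1" "\<And>z. norm z < 1 \<Longrightarrow> norm (f z) \<le> Re (A z)"
proof -
  have f: "f holomorphic_on ball 0 1" using assms by (simp add: hardy1_def)
  have "bdd_above ((\<lambda>r. LBINT t:{0..2*pi}. norm (f (polar r t))) ` {0..<1})"
    using assms by (simp add: hardy1_def)
  then obtain M where M: "\<And>r. r \<in> {0..<1} \<Longrightarrow> (LBINT t:{0..2*pi}. norm (f (polar r t))) \<le> M"
    unfolding bdd_above_def by blast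
  define \<rho> where "\<rho> = (\<lambda>n t. norm (f (polar (rseq n) t)))"
  define A where "A = (\<lambda>n. herglotz circ cis (\<rho> n))"
  have fc: "continuous_on (sphere 0 1) (\<lambda>w. f (complex_of_real (rseq n) * w))" for n
    by (rule continuous_on_compose2[OF holomorphic_on_imp_continuous_on[OF f]])
       (auto intro!: continuous_intros simp: norm_mult)
  have irho: "integrable circ (\<rho> n)" for n
    unfolding \<rho>_def by (intro integrable_circ_continuous[of "\<lambda>w. norm (f (complex_of_real (rseq n) * w))"] continuous_intros fc)
  have cd: "circle_density circ cis (\<rho> n)" for n by (rule circle_density_circ[OF irho])
  have mean: "(LINT t|circ. \<rho> n t) \<le> M / (2*pi)" for n
  proof -
    have "\<rho> n \<in> borel_measurable borel" using borel_measurable_integrable[OF irho] by simp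
    from integral_circ[OF this] have "(LINT t|circ. \<rho> n t) = (LBINT t:{0..2*pi}. \<rho> n t) / (2*pi)"
      by (simp add: inverse_eq_divide)
    then show ?thesis using M[of "rseq n"] by (simp add: \<rho>_def divide_right_mono)
  qed
  have Ab: "norm (A n z) \<le> 2 / (1 - norm z) * (M / (2*pi))" if z: "norm z < 1" for n z
  proof -
    have "norm (A n z) \<le> (LINT t|circ. norm (complex_of_real (\<rho> n t) * ((cis t + z) / (cis t - z))))"
      unfolding A_def herglotz_def by (rule integral_norm_bound)
    also have "\<dots> \<le> (LINT t|circ. 2 / (1 - norm z) * \<rho> n t)"
    proof (rule integral_mono)
      show "integrable circ (\<lambda>t. norm (complex_of_real (\<rho> n t) * ((cis t + z) / (cis t - z))))"
        by (intro integrable_norm circle_density.integrable_kernel[OF cd z])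
      show "integrable circ (\<lambda>t. 2 / (1 - norm z) * \<rho> n t)" by (intro integrable_mult_right irho)
      fix t
      have "\<rho> n t * norm ((cis t + z) / (cis t - z)) \<le> \<rho> n t * (2 / (1 - norm z))"
        by (intro mult_left_mono circle_density.kernel_bound[OF cd z]) (auto simp: \<rho>_def)
      then show "norm (complex_of_real (\<rho> n t) * ((cis t + z) / (cis t - z))) \<le> 2 / (1 - norm z) * \<rho> n t"
        unfolding norm_mult norm_of_real by (simp add: \<rho>_def mult.commute)
    qed
    also have "\<dots> = 2 / (1 - norm z) * (LINT t|circ. \<rho> n t)" by (rule integral_mult_right_zero)
    also have "\<dots> \<le> 2 / (1 - norm z) * (M / (2*pi))" using z by (intro mult_left_mono mean) auto
    finally show ?thesis .
  qed
  have fA: "norm (f (complex_of_real (rseq n) * z)) \<le> Re (A n z)" if z: "norm z < 1" for n z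
  proof -
    have P0: "0 \<le> poisson z w" for w by (intro poisson_nonneg less_imp_le[OF z])
    have "f (complex_of_real (rseq n) * z) = (LINT t|circ. complex_of_real (poisson z (cis t)) * f (polar (rseq n) t))"
      by (rule poisson_formula[OF dilate_holomorphic[OF f, of "rseq n"] _ z, symmetric]) auto
    also have "norm \<dots> \<le> (LINT t|circ. norm (complex_of_real (poisson z (cis t)) * f (polar (rseq n) t)))"
      by (rule integral_norm_bound)
    also have "\<dots> = (LINT t|circ. \<rho> n t * poisson z (cis t))"
      unfolding norm_mult norm_of_real abs_of_nonneg[OF P0] \<rho>_def by (simp add: mult.commute)
    also have "\<dots> = Re (A n z)" unfolding A_def by (rule circle_density.Re_herglotz[OF cd z, symmetric])
    finally show ?thesis .
  qed
  have Ah: "A n holomorphic_on ball 0 1" for n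
    unfolding A_def by (rule circle_density.herglotz_holomorphic[OF cd])
  have M0: "0 \<le> M / (2*pi)"
  proof -
    have "0 \<le> (LINT t|circ. \<rho> 0 t)" by (intro Bochner_Integration.integral_nonneg) (simp add: \<rho>_def)
    then show ?thesis using mean[of 0] by linarith
  qed
  obtain g r where g: "g holomorphic_on ball 0 1" "strict_mono (r :: nat \<Rightarrow> nat)"
    "\<And>x. x \<in> ball 0 1 \<Longrightarrow> (\<lambda>n. A (r n) x) \<longlonglongrightarrow> g x"
  proof (rule Montel[of "ball 0 1" "range A" A])
    show "open (ball (0::complex) 1)" by simp
    show "\<And>h. h \<in> range A \<Longrightarrow> h holomorphic_on ball 0 1" using Ah by auto
    fix K :: "complex set" assume K: "compact K" "K \<subseteq> ball 0 1"
    show "\<exists>B. \<forall>h\<in>range A. \<forall>z\<in>K. norm (h z) \<le> B"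
    proof (cases "K = {}")
      case False
      obtain x where x: "x \<in> K" "\<forall>y\<in>K. norm y \<le> norm x"
        using continuous_attains_sup[OF K(1) False continuous_on_norm_id] by blast
      have "norm (A n z) \<le> 2 / (1 - norm x) * (M / (2*pi))" if "z \<in> K" for n z
      proof -
        have "norm z < 1" "norm x < 1" "norm z \<le> norm x" using that K x by auto
        then have "2 / (1 - norm z) * (M / (2*pi)) \<le> 2 / (1 - norm x) * (M / (2*pi))"
          by (intro mult_right_mono M0 divide_left_mono mult_pos_pos) auto
        then show ?thesis using Ab[OF \<open>norm z < 1\<close>] by (rule order_trans[rotated])
      qed
      then show ?thesis by auto
    qed auto
  qed auto
  show ?thesis
  proof (rule that[OF g(1)])
    fix z :: complex assume z: "norm z < 1"
    have "isCont f z" using f z by (intro continuous_on_interior[OF holomorphic_on_imp_continuous_on]) auto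
    moreover have "(\<lambda>n. complex_of_real (rseq (r n)) * z) \<longlonglongrightarrow> complex_of_real 1 * z"
      by (intro tendsto_intros LIMSEQ_subseq_LIMSEQ[OF rseq_lim g(2), unfolded o_def])
    ultimately have "(\<lambda>n. norm (f (complex_of_real (rseq (r n)) * z))) \<longlonglongrightarrow> norm (f z)"
      by (intro tendsto_norm isCont_tendsto_compose[where g=f]) auto
    moreover have "(\<lambda>n. Re (A (r n) z)) \<longlonglongrightarrow> Re (g z)" using g(3)[of z] z by (intro tendsto_Re) auto
    ultimately show "norm (f z) \<le> Re (g z)" by (rule LIMSEQ_le) (use fA[OF z] in auto)
  qed
qed

lemma arc_bound:
  assumes p: "p holomorphic_on ball 0 1" and A: "continuous_on (ball 0 1) U"
    and le: "\<And>z. norm z < 1 \<Longrightarrow> norm (deriv p z) \<le> (U z :: real)"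
    and \<rho>: "0 \<le> \<rho>" "\<rho> < 1" and xy: "0 \<le> x" "x \<le> y" "y \<le> 2*pi"
  shows "norm (p (polar \<rho> y) - p (polar \<rho> x))
    \<le> 2*pi * (LINT s|circ. indicator {x..y} s * U (polar \<rho> s))"
proof -
  have n: "norm (polar \<rho> s) < 1" for s using \<rho> by (simp add: norm_mult)
  let ?D = "\<lambda>s. deriv p (polar \<rho> s) * (complex_of_real \<rho> * (\<i> * cis s))"
  have der: "((\<lambda>s. p (polar \<rho> s)) has_vector_derivative ?D s) (at s within {x..y})" for s
  proof -
    have "(cis has_vector_derivative \<i> * cis s) (at s within {x..y})"
      by (auto simp: has_vector_derivative_def intro!: derivative_eq_intros)
    then have d1: "((\<lambda>s. polar \<rho> s) has_vector_derivative complex_of_real \<rho> * (\<i> * cis s)) (at s within {x..y})"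
      by (rule has_vector_derivative_mult_right)
    have d2: "(p has_field_derivative deriv p (polar \<rho> s)) (at (polar \<rho> s))"
      using holomorphic_derivI[OF p open_ball] n by simp
    from field_vector_diff_chain_within[OF d1 has_field_derivative_at_within[OF d2]] show ?thesis
      by (simp add: o_def mult_ac)
  qed
  have ftc: "(?D has_integral (p (polar \<rho> y) - p (polar \<rho> x))) {x..y}"
    by (rule fundamental_theorem_of_calculus[OF xy(2)]) (rule der)
  have Uc: "continuous_on UNIV (\<lambda>s. U (polar \<rho> s))"
    by (rule continuous_on_compose2[OF A]) (use n in \<open>auto intro!: continuous_intros\<close>)
  have Um [measurable]: "(\<lambda>s. U (polar \<rho> s)) \<in> borel_measurable borel"
    by (rule borel_measurable_continuous_onI[OF Uc])
  have si: "set_integrable lborel {x..y} (\<lambda>s. U (polar \<rho> s))"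
    by (rule borel_integrable_atLeastAtMost') (rule continuous_on_subset[OF Uc], simp)
  note Ui = set_borel_integral_eq_integral[OF si]
  have "norm (p (polar \<rho> y) - p (polar \<rho> x)) = norm (integral {x..y} ?D)"
    using ftc by (simp add: integral_unique)
  also have "\<dots> \<le> integral {x..y} (\<lambda>s. U (polar \<rho> s))"
  proof (rule integral_norm_bound_integral)
    show "?D integrable_on {x..y}" using ftc by blast
    fix s assume "s \<in> {x..y}"
    have "norm (deriv p (polar \<rho> s)) * \<rho> \<le> U (polar \<rho> s) * 1"
      using le[OF n[of s]] \<rho> order_trans[OF norm_ge_zero le[OF n[of s]]] by (intro mult_mono) auto
    then show "norm (?D s) \<le> U (polar \<rho> s)" using \<rho> by (simp add: norm_mult)
  qed (rule Ui)
  also have "\<dots> = (LBINT s:{x..y}. U (polar \<rho> s))" by (rule Ui(2)[symmetric])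
  also have "\<dots> = (LBINT s:{0..2*pi}. indicator {x..y} s * U (polar \<rho> s))"
    unfolding set_lebesgue_integral_def using xy by (intro Bochner_Integration.integral_cong) (auto simp: indicator_def)
  also have "\<dots> = 2*pi * (LINT s|circ. indicator {x..y} s * U (polar \<rho> s))"
    by (subst integral_circ) auto
  finally show ?thesis .
qed

text \<open>
  Along any arc of a circle the variation of \<open>p\<close> is at most the integral of \<open>Re A\<close> over the
  circle, which is \<open>2 * pi * Re (A 0)\<close> for every radius. Averaging over the circle compares \<open>p z\<close>
  with \<open>p 0\<close>.
\<close>

lemma bounded_primitive:
  assumes p: "p holomorphic_on ball 0 1" and A: "A holomorphic_on ball 0 1"
    and le: "\<And>z. norm z < 1 \<Longrightarrow> norm (deriv p z) \<le> Re (A z)"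
  obtains B where "\<And>z. norm z < 1 \<Longrightarrow> norm (p z) \<le> B"
proof -
  have Ac: "continuous_on (ball 0 1) (\<lambda>z. Re (A z))"
    by (intro continuous_intros holomorphic_on_imp_continuous_on A)
  have A0: "0 \<le> Re (A z)" if "norm z < 1" for z using order_trans[OF norm_ge_zero le[OF that]] .
  have mean: "(LINT s|circ. Re (A (polar \<rho> s))) = Re (A 0)" if r: "0 < \<rho>" "\<rho> < 1" for \<rho>
  proof -
    have "(LINT t|circ. poisson 0 (cis t) * Re (A (polar \<rho> t))) = Re (A (complex_of_real \<rho> * 0))"
      by (rule poisson_formula_Re[OF dilate_holomorphic[OF A r(1)]]) (use r in auto)
    then show ?thesis by (simp add: poisson_def)
  qed
  have n: "norm (polar \<rho> s) < 1" if "0 < \<rho>" "\<rho> < 1" for \<rho> s using that by (simp add: norm_mult)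
  have osc: "norm (p (polar \<rho> y) - p (polar \<rho> x)) \<le> 2*pi * Re (A 0)"
    if r: "0 < \<rho>" "\<rho> < 1" and xy: "0 \<le> x" "x \<le> y" "y \<le> 2*pi" for \<rho> x y
  proof -
    have cU: "continuous_on (sphere 0 1) (\<lambda>w. Re (A (complex_of_real \<rho> * w)))"
      by (rule continuous_on_compose2[OF Ac]) (use r in \<open>auto intro!: continuous_intros simp: norm_mult\<close>)
    have i: "integrable circ (\<lambda>s. Re (A (polar \<rho> s)))"
      by (rule integrable_circ_continuous[OF cU])
    have "norm (p (polar \<rho> y) - p (polar \<rho> x))
        \<le> 2*pi * (LINT s|circ. indicator {x..y} s * Re (A (polar \<rho> s)))"
      by (rule arc_bound[OF p Ac le _ _ xy]) (use r in auto)
    also have "\<dots> \<le> 2*pi * (LINT s|circ. Re (A (polar \<rho> s)))"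
    proof (intro mult_left_mono integral_mono i)
      show "integrable circ (\<lambda>s. indicator {x..y} s * Re (A (polar \<rho> s)))"
        by (rule Bochner_Integration.integrable_bound[OF i])
           (use borel_measurable_integrable[OF i] in \<open>auto simp: indicator_def\<close>)
      show "indicator {x..y} s * Re (A (polar \<rho> s)) \<le> Re (A (polar \<rho> s))" for s
        using A0[OF n[OF r]] by (auto simp: indicator_def)
    qed auto
    finally show ?thesis using mean[OF r] by simp
  qed
  have "norm (p z - p 0) \<le> 2*pi * Re (A 0)" if z: "norm z < 1" for z
  proof (cases "z = 0")
    case True then show ?thesis using A0[of 0] by simp
  next
    case False
    define \<rho> where "\<rho> = norm z"
    have r: "0 < \<rho>" "\<rho> < 1" using False z by (auto simp: \<rho>_def)
    obtain y where y: "0 \<le> y" "y \<le> 2*pi" "z = polar \<rho> y"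
      using Arg2pi_ge_0[of z] Arg2pi_lt_2pi[of z] complex_norm_eq_1_exp Arg2pi_eq[of z]
      by (intro that[of "Arg2pi z"]) (auto simp: \<rho>_def cis_conv_exp mult.commute)
    have osc': "norm (p z - p (polar \<rho> x)) \<le> 2*pi * Re (A 0)" if x: "0 \<le> x" "x \<le> 2*pi" for x
      using osc[OF r, of x y] osc[OF r, of y x] x y by (cases "x \<le> y") (auto simp: norm_minus_commute)
    have cp: "continuous_on (sphere 0 1) (\<lambda>w. p (complex_of_real \<rho> * w))"
      by (rule continuous_on_compose2[OF holomorphic_on_imp_continuous_on[OF p]])
         (use r in \<open>auto intro!: continuous_intros simp: norm_mult\<close>)
    have ip: "integrable circ (\<lambda>x. p (polar \<rho> x))" by (rule integrable_circ_continuous[OF cp])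
    have "(LINT x|circ. complex_of_real (poisson 0 (cis x)) * p (polar \<rho> x)) = p (complex_of_real \<rho> * 0)"
      by (rule poisson_formula[OF dilate_holomorphic[OF p r(1)]]) (use r in auto)
    then have "(LINT x|circ. p (polar \<rho> x)) = p 0" by (simp add: poisson_def)
    then have e: "p z - p 0 = (LINT x|circ. p z - p (polar \<rho> x))" using ip by simp
    have id: "integrable circ (\<lambda>x. p z - p (polar \<rho> x))" using ip by simp
    have "norm (p z - p 0) \<le> (LINT x|circ. norm (p z - p (polar \<rho> x)))"
      unfolding e by (rule integral_norm_bound)
    also have "\<dots> \<le> (LINT x|circ. 2*pi * Re (A 0))"
    proof (rule integral_mono_AE)
      show "AE x in circ. norm (p z - p (polar \<rho> x)) \<le> 2*pi * Re (A 0)"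
        unfolding AE_circ_iff by (intro AE_I2 impI osc') auto
    qed (use id in auto)
    finally show ?thesis by simp
  qed
  then have "norm (p z) \<le> norm (p 0) + 2*pi * Re (A 0)" if "norm z < 1" for z
    using that norm_triangle_ineq2[of "p z" "p 0"] by fastforce
  then show ?thesis using that by blast
qed

text \<open>
  Descending induction on \<open>k\<close>: the majorant of the derivative of order \<open>k + 1\<close> makes the one of
  order \<open>k\<close> bounded.
\<close>

lemma hardy1_deriv_majorant:
  assumes f: "f \<in> hardy1_deriv n" and k: "k \<le> n"
  shows "\<exists>A. A holomorphic_on ball 0 1 \<and> (\<forall>z. norm z < 1 \<longrightarrow> norm ((deriv ^^ k) f z) \<le> Re (A z))"
  using k
proof (induction k rule: inc_induct)
  case base
  have "(deriv ^^ n) f \<in> hardy1" using f by (simp add: hardy1_deriv_def)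
  then show ?case by (metis hardy1_majorant)
next
  case (step m)
  then obtain A where A: "A holomorphic_on ball 0 1" "\<And>z. norm z < 1 \<Longrightarrow> norm (deriv ((deriv ^^ m) f) z) \<le> Re (A z)"
    by auto
  have "f holomorphic_on ball 0 1" using f by (simp add: hardy1_deriv_def)
  then have "(deriv ^^ m) f holomorphic_on ball 0 1" by (rule holomorphic_higher_deriv) simp
  then obtain B where "\<And>z. norm z < 1 \<Longrightarrow> norm ((deriv ^^ m) f z) \<le> B"
    using bounded_primitive[OF _ A] by blast
  then show ?case by (intro exI[of _ "\<lambda>_. complex_of_real B"]) auto
qed

section \<open>Wronskians\<close>

lemma deriv_cong_disc:
  assumes "\<And>z. norm z < 1 \<Longrightarrow> p z = q z" "norm z < 1" shows "deriv p z = deriv q z"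
proof (rule deriv_cong_ev[OF _ refl])
  have "eventually (\<lambda>w. w \<in> ball 0 1) (nhds z)" using assms(2) by (intro eventually_nhds_in_open) auto
  then show "eventually (\<lambda>w. p w = q w) (nhds z)" by eventually_elim (simp add: assms(1))
qed

text \<open>
  Cauchy's estimate on the disc that reaches half way to the circle, where Harnack's inequality is
  available.
\<close>

lemma cauchy_half_disc:
  assumes p: "p holomorphic_on ball 0 1" and z: "norm z < 1"
    and B: "\<And>w. norm (w - z) \<le> (1 - norm z)/2 \<Longrightarrow> norm (p w) \<le> B"
  shows "norm ((deriv ^^ k) p z) \<le> fact k * B * (2 / (1 - norm z))^k"
proof -
  define d where "d = (1 - norm z)/2"
  have d: "d > 0" using z by (simp add: d_def)
  have sub: "cball z d \<subseteq> ball 0 1"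
  proof
    fix w assume "w \<in> cball z d"
    then have "norm (w - z) \<le> d" by (simp add: dist_norm norm_minus_commute)
    then have "norm w \<le> norm z + d" using norm_triangle_sub[of w z] by linarith
    also have "\<dots> < 1" using z by (simp add: d_def field_simps)
    finally show "w \<in> ball 0 1" by simp
  qed
  have hol: "p holomorphic_on cball z d" using p sub by (rule holomorphic_on_subset)
  have "norm ((deriv ^^ k) p z) \<le> fact k * B / d^k"
  proof (rule Cauchy_inequality)
    show "p holomorphic_on ball z d" using hol by (rule holomorphic_on_subset) auto
    show "continuous_on (cball z d) p" using hol by (rule holomorphic_on_imp_continuous_on)
    show "norm (p x) \<le> B" if "norm (z - x) = d" for x
      using that by (intro B) (simp add: d_def norm_minus_commute)
  qed (rule d)
  also have "\<dots> = fact k * B * (2 / (1 - norm z))^k" by (simp add: d_def power_divide)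
  finally show ?thesis .
qed

definition poly_growth :: "(complex \<Rightarrow> complex) \<Rightarrow> bool" where
  "poly_growth p \<longleftrightarrow> p holomorphic_on ball 0 1 \<and>
     (\<exists>C M. 0 \<le> C \<and> (\<forall>z. norm z < 1 \<longrightarrow> norm (p z) \<le> C / (1 - norm z)^M))"

lemma poly_growth_holomorphic: "poly_growth p \<Longrightarrow> p holomorphic_on ball 0 1"
  by (simp add: poly_growth_def)

lemma poly_growth_bounded:
  assumes "p holomorphic_on ball 0 1" "\<And>z. norm z < 1 \<Longrightarrow> norm (p z) \<le> B"
  shows "poly_growth p"
  unfolding poly_growth_def
proof (intro conjI exI[of _ B] exI[of _ 0])
  show "0 \<le> B" using order_trans[OF norm_ge_zero assms(2)[of 0]] by simp
qed (use assms in auto)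

lemma poly_growth_const: "poly_growth (\<lambda>_. c)"
  by (rule poly_growth_bounded[where B="norm c"]) auto

lemma poly_growth_add:
  assumes "poly_growth p" "poly_growth q" shows "poly_growth (\<lambda>z. p z + q z)"
proof -
  obtain C M D N where C: "0 \<le> C" "\<And>z. norm z < 1 \<Longrightarrow> norm (p z) \<le> C / (1 - norm z)^M"
    and D: "0 \<le> D" "\<And>z. norm z < 1 \<Longrightarrow> norm (q z) \<le> D / (1 - norm z)^N"
    using assms unfolding poly_growth_def by blast
  have "norm (p z + q z) \<le> (C + D) / (1 - norm z)^(M+N)" if z: "norm z < 1" for z
  proof -
    have "(1 - norm z)^(M+N) \<le> (1 - norm z)^M" "(1 - norm z)^(M+N) \<le> (1 - norm z)^N"
      using z by (auto intro!: power_decreasing)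
    then have "C / (1 - norm z)^M \<le> C / (1 - norm z)^(M+N)" "D / (1 - norm z)^N \<le> D / (1 - norm z)^(M+N)"
      using z C D by (auto intro!: divide_left_mono mult_pos_pos)
    then show ?thesis using norm_triangle_ineq[of "p z" "q z"] C(2)[OF z] D(2)[OF z] by (simp add: add_divide_distrib)
  qed
  moreover have "(\<lambda>z. p z + q z) holomorphic_on ball 0 1"
    using assms by (intro holomorphic_intros poly_growth_holomorphic)
  ultimately show ?thesis unfolding poly_growth_def using C D by (metis add_nonneg_nonneg)
qed

lemma poly_growth_mult:
  assumes "poly_growth p" "poly_growth q" shows "poly_growth (\<lambda>z. p z * q z)"
proof -
  obtain C M D N where C: "0 \<le> C" "\<And>z. norm z < 1 \<Longrightarrow> norm (p z) \<le> C / (1 - norm z)^M"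
    and D: "0 \<le> D" "\<And>z. norm z < 1 \<Longrightarrow> norm (q z) \<le> D / (1 - norm z)^N"
    using assms unfolding poly_growth_def by blast
  have "norm (p z * q z) \<le> (C * D) / (1 - norm z)^(M+N)" if z: "norm z < 1" for z
  proof -
    have "norm (p z * q z) \<le> (C / (1 - norm z)^M) * (D / (1 - norm z)^N)"
      unfolding norm_mult using C(2)[OF z] D(2)[OF z] C D z by (intro mult_mono) auto
    then show ?thesis by (simp add: power_add)
  qed
  moreover have "(\<lambda>z. p z * q z) holomorphic_on ball 0 1"
    using assms by (intro holomorphic_intros poly_growth_holomorphic)
  ultimately show ?thesis unfolding poly_growth_def using C D by (metis mult_nonneg_nonneg)
qed

lemma half_disc:
  assumes "norm z < 1" "norm (w - z) \<le> (1 - norm z)/2"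
  shows "norm (w::complex) < 1" "(1 - norm z)/2 \<le> 1 - norm w"
proof -
  have "norm w \<le> norm z + (1 - norm z)/2" using norm_triangle_sub[of w z] assms by linarith
  then have "2 * norm w \<le> norm z + 1" by (simp add: field_simps)
  then show "norm w < 1" "(1 - norm z)/2 \<le> 1 - norm w" using assms by (auto simp: field_simps)
qed

lemma poly_growth_deriv:
  assumes "poly_growth p" shows "poly_growth (deriv p)"
proof -
  obtain C M where C: "0 \<le> C" "\<And>z. norm z < 1 \<Longrightarrow> norm (p z) \<le> C / (1 - norm z)^M"
    using assms unfolding poly_growth_def by blast
  have p: "p holomorphic_on ball 0 1" by (rule poly_growth_holomorphic[OF assms])
  have "norm (deriv p z) \<le> (2 * 2^M * C) / (1 - norm z)^(Suc M)" if z: "norm z < 1" for z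
  proof -
    have "norm ((deriv ^^ 1) p z) \<le> fact 1 * (C / ((1 - norm z)/2)^M) * (2 / (1 - norm z))^1"
    proof (rule cauchy_half_disc[OF p z])
      fix w assume w: "norm (w - z) \<le> (1 - norm z)/2"
      note hw = half_disc[OF z w]
      have "norm (p w) \<le> C / (1 - norm w)^M" by (rule C(2)[OF hw(1)])
      also have "\<dots> \<le> C / ((1 - norm z)/2)^M"
        using C(1) hw z by (intro divide_left_mono power_mono mult_pos_pos) auto
      finally show "norm (p w) \<le> C / ((1 - norm z)/2)^M" .
    qed
    then show ?thesis by (simp add: power_divide field_simps)
  qed
  moreover have "deriv p holomorphic_on ball 0 1" by (intro holomorphic_deriv p) simp
  ultimately show ?thesis unfolding poly_growth_def using C
    by (intro conjI exI[of _ "2 * 2^M * C"] exI[of _ "Suc M"]) auto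
qed

text \<open>
  \<open>p\<close> is the value at \<open>g\<close> of a linear differential operator of order at most \<open>k\<close> with holomorphic
  coefficients of polynomial growth.
\<close>

definition diff_combo :: "(complex \<Rightarrow> complex) \<Rightarrow> nat \<Rightarrow> (complex \<Rightarrow> complex) \<Rightarrow> bool" where
  "diff_combo g k p \<longleftrightarrow> (\<exists>c. (\<forall>i. poly_growth (c i)) \<and>
     (\<forall>z. norm z < 1 \<longrightarrow> p z = (\<Sum>i\<le>k. c i z * (deriv ^^ i) g z)))"

lemma diff_combo_cong: "diff_combo g k p \<Longrightarrow> (\<And>z. norm z < 1 \<Longrightarrow> q z = p z) \<Longrightarrow> diff_combo g k q"
  unfolding diff_combo_def by auto

lemma diff_combo_single:
  assumes "i \<le> k" shows "diff_combo g k ((deriv ^^ i) g)"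
  unfolding diff_combo_def
proof (intro exI[of _ "\<lambda>j _. if j = i then 1 else 0"] conjI allI impI)
  show "poly_growth (\<lambda>_. if j = i then 1 else 0)" for j by (rule poly_growth_const)
  show "(deriv ^^ i) g z = (\<Sum>j\<le>k. (if j = i then 1 else 0) * (deriv ^^ j) g z)" for z
    using assms by (simp add: if_distrib[of "\<lambda>x. x * _"] sum.delta cong: if_cong)
qed

lemma diff_combo_add:
  assumes "diff_combo g k p" "diff_combo g k q" shows "diff_combo g k (\<lambda>z. p z + q z)"
proof -
  obtain c d where "\<And>i. poly_growth (c i)" "\<And>z. norm z < 1 \<Longrightarrow> p z = (\<Sum>i\<le>k. c i z * (deriv ^^ i) g z)"
    "\<And>i. poly_growth (d i)" "\<And>z. norm z < 1 \<Longrightarrow> q z = (\<Sum>i\<le>k. d i z * (deriv ^^ i) g z)"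
    using assms unfolding diff_combo_def by blast
  then show ?thesis unfolding diff_combo_def
    by (intro exI[of _ "\<lambda>i z. c i z + d i z"]) (auto intro: poly_growth_add simp: distrib_right sum.distrib)
qed

lemma diff_combo_mult:
  assumes "poly_growth a" "diff_combo g k p" shows "diff_combo g k (\<lambda>z. a z * p z)"
proof -
  obtain c where "\<And>i. poly_growth (c i)" "\<And>z. norm z < 1 \<Longrightarrow> p z = (\<Sum>i\<le>k. c i z * (deriv ^^ i) g z)"
    using assms unfolding diff_combo_def by blast
  then show ?thesis unfolding diff_combo_def using assms(1)
    by (intro exI[of _ "\<lambda>i z. a z * c i z"]) (auto intro: poly_growth_mult simp: sum_distrib_left mult.assoc)
qed

lemma diff_combo_sum:
  "(\<And>i. i \<le> (m::nat) \<Longrightarrow> diff_combo g k (p i)) \<Longrightarrow> diff_combo g k (\<lambda>z. \<Sum>i\<le>m. p i z)"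
  by (induction m) (auto intro: diff_combo_add)

lemma diff_combo_mono:
  assumes "diff_combo g k p" "k \<le> m" shows "diff_combo g m p"
proof -
  obtain c where c: "\<And>i. poly_growth (c i)" "\<And>z. norm z < 1 \<Longrightarrow> p z = (\<Sum>i\<le>k. c i z * (deriv ^^ i) g z)"
    using assms unfolding diff_combo_def by blast
  have "diff_combo g m (\<lambda>z. \<Sum>i\<le>k. c i z * (deriv ^^ i) g z)"
    using assms(2) by (intro diff_combo_sum diff_combo_mult c diff_combo_single) auto
  then show ?thesis by (rule diff_combo_cong) (rule c(2))
qed

lemma diff_combo_deriv:
  assumes g: "g holomorphic_on ball 0 1" and p: "diff_combo g k p" shows "diff_combo g (Suc k) (deriv p)"
proof -
  obtain c where c: "\<And>i. poly_growth (c i)" "\<And>z. norm z < 1 \<Longrightarrow> p z = (\<Sum>i\<le>k. c i z * (deriv ^^ i) g z)"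
    using p unfolding diff_combo_def by blast
  have fd: "c i field_differentiable at z" "(deriv ^^ i) g field_differentiable at z" if "norm z < 1" for i z
    using that poly_growth_holomorphic[OF c(1)[of i]] holomorphic_higher_deriv[OF g open_ball, of i]
    by (auto intro: holomorphic_on_imp_differentiable_at)
  have "diff_combo g (Suc k) (\<lambda>z. \<Sum>i\<le>k. (deriv (c i) z * (deriv ^^ i) g z + c i z * (deriv ^^ Suc i) g z))"
    by (intro diff_combo_sum diff_combo_add diff_combo_mult c poly_growth_deriv diff_combo_single) auto
  then show ?thesis
  proof (rule diff_combo_cong)
    fix z :: complex assume z: "norm z < 1"
    have "deriv p z = deriv (\<lambda>z. \<Sum>i\<le>k. c i z * (deriv ^^ i) g z) z"
      by (rule deriv_cong_disc[OF c(2) z])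
    also have "\<dots> = (\<Sum>i\<le>k. deriv (\<lambda>z. c i z * (deriv ^^ i) g z) z)"
      using fd[OF z] by (intro deriv_sum field_differentiable_mult) auto
    also have "\<dots> = (\<Sum>i\<le>k. (deriv (c i) z * (deriv ^^ i) g z + c i z * (deriv ^^ Suc i) g z))"
      using fd[OF z] by (intro sum.cong refl) (simp add: deriv_mult)
    finally show "deriv p z = (\<Sum>i\<le>k. (deriv (c i) z * (deriv ^^ i) g z + c i z * (deriv ^^ Suc i) g z))" .
  qed
qed

lemma diff_combo_higher_deriv:
  assumes g: "g holomorphic_on ball 0 1" and p: "diff_combo g k p" shows "diff_combo g (k + i) ((deriv ^^ i) p)"
  by (induction i) (auto intro: p diff_combo_deriv[OF g])

lemma diff_combo_trans:
  assumes g: "g holomorphic_on ball 0 1" and h: "diff_combo g j h" and p: "diff_combo h k p"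
  shows "diff_combo g (j + k) p"
proof -
  obtain c where c: "\<And>i. poly_growth (c i)" "\<And>z. norm z < 1 \<Longrightarrow> p z = (\<Sum>i\<le>k. c i z * (deriv ^^ i) h z)"
    using p unfolding diff_combo_def by blast
  have "diff_combo g (j + k) (\<lambda>z. \<Sum>i\<le>k. c i z * (deriv ^^ i) h z)"
    by (intro diff_combo_sum diff_combo_mult c diff_combo_mono[OF diff_combo_higher_deriv[OF g h]]) auto
  then show ?thesis by (rule diff_combo_cong) (rule c(2))
qed

text \<open>
  The Wronskians of \<open>f 0\<close> with the other functions. Taking this step repeatedly gives a Wronskian
  of the whole system up to a factor; the iterated form suits induction and involves no division.
\<close>

definition wronskian_step :: "(nat \<Rightarrow> complex \<Rightarrow> complex) \<Rightarrow> nat \<Rightarrow> complex \<Rightarrow> complex" where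
  "wronskian_step f j z = f 0 z * deriv (f (Suc j)) z - deriv (f 0) z * f (Suc j) z"

fun iter_wronskian :: "nat \<Rightarrow> (nat \<Rightarrow> complex \<Rightarrow> complex) \<Rightarrow> complex \<Rightarrow> complex" where
  "iter_wronskian 0 f = f 0"
| "iter_wronskian (Suc n) f = iter_wronskian n (wronskian_step f)"

lemma poly_growth_wronskian_step:
  assumes "poly_growth (f 0)" "poly_growth (f (Suc j))" shows "poly_growth (wronskian_step f j)"
proof -
  have "poly_growth (\<lambda>z. f 0 z * deriv (f (Suc j)) z + (- 1) * (deriv (f 0) z * f (Suc j) z))"
    by (intro poly_growth_add poly_growth_mult poly_growth_const poly_growth_deriv assms)
  then show ?thesis by (simp add: wronskian_step_def[abs_def])
qed

text \<open>
  The idea of the whole argument: the same function \<open>iter_wronskian n f\<close> serves all coefficients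
  \<open>l\<close>. If some coefficient beyond \<open>l 0\<close> is nonzero, the Wronskian of \<open>f 0\<close> and \<open>g\<close> is a nontrivial
  combination of the functions of the next step. Otherwise \<open>g\<close> is a multiple of \<open>f 0\<close>, and the
  first function of the next step, \<open>f 0 * f 1' - f 0' * f 1\<close>, is itself an operator of order 1
  applied to \<open>g\<close>. In both cases one derivative is spent per step.
\<close>

lemma iter_wronskian_combo:
  assumes "\<And>j. j \<le> n \<Longrightarrow> poly_growth (f j)"
    and "\<And>z. norm z < 1 \<Longrightarrow> g z = (\<Sum>j\<le>n. l j * f j z)"
    and "\<exists>j\<le>n. l j \<noteq> 0" and "g holomorphic_on ball 0 1"
  shows "diff_combo g n (iter_wronskian n f)"
  using assms
proof (induction n arbitrary: f g l)
  case 0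
  then have l0: "l 0 \<noteq> 0" by auto
  have "diff_combo g 0 (\<lambda>z. (1 / l 0) * (deriv ^^ 0) g z)"
    by (intro diff_combo_mult poly_growth_const diff_combo_single) auto
  then show ?case by (rule diff_combo_cong) (use 0 l0 in auto)
next
  case (Suc n)
  note pg = Suc.prems(1) and geq = Suc.prems(2) and g = Suc.prems(4)
  have hf: "f j field_differentiable at z" if "j \<le> Suc n" "norm z < 1" for j z
    using that poly_growth_holomorphic[OF pg[OF that(1)]] by (auto intro: holomorphic_on_imp_differentiable_at)
  have dg: "deriv g z = (\<Sum>j\<le>Suc n. l j * deriv (f j) z)" if z: "norm z < 1" for z
  proof -
    have "deriv g z = deriv (\<lambda>z. \<Sum>j\<le>Suc n. l j * f j z) z"
      by (rule deriv_cong_disc[OF geq z])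
    also have "\<dots> = (\<Sum>j\<le>Suc n. l j * deriv (f j) z)"
    proof (rule DERIV_imp_deriv, rule DERIV_sum)
      fix j assume "j \<in> {..Suc n}"
      then show "((\<lambda>z. l j * f j z) has_field_derivative l j * deriv (f j) z) (at z)"
        by (intro DERIV_cmult field_differentiable_derivI hf z) simp
    qed
    finally show ?thesis .
  qed
  have pgs: "poly_growth (wronskian_step f j)" if "j \<le> n" for j
    using that by (intro poly_growth_wronskian_step pg) auto
  have g1: "diff_combo g 1 g" "diff_combo g 1 (deriv g)"
    using diff_combo_single[of 0 1 g] diff_combo_single[of 1 1 g] by auto
  have main: "diff_combo g (Suc n) (iter_wronskian n (wronskian_step f))"
    if h: "h holomorphic_on ball 0 1" "diff_combo g 1 h" "\<exists>j\<le>n. l' j \<noteq> 0"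
      "\<And>z. norm z < 1 \<Longrightarrow> h z = (\<Sum>j\<le>n. l' j * wronskian_step f j z)" for h l'
  proof -
    have "diff_combo h n (iter_wronskian n (wronskian_step f))"
      by (rule Suc.IH[OF pgs h(4) h(3) h(1)])
    from diff_combo_trans[OF g h(2) this] show ?thesis by simp
  qed
  show ?case
  proof (cases "\<exists>j\<le>n. l (Suc j) \<noteq> 0")
    case True
    define h where "h = (\<lambda>z. f 0 z * deriv g z + (- 1) * (deriv (f 0) z * g z))"
    have "diff_combo g 1 h" unfolding h_def
      by (intro diff_combo_add diff_combo_mult g1 poly_growth_const poly_growth_deriv pg) auto
    moreover have "h holomorphic_on ball 0 1" unfolding h_def
      by (intro holomorphic_intros holomorphic_deriv g poly_growth_holomorphic[OF pg]) auto
    moreover have "h z = (\<Sum>j\<le>n. l (Suc j) * wronskian_step f j z)" if z: "norm z < 1" for z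
    proof -
      have "h z = (\<Sum>j\<le>Suc n. l j * (f 0 z * deriv (f j) z - deriv (f 0) z * f j z))"
        unfolding h_def dg[OF z] geq[OF z] sum_distrib_left sum_subtractf right_diff_distrib
        by (simp add: sum_negf[symmetric] sum_distrib_left mult_ac)
      also have "\<dots> = (\<Sum>j\<le>n. l (Suc j) * wronskian_step f j z)"
        by (subst sum.atMost_Suc_shift) (simp add: wronskian_step_def mult.commute)
      finally show ?thesis .
    qed
    ultimately show ?thesis using main[of h "\<lambda>j. l (Suc j)"] True by simp
  next
    case False
    then have l0: "l 0 \<noteq> 0" using Suc.prems(3) by (metis Suc_le_mono not0_implies_Suc)
    have g0: "g z = l 0 * f 0 z" if "norm z < 1" for z
    proof -
      have "(\<Sum>j\<le>n. l (Suc j) * f (Suc j) z) = 0" using False by (intro sum.neutral) auto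
      then show ?thesis using geq[OF that] by (simp only: sum.atMost_Suc_shift add_0_right)
    qed
    have dg0: "deriv g z = l 0 * deriv (f 0) z" if z: "norm z < 1" for z
      using deriv_cong_disc[OF g0 z] hf[OF _ z, of 0] by (simp add: deriv_cmult)
    have "diff_combo g 1 (\<lambda>z. deriv (f 1) z * (1 / l 0 * g z) + f 1 z * (- 1 / l 0 * deriv g z))"
      by (intro diff_combo_add diff_combo_mult g1 poly_growth_const poly_growth_deriv pg) auto
    then have "diff_combo g 1 (wronskian_step f 0)"
      by (rule diff_combo_cong) (simp add: wronskian_step_def g0 dg0 l0 field_simps)
    moreover have "wronskian_step f 0 z = (\<Sum>j\<le>n. (if j = 0 then 1 else 0) * wronskian_step f j z)" for z
      by (simp add: if_distrib[of "\<lambda>x. x * _"] sum.delta cong: if_cong)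
    ultimately show ?thesis
      using main[of "wronskian_step f 0" "\<lambda>j. if j = 0 then 1 else 0"] poly_growth_holomorphic[OF pgs[of 0]] by auto
  qed
qed

text \<open>
  A relation between the Wronskians of \<open>f 0\<close> with the others says that a combination \<open>s\<close> of these
  others has \<open>s / f 0\<close> locally constant, so \<open>s\<close> is a multiple of \<open>f 0\<close> on the whole disc.
\<close>

lemma lin_indep_wronskian_step:
  assumes hol: "\<And>j. j \<le> Suc n \<Longrightarrow> f j holomorphic_on ball 0 1" and li: "lin_indep_on_disk (Suc n) f"
  shows "lin_indep_on_disk n (wronskian_step f)"
  unfolding lin_indep_on_disk_def
proof (intro allI impI)
  fix c j assume c: "\<forall>z\<in>ball 0 1. (\<Sum>j\<le>n. c j * wronskian_step f j z) = 0" and j: "j \<le> n"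
  have hf: "f j field_differentiable at z" if "j \<le> Suc n" "norm z < 1" for j z
    using that hol[OF that(1)] by (auto intro: holomorphic_on_imp_differentiable_at)
  have "\<exists>z0. norm z0 < 1 \<and> f 0 z0 \<noteq> 0"
  proof (rule ccontr)
    assume "\<nexists>z0. norm z0 < 1 \<and> f 0 z0 \<noteq> 0"
    then have "\<forall>z\<in>ball 0 1. (\<Sum>j\<le>Suc n. (if j = 0 then 1 else 0) * f j z) = 0"
      by (simp add: if_distrib[of "\<lambda>x. x * _"] sum.delta cong: if_cong)
    then have "\<forall>j\<le>Suc n. (if j = 0 then 1 else 0) = (0::complex)"
      using li unfolding lin_indep_on_disk_def by (elim allE[of _ "\<lambda>j. if j = 0 then 1 else 0"]) blast
    then show False by auto
  qed
  then obtain z0 where z0: "norm z0 < 1" "f 0 z0 \<noteq> 0" by blast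
  have c0: "isCont (f 0) z0" using hf[of 0 z0] z0 by (simp add: field_differentiable_imp_continuous_at)
  obtain d1 where d1: "d1 > 0" "\<And>z. dist z0 z < d1 \<Longrightarrow> f 0 z \<noteq> 0"
    using continuous_at_avoid[OF c0 z0(2)] by blast
  define d where "d = min d1 (1 - norm z0)"
  have d: "d > 0" using d1 z0 by (simp add: d_def)
  have sub: "ball z0 d \<subseteq> ball 0 1"
  proof
    fix w assume "w \<in> ball z0 d"
    then have "norm (w - z0) < 1 - norm z0" by (simp add: d_def dist_norm norm_minus_commute)
    then show "w \<in> ball 0 1" using norm_triangle_sub[of w z0] by simp
  qed
  have nz: "f 0 z \<noteq> 0" if "z \<in> ball z0 d" for z using that d1 by (simp add: d_def)
  define s where "s = (\<lambda>z. \<Sum>j\<le>n. c j * f (Suc j) z)"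
  have sh: "s holomorphic_on ball 0 1" unfolding s_def by (intro holomorphic_intros hol) auto
  have ds: "deriv s z = (\<Sum>j\<le>n. c j * deriv (f (Suc j)) z)" if z: "norm z < 1" for z
  proof -
    have "((\<lambda>z. \<Sum>j\<le>n. c j * f (Suc j) z) has_field_derivative (\<Sum>j\<le>n. c j * deriv (f (Suc j)) z)) (at z)"
    proof (rule DERIV_sum)
      fix j assume "j \<in> {..n}"
      then show "((\<lambda>z. c j * f (Suc j) z) has_field_derivative c j * deriv (f (Suc j)) z) (at z)"
        by (intro DERIV_cmult field_differentiable_derivI hf z) simp
    qed
    then show ?thesis unfolding s_def by (rule DERIV_imp_deriv)
  qed
  have w0: "f 0 z * deriv s z - deriv (f 0) z * s z = 0" if z: "norm z < 1" for z
  proof -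
    have "f 0 z * deriv s z - deriv (f 0) z * s z = (\<Sum>j\<le>n. c j * wronskian_step f j z)"
      unfolding ds[OF z] unfolding s_def sum_distrib_left sum_subtractf[symmetric] wronskian_step_def
      by (intro sum.cong refl) (simp add: algebra_simps)
    then show ?thesis using c z by simp
  qed
  have "\<exists>\<kappa>. \<forall>z\<in>ball z0 d. s z / f 0 z = \<kappa>"
  proof (rule has_field_derivative_zero_constant)
    show "convex (ball z0 d)" by simp
    fix z assume z: "z \<in> ball z0 d"
    then have z1: "norm z < 1" using sub by auto
    have "(s has_field_derivative deriv s z) (at z)" "(f 0 has_field_derivative deriv (f 0) z) (at z)"
      using holomorphic_derivI[OF sh open_ball] holomorphic_derivI[OF hol[of 0] open_ball] z1 by auto
    then have "((\<lambda>z. s z / f 0 z) has_field_derivative (deriv s z * f 0 z - s z * deriv (f 0) z) / (f 0 z * f 0 z)) (at z)"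
      using nz[OF z] by (rule DERIV_divide)
    moreover have "deriv s z * f 0 z - s z * deriv (f 0) z = 0" using w0[OF z1] by (simp add: mult.commute)
    ultimately show "((\<lambda>z. s z / f 0 z) has_field_derivative 0) (at z within ball z0 d)"
      by (simp add: has_field_derivative_at_within)
  qed
  then obtain \<kappa> where k: "\<And>z. z \<in> ball z0 d \<Longrightarrow> s z = \<kappa> * f 0 z" using nz by (metis nonzero_divide_eq_eq)
  have kall: "s z = \<kappa> * f 0 z" if "z \<in> ball 0 1" for z
  proof (rule analytic_continuation_open[of "ball z0 d" "ball 0 1" s "\<lambda>z. \<kappa> * f 0 z"])
    show "(\<lambda>z. \<kappa> * f 0 z) holomorphic_on ball 0 1" by (intro holomorphic_intros hol) auto
  qed (use d sub sh k that in auto)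
  have "\<forall>z\<in>ball 0 1. (\<Sum>i\<le>Suc n. (case i of 0 \<Rightarrow> - \<kappa> | Suc i \<Rightarrow> c i) * f i z) = 0"
    using kall by (simp add: sum.atMost_Suc_shift s_def del: sum.atMost_Suc)
  then have "\<forall>i\<le>Suc n. (case i of 0 \<Rightarrow> - \<kappa> | Suc i \<Rightarrow> c i) = 0"
    using li unfolding lin_indep_on_disk_def by (elim allE[of _ "\<lambda>i. case i of 0 \<Rightarrow> - \<kappa> | Suc i \<Rightarrow> c i"]) blast
  then show "c j = 0" using j by (elim allE[of _ "Suc j"]) auto
qed

lemma iter_wronskian_nonzero:
  assumes "\<And>j. j \<le> n \<Longrightarrow> f j holomorphic_on ball 0 1" "lin_indep_on_disk n f"
  shows "\<exists>z. norm z < 1 \<and> iter_wronskian n f z \<noteq> 0"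
  using assms
proof (induction n arbitrary: f)
  case 0
  show ?case
  proof (rule ccontr)
    assume "\<not> ?case"
    then have "\<forall>z\<in>ball 0 1. (\<Sum>j\<le>0. (1::complex) * f j z) = 0" by auto
    then have "\<forall>j\<le>(0::nat). (1::complex) = 0" using 0(2) unfolding lin_indep_on_disk_def by (elim allE[of _ "\<lambda>_. 1"]) blast
    then show False by auto
  qed
next
  case (Suc n)
  have "wronskian_step f j holomorphic_on ball 0 1" if "j \<le> n" for j
    unfolding wronskian_step_def[abs_def] using that
    by (intro holomorphic_intros holomorphic_deriv Suc.prems) auto
  then show ?case using Suc.IH[OF _ lin_indep_wronskian_step[OF Suc.prems]] by simp
qed

text \<open>
  All derivatives of \<open>p\<close> up to order \<open>k\<close> are bounded by a polynomial in \<open>U\<close>. Unlike boundedness in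
  \<open>U\<close> itself, this is preserved by products.
\<close>

fun controlled :: "(complex \<Rightarrow> real) \<Rightarrow> nat \<Rightarrow> (complex \<Rightarrow> complex) \<Rightarrow> bool" where
  "controlled U 0 p \<longleftrightarrow> p holomorphic_on ball 0 1 \<and> (\<exists>C M. 0 \<le> C \<and> (\<forall>z. norm z < 1 \<longrightarrow> norm (p z) \<le> C * (1 + U z)^M))"
| "controlled U (Suc k) p \<longleftrightarrow> controlled U 0 p \<and> controlled U k (deriv p)"

lemma controlled_0: "controlled U k p \<Longrightarrow> controlled U 0 p"
  by (cases k) auto

lemma controlled_hol: "controlled U k p \<Longrightarrow> p holomorphic_on ball 0 1"
  by (cases k) auto

lemma controlled_Suc_imp: "controlled U (Suc k) p \<Longrightarrow> controlled U k p"
  by (induction k arbitrary: p) auto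

lemma controlled_cong:
  "controlled U k p \<Longrightarrow> (\<And>z. norm z < 1 \<Longrightarrow> q z = p z) \<Longrightarrow> controlled U k q"
proof (induction k arbitrary: p q)
  case 0
  then show ?case using holomorphic_cong[of "ball 0 1" "ball 0 1" q p] by auto
next
  case (Suc k)
  have "controlled U 0 q" using Suc.prems holomorphic_cong[of "ball 0 1" "ball 0 1" q p] by auto
  moreover have "controlled U k (deriv q)"
    by (rule Suc.IH[of "deriv p"]) (use Suc.prems deriv_cong_disc[of q p] in auto)
  ultimately show ?case by simp
qed

context
  fixes U :: "complex \<Rightarrow> real"
  assumes U0: "\<And>z. norm z < 1 \<Longrightarrow> 0 \<le> U z"
begin

lemma controlled_add:
  "controlled U k p \<Longrightarrow> controlled U k q \<Longrightarrow> controlled U k (\<lambda>z. p z + q z)"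
proof (induction k arbitrary: p q)
  case 0
  obtain C M D N where C: "0 \<le> C" "\<And>z. norm z < 1 \<Longrightarrow> norm (p z) \<le> C * (1 + U z)^M"
    and D: "0 \<le> D" "\<And>z. norm z < 1 \<Longrightarrow> norm (q z) \<le> D * (1 + U z)^N" using 0 by auto
  have "norm (p z + q z) \<le> (C + D) * (1 + U z)^(M+N)" if z: "norm z < 1" for z
  proof -
    have "(1 + U z)^M \<le> (1 + U z)^(M+N)" "(1 + U z)^N \<le> (1 + U z)^(M+N)"
      using U0[OF z] by (auto intro!: power_increasing)
    then have "C * (1 + U z)^M + D * (1 + U z)^N \<le> C * (1 + U z)^(M+N) + D * (1 + U z)^(M+N)"
      using C D by (intro add_mono mult_left_mono) auto
    then show ?thesis using norm_triangle_ineq[of "p z" "q z"] C(2)[OF z] D(2)[OF z] by (simp add: distrib_right)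
  qed
  moreover have "0 \<le> C + D" using C D by simp
  moreover have "(\<lambda>z. p z + q z) holomorphic_on ball 0 1" using 0 by (auto intro!: holomorphic_intros)
  ultimately show ?case by auto
next
  case (Suc k)
  have fd: "p field_differentiable at z" "q field_differentiable at z" if "norm z < 1" for z
    using that controlled_hol[OF Suc.prems(1)] controlled_hol[OF Suc.prems(2)]
    by (auto intro: holomorphic_on_imp_differentiable_at)
  have "controlled U k (\<lambda>z. deriv p z + deriv q z)" using Suc by simp
  then have "controlled U k (deriv (\<lambda>z. p z + q z))"
    by (rule controlled_cong) (use fd in simp)
  moreover have "controlled U 0 (\<lambda>z. p z + q z)"
  proof -
    have "controlled U 0 p" "controlled U 0 q" using Suc.prems by auto
    then obtain C M D N where C: "0 \<le> C" "\<And>z. norm z < 1 \<Longrightarrow> norm (p z) \<le> C * (1 + U z)^M"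
      and D: "0 \<le> D" "\<And>z. norm z < 1 \<Longrightarrow> norm (q z) \<le> D * (1 + U z)^N" by auto
    have "norm (p z + q z) \<le> (C + D) * (1 + U z)^(M+N)" if z: "norm z < 1" for z
    proof -
      have "(1 + U z)^M \<le> (1 + U z)^(M+N)" "(1 + U z)^N \<le> (1 + U z)^(M+N)"
        using U0[OF z] by (auto intro!: power_increasing)
      then have "C * (1 + U z)^M + D * (1 + U z)^N \<le> C * (1 + U z)^(M+N) + D * (1 + U z)^(M+N)"
        using C D by (intro add_mono mult_left_mono) auto
      then show ?thesis using norm_triangle_ineq[of "p z" "q z"] C(2)[OF z] D(2)[OF z] by (simp add: distrib_right)
    qed
    moreover have "0 \<le> C + D" using C D by simp
    moreover have "(\<lambda>z. p z + q z) holomorphic_on ball 0 1" using Suc.prems by (auto intro!: holomorphic_intros)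
    ultimately show ?thesis by auto
  qed
  ultimately show ?case by simp
qed

lemma controlled_mult_0:
  assumes "controlled U 0 p" "controlled U 0 q" shows "controlled U 0 (\<lambda>z. p z * q z)"
proof -
  obtain C M D N where C: "0 \<le> C" "\<And>z. norm z < 1 \<Longrightarrow> norm (p z) \<le> C * (1 + U z)^M"
    and D: "0 \<le> D" "\<And>z. norm z < 1 \<Longrightarrow> norm (q z) \<le> D * (1 + U z)^N" using assms by auto
  have "norm (p z * q z) \<le> (C * D) * (1 + U z)^(M+N)" if z: "norm z < 1" for z
  proof -
    have "norm (p z * q z) \<le> (C * (1 + U z)^M) * (D * (1 + U z)^N)"
      unfolding norm_mult using C(2)[OF z] D(2)[OF z] C D U0[OF z] by (intro mult_mono) auto
    then show ?thesis by (simp add: power_add mult_ac)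
  qed
  moreover have "0 \<le> C * D" using C D by simp
  moreover have "(\<lambda>z. p z * q z) holomorphic_on ball 0 1" using assms by (auto intro!: holomorphic_intros)
  ultimately show ?thesis by auto
qed

lemma controlled_const: "controlled U k (\<lambda>_. c)"
proof (induction k arbitrary: c)
  case 0 show ?case by (auto intro!: exI[of _ "norm c"] exI[of _ "0::nat"])
next
  case (Suc k)
  have "controlled U 0 (\<lambda>_. c)" by (auto intro!: exI[of _ "norm c"] exI[of _ "0::nat"])
  moreover have "deriv (\<lambda>_. c) = (\<lambda>_. 0)" by (simp add: fun_eq_iff)
  ultimately show ?case using Suc by simp
qed

lemma controlled_mult:
  "controlled U k p \<Longrightarrow> controlled U k q \<Longrightarrow> controlled U k (\<lambda>z. p z * q z)"
proof (induction k arbitrary: p q)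
  case 0 then show ?case by (rule controlled_mult_0)
next
  case (Suc k)
  have fd: "p field_differentiable at z" "q field_differentiable at z" if "norm z < 1" for z
    using that controlled_hol[OF Suc.prems(1)] controlled_hol[OF Suc.prems(2)]
    by (auto intro: holomorphic_on_imp_differentiable_at)
  have "controlled U k (\<lambda>z. p z * deriv q z + deriv p z * q z)"
  proof -
    have "controlled U k p" "controlled U k q"
      by (rule controlled_Suc_imp, rule Suc.prems)+
    moreover have "controlled U k (deriv p)" "controlled U k (deriv q)"
      using Suc.prems unfolding controlled.simps(2) by blast+
    ultimately show ?thesis by (intro controlled_add Suc.IH)
  qed
  then have "controlled U k (deriv (\<lambda>z. p z * q z))"
    by (rule controlled_cong) (simp add: deriv_mult fd)
  moreover have "controlled U 0 (\<lambda>z. p z * q z)"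
    by (rule controlled_mult_0; rule controlled_0; rule Suc.prems)
  ultimately show ?case unfolding controlled.simps(2) by blast
qed

lemma controlled_wronskian_step:
  assumes "controlled U (Suc k) (f 0)" "controlled U (Suc k) (f (Suc j))"
  shows "controlled U k (wronskian_step f j)"
proof -
  have "controlled U k (\<lambda>z. f 0 z * deriv (f (Suc j)) z + (- 1) * (deriv (f 0) z * f (Suc j) z))"
  proof -
    have "controlled U k (f 0)" "controlled U k (f (Suc j))"
      by (rule controlled_Suc_imp, rule assms)+
    moreover have "controlled U k (deriv (f 0))" "controlled U k (deriv (f (Suc j)))"
      using assms unfolding controlled.simps(2) by blast+
    ultimately show ?thesis by (intro controlled_add controlled_mult controlled_const)
  qed
  then show ?thesis by (simp add: wronskian_step_def[abs_def])
qed

text \<open>Each step spends one of the \<open>n\<close> available derivatives.\<close>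

lemma controlled_iter_wronskian:
  "(\<And>j. j \<le> n \<Longrightarrow> controlled U n (f j)) \<Longrightarrow> controlled U 0 (iter_wronskian n f)"
proof (induction n arbitrary: f)
  case 0
  show ?case unfolding iter_wronskian.simps by (rule 0) simp
next
  case (Suc n)
  have "controlled U 0 (iter_wronskian n (wronskian_step f))"
  proof (rule Suc.IH, rule controlled_wronskian_step)
    show "controlled U (Suc n) (f 0)" by (rule Suc.prems) simp
    show "controlled U (Suc n) (f (Suc j))" if "j \<le> n" for j by (rule Suc.prems) (use that in simp)
  qed
  then show ?case unfolding iter_wronskian.simps .
qed

end

lemma controlled_derivs:
  assumes "p holomorphic_on ball 0 1" "\<And>i z. i \<le> k \<Longrightarrow> norm z < 1 \<Longrightarrow> norm ((deriv ^^ i) p z) \<le> U z"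
    and "\<And>z. norm z < 1 \<Longrightarrow> 0 \<le> U z"
  shows "controlled U k p"
  using assms(1,2)
proof (induction k arbitrary: p)
  case 0
  have "norm (p z) \<le> 1 * (1 + U z)^1" if "norm z < 1" for z
    using 0(2)[of 0 z] that by simp
  then show ?case unfolding controlled.simps using 0(1)
    by (intro conjI exI[of _ "1::real"] exI[of _ "1::nat"] allI impI) auto
next
  case (Suc k)
  have "controlled U k (deriv p)"
  proof (rule Suc.IH)
    show "deriv p holomorphic_on ball 0 1" by (intro holomorphic_deriv Suc.prems) simp
    show "norm ((deriv ^^ i) (deriv p) z) \<le> U z" if "i \<le> k" "norm z < 1" for i z
      using Suc.prems(2)[of "Suc i" z] that by (simp only: funpow_Suc_right o_apply Suc_le_mono)
  qed
  moreover have "norm (p z) \<le> 1 * (1 + U z)^1" if "norm z < 1" for z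
    using Suc.prems(2)[of 0 z] that by simp
  moreover have "controlled U 0 p" unfolding controlled.simps using Suc.prems(1) calculation(2)
    by (intro conjI exI[of _ "1::real"] exI[of _ "1::nat"] allI impI) auto
  ultimately show ?case by (simp only: controlled.simps(2))
qed

text \<open>
  Zeros are divided out one at a time; continuity carries the bound for the quotient over to the
  point \<open>a\<close>.
\<close>

lemma factor_from_bound:
  assumes "p holomorphic_on ball 0 1" "norm a < 1" "\<delta> > 0"
    "\<And>z. norm z < 1 \<Longrightarrow> norm (z - a) < \<delta> \<Longrightarrow> norm (p z) \<le> C * norm (z - a)^m"
  shows "\<exists>q. q holomorphic_on ball 0 1 \<and> (\<forall>z. norm z < 1 \<longrightarrow> p z = (z - a)^m * q z)"
  using assms(1,4)
proof (induction m arbitrary: p)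
  case 0
  then show ?case by (intro exI[of _ p]) auto
next
  case (Suc m)
  have pa: "p a = 0" using Suc.prems(2)[of a] assms(2,3) by simp
  define q where "q = (\<lambda>z. if z = a then deriv p a else p z / (z - a))"
  have q: "q holomorphic_on ball 0 1"
    by (rule pole_theorem_open_0[OF Suc.prems(1), of a]) (auto simp: q_def pa)
  have pq: "p z = (z - a) * q z" for z by (simp add: q_def pa)
  have le1: "norm (q z) \<le> C * norm (z - a)^m" if z: "norm z < 1" "norm (z - a) < \<delta>" "z \<noteq> a" for z
  proof -
    have "norm (z - a) * norm (q z) \<le> norm (z - a) * (C * norm (z - a)^m)"
      using Suc.prems(2)[OF z(1,2)] pq[of z] by (simp add: norm_mult mult_ac)
    then show ?thesis using z by simp
  qed
  have "norm (q a) \<le> C * norm (a - a)^m"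
  proof (rule tendsto_le[of "at a"])
    have "isCont q a" using q assms(2) by (intro continuous_on_interior[OF holomorphic_on_imp_continuous_on]) auto
    then show "((\<lambda>z. norm (q z)) \<longlongrightarrow> norm (q a)) (at a)" by (intro tendsto_norm) (simp add: isCont_def)
    show "((\<lambda>z. C * norm (z - a)^m) \<longlongrightarrow> C * norm (a - a)^m) (at a)" by (intro tendsto_intros)
    have "eventually (\<lambda>z. z \<in> ball 0 1) (at a)" using assms(2) by (intro eventually_at_in_open') auto
    moreover have "eventually (\<lambda>z. z \<in> ball a \<delta>) (at a)" using assms(3) by (intro eventually_at_in_open') auto
    moreover have "eventually (\<lambda>z. z \<noteq> a) (at a)" by (simp add: eventually_at_filter)
    ultimately show "eventually (\<lambda>z. norm (q z) \<le> C * norm (z - a)^m) (at a)"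
      by eventually_elim (auto intro!: le1 simp: dist_norm norm_minus_commute)
  qed simp
  then have "norm (q z) \<le> C * norm (z - a)^m" if z: "norm z < 1" "norm (z - a) < \<delta>" for z
    using le1[OF z] by (cases "z = a") auto
  from Suc.IH[OF q this] obtain q1 where "q1 holomorphic_on ball 0 1" "\<And>z. norm z < 1 \<Longrightarrow> q z = (z - a)^m * q1 z" by blast
  then show ?case by (intro exI[of _ q1]) (auto simp: pq mult_ac)
qed

lemma factor_higher_deriv:
  assumes q: "q holomorphic_on ball 0 1" and p: "\<And>z. norm z < 1 \<Longrightarrow> p z = (z - a)^m * q z" and "k \<le> m"
  shows "\<exists>q'. q' holomorphic_on ball 0 1 \<and> (\<forall>z. norm z < 1 \<longrightarrow> (deriv ^^ k) p z = (z - a)^(m - k) * q' z)"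
  using assms(3)
proof (induction k)
  case 0 then show ?case using q p by auto
next
  case (Suc k)
  then obtain q' where q': "q' holomorphic_on ball 0 1" "\<And>z. norm z < 1 \<Longrightarrow> (deriv ^^ k) p z = (z - a)^(m - k) * q' z" by auto
  define j where "j = m - Suc k"
  have mk: "m - k = Suc j" using Suc.prems by (simp add: j_def)
  have "(deriv ^^ Suc k) p z = (z - a)^j * (of_nat (Suc j) * q' z + (z - a) * deriv q' z)" if z: "norm z < 1" for z
  proof -
    have d: "(q' has_field_derivative deriv q' z) (at z)" using holomorphic_derivI[OF q'(1) open_ball] z by simp
    have "(deriv ^^ Suc k) p z = deriv (\<lambda>z. (z - a)^Suc j * q' z) z"
      using deriv_cong_disc[OF q'(2) z] by (simp add: mk)
    also have "\<dots> = (z - a)^j * (of_nat (Suc j) * q' z + (z - a) * deriv q' z)"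
    proof (rule DERIV_imp_deriv)
      have "((\<lambda>z. z - a) has_field_derivative 1) (at z)" by (auto intro!: derivative_eq_intros)
      from DERIV_mult[OF DERIV_power[OF this, of "Suc j"] d]
      show "((\<lambda>z. (z - a)^Suc j * q' z) has_field_derivative
          (z - a)^j * (of_nat (Suc j) * q' z + (z - a) * deriv q' z)) (at z)"
        by (rule DERIV_cong) (simp only: diff_Suc_1' diff_Suc_1 power_Suc distrib_left mult_1 mult_ac)
    qed
    finally show ?thesis .
  qed
  moreover have "(\<lambda>z. of_nat (Suc j) * q' z + (z - a) * deriv q' z) holomorphic_on ball 0 1"
    by (intro holomorphic_intros holomorphic_deriv q') auto
  ultimately show ?case unfolding j_def[symmetric] by blast
qed

text \<open>
  An operator of order \<open>n\<close> lowers the multiplicity of a zero by at most \<open>n\<close>. This is where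
  multiplicities up to \<open>n\<close> drop out.
\<close>

lemma diff_combo_factor:
  assumes q: "q holomorphic_on ball 0 1" and g: "\<And>z. norm z < 1 \<Longrightarrow> g z = (z - a)^m * q z" and nm: "n \<le> m"
    and c: "diff_combo g n p"
  shows "\<exists>q'. q' holomorphic_on ball 0 1 \<and> (\<forall>z. norm z < 1 \<longrightarrow> p z = (z - a)^(m - n) * q' z)"
proof -
  obtain c where c: "\<And>i. poly_growth (c i)" "\<And>z. norm z < 1 \<Longrightarrow> p z = (\<Sum>i\<le>n. c i z * (deriv ^^ i) g z)"
    using c unfolding diff_combo_def by blast
  have "\<forall>i\<in>{..n}. \<exists>q'. q' holomorphic_on ball 0 1 \<and> (\<forall>z. norm z < 1 \<longrightarrow> (deriv ^^ i) g z = (z - a)^(m - i) * q' z)"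
    using factor_higher_deriv[OF q g] nm by auto
  then obtain q' where q': "\<And>i. i \<le> n \<Longrightarrow> q' i holomorphic_on ball 0 1"
    "\<And>i z. i \<le> n \<Longrightarrow> norm z < 1 \<Longrightarrow> (deriv ^^ i) g z = (z - a)^(m - i) * q' i z"
    by (subst (asm) bchoice_iff) auto
  have "p z = (z - a)^(m - n) * (\<Sum>i\<le>n. c i z * ((z - a)^(n - i) * q' i z))" if z: "norm z < 1" for z
  proof -
    have "c i z * (deriv ^^ i) g z = (z - a)^(m - n) * (c i z * ((z - a)^(n - i) * q' i z))" if i: "i \<le> n" for i
    proof -
      have "m - i = (m - n) + (n - i)" using i nm by simp
      then show ?thesis using q'(2)[OF i z] by (simp add: power_add mult_ac)
    qed
    then show ?thesis unfolding c(2)[OF z] sum_distrib_left by (intro sum.cong) auto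
  qed
  moreover have "(\<lambda>z. \<Sum>i\<le>n. c i z * ((z - a)^(n - i) * q' i z)) holomorphic_on ball 0 1"
    by (intro holomorphic_intros poly_growth_holomorphic c q') auto
  ultimately show ?thesis by blast
qed

section \<open>Decay near a boundary zero\<close>

lemma norm_cis_diff_le: "norm (cis a - cis b) \<le> \<bar>a - b\<bar>"
proof -
  have "cis a - cis b = cis b * (cis (a - b) - 1)" by (simp add: algebra_simps cis_mult)
  then have "norm (cis a - cis b) = norm (exp (\<i> * complex_of_real (a - b)) - 1)"
    by (simp add: norm_mult cis_conv_exp)
  also have "\<dots> = 2 * \<bar>sin ((a - b)/2)\<bar>" by (rule dist_exp_i_1)
  also have "\<dots> \<le> 2 * \<bar>(a - b)/2\<bar>" by (intro mult_left_mono abs_sin_x_le_abs_x) auto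
  finally show ?thesis by simp
qed

lemma angle_le_chord:
  assumes "\<bar>t\<bar> \<le> pi" "norm (cis t - 1) \<le> 1" shows "\<bar>t\<bar> \<le> 2 * norm (cis t - 1)"
proof -
  have "(norm (cis t - 1))^2 = (cos t - 1)^2 + (sin t)^2" by (simp add: cmod_power2)
  also have "\<dots> = 2 - 2 * cos t" using sin_cos_squared_add[of t] by (simp add: power2_eq_square algebra_simps)
  finally have "2 - 2 * cos t \<le> 1^2" using power_mono[OF assms(2), of 2] by simp
  then have "cos (pi/3) \<le> cos \<bar>t\<bar>" by (simp add: cos_60)
  then have t3: "\<bar>t\<bar> \<le> pi/3" using assms(1) by (subst (asm) cos_mono_le_eq) auto
  have "sin 0 - 0/2 \<le> sin \<bar>t\<bar> - \<bar>t\<bar>/2"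
  proof (rule DERIV_nonneg_imp_nondecreasing[of 0 "\<bar>t\<bar>" "\<lambda>y. sin y - y/2"])
    fix y assume y: "0 \<le> y" "y \<le> \<bar>t\<bar>"
    have "cos (pi/3) \<le> cos y" using y t3 by (subst cos_mono_le_eq) auto
    then show "\<exists>d. ((\<lambda>y. sin y - y/2) has_real_derivative d) (at y) \<and> 0 \<le> d"
      by (intro exI[of _ "cos y - 1/2"]) (auto intro!: derivative_eq_intros simp: cos_60)
  qed auto
  moreover have "sin \<bar>t\<bar> \<le> \<bar>sin t\<bar>" by (simp add: abs_if)
  moreover have "\<bar>sin t\<bar> \<le> norm (cis t - 1)" using abs_Im_le_cmod[of "cis t - 1"] by simp
  ultimately show ?thesis by simp
qed

text \<open>
  The arc is centred at \<open>- 1\<close> so that its angles stay inside one period. If \<open>cis s\<close> is far from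
  the arc, the kernels with poles above the arc are pointwise at most three times the one with
  pole \<open>- r\<close>, and the arc contributes its length. If it is near, the total mass 1 of the kernel is
  used, and \<open>|cis s + r| \<le> (8 * K + 5) * (1 - r)\<close> makes the right-hand side at least 1.
\<close>

lemma arc_poisson_bound:
  assumes r: "0 \<le> r" "r < 1" and K: "K \<ge> 1" and \<rho>: "r \<le> \<rho>" "\<rho> < 1"
    and K1: "K * (1 - r) \<le> 1"
  shows "(\<integral>\<^sup>+ x. ennreal (indicator {pi - 2*(K*(1-r))..pi + 2*(K*(1-r))} x * poisson (polar \<rho> x) (cis s)) \<partial>circ)
    \<le> ennreal ((8*K+5)^2 * (1 - r) * poisson (complex_of_real (- r)) (cis s))" (is "?L \<le> _")
proof -
  define \<delta> where "\<delta> = K * (1 - r)"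
  have d0: "0 < \<delta>" "1 - r \<le> \<delta>" using r K mult_right_mono[of 1 K "1 - r"] by (auto simp: \<delta>_def)
  define I where "I = {pi - 2*\<delta>..pi + 2*\<delta>}"
  define D where "D = norm (cis s + 1)"
  define \<eta> where "\<eta> = 2*\<delta> + (1 - r)"
  have nz: "norm (polar \<rho> x) < 1" for x using r \<rho> by (simp add: norm_mult)
  have P0: "0 \<le> poisson (polar \<rho> x) w" for x w by (intro poisson_nonneg less_imp_le[OF nz])
  have Pr0: "0 < poisson (complex_of_real (- r)) (cis s)" using r by (intro poisson_pos) auto
  have nr: "norm (cis s - complex_of_real (- r)) \<le> D + (1 - r)"
  proof -
    have "cis s - complex_of_real (- r) = (cis s + 1) - complex_of_real (1 - r)" by simp
    then have "norm (cis s - complex_of_real (- r)) \<le> norm (cis s + 1) + norm (complex_of_real (1 - r))"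
      by (metis norm_triangle_ineq4)
    then show ?thesis using r by (simp add: D_def del: of_real_diff)
  qed
  have nrp: "0 < norm (cis s - complex_of_real (- r))"
  proof -
    have "norm (complex_of_real (- r)) = r" using r by simp
    then show ?thesis using norm_triangle_ineq2[of "cis s" "complex_of_real (- r)"] r norm_cis[of s] by linarith
  qed
  show ?thesis
  proof (cases "D \<ge> 4 * \<eta>")
    case True
    have pt: "poisson (polar \<rho> x) (cis s) \<le> 3 * poisson (complex_of_real (- r)) (cis s)" if x: "x \<in> I" for x
    proof -
      have "norm (cis x + 1) \<le> 2*\<delta>"
      proof -
        have "norm (cis x - cis pi) \<le> \<bar>x - pi\<bar>" by (rule norm_cis_diff_le)
        also have "\<dots> \<le> 2*\<delta>" using x by (auto simp: I_def)
        finally show ?thesis by simp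
      qed
      moreover have "norm (cis x - polar \<rho> x) = 1 - \<rho>"
      proof -
        have "cis x - polar \<rho> x = polar (1 - \<rho>) x" by (simp add: algebra_simps)
        then show ?thesis using \<rho> by (simp add: norm_mult del: of_real_diff)
      qed
      moreover have "D \<le> norm (cis s - polar \<rho> x) + norm (cis x + 1) + norm (cis x - polar \<rho> x)"
      proof -
        have "cis s + 1 = (cis s - polar \<rho> x) + (cis x + 1) - (cis x - polar \<rho> x)" by simp
        then show ?thesis unfolding D_def by (metis norm_triangle_ineq norm_triangle_ineq4 add_right_mono order_trans)
      qed
      ultimately have "D - \<eta> \<le> norm (cis s - polar \<rho> x)" using \<rho> by (simp add: \<eta>_def)
      then have a: "3 * D \<le> 4 * norm (cis s - polar \<rho> x)" using True by simp
      have b: "4 * norm (cis s - complex_of_real (- r)) \<le> 5 * D"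
        using nr True d0 by (simp add: \<eta>_def)
      have "12 * norm (cis s - complex_of_real (- r)) \<le> 20 * norm (cis s - polar \<rho> x)"
        using a b by linarith
      then have c: "norm (cis s - complex_of_real (- r)) \<le> 5/3 * norm (cis s - polar \<rho> x)" by simp
      have "(norm (cis s - complex_of_real (- r)))^2 \<le> (5/3 * norm (cis s - polar \<rho> x))^2"
        by (rule power_mono[OF c]) simp
      also have "\<dots> = 25/9 * (norm (cis s - polar \<rho> x))^2" by (simp add: power2_eq_square)
      also have "\<dots> \<le> 3 * (norm (cis s - polar \<rho> x))^2" by (rule mult_right_mono) auto
      finally have sq: "(norm (cis s - complex_of_real (- r)))^2 \<le> 3 * (norm (cis s - polar \<rho> x))^2" .
      have p1: "0 < norm (cis s - polar \<rho> x)"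
        using norm_triangle_ineq2[of "cis s" "polar \<rho> x"] nz[of x] norm_cis[of s] by linarith
      have num: "1 - \<rho>^2 \<le> 1 - r^2" "0 \<le> 1 - \<rho>^2" using \<rho> r by (auto intro!: power_mono power_le_one)
      have "(1 - \<rho>^2) * (norm (cis s - complex_of_real (- r)))^2 \<le> (1 - r^2) * (3 * (norm (cis s - polar \<rho> x))^2)"
        using num sq by (intro mult_mono) auto
      then have "(1 - \<rho>^2) / (norm (cis s - polar \<rho> x))^2 \<le> 3 * ((1 - r^2) / (norm (cis s - complex_of_real (- r)))^2)"
        using p1 nrp by (simp add: divide_le_eq) (simp add: field_simps)
      moreover have "norm (polar \<rho> x) = \<rho>" "norm (complex_of_real (- r)) = r" using r \<rho> by (auto simp: norm_mult)
      ultimately show ?thesis unfolding poisson_def by simp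
    qed
    have "?L \<le> (\<integral>\<^sup>+ x. ennreal (3 * poisson (complex_of_real (- r)) (cis s)) * indicator I x \<partial>circ)"
      unfolding \<delta>_def[symmetric] I_def[symmetric]
      using pt by (intro nn_integral_mono) (auto simp: indicator_def intro!: ennreal_leI)
    also have "\<dots> = ennreal (3 * poisson (complex_of_real (- r)) (cis s)) * emeasure circ I"
      by (rule nn_integral_cmult_indicator) (simp add: I_def)
    also have "emeasure circ I \<le> ennreal (\<delta>)"
    proof -
      have I: "I \<in> sets borel" by (simp add: I_def)
      have "emeasure circ I \<le> emeasure lborel I / ennreal (2*pi)"
        unfolding emeasure_circ[OF I] by (intro divide_right_mono_ennreal emeasure_mono) (auto simp: I_def)
      also have "\<dots> = ennreal (4*\<delta> / (2*pi))" using d0 by (simp add: I_def divide_ennreal)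
      also have "\<dots> \<le> ennreal \<delta>"
      proof (rule ennreal_leI)
        have "4 * \<delta> \<le> (2*pi) * \<delta>" by (rule mult_right_mono) (use d0 pi_ge_two in auto)
        then show "4*\<delta> / (2*pi) \<le> \<delta>" using pi_gt_zero by (simp add: pos_divide_le_eq mult.commute)
      qed
      finally show ?thesis .
    qed
    also have "ennreal (3 * poisson (complex_of_real (- r)) (cis s)) * ennreal \<delta>
      \<le> ennreal ((8*K+5)^2 * (1 - r) * poisson (complex_of_real (- r)) (cis s))"
    proof -
      have "3 * K \<le> (8*K+5)^2" using K by (simp add: power2_eq_square algebra_simps)
      then have "3 * K * ((1 - r) * poisson (complex_of_real (- r)) (cis s)) \<le> (8*K+5)^2 * ((1 - r) * poisson (complex_of_real (- r)) (cis s))"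
        using r Pr0 by (intro mult_right_mono) auto
      then have "3 * poisson (complex_of_real (- r)) (cis s) * \<delta> \<le> (8*K+5)^2 * (1 - r) * poisson (complex_of_real (- r)) (cis s)"
        by (simp add: \<delta>_def mult_ac)
      then have "ennreal (3 * poisson (complex_of_real (- r)) (cis s) * \<delta>) \<le> ennreal ((8*K+5)^2 * (1 - r) * poisson (complex_of_real (- r)) (cis s))"
        by (rule ennreal_leI)
      then show ?thesis using d0 Pr0 by (subst ennreal_mult[symmetric]) auto
    qed
    finally show ?thesis by (simp add: mult_left_mono)
  next
    case False
    have "norm (cis s - complex_of_real (- r)) \<le> (8*K+5) * (1 - r)"
      using nr False by (simp add: \<eta>_def \<delta>_def algebra_simps)
    then have "(norm (cis s - complex_of_real (- r)))^2 \<le> ((8*K+5) * (1 - r))^2" by (intro power_mono) auto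
    then have sq: "(norm (cis s - complex_of_real (- r)))^2 \<le> (8*K+5)^2 * (1 - r) * (1 - r)"
      by (simp add: power_mult_distrib power2_eq_square mult_ac)
    have "1 - r \<le> 1 - r^2"
      using r mult_left_mono[of r 1 r] by (simp add: power2_eq_square)
    then have "(8*K+5)^2 * (1 - r) * (1 - r) \<le> (8*K+5)^2 * (1 - r) * (1 - r^2)"
      using r by (intro mult_left_mono) auto
    then have "1 \<le> (8*K+5)^2 * (1 - r) * ((1 - r^2) / (norm (cis s - complex_of_real (- r)))^2)"
      using sq nrp by (simp add: le_divide_eq)
    then have one: "1 \<le> (8*K+5)^2 * (1 - r) * poisson (complex_of_real (- r)) (cis s)"
      using r by (simp add: poisson_def)
    have "?L \<le> (\<integral>\<^sup>+ x. ennreal (poisson (polar \<rho> x) (cis s)) * 1 \<partial>circ)"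
      using P0 by (intro nn_integral_mono) (auto simp: indicator_def intro!: ennreal_leI)
    also have "\<dots> = (\<integral>\<^sup>+ x. ennreal (poisson (polar \<rho> s) (cis x)) \<partial>circ)"
      by (intro nn_integral_cong) (simp add: poisson_swap[of "cis _" "cis s"])
    also have "\<dots> = ennreal (LINT x|circ. poisson (polar \<rho> s) (cis x))"
      by (rule nn_integral_eq_integral[OF integrable_poisson[OF nz]]) (intro AE_I2 P0)
    also have "\<dots> = ennreal 1" using integral_poisson[OF nz] by simp
    also have "\<dots> \<le> ennreal ((8*K+5)^2 * (1 - r) * poisson (complex_of_real (- r)) (cis s))"
      by (rule ennreal_leI[OF one])
    finally show ?thesis .
  qed
qed

text \<open>
  A positive harmonic function is a Poisson integral, up to a dilation, so \<open>arc_poisson_bound\<close> may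
  be integrated. The bound is uniform in the radius \<open>\<rho> \<ge> r\<close>.
\<close>

lemma arc_mean_bound:
  assumes A: "A holomorphic_on ball 0 1" and A0: "\<And>z. norm z < 1 \<Longrightarrow> 0 \<le> Re (A z)"
    and r: "0 \<le> r" "r < 1" and K: "K \<ge> 1" and \<rho>: "r \<le> \<rho>" "\<rho> < 1" and K1: "K * (1 - r) \<le> 1"
  shows "(LINT x|circ. indicator {pi - 2*(K*(1-r))..pi + 2*(K*(1-r))} x * Re (A (polar \<rho> x)))
    \<le> (8*K+5)^2 * (1 - r) * Re (A (complex_of_real (- r)))" (is "(LINT x|circ. ?ind x * _) \<le> ?C * _")
proof -
  have Ac: "continuous_on (ball 0 1) (\<lambda>z. Re (A z))" by (intro continuous_intros holomorphic_on_imp_continuous_on A)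
  have nz: "norm (polar \<rho> x) < 1" for x using r \<rho> by (simp add: norm_mult)
  have P0: "0 \<le> poisson (polar \<rho> x) w" for x w by (intro poisson_nonneg less_imp_le[OF nz])
  have C0: "0 \<le> ?C" using r by simp
  have nn: "norm (complex_of_real (rseq n) * w) < 1" if "norm w \<le> 1" for w n
  proof -
    have "rseq n * norm w \<le> rseq n * 1" using that by (intro mult_left_mono) auto
    moreover have "norm (complex_of_real (rseq n) * w) = rseq n * norm w" by (simp add: norm_mult)
    ultimately show ?thesis using rseq_range(2)[of n] by linarith
  qed
  have step: "(LINT x|circ. ?ind x * Re (A (complex_of_real (rseq n) * (polar \<rho> x))))
     \<le> ?C * Re (A (complex_of_real (rseq n) * complex_of_real (- r)))" for n
  proof -
    define f where "f = (\<lambda>z. A (complex_of_real (rseq n) * z))"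
    have f: "f holomorphic_on ball 0 (1 / rseq n)" unfolding f_def by (rule dilate_holomorphic[OF A]) simp
    have R1: "1 < 1 / rseq n" by simp
    have f0: "0 \<le> Re (f w)" if "norm w \<le> 1" for w unfolding f_def by (rule A0[OF nn[OF that]])
    have fs: "continuous_on (sphere 0 1) (\<lambda>w. Re (f w))"
      unfolding f_def by (rule continuous_on_compose2[OF Ac]) (auto intro!: continuous_intros nn)
    have fm [measurable]: "(\<lambda>s. Re (f (cis s))) \<in> borel_measurable borel"
      using borel_measurable_integrable[OF integrable_circ_continuous[OF fs]] by simp
    have fcm: "continuous_on UNIV (\<lambda>x. Re (f (polar \<rho> x)))"
      unfolding f_def by (rule continuous_on_compose2[OF Ac]) (use nz in \<open>auto intro!: continuous_intros nn simp: less_imp_le\<close>)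
    have fm2 [measurable]: "(\<lambda>x. Re (f (polar \<rho> x))) \<in> borel_measurable borel"
      by (rule borel_measurable_continuous_onI[OF fcm])
    have pi: "integrable circ (\<lambda>s. poisson z (cis s) * Re (f (cis s)))" if "norm z < 1" for z
      by (intro integrable_circ_continuous[of "\<lambda>w. poisson z w * Re (f w)"] continuous_on_mult continuous_on_poisson that fs)
    have pos: "0 \<le> poisson z (cis s) * Re (f (cis s))" if "norm z < 1" for z s
      using that by (intro mult_nonneg_nonneg poisson_nonneg f0) auto
    have nnP: "ennreal (Re (f z)) = (\<integral>\<^sup>+ s. ennreal (poisson z (cis s) * Re (f (cis s))) \<partial>circ)" if z: "norm z < 1" for z
      using poisson_formula_Re[OF f R1 z] nn_integral_eq_integral[OF pi[OF z]] pos[OF z] by simp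
    have "(\<integral>\<^sup>+ x. ennreal (?ind x * Re (f (polar \<rho> x))) \<partial>circ)
       = (\<integral>\<^sup>+ x. (\<integral>\<^sup>+ s. ennreal (?ind x) * ennreal (poisson (polar \<rho> x) (cis s) * Re (f (cis s))) \<partial>circ) \<partial>circ)"
    proof (rule nn_integral_cong)
      fix x
      have "0 \<le> Re (f (polar \<rho> x))" using nz by (intro f0 less_imp_le)
      then have "ennreal (?ind x * Re (f (polar \<rho> x))) = ennreal (?ind x) * ennreal (Re (f (polar \<rho> x)))"
        by (intro ennreal_mult) auto
      also have "\<dots> = (\<integral>\<^sup>+ s. ennreal (?ind x) * ennreal (poisson (polar \<rho> x) (cis s) * Re (f (cis s))) \<partial>circ)"
        unfolding nnP[OF nz] by (rule nn_integral_cmult[symmetric]) measurable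
      finally show "ennreal (?ind x * Re (f (polar \<rho> x))) = \<dots>" .
    qed
    also have "\<dots> = (\<integral>\<^sup>+ s. (\<integral>\<^sup>+ x. ennreal (?ind x) * ennreal (poisson (polar \<rho> x) (cis s) * Re (f (cis s))) \<partial>circ) \<partial>circ)"
      by (rule cc.Fubini') measurable
    also have "\<dots> \<le> (\<integral>\<^sup>+ s. ennreal (?C * (poisson (complex_of_real (- r)) (cis s) * Re (f (cis s)))) \<partial>circ)"
    proof (rule nn_integral_mono)
      fix s
      have f1: "0 \<le> Re (f (cis s))" by (rule f0) simp
      have "(\<integral>\<^sup>+ x. ennreal (?ind x) * ennreal (poisson (polar \<rho> x) (cis s) * Re (f (cis s))) \<partial>circ)
         = (\<integral>\<^sup>+ x. ennreal (?ind x * poisson (polar \<rho> x) (cis s)) * ennreal (Re (f (cis s))) \<partial>circ)"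
        using f1 P0 by (intro nn_integral_cong) (simp add: ennreal_mult[symmetric] mult.assoc)
      also have "\<dots> = (\<integral>\<^sup>+ x. ennreal (?ind x * poisson (polar \<rho> x) (cis s)) \<partial>circ) * ennreal (Re (f (cis s)))"
        by (rule nn_integral_multc) measurable
      also have "\<dots> \<le> ennreal (?C * poisson (complex_of_real (- r)) (cis s)) * ennreal (Re (f (cis s)))"
        by (intro mult_right_mono arc_poisson_bound r K \<rho> K1) auto
      also have "\<dots> = ennreal (?C * (poisson (complex_of_real (- r)) (cis s) * Re (f (cis s))))"
        using f1 C0 r by (subst ennreal_mult[symmetric]) (auto intro!: mult_nonneg_nonneg poisson_nonneg simp: mult_ac)
      finally show "(\<integral>\<^sup>+ x. ennreal (?ind x) * ennreal (poisson (polar \<rho> x) (cis s) * Re (f (cis s))) \<partial>circ)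
        \<le> ennreal (?C * (poisson (complex_of_real (- r)) (cis s) * Re (f (cis s))))" .
    qed
    also have "\<dots> = ennreal ?C * (\<integral>\<^sup>+ s. ennreal (poisson (complex_of_real (- r)) (cis s) * Re (f (cis s))) \<partial>circ)"
      using C0 r by (subst nn_integral_cmult[symmetric]) (auto intro!: nn_integral_cong ennreal_mult pos)
    also have "\<dots> = ennreal ?C * ennreal (Re (f (complex_of_real (- r))))"
      using r by (subst nnP) auto
    also have "\<dots> = ennreal (?C * Re (f (complex_of_real (- r))))"
      using C0 f0[of "complex_of_real (- r)"] r by (subst ennreal_mult) auto
    finally have main: "(\<integral>\<^sup>+ x. ennreal (?ind x * Re (f (polar \<rho> x))) \<partial>circ) \<le> ennreal (?C * Re (f (complex_of_real (- r))))" .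
    have fr: "0 \<le> ?C * Re (f (complex_of_real (- r)))" using C0 r by (intro mult_nonneg_nonneg f0) auto
    have p2: "0 \<le> ?ind x * Re (f (polar \<rho> x))" for x
      by (rule mult_nonneg_nonneg, simp, rule f0, rule less_imp_le[OF nz])
    have "(LINT x|circ. ?ind x * Re (f (polar \<rho> x))) = enn2real (\<integral>\<^sup>+ x. ennreal (?ind x * Re (f (polar \<rho> x))) \<partial>circ)"
      by (rule integral_eq_nn_integral) (use p2 in auto)
    also have "\<dots> \<le> enn2real (ennreal (?C * Re (f (complex_of_real (- r)))))"
      by (rule enn2real_mono[OF main]) simp
    also have "\<dots> = ?C * Re (f (complex_of_real (- r)))" using fr by simp
    finally show ?thesis unfolding f_def .
  qed
  have Acont: "isCont A z" if "norm z < 1" for z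
    using A that by (intro continuous_on_interior[OF holomorphic_on_imp_continuous_on]) auto
  have lim: "(\<lambda>n. Re (A (complex_of_real (rseq n) * z))) \<longlonglongrightarrow> Re (A z)" if z: "norm z < 1" for z
  proof -
    have "(\<lambda>n. complex_of_real (rseq n) * z) \<longlonglongrightarrow> complex_of_real 1 * z" by (intro tendsto_intros rseq_lim)
    then show ?thesis using Acont[OF z] by (intro tendsto_Re isCont_tendsto_compose[where g=A]) auto
  qed
  have "compact (cball 0 \<rho> :: complex set)" by simp
  moreover have "continuous_on (cball 0 \<rho>) A"
    by (rule continuous_on_subset[OF holomorphic_on_imp_continuous_on[OF A]]) (use \<rho> in auto)
  ultimately have "bounded (A ` cball 0 \<rho>)" using compact_continuous_image compact_imp_bounded by blast
  then obtain B where "\<forall>x\<in>A ` cball 0 \<rho>. norm x \<le> B" unfolding bounded_iff by blast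
  then have B: "norm (A z) \<le> B" if "norm z \<le> \<rho>" for z using that by simp
  have L: "(\<lambda>n. LINT x|circ. ?ind x * Re (A (complex_of_real (rseq n) * (polar \<rho> x))))
     \<longlonglongrightarrow> (LINT x|circ. ?ind x * Re (A (polar \<rho> x)))"
  proof (rule integral_dominated_convergence[where w="\<lambda>_. B"])
    show "AE x in circ. (\<lambda>n. ?ind x * Re (A (complex_of_real (rseq n) * (polar \<rho> x)))) \<longlonglongrightarrow> ?ind x * Re (A (polar \<rho> x))"
      by (intro AE_I2 tendsto_mult_left lim nz)
    show "AE x in circ. norm (?ind x * Re (A (complex_of_real (rseq n) * (polar \<rho> x)))) \<le> B" for n
    proof (rule AE_I2)
      fix x
      have "norm (complex_of_real (rseq n) * (polar \<rho> x)) \<le> \<rho>"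
        using r \<rho> mult_right_mono[OF less_imp_le[OF rseq_range(2)[of n]], of \<rho>] by (simp add: norm_mult)
      from B[OF this] have "\<bar>Re (A (complex_of_real (rseq n) * (polar \<rho> x)))\<bar> \<le> B"
        using abs_Re_le_cmod order_trans by blast
      then show "norm (?ind x * Re (A (complex_of_real (rseq n) * (polar \<rho> x)))) \<le> B"
        by (auto simp: indicator_def)
    qed
    have m: "(\<lambda>x. Re (A (c * (polar \<rho> x)))) \<in> borel_measurable borel" if "norm c \<le> 1" for c
    proof (rule borel_measurable_continuous_onI, rule continuous_on_compose2[OF Ac])
      have "norm (c * (polar \<rho> x)) < 1" for x
      proof -
        have "norm c * \<rho> \<le> 1 * \<rho>" using that r \<rho> by (intro mult_right_mono) auto
        then show ?thesis using r \<rho> by (simp add: norm_mult)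
      qed
      then show "(\<lambda>x. c * (polar \<rho> x)) ` UNIV \<subseteq> ball 0 1" by auto
    qed (intro continuous_intros)
    show "(\<lambda>x. ?ind x * Re (A (polar \<rho> x))) \<in> borel_measurable circ"
      using m[of 1] by simp
    show "(\<lambda>x. ?ind x * Re (A (complex_of_real (rseq n) * (polar \<rho> x)))) \<in> borel_measurable circ" for n
      using m[of "complex_of_real (rseq n)"] rseq_range[of n] by (simp add: less_imp_le)
  qed simp
  have Rr: "(\<lambda>n. ?C * Re (A (complex_of_real (rseq n) * complex_of_real (- r)))) \<longlonglongrightarrow> ?C * Re (A (complex_of_real (- r)))"
    using r by (intro tendsto_mult_left lim) auto
  show ?thesis by (rule LIMSEQ_le[OF L Rr]) (use step in auto)
qed

text \<open>
  Above the arc \<open>|x - pi| \<le> 2 * K * (1 - r)\<close>, between the radii \<open>r\<close> and 1, the oscillation of \<open>p\<close>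
  along each circle is controlled by \<open>arc_mean_bound\<close>. To pass from one radius to another, the
  integral of \<open>p\<close> over the arc is written with a primitive in the variable \<open>ln z\<close>: its derivative
  in the logarithm of the radius is the difference of the values of \<open>p\<close> at the two ends of the
  arc, which is an oscillation along a circle again.
\<close>

lemma tent_oscillation:
  assumes p: "p holomorphic_on ball 0 1" and A: "A holomorphic_on ball 0 1"
    and le: "\<And>z. norm z < 1 \<Longrightarrow> norm (deriv p z) \<le> Re (A z)"
    and r: "1/2 \<le> r" "r < 1" and K: "K \<ge> 1" and K1: "K * (1 - r) \<le> 1"
    and R1: "r \<le> R1" "R1 < 1" and R2: "r \<le> R2" "R2 < 1"
    and x1: "\<bar>x1 - pi\<bar> \<le> 2 * (K * (1 - r))" and x2: "\<bar>x2 - pi\<bar> \<le> 2 * (K * (1 - r))"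
  shows "norm (p (polar R1 x1) - p (polar R2 x2))
     \<le> 24 * ((8*K+5)^2 * (1 - r) * Re (A (complex_of_real (- r))))"
proof -
  have A0: "0 \<le> Re (A z)" if "norm z < 1" for z using order_trans[OF norm_ge_zero le[OF that]] .
  have Ac: "continuous_on (ball 0 1) (\<lambda>z. Re (A z))" by (intro continuous_intros holomorphic_on_imp_continuous_on A)
  define \<delta> where "\<delta> = K * (1 - r)"
  have d0: "0 < \<delta>" "1 - r \<le> \<delta>" "\<delta> \<le> 1" using r K K1 mult_right_mono[of 1 K "1 - r"] by (auto simp: \<delta>_def)
  define a where "a = pi - 2*\<delta>"
  define b where "b = pi + 2*\<delta>"
  have ab: "0 \<le> a" "a < b" "b \<le> 2*pi" "b - a = 4*\<delta>"
    using d0 pi_ge_two by (auto simp: a_def b_def)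
  define X where "X = (8*K+5)^2 * (1 - r) * Re (A (complex_of_real (- r)))"
  define Q where "Q = 2*pi * X"
  have n\<rho>: "norm (polar \<rho> x) < 1" if "r \<le> \<rho>" "\<rho> < 1" for \<rho> x using that r by (simp add: norm_mult)
  have iU: "integrable circ (\<lambda>s. Re (A (polar \<rho> s)))" if "r \<le> \<rho>" "\<rho> < 1" for \<rho>
  proof (rule integrable_circ_continuous[of "\<lambda>w. Re (A (complex_of_real \<rho> * w))"])
    show "continuous_on (sphere 0 1) (\<lambda>w. Re (A (complex_of_real \<rho> * w)))"
      by (rule continuous_on_compose2[OF Ac]) (use that r in \<open>auto intro!: continuous_intros simp: norm_mult\<close>)
  qed
  have iI: "integrable circ (\<lambda>s. indicator {u..v} s * Re (A (polar \<rho> s)))" if "r \<le> \<rho>" "\<rho> < 1" for \<rho> u v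
    by (rule Bochner_Integration.integrable_bound[OF iU[OF that]])
       (use borel_measurable_integrable[OF iU[OF that]] in \<open>auto simp: indicator_def\<close>)
  have osc1: "norm (p (polar \<rho> y) - p (polar \<rho> x)) \<le> Q"
    if r\<rho>: "r \<le> \<rho>" "\<rho> < 1" and xy: "a \<le> x" "x \<le> y" "y \<le> b" for \<rho> x y
  proof -
    have "norm (p (polar \<rho> y) - p (polar \<rho> x))
        \<le> 2*pi * (LINT s|circ. indicator {x..y} s * Re (A (polar \<rho> s)))"
      by (rule arc_bound[OF p Ac le]) (use r\<rho> r xy ab in auto)
    also have "\<dots> \<le> 2*pi * (LINT s|circ. indicator {a..b} s * Re (A (polar \<rho> s)))"
      using xy A0[OF n\<rho>[OF r\<rho>]] by (intro mult_left_mono integral_mono iI r\<rho>) (auto simp: indicator_def)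
    also have "\<dots> \<le> Q"
      unfolding Q_def X_def a_def b_def \<delta>_def
      by (intro mult_left_mono arc_mean_bound A A0 K K1 r\<rho>) (use r in auto)
    finally show ?thesis .
  qed
  have osc: "norm (p (polar \<rho> y) - p (polar \<rho> x)) \<le> Q"
    if r\<rho>: "r \<le> \<rho>" "\<rho> < 1" and xy: "x \<in> {a..b}" "y \<in> {a..b}" for \<rho> x y
    using osc1[OF r\<rho>, of x y] osc1[OF r\<rho>, of y x] xy by (cases "x \<le> y") (auto simp: norm_minus_commute)
  have Q0: "0 \<le> Q" using osc[of r a a] r ab order_trans[OF norm_ge_zero] by auto
  (* In the variable w = ln z circles become vertical lines, and \<Phi> integrates p along them. *)
  define S where "S = {w::complex. Re w < 0}"
  define \<gamma> where "\<gamma> = (\<lambda>w. p (exp w))"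
  have S: "convex S" "open S" by (auto simp: S_def convex_halfspace_Re_lt open_halfspace_Re_lt)
  have "exp ` S \<subseteq> ball 0 1" by (auto simp: S_def norm_exp_eq_Re)
  then have "\<gamma> holomorphic_on S" unfolding \<gamma>_def
    using holomorphic_on_compose_gen[of exp S p "ball 0 1"] p by (auto simp: o_def intro!: holomorphic_intros)
  then obtain \<Phi> where "\<And>w. w \<in> S \<Longrightarrow> (\<Phi> has_field_derivative \<gamma> w) (at w within S)"
    using holomorphic_convex_primitive'[OF S] by blast
  then have \<Phi>: "(\<Phi> has_field_derivative \<gamma> w) (at w)" if "w \<in> S" for w
    using that S at_within_open by metis
  have gam: "\<gamma> (Complex (ln \<rho>) x) = p (polar \<rho> x)" if "0 < \<rho>" for \<rho> x
  proof -
    have "exp (Complex (ln \<rho>) x) = polar \<rho> x"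
      using that by (simp only: exp_eq_polar complex.sel exp_ln)
    then show ?thesis by (simp add: \<gamma>_def)
  qed
  define d where "d = (\<lambda>s. \<Phi> (Complex s b) - \<Phi> (Complex s a))"
  have inS: "Complex s y \<in> S" if "s < 0" for s y using that by (simp add: S_def)
  have avg: "norm (d (ln \<rho>) - \<i> * complex_of_real (b - a) * p (polar \<rho> x)) \<le> Q * (b - a)"
    if r\<rho>: "r \<le> \<rho>" "\<rho> < 1" and x: "x \<in> {a..b}" for \<rho> x
  proof -
    have \<rho>0: "0 < \<rho>" using r\<rho> r by simp
    then have ls: "ln \<rho> < 0" using r\<rho> by simp
    let ?seg = "closed_segment (Complex (ln \<rho>) a) (Complex (ln \<rho>) b)"
    let ?c = "p (polar \<rho> x)"
    have seg: "\<exists>y\<in>{a..b}. w = Complex (ln \<rho>) y" if ws: "w \<in> ?seg" for w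
    proof -
      have "\<exists>u. 0 \<le> u \<and> u \<le> 1 \<and> w = (1 - u) *\<^sub>R Complex (ln \<rho>) a + u *\<^sub>R Complex (ln \<rho>) b"
        using ws by (simp only: in_segment)
      then obtain u where u: "0 \<le> u" "u \<le> 1" "w = (1 - u) *\<^sub>R Complex (ln \<rho>) a + u *\<^sub>R Complex (ln \<rho>) b"
        by blast
      have "w = Complex (ln \<rho>) ((1 - u) * a + u * b)"
        unfolding u(3) by (rule complex_eqI) (simp_all add: algebra_simps)
      moreover have "(1 - u) * a + u * b \<in> {a..b}"
      proof -
        have "0 \<le> u * (b - a)" "u * (b - a) \<le> 1 * (b - a)" using u ab by (auto intro!: mult_right_mono mult_nonneg_nonneg)
        then show ?thesis by (simp add: algebra_simps)
      qed
      ultimately show ?thesis by blast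
    qed
    have "norm ((\<Phi> (Complex (ln \<rho>) b) - Complex (ln \<rho>) b * ?c) - (\<Phi> (Complex (ln \<rho>) a) - Complex (ln \<rho>) a * ?c))
       \<le> Q * norm (Complex (ln \<rho>) b - Complex (ln \<rho>) a)"
    proof (rule field_differentiable_bound[of ?seg "\<lambda>w. \<Phi> w - w * ?c" "\<lambda>w. \<gamma> w - ?c"])
      fix w assume w: "w \<in> ?seg"
      then obtain y where y: "y \<in> {a..b}" "w = Complex (ln \<rho>) y" using seg by blast
      have "(\<Phi> has_field_derivative \<gamma> w) (at w)" using y inS[OF ls] by (intro \<Phi>) auto
      then have "((\<lambda>w. \<Phi> w - w * ?c) has_field_derivative (\<gamma> w - 1 * ?c)) (at w)"
        by (rule DERIV_diff[OF _ DERIV_cmult_right[OF DERIV_ident]])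
      then show "((\<lambda>w. \<Phi> w - w * ?c) has_field_derivative (\<gamma> w - ?c)) (at w within ?seg)"
        by (simp add: has_field_derivative_at_within)
      show "norm (\<gamma> w - ?c) \<le> Q" unfolding y(2) gam[OF \<rho>0] by (rule osc[OF r\<rho> x y(1)])
    qed auto
    also have "Complex (ln \<rho>) b - Complex (ln \<rho>) a = \<i> * complex_of_real (b - a)" by (simp add: complex_eq_iff)
    also have "norm (\<i> * complex_of_real (b - a)) = b - a" using ab by (simp add: norm_mult del: of_real_diff)
    also have "(\<Phi> (Complex (ln \<rho>) b) - Complex (ln \<rho>) b * ?c) - (\<Phi> (Complex (ln \<rho>) a) - Complex (ln \<rho>) a * ?c)
       = d (ln \<rho>) - (Complex (ln \<rho>) b - Complex (ln \<rho>) a) * ?c"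
      by (simp add: d_def algebra_simps)
    also have "Complex (ln \<rho>) b - Complex (ln \<rho>) a = \<i> * complex_of_real (b - a)" by (simp add: complex_eq_iff)
    finally show ?thesis .
  qed
  have dd: "norm (d (ln R1) - d (ln R2)) \<le> Q * (2 * (1 - r))"
  proof -
    have pos: "0 < R1" "0 < R2" "0 < r" using R1 R2 r by auto
    have lr: "- ln r \<le> 2 * (1 - r)"
    proof -
      have "ln (1/r) \<le> 1/r - 1" using pos by (intro ln_le_minus_one) auto
      also have "1/r - 1 = (1 - r) / r" using pos by (simp add: field_simps)
      also have "\<dots> \<le> (1 - r) / (1/2)" using r by (intro divide_left_mono) auto
      finally show ?thesis using pos by (simp add: ln_div)
    qed
    have l: "ln r \<le> ln R1" "ln R1 < 0" "ln r \<le> ln R2" "ln R2 < 0" using R1 R2 pos by auto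
    let ?seg = "closed_segment (complex_of_real (ln R2)) (complex_of_real (ln R1))"
    let ?D = "\<lambda>w. \<Phi> (w + \<i> * complex_of_real b) - \<Phi> (w + \<i> * complex_of_real a)"
    have cm: "complex_of_real s + \<i> * complex_of_real y = Complex s y" for s y by (simp add: complex_eq_iff)
    have "norm (?D (complex_of_real (ln R1)) - ?D (complex_of_real (ln R2))) \<le> Q * norm (complex_of_real (ln R1) - complex_of_real (ln R2))"
    proof (rule field_differentiable_bound[of ?seg ?D "\<lambda>w. \<gamma> (w + \<i> * complex_of_real b) - \<gamma> (w + \<i> * complex_of_real a)"])
      fix w assume w: "w \<in> ?seg"
      then obtain s where s: "w = complex_of_real s" "s \<in> closed_segment (ln R2) (ln R1)"
        by (auto simp: closed_segment_of_real)
      have s0: "ln r \<le> s" "s < 0" using s l by (auto simp: closed_segment_eq_real_ivl split: if_splits)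
      have "exp (ln r) \<le> exp s" by (subst exp_le_cancel_iff) (rule s0(1))
      then have e: "r \<le> exp s" "exp s < 1" "0 < exp s" using s0 pos by auto
      have "(\<Phi> has_field_derivative \<gamma> (w + \<i> * complex_of_real y)) (at (w + \<i> * complex_of_real y))" for y
        unfolding s cm using inS s0 by (intro \<Phi>) auto
      then have "((\<lambda>w. \<Phi> (w + \<i> * complex_of_real y)) has_field_derivative \<gamma> (w + \<i> * complex_of_real y)) (at w)" for y
        by (simp add: DERIV_shift)
      then have "(?D has_field_derivative (\<gamma> (w + \<i> * complex_of_real b) - \<gamma> (w + \<i> * complex_of_real a))) (at w)"
        by (intro DERIV_diff)
      then show "(?D has_field_derivative (\<gamma> (w + \<i> * complex_of_real b) - \<gamma> (w + \<i> * complex_of_real a))) (at w within ?seg)"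
        by (rule has_field_derivative_at_within)
      have "\<gamma> (Complex s y) = p (polar (exp s) y)" for y using gam[OF e(3), of y] by simp
      then show "norm (\<gamma> (w + \<i> * complex_of_real b) - \<gamma> (w + \<i> * complex_of_real a)) \<le> Q"
        unfolding s cm using osc[OF e(1,2), of a b] ab by auto
    qed auto
    then have "norm (d (ln R1) - d (ln R2)) \<le> Q * norm (complex_of_real (ln R1) - complex_of_real (ln R2))"
      unfolding d_def cm .
    also have "\<dots> \<le> Q * (2 * (1 - r))"
    proof (rule mult_left_mono[OF _ Q0])
      have "norm (complex_of_real (ln R1) - complex_of_real (ln R2)) = \<bar>ln R1 - ln R2\<bar>"
        by (metis norm_of_real of_real_diff)
      also have "\<dots> \<le> - ln r" using l by auto
      finally show "norm (complex_of_real (ln R1) - complex_of_real (ln R2)) \<le> 2 * (1 - r)" using lr by linarith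
    qed
    finally show ?thesis .
  qed
  have xi: "x1 \<in> {a..b}" "x2 \<in> {a..b}" using x1 x2 by (auto simp: a_def b_def \<delta>_def abs_le_iff)
  let ?p1 = "p (polar R1 x1)" let ?p2 = "p (polar R2 x2)"
  let ?w = "\<i> * complex_of_real (b - a)"
  have "norm (?w * (?p1 - ?p2)) \<le> norm (d (ln R1) - d (ln R2)) + norm (d (ln R1) - ?w * ?p1) + norm (d (ln R2) - ?w * ?p2)"
  proof -
    have e: "?w * (?p1 - ?p2) = (d (ln R1) - d (ln R2)) - (d (ln R1) - ?w * ?p1) + (d (ln R2) - ?w * ?p2)"
      by (simp only: right_diff_distrib) simp
    show ?thesis unfolding e
      using norm_triangle_ineq[of "(d (ln R1) - d (ln R2)) - (d (ln R1) - ?w * ?p1)" "d (ln R2) - ?w * ?p2"]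
        norm_triangle_ineq4[of "d (ln R1) - d (ln R2)" "d (ln R1) - ?w * ?p1"] by linarith
  qed
  also have "\<dots> \<le> Q * (2 * (1 - r)) + Q * (b - a) + Q * (b - a)"
    by (intro add_mono dd avg R1 R2 xi)
  also have "\<dots> \<le> 3 * Q * (b - a)"
  proof -
    have "2 * (1 - r) \<le> 2 * \<delta>" by (rule mult_left_mono[OF d0(2)]) simp
    then have "2 * (1 - r) \<le> b - a" using d0 ab by linarith
    then have "Q * (2 * (1 - r)) \<le> Q * (b - a)" by (rule mult_left_mono[OF _ Q0])
    then show ?thesis by linarith
  qed
  also have "norm (?w * (?p1 - ?p2)) = (b - a) * norm (?p1 - ?p2)"
  proof -
    have "norm ?w = b - a" using ab by (simp add: norm_mult del: of_real_diff)
    then show ?thesis by (simp only: norm_mult)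
  qed
  finally have "norm (?p1 - ?p2) * (b - a) \<le> 3 * Q * (b - a)" by (simp add: mult.commute)
  then have "norm (?p1 - ?p2) \<le> 3 * Q" using ab by (simp add: mult_le_cancel_right)
  also have "\<dots> \<le> 24 * X"
  proof -
    have "0 \<le> X" unfolding X_def using r by (intro mult_nonneg_nonneg A0) auto
    then have "(6*pi) * X \<le> 24 * X" using pi_less_4 by (intro mult_right_mono) auto
    then show ?thesis by (simp add: Q_def)
  qed
  finally show ?thesis by (simp add: X_def)
qed

text \<open>
  After a rotation, \<open>R * \<zeta>\<close> and a point arbitrarily near \<open>\<xi>\<close> at which \<open>g\<close> is arbitrarily small
  both lie in the region of \<open>tent_oscillation\<close>. The gain over the boundedness of \<open>g\<close> is the factor
  \<open>1 - r\<close>.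
\<close>

lemma boundary_zero_decay:
  assumes g: "g holomorphic_on ball 0 1" and A: "A holomorphic_on ball 0 1"
    and le: "\<And>z. norm z < 1 \<Longrightarrow> norm (deriv g z) \<le> Re (A z)"
    and r: "1/2 \<le> r" "r < 1" and K: "K \<ge> 1" and K1: "K * (1 - r) \<le> 1"
    and z: "norm \<zeta> = 1" "norm \<xi> = 1" "norm (\<zeta> - \<xi>) < K * (1 - r)"
    and zero: "\<And>e. e > 0 \<Longrightarrow> \<exists>z. norm z < 1 \<and> norm (z - \<xi>) < e \<and> norm (g z) < e"
    and R: "r \<le> R" "R < 1"
  shows "norm (g (complex_of_real R * \<zeta>)) \<le> 24 * ((8*K+5)^2 * (1 - r) * Re (A (complex_of_real r * \<zeta>)))"
proof (rule field_le_epsilon)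
  fix e :: real assume e: "e > 0"
  define \<delta> where "\<delta> = K * (1 - r)"
  (* The last term keeps the chosen point inside the tent of \<zeta>, although \<xi> lies in the open arc only. *)
  define e' where "e' = min e (min (1 - r) ((\<delta> - norm (\<zeta> - \<xi>))/3))"
  have e': "0 < e'" "e' \<le> e" "e' \<le> 1 - r" "2 * e' + norm (\<zeta> - \<xi>) < \<delta>"
    using e r z by (auto simp: e'_def \<delta>_def min_def field_simps)
  obtain z0 where z0: "norm z0 < 1" "norm (z0 - \<xi>) < e'" "norm (g z0) < e'" using zero[OF e'(1)] by blast
  have zz: "\<zeta> * cnj \<zeta> = 1" using z by (simp add: complex_norm_square[symmetric])
  define p where "p = (\<lambda>w. g (- \<zeta> * w))"
  define A' where "A' = (\<lambda>w. A (- \<zeta> * w))"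
  have nm: "norm (- \<zeta> * w) = norm w" for w using z by (simp add: norm_mult)
  have im: "(\<lambda>w. - \<zeta> * w) ` ball 0 1 \<subseteq> ball 0 1" using nm by auto
  have hol: "p holomorphic_on ball 0 1" "A' holomorphic_on ball 0 1"
    unfolding p_def A'_def
    using holomorphic_on_compose_gen[of "\<lambda>w. - \<zeta> * w" "ball 0 1" g "ball 0 1"]
      holomorphic_on_compose_gen[of "\<lambda>w. - \<zeta> * w" "ball 0 1" A "ball 0 1"] im g A
    by (auto simp: o_def intro!: holomorphic_intros)
  have dp: "norm (deriv p w) \<le> Re (A' w)" if w: "norm w < 1" for w
  proof -
    have "(g has_field_derivative deriv g (- \<zeta> * w)) (at (- \<zeta> * w))"
      using holomorphic_derivI[OF g open_ball] w nm[of w] by simp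
    moreover have "((\<lambda>w. - \<zeta> * w) has_field_derivative - \<zeta>) (at w)" by (auto intro!: derivative_eq_intros)
    ultimately have "(p has_field_derivative deriv g (- \<zeta> * w) * (- \<zeta>)) (at w)"
      unfolding p_def by (rule DERIV_chain2)
    then have "deriv p w = deriv g (- \<zeta> * w) * (- \<zeta>)" by (rule DERIV_imp_deriv)
    then have "norm (deriv p w) = norm (deriv g (- \<zeta> * w))" using z by (simp add: norm_mult)
    also have "\<dots> \<le> Re (A (- \<zeta> * w))" using w nm[of w] by (intro le) simp
    finally show ?thesis by (simp add: A'_def)
  qed
  define w where "w = - cnj \<zeta> * z0"
  have "- \<zeta> * w = (\<zeta> * cnj \<zeta>) * z0" by (simp add: w_def)
  then have gw: "- \<zeta> * w = z0" unfolding zz by simp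
  have nw: "norm w = norm z0" using gw nm[of w] by simp
  define \<rho> where "\<rho> = norm w"
  have \<rho>1: "\<rho> < 1" using z0 nw by (simp add: \<rho>_def)
  have \<rho>e: "1 - e' \<le> \<rho>"
  proof -
    have "norm \<xi> \<le> norm z0 + norm (z0 - \<xi>)" by (metis norm_minus_commute norm_triangle_sub)
    then show ?thesis using z0 z nw by (simp add: \<rho>_def)
  qed
  then have \<rho>r: "r \<le> \<rho>" using e' by simp
  define x where "x = Arg2pi w"
  have wx: "w = polar \<rho> x"
    using Arg2pi_eq[of w] by (simp add: x_def \<rho>_def cis_conv_exp)
  have xr: "\<bar>x - pi\<bar> \<le> pi" using Arg2pi_ge_0[of w] Arg2pi_lt_2pi[of w] by (auto simp: x_def abs_le_iff)
  have c1: "norm (cis (x - pi) - 1) < \<delta>"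
  proof -
    have "cis (x - pi) = - cis x" by (simp add: cis_divide[symmetric])
    then have "norm (cis (x - pi) - 1) = norm (cis x + 1)" by (metis minus_add_distrib norm_minus_cancel uminus_add_conv_diff add.commute)
    also have "\<dots> \<le> norm (cis x - w) + norm (w + 1)"
      using norm_triangle_ineq[of "cis x - w" "w + 1"] by simp
    also have "norm (cis x - w) = 1 - \<rho>"
    proof -
      have "cis x - w = polar (1 - \<rho>) x" by (simp add: wx algebra_simps)
      then show ?thesis using \<rho>1 by (simp add: norm_mult del: of_real_diff)
    qed
    also have "norm (w + 1) = norm (\<zeta> - z0)"
    proof -
      have "- \<zeta> * (w + 1) = z0 - \<zeta>" using gw by (simp add: algebra_simps)
      then show ?thesis using nm[of "w + 1"] by (simp add: norm_minus_commute)
    qed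
    also have "norm (\<zeta> - z0) \<le> norm (\<zeta> - \<xi>) + norm (z0 - \<xi>)"
      using norm_triangle_ineq4[of "\<zeta> - \<xi>" "z0 - \<xi>"] by simp
    finally show ?thesis using e' \<rho>e z0 by linarith
  qed
  have x2: "\<bar>x - pi\<bar> \<le> 2 * (K * (1 - r))"
  proof -
    have "\<bar>x - pi\<bar> \<le> 2 * norm (cis (x - pi) - 1)" using xr c1 K1 by (intro angle_le_chord) (auto simp: \<delta>_def)
    then show ?thesis using c1 by (simp add: \<delta>_def)
  qed
  have "norm (p (polar R pi) - p (polar \<rho> x))
     \<le> 24 * ((8*K+5)^2 * (1 - r) * Re (A' (complex_of_real (- r))))"
    by (rule tent_oscillation[OF hol dp r K K1 R \<rho>r \<rho>1 _ x2]) (use K r in auto)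
  moreover have "p (polar R pi) = g (complex_of_real R * \<zeta>)" by (simp add: p_def mult.commute)
  moreover have "p (polar \<rho> x) = g z0" by (simp add: p_def wx[symmetric] gw[symmetric])
  moreover have "A' (complex_of_real (- r)) = A (complex_of_real r * \<zeta>)" by (simp add: A'_def mult.commute)
  ultimately have "norm (g (complex_of_real R * \<zeta>) - g z0) \<le> 24 * ((8*K+5)^2 * (1 - r) * Re (A (complex_of_real r * \<zeta>)))" by simp
  moreover have "norm (g z0) \<le> e" using z0 e' by simp
  ultimately show "norm (g (complex_of_real R * \<zeta>)) \<le> 24 * ((8*K+5)^2 * (1 - r) * Re (A (complex_of_real r * \<zeta>))) + e"
    using norm_triangle_sub[of "g (complex_of_real R * \<zeta>)" "g z0"] by linarith
qed

section \<open>Potentials of singular measures\<close>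

lemma measurable_circ: "measurable circ N = measurable borel N"
  by (rule measurable_cong_sets) auto

text \<open>
  By Fubini and the symmetry of the Poisson kernel, testing the circle means of a Poisson integral
  against \<open>\<phi>\<close> amounts to testing the measure against the Poisson means of \<open>\<phi>\<close>.
\<close>

lemma (in circle_density) herglotz_test:
  assumes sf: "sigma_finite_measure M" and pos: "\<And>x. \<rho> x \<ge> 0" and r: "0 \<le> r" "r < 1"
    and \<phi>: "continuous_on (sphere 0 1) \<phi>" "\<And>w. 0 \<le> \<phi> w"
  shows "(\<integral>\<^sup>+ t. ennreal (\<phi> (cis t) * Re (herglotz M \<kappa> \<rho> (polar r t))) \<partial>circ)
     = (\<integral>\<^sup>+ x. ennreal (\<rho> x * (LINT t|circ. poisson (complex_of_real r * \<kappa> x) (cis t) * \<phi> (cis t))) \<partial>M)"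
proof -
  interpret pr: pair_sigma_finite M circ
    using sf circ.sigma_finite_measure_axioms by (simp add: pair_sigma_finite_def)
  have nz: "norm (complex_of_real r * w) < 1" if "norm w = 1" for w using r that by (simp add: norm_mult)
  have [measurable]: "(\<lambda>t. \<phi> (cis t)) \<in> borel_measurable borel"
    using borel_measurable_integrable[OF integrable_circ_continuous[OF \<phi>(1)]] by simp
  have "(\<integral>\<^sup>+ t. ennreal (\<phi> (cis t) * Re (herglotz M \<kappa> \<rho> (polar r t))) \<partial>circ)
     = (\<integral>\<^sup>+ t. (\<integral>\<^sup>+ x. ennreal (\<phi> (cis t) * (\<rho> x * \<bar>poisson (polar r t) (\<kappa> x)\<bar>)) \<partial>M) \<partial>circ)"
  proof (rule nn_integral_cong)
    fix t
    let ?z = "polar r t"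
    have z: "norm ?z < 1" by (rule nz) simp
    have P0: "0 \<le> poisson ?z w" for w by (intro poisson_nonneg less_imp_le[OF z])
    have "ennreal (\<phi> (cis t) * Re (herglotz M \<kappa> \<rho> ?z)) = ennreal (LINT x|M. \<phi> (cis t) * (\<rho> x * poisson ?z (\<kappa> x)))"
      unfolding Re_herglotz[OF z] by simp
    also have "\<dots> = (\<integral>\<^sup>+ x. ennreal (\<phi> (cis t) * (\<rho> x * poisson ?z (\<kappa> x))) \<partial>M)"
      by (rule nn_integral_eq_integral[symmetric])
         (use integrable_rho_poisson[OF z] \<phi> pos P0 in auto)
    finally show "ennreal (\<phi> (cis t) * Re (herglotz M \<kappa> \<rho> ?z)) = (\<integral>\<^sup>+ x. ennreal (\<phi> (cis t) * (\<rho> x * \<bar>poisson ?z (\<kappa> x)\<bar>)) \<partial>M)"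
      using P0 by simp
  qed
  also have "\<dots> = (\<integral>\<^sup>+ x. (\<integral>\<^sup>+ t. ennreal (\<phi> (cis t) * (\<rho> x * \<bar>poisson (polar r t) (\<kappa> x)\<bar>)) \<partial>circ) \<partial>M)"
    by (rule pr.Fubini') measurable
  also have "\<dots> = (\<integral>\<^sup>+ x. ennreal (\<rho> x * (LINT t|circ. poisson (complex_of_real r * \<kappa> x) (cis t) * \<phi> (cis t))) \<partial>M)"
  proof (rule nn_integral_cong_AE)
    show "AE x in M. (\<integral>\<^sup>+ t. ennreal (\<phi> (cis t) * (\<rho> x * \<bar>poisson (polar r t) (\<kappa> x)\<bar>)) \<partial>circ)
       = ennreal (\<rho> x * (LINT t|circ. poisson (complex_of_real r * \<kappa> x) (cis t) * \<phi> (cis t)))"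
      using kappa_norm
    proof eventually_elim
      case (elim x)
      let ?z = "complex_of_real r * \<kappa> x"
      have z: "norm ?z < 1" by (rule nz[OF elim])
      have P0: "0 \<le> poisson ?z w" for w by (intro poisson_nonneg less_imp_le[OF z])
      have i: "integrable circ (\<lambda>t. \<rho> x * (poisson ?z (cis t) * \<phi> (cis t)))"
        by (intro integrable_mult_right integrable_circ_continuous[of "\<lambda>w. poisson ?z w * \<phi> w"] continuous_on_mult continuous_on_poisson z \<phi>)
      have "poisson (polar r t) (\<kappa> x) = poisson ?z (cis t)" for t
        by (rule poisson_swap) (use elim in auto)
      then have "(\<integral>\<^sup>+ t. ennreal (\<phi> (cis t) * (\<rho> x * \<bar>poisson (polar r t) (\<kappa> x)\<bar>)) \<partial>circ)
         = (\<integral>\<^sup>+ t. ennreal (\<rho> x * (poisson ?z (cis t) * \<phi> (cis t))) \<partial>circ)"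
        using P0 by (intro nn_integral_cong) (simp add: mult_ac)
      also have "\<dots> = ennreal (LINT t|circ. \<rho> x * (poisson ?z (cis t) * \<phi> (cis t)))"
        by (rule nn_integral_eq_integral[OF i]) (intro AE_I2 mult_nonneg_nonneg pos P0 \<phi>)
      finally show ?case by simp
    qed
  qed
  finally show ?thesis .
qed

lemma (in circle_density) herglotz_mean:
  assumes r: "0 \<le> r" "r < 1" and pos: "\<And>x. \<rho> x \<ge> 0"
  shows "integrable circ (\<lambda>t. Re (herglotz M \<kappa> \<rho> (polar r t)))"
    "(LINT t|circ. Re (herglotz M \<kappa> \<rho> (polar r t))) = (LINT x|M. \<rho> x)"
proof -
  have hc: "continuous_on (ball 0 1) (\<lambda>z. Re (herglotz M \<kappa> \<rho> z))"
    by (intro continuous_intros holomorphic_on_imp_continuous_on herglotz_holomorphic)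
  show "integrable circ (\<lambda>t. Re (herglotz M \<kappa> \<rho> (polar r t)))"
  proof (rule integrable_circ_continuous[of "\<lambda>w. Re (herglotz M \<kappa> \<rho> (complex_of_real r * w))"])
    show "continuous_on (sphere 0 1) (\<lambda>w. Re (herglotz M \<kappa> \<rho> (complex_of_real r * w)))"
      by (rule continuous_on_compose2[OF hc]) (use r in \<open>auto intro!: continuous_intros simp: norm_mult\<close>)
  qed
  have r0: "Re (herglotz M \<kappa> \<rho> 0) = (LINT x|M. \<rho> x)"
  proof -
    have "Re (herglotz M \<kappa> \<rho> 0) = (LINT x|M. \<rho> x * poisson 0 (\<kappa> x))" by (rule Re_herglotz) simp
    also have "\<dots> = (LINT x|M. \<rho> x)"
    proof (rule integral_cong_AE)
      show "AE x in M. \<rho> x * poisson 0 (\<kappa> x) = \<rho> x"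
        using kappa_norm by eventually_elim (simp add: poisson_def)
    qed measurable
    finally show ?thesis .
  qed
  show "(LINT t|circ. Re (herglotz M \<kappa> \<rho> (polar r t))) = (LINT x|M. \<rho> x)"
  proof (cases "r = 0")
    case True then show ?thesis using r0 by simp
  next
    case False
    then have "(LINT t|circ. poisson 0 (cis t) * Re (herglotz M \<kappa> \<rho> (polar r t))) = Re (herglotz M \<kappa> \<rho> (complex_of_real r * 0))"
      by (intro poisson_formula_Re[OF dilate_holomorphic[OF herglotz_holomorphic]]) (use r in auto)
    then show ?thesis using r0 by (simp add: poisson_def)
  qed
qed

definition msupport :: "complex measure \<Rightarrow> complex set" where
  "msupport \<mu> = {\<xi>. \<forall>\<epsilon>>0. emeasure \<mu> (ball \<xi> \<epsilon>) \<noteq> 0}"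

locale singular_measure =
  fixes \<mu> :: "complex measure"
  assumes singular: "singular_circle_measure \<mu>"
begin

sublocale finite_measure \<mu> using singular by (simp add: singular_circle_measure_def)

lemma sets_mu [simp, measurable_cong]: "sets \<mu> = sets borel"
  using singular by (simp add: singular_circle_measure_def)

lemma space_mu [simp]: "space \<mu> = UNIV"
  using sets_eq_imp_space_eq[OF sets_mu] by simp

lemma AE_norm: "AE \<zeta> in \<mu>. norm \<zeta> = 1"
proof (rule AE_I')
  show "- sphere 0 1 \<in> null_sets \<mu>"
    using singular by (auto simp: null_sets_def singular_circle_measure_def)
qed auto

sublocale sd: circle_density \<mu> "\<lambda>\<zeta>. \<zeta>" "\<lambda>_. 1"
  by unfold_locales (auto simp: AE_norm)

text \<open>Minus the logarithm of the modulus of the singular inner function.\<close>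

definition potential :: "complex \<Rightarrow> real" where
  "potential z = Re (herglotz \<mu> (\<lambda>\<zeta>. \<zeta>) (\<lambda>_. 1) z)"

lemma singular_inner_eq: "singular_inner \<mu> z = exp (- herglotz \<mu> (\<lambda>\<zeta>. \<zeta>) (\<lambda>_. 1) z)"
  by (simp add: singular_inner_def herglotz_def)

lemma norm_singular_inner: "norm (singular_inner \<mu> z) = exp (- potential z)"
  by (simp add: singular_inner_eq potential_def)

lemma potential_nonneg: "norm z < 1 \<Longrightarrow> 0 \<le> potential z"
  unfolding potential_def by (rule sd.Re_herglotz_nonneg) auto

lemma potential_eq: "norm z < 1 \<Longrightarrow> potential z = (LINT \<zeta>|\<mu>. poisson z \<zeta>)"
  unfolding potential_def using sd.Re_herglotz[of z] by simp

lemma closed_support: "closed (msupport \<mu>)"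
  unfolding closed_def open_contains_ball
proof (intro ballI)
  fix x assume "x \<in> - msupport \<mu>"
  then obtain \<epsilon> where e: "\<epsilon> > 0" "emeasure \<mu> (ball x \<epsilon>) = 0" by (auto simp: msupport_def)
  show "\<exists>e>0. ball x e \<subseteq> - msupport \<mu>"
  proof (intro exI[of _ \<epsilon>] conjI e subsetI)
    fix y assume y: "y \<in> ball x \<epsilon>"
    obtain d where d: "d > 0" "ball y d \<subseteq> ball x \<epsilon>" by (rule openE[OF open_ball y])
    have "emeasure \<mu> (ball y d) \<le> emeasure \<mu> (ball x \<epsilon>)" using d by (intro emeasure_mono) auto
    then have "emeasure \<mu> (ball y d) = 0" using e by simp
    then show "y \<in> - msupport \<mu>" using d by (auto simp: msupport_def)
  qed
qed

lemma AE_support: "AE \<zeta> in \<mu>. \<zeta> \<in> msupport \<mu>"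
proof -
  define F where "F = {ball x e |x e. emeasure \<mu> (ball x e) = 0}"
  obtain F' where F': "F' \<subseteq> F" "countable F'" "\<Union>F' = \<Union>F"
    by (rule Lindelof[of F]) (auto simp: F_def)
  have "- msupport \<mu> \<subseteq> \<Union>F"
  proof
    fix x assume "x \<in> - msupport \<mu>"
    then obtain e where "e > 0" "emeasure \<mu> (ball x e) = 0" by (auto simp: msupport_def)
    then have "x \<in> ball x e" "ball x e \<in> F" by (auto simp: F_def)
    then show "x \<in> \<Union>F" by blast
  qed
  moreover have "\<Union>F' \<in> null_sets \<mu>"
    using F' by (intro null_sets_UN'[of F' "\<lambda>x. x", simplified]) (auto simp: F_def null_sets_def)
  ultimately show ?thesis by (intro AE_I'[of "\<Union>F'"]) (auto simp: F')
qed

text \<open>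
  As the radius tends to 1, \<open>herglotz_test\<close> turns a pointwise inequality between Poisson integrals
  near \<open>\<xi>\<close> into the inequality between the measures, tested against functions that live near \<open>\<xi>\<close>.
\<close>

lemma test_inequality:
  assumes \<psi>: "integrable circ \<psi>" "\<And>t. 0 \<le> \<psi> t" and C: "0 \<le> C" and e: "\<epsilon> > 0"
    and le: "\<And>z. norm z < 1 \<Longrightarrow> norm (z - \<xi>) < \<epsilon> \<Longrightarrow> potential z \<le> Re (herglotz circ cis \<psi> z) + C"
    and \<phi>: "continuous_on UNIV \<phi>" "\<And>w. 0 \<le> \<phi> w" "\<And>w. \<phi> w \<noteq> 0 \<Longrightarrow> w \<in> ball \<xi> (\<epsilon>/2)"
  shows "(\<integral>\<^sup>+ \<zeta>. ennreal (\<phi> \<zeta>) \<partial>\<mu>) \<le> (\<integral>\<^sup>+ t. ennreal (\<phi> (cis t) * (\<psi> t + C)) \<partial>circ)"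
proof (rule ennreal_le_epsilon)
  fix d :: real assume d: "d > 0"
  interpret cd: circle_density circ cis \<psi> by (rule circle_density_circ[OF \<psi>(1)])
  have [measurable]: "\<psi> \<in> borel_measurable borel" using borel_measurable_integrable[OF \<psi>(1)] by simp
  have [measurable]: "\<phi> \<in> borel_measurable borel" by (rule borel_measurable_continuous_onI[OF \<phi>(1)])
  have \<phi>s: "continuous_on (sphere 0 1) \<phi>" by (rule continuous_on_subset[OF \<phi>(1)]) simp
  define m where "m = measure \<mu> UNIV + (LINT t|circ. \<psi> t) + 1"
  have m: "m > 0"
    using Bochner_Integration.integral_nonneg[of circ \<psi>] \<psi> by (simp add: m_def add_nonneg_pos)
  define e' where "e' = d / m"
  have e': "e' > 0" using d m by (simp add: e'_def)
  obtain r0 where r0: "0 \<le> r0" "r0 < 1" "\<And>r a. r0 \<le> r \<Longrightarrow> r < 1 \<Longrightarrow> norm a = 1 \<Longrightarrow>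
       \<bar>(LINT t|circ. poisson (complex_of_real r * a) (cis t) * \<phi> (cis t)) - \<phi> a\<bar> \<le> e'"
    using poisson_approx[OF \<phi>s e'] by blast
  define r where "r = max r0 (1 - \<epsilon>/4)"
  have r: "0 \<le> r" "r < 1" "r0 \<le> r" using r0 e by (auto simp: r_def)
  have "1 - \<epsilon>/4 \<le> r" by (simp add: r_def)
  then have r4: "1 - r < \<epsilon>/2" using e by linarith
  define \<Phi> where "\<Phi> = (\<lambda>a. LINT t|circ. poisson (complex_of_real r * a) (cis t) * \<phi> (cis t))"
  have \<Phi>: "\<bar>\<Phi> a - \<phi> a\<bar> \<le> e'" if "norm a = 1" for a unfolding \<Phi>_def by (rule r0(3)[OF r(3,2) that])
  have \<Phi>0: "0 \<le> \<Phi> a" if "norm a = 1" for a unfolding \<Phi>_def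
    using r that by (intro Bochner_Integration.integral_nonneg mult_nonneg_nonneg poisson_nonneg \<phi>) (auto simp: norm_mult)
  have nz: "norm (polar r t) < 1" for t using r by (simp add: norm_mult)
  have test1: "(\<integral>\<^sup>+ t. ennreal (\<phi> (cis t) * potential (polar r t)) \<partial>circ) = (\<integral>\<^sup>+ \<zeta>. ennreal (\<Phi> \<zeta>) \<partial>\<mu>)"
    using sd.herglotz_test[OF sigma_finite_measure_axioms _ r(1,2) \<phi>s \<phi>(2)]
    by (simp add: potential_def \<Phi>_def)
  define V where "V = (\<lambda>t. Re (herglotz circ cis \<psi> (polar r t)))"
  have test2: "(\<integral>\<^sup>+ t. ennreal (\<phi> (cis t) * V t) \<partial>circ) = (\<integral>\<^sup>+ t. ennreal (\<psi> t * \<Phi> (cis t)) \<partial>circ)"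
    using cd.herglotz_test[OF circ.sigma_finite_measure_axioms \<psi>(2) r(1,2) \<phi>s \<phi>(2)]
    by (simp add: \<Phi>_def V_def)
  have fin1: "ennreal e' * emeasure \<mu> UNIV = ennreal (e' * measure \<mu> UNIV)"
    using e' by (simp add: emeasure_eq_measure ennreal_mult)
  have vm: "V \<in> borel_measurable borel"
    unfolding V_def
    by (rule borel_measurable_integrable[OF cd.herglotz_mean(1)[OF r(1,2) \<psi>(2)], unfolded measurable_circ])
  note vm[measurable]
  have \<Phi>m [measurable]: "(\<lambda>t. \<Phi> (cis t)) \<in> borel_measurable borel"
    unfolding \<Phi>_def by measurable
  have "(\<integral>\<^sup>+ \<zeta>. ennreal (\<phi> \<zeta>) \<partial>\<mu>) \<le> (\<integral>\<^sup>+ \<zeta>. ennreal (\<Phi> \<zeta>) + ennreal e' \<partial>\<mu>)"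
  proof (rule nn_integral_mono_AE)
    show "AE \<zeta> in \<mu>. ennreal (\<phi> \<zeta>) \<le> ennreal (\<Phi> \<zeta>) + ennreal e'"
      using AE_norm
    proof eventually_elim
      case (elim x)
      have "\<phi> x \<le> \<Phi> x + e'" using \<Phi>[OF elim] by linarith
      then have "ennreal (\<phi> x) \<le> ennreal (\<Phi> x + e')" by (rule ennreal_leI)
      then show ?case using \<Phi>0[OF elim] e' by simp
    qed
  qed
  also have eq1: "\<dots> = (\<integral>\<^sup>+ \<zeta>. ennreal (\<Phi> \<zeta>) \<partial>\<mu>) + ennreal (e' * measure \<mu> UNIV)"
  proof (subst nn_integral_add)
    show "(\<lambda>x. ennreal (\<Phi> x)) \<in> borel_measurable \<mu>"
      unfolding \<Phi>_def by measurable
  qed (auto simp: fin1)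
  finally have s1: "(\<integral>\<^sup>+ \<zeta>. ennreal (\<phi> \<zeta>) \<partial>\<mu>) \<le> (\<integral>\<^sup>+ \<zeta>. ennreal (\<Phi> \<zeta>) \<partial>\<mu>) + ennreal (e' * measure \<mu> UNIV)" .
  have "(\<integral>\<^sup>+ \<zeta>. ennreal (\<Phi> \<zeta>) \<partial>\<mu>) \<le> (\<integral>\<^sup>+ t. ennreal (\<phi> (cis t) * V t) + ennreal (\<phi> (cis t) * C) \<partial>circ)"
    unfolding test1[symmetric]
  proof (rule nn_integral_mono)
    fix t
    have "\<phi> (cis t) * potential (polar r t) \<le> \<phi> (cis t) * (V t + C)"
    proof (cases "\<phi> (cis t) = 0")
      case False
      then have "norm (cis t - \<xi>) < \<epsilon>/2" using \<phi>(3)[of "cis t"] by (simp add: dist_norm norm_minus_commute)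
      moreover have "norm (polar r t - cis t) = 1 - r"
      proof -
        have "polar r t - cis t = polar (r - 1) t" by (simp add: algebra_simps)
        then show ?thesis using r by (simp add: norm_mult del: of_real_diff)
      qed
      moreover have "norm (polar r t - \<xi>) \<le> norm (polar r t - cis t) + norm (cis t - \<xi>)"
        using norm_triangle_ineq[of "polar r t - cis t" "cis t - \<xi>"] by simp
      ultimately have "norm (polar r t - \<xi>) < \<epsilon>" using r4 by linarith
      then show ?thesis unfolding V_def by (intro mult_left_mono le nz \<phi>)
    qed simp
    then have "ennreal (\<phi> (cis t) * potential (polar r t)) \<le> ennreal (\<phi> (cis t) * V t + \<phi> (cis t) * C)"
      by (intro ennreal_leI) (simp add: distrib_left)
    also have "\<dots> = ennreal (\<phi> (cis t) * V t) + ennreal (\<phi> (cis t) * C)"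
      using cd.Re_herglotz_nonneg[OF nz \<psi>(2)] by (intro ennreal_plus mult_nonneg_nonneg \<phi>(2) C) (simp add: V_def)
    finally show "ennreal (\<phi> (cis t) * potential (polar r t)) \<le> \<dots>" .
  qed
  also have "\<dots> = (\<integral>\<^sup>+ t. ennreal (\<psi> t * \<Phi> (cis t)) \<partial>circ) + (\<integral>\<^sup>+ t. ennreal (\<phi> (cis t) * C) \<partial>circ)"
    unfolding test2[symmetric] by (rule nn_integral_add) measurable
  finally have s2: "(\<integral>\<^sup>+ \<zeta>. ennreal (\<Phi> \<zeta>) \<partial>\<mu>) \<le> (\<integral>\<^sup>+ t. ennreal (\<psi> t * \<Phi> (cis t)) \<partial>circ) + (\<integral>\<^sup>+ t. ennreal (\<phi> (cis t) * C) \<partial>circ)" .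
  have "(\<integral>\<^sup>+ t. ennreal (\<psi> t * \<Phi> (cis t)) \<partial>circ) \<le> (\<integral>\<^sup>+ t. ennreal (\<phi> (cis t) * \<psi> t) + ennreal (e' * \<psi> t) \<partial>circ)"
  proof (rule nn_integral_mono)
    fix t
    have "\<Phi> (cis t) \<le> \<phi> (cis t) + e'" using \<Phi>[of "cis t"] by (simp add: abs_le_iff)
    then have "\<psi> t * \<Phi> (cis t) \<le> \<psi> t * (\<phi> (cis t) + e')" by (rule mult_left_mono[OF _ \<psi>(2)])
    then have "ennreal (\<psi> t * \<Phi> (cis t)) \<le> ennreal (\<phi> (cis t) * \<psi> t + e' * \<psi> t)"
      by (intro ennreal_leI) (simp add: distrib_left mult.commute)
    also have "\<dots> = ennreal (\<phi> (cis t) * \<psi> t) + ennreal (e' * \<psi> t)"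
      using \<phi>(2) \<psi>(2) e' by (intro ennreal_plus mult_nonneg_nonneg) auto
    finally show "ennreal (\<psi> t * \<Phi> (cis t)) \<le> \<dots>" .
  qed
  also have "\<dots> = (\<integral>\<^sup>+ t. ennreal (\<phi> (cis t) * \<psi> t) \<partial>circ) + ennreal (e' * (LINT t|circ. \<psi> t))"
  proof (subst nn_integral_add)
    have "(\<integral>\<^sup>+ t. ennreal (e' * \<psi> t) \<partial>circ) = ennreal (LINT t|circ. e' * \<psi> t)"
      using \<psi> e' by (intro nn_integral_eq_integral) auto
    then show "(\<integral>\<^sup>+ t. ennreal (\<phi> (cis t) * \<psi> t) \<partial>circ) + (\<integral>\<^sup>+ t. ennreal (e' * \<psi> t) \<partial>circ)
      = (\<integral>\<^sup>+ t. ennreal (\<phi> (cis t) * \<psi> t) \<partial>circ) + ennreal (e' * (LINT t|circ. \<psi> t))" by simp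
  qed auto
  finally have s3: "(\<integral>\<^sup>+ t. ennreal (\<psi> t * \<Phi> (cis t)) \<partial>circ) \<le> (\<integral>\<^sup>+ t. ennreal (\<phi> (cis t) * \<psi> t) \<partial>circ) + ennreal (e' * (LINT t|circ. \<psi> t))" .
  have "(\<integral>\<^sup>+ \<zeta>. ennreal (\<phi> \<zeta>) \<partial>\<mu>) \<le> (\<integral>\<^sup>+ t. ennreal (\<phi> (cis t) * \<psi> t) \<partial>circ) + ennreal (e' * (LINT t|circ. \<psi> t))
     + (\<integral>\<^sup>+ t. ennreal (\<phi> (cis t) * C) \<partial>circ) + ennreal (e' * measure \<mu> UNIV)"
    by (rule order_trans[OF s1 add_right_mono[OF order_trans[OF s2 add_right_mono[OF s3]]]])
  also have "\<dots> = ((\<integral>\<^sup>+ t. ennreal (\<phi> (cis t) * \<psi> t) \<partial>circ) + (\<integral>\<^sup>+ t. ennreal (\<phi> (cis t) * C) \<partial>circ))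
     + (ennreal (e' * (LINT t|circ. \<psi> t)) + ennreal (e' * measure \<mu> UNIV))"
    by (simp only: add_ac)
  finally have s4: "(\<integral>\<^sup>+ \<zeta>. ennreal (\<phi> \<zeta>) \<partial>\<mu>) \<le> ((\<integral>\<^sup>+ t. ennreal (\<phi> (cis t) * \<psi> t) \<partial>circ) + (\<integral>\<^sup>+ t. ennreal (\<phi> (cis t) * C) \<partial>circ))
     + (ennreal (e' * (LINT t|circ. \<psi> t)) + ennreal (e' * measure \<mu> UNIV))" .
  have s5: "(\<integral>\<^sup>+ t. ennreal (\<phi> (cis t) * \<psi> t) \<partial>circ) + (\<integral>\<^sup>+ t. ennreal (\<phi> (cis t) * C) \<partial>circ) = (\<integral>\<^sup>+ t. ennreal (\<phi> (cis t) * (\<psi> t + C)) \<partial>circ)"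
  proof (subst nn_integral_add[symmetric])
    show "(\<integral>\<^sup>+ t. ennreal (\<phi> (cis t) * \<psi> t) + ennreal (\<phi> (cis t) * C) \<partial>circ) = (\<integral>\<^sup>+ t. ennreal (\<phi> (cis t) * (\<psi> t + C)) \<partial>circ)"
      unfolding distrib_left by (intro nn_integral_cong ennreal_plus[symmetric] mult_nonneg_nonneg \<phi> \<psi> C)
  qed measurable
  have s6: "ennreal (e' * (LINT t|circ. \<psi> t)) + ennreal (e' * measure \<mu> UNIV) \<le> ennreal d"
  proof -
    have "e' * (LINT t|circ. \<psi> t) + e' * measure \<mu> UNIV \<le> e' * m" using e' by (simp add: m_def distrib_left)
    also have "\<dots> = d" using m by (simp add: e'_def)
    finally have le: "e' * (LINT t|circ. \<psi> t) + e' * measure \<mu> UNIV \<le> d" .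
    have "0 \<le> (LINT t|circ. \<psi> t)" by (rule Bochner_Integration.integral_nonneg) (rule \<psi>(2))
    then have "ennreal (e' * (LINT t|circ. \<psi> t)) + ennreal (e' * measure \<mu> UNIV) = ennreal (e' * (LINT t|circ. \<psi> t) + e' * measure \<mu> UNIV)"
      using e' by (intro ennreal_plus[symmetric] mult_nonneg_nonneg) auto
    then show ?thesis using ennreal_leI[OF le] by simp
  qed
  show "(\<integral>\<^sup>+ \<zeta>. ennreal (\<phi> \<zeta>) \<partial>\<mu>) \<le> (\<integral>\<^sup>+ t. ennreal (\<phi> (cis t) * (\<psi> t + C)) \<partial>circ) + ennreal d"
    using order_trans[OF s4 add_left_mono[OF s6]] unfolding s5 .
qed

text \<open>
  Otherwise \<open>test_inequality\<close> bounds \<open>\<mu>\<close> near \<open>\<xi>\<close> by an absolutely continuous measure \<open>\<nu>\<close>. The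
  null set \<open>N\<close> that carries \<open>\<mu>\<close> has open neighbourhoods of arbitrarily small \<open>\<nu>\<close> measure, so \<open>\<mu>\<close>
  would vanish near \<open>\<xi>\<close>.
\<close>

lemma not_dominated_near_support:
  assumes \<psi>: "integrable circ \<psi>" "\<And>t. 0 \<le> \<psi> t" and \<xi>: "\<xi> \<in> msupport \<mu>" and e: "\<epsilon> > 0"
  shows "\<exists>z. norm z < 1 \<and> norm (z - \<xi>) < \<epsilon> \<and> potential z > Re (herglotz circ cis \<psi> z) + C"
proof (rule ccontr)
  assume neg: "\<not> ?thesis"
  define C' where "C' = max C 0"
  have C': "0 \<le> C'" by (simp add: C'_def)
  have le: "potential z \<le> Re (herglotz circ cis \<psi> z) + C'" if "norm z < 1" "norm (z - \<xi>) < \<epsilon>" for z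
  proof -
    have "potential z \<le> Re (herglotz circ cis \<psi> z) + C" using neg that by (meson not_less)
    then show ?thesis by (simp add: C'_def)
  qed
  have [measurable]: "\<psi> \<in> borel_measurable borel" using borel_measurable_integrable[OF \<psi>(1)] by simp
  obtain N where N: "N \<in> sets borel" "emeasure arc_length N = 0" "emeasure \<mu> (- N) = 0"
    using singular unfolding singular_circle_measure_def by blast
  have AEN: "AE t in circ. cis t \<notin> N"
  proof -
    have "emeasure arc_length N = emeasure (restrict_space lborel {0..2*pi}) (cis -` N \<inter> {0..2*pi})"
      unfolding arc_length_def using N by (subst emeasure_distr) (auto simp: space_restrict_space measurable_restrict_space1)
    also have "\<dots> = emeasure lborel (cis -` N \<inter> {0..2*pi})"
      by (rule emeasure_restrict_space) auto
    finally have z: "emeasure lborel (cis -` N \<inter> {0..2*pi}) = 0" using N by simp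
    have "cis -` N \<in> sets borel" using measurable_sets[OF borel_measurable_cis N(1)] by simp
    then have "cis -` N \<inter> {0..2*pi} \<in> null_sets lborel" using z by (auto simp: null_sets_def)
    then show ?thesis unfolding AE_circ_iff by (intro AE_I'[of "cis -` N \<inter> {0..2*pi}"]) auto
  qed
  define \<nu> where "\<nu> = distr (density circ (\<lambda>t. ennreal (\<psi> t + C'))) borel cis"
  have sets\<nu>: "sets \<nu> = sets borel" by (simp add: \<nu>_def)
  have nn\<nu>: "(\<integral>\<^sup>+ w. f w \<partial>\<nu>) = (\<integral>\<^sup>+ t. ennreal (\<psi> t + C') * f (cis t) \<partial>circ)" if [measurable]: "f \<in> borel_measurable borel" for f
    unfolding \<nu>_def by (subst nn_integral_distr) (auto simp: nn_integral_density)
  have em\<nu>: "emeasure \<nu> X = (\<integral>\<^sup>+ t. ennreal (\<psi> t + C') * indicator X (cis t) \<partial>circ)" if "X \<in> sets borel" for X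
    using nn\<nu>[of "indicator X"] that sets\<nu> by (simp add: nn_integral_indicator)
  have fin: "emeasure \<nu> (space \<nu>) \<noteq> \<infinity>"
  proof -
    have "emeasure \<nu> UNIV = (\<integral>\<^sup>+ t. ennreal (\<psi> t + C') \<partial>circ)" by (subst em\<nu>) auto
    also have "\<dots> = ennreal (LINT t|circ. \<psi> t + C')" using \<psi> C' by (intro nn_integral_eq_integral) auto
    finally show ?thesis by (simp add: \<nu>_def)
  qed
  have "emeasure \<nu> N = 0"
  proof -
    have "emeasure \<nu> N = (\<integral>\<^sup>+ t. 0 \<partial>circ)"
      unfolding em\<nu>[OF N(1)] by (rule nn_integral_cong_AE) (use AEN in \<open>auto elim!: eventually_mono\<close>)
    then show ?thesis by simp
  qed
  moreover have "emeasure \<nu> N = (INF U \<in> {U. N \<subseteq> U \<and> open U}. emeasure \<nu> U)"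
    by (rule outer_regular[OF sets\<nu> fin N(1)])
  ultimately have inf0: "(INF U \<in> {U. N \<subseteq> U \<and> open U}. emeasure \<nu> U) = 0" by simp
  have small: "emeasure \<mu> (ball \<xi> (\<epsilon>/2)) \<le> ennreal d" if d: "d > 0" for d
  proof -
    have "(INF U \<in> {U. N \<subseteq> U \<and> open U}. emeasure \<nu> U) < ennreal d" unfolding inf0 using d by simp
    then obtain U where U: "N \<subseteq> U" "open U" "emeasure \<nu> U < ennreal d" unfolding INF_less_iff by auto
    define O' where "O' = U \<inter> ball \<xi> (\<epsilon>/2)"
    have O: "open O'" "O' \<subseteq> ball \<xi> (\<epsilon>/2)" using U by (auto simp: O'_def)
    have ne: "- O' \<noteq> {}"
    proof
      assume "- O' = {}"
      then have "UNIV \<subseteq> ball \<xi> (\<epsilon>/2)" using O by auto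
      then have "bounded (UNIV :: complex set)" using bounded_ball bounded_subset by blast
      then show False using not_bounded_UNIV by blast
    qed
    (* Continuous functions increasing to the indicator of the open set. *)
    define \<phi> where "\<phi> = (\<lambda>j::nat. \<lambda>x. min 1 (real j * infdist x (- O')))"
    have ph: "continuous_on UNIV (\<phi> j)" "\<And>w. 0 \<le> \<phi> j w" "\<And>w. \<phi> j w \<noteq> 0 \<Longrightarrow> w \<in> O'" "\<And>w. \<phi> j w \<le> 1" for j
    proof -
      show "continuous_on UNIV (\<phi> j)" unfolding \<phi>_def by (intro continuous_intros)
      show "0 \<le> \<phi> j w" for w by (simp add: \<phi>_def infdist_nonneg)
      show "w \<in> O'" if "\<phi> j w \<noteq> 0" for w
      proof (rule ccontr)
        assume "w \<notin> O'"
        then have "infdist w (- O') = 0" by (intro infdist_zero) auto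
        then show False using that by (simp add: \<phi>_def)
      qed
      show "\<phi> j w \<le> 1" for w by (simp add: \<phi>_def)
    qed
    have step: "(\<integral>\<^sup>+ \<zeta>. ennreal (\<phi> j \<zeta>) \<partial>\<mu>) \<le> ennreal d" for j
    proof -
      have [measurable]: "\<phi> j \<in> borel_measurable borel" by (rule borel_measurable_continuous_onI[OF ph(1)])
      have "(\<integral>\<^sup>+ \<zeta>. ennreal (\<phi> j \<zeta>) \<partial>\<mu>) \<le> (\<integral>\<^sup>+ t. ennreal (\<phi> j (cis t) * (\<psi> t + C')) \<partial>circ)"
        by (rule test_inequality[OF \<psi> C' e le ph(1,2) subsetD[OF O(2) ph(3)]])
      also have "\<dots> \<le> (\<integral>\<^sup>+ t. ennreal (\<psi> t + C') * indicator U (cis t) \<partial>circ)"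
      proof (rule nn_integral_mono)
        fix t
        show "ennreal (\<phi> j (cis t) * (\<psi> t + C')) \<le> ennreal (\<psi> t + C') * indicator U (cis t)"
        proof (cases "\<phi> j (cis t) = 0")
          case False
          then have "cis t \<in> U" using ph(3) by (auto simp: O'_def)
          moreover have "\<phi> j (cis t) * (\<psi> t + C') \<le> 1 * (\<psi> t + C')" using ph(4) \<psi>(2) C' by (intro mult_right_mono) auto
          ultimately show ?thesis by (simp add: ennreal_leI)
        qed simp
      qed
      also have "\<dots> = emeasure \<nu> U" using U by (subst em\<nu>) auto
      finally show ?thesis using U(3) by (simp add: less_imp_le order_trans)
    qed
    have "emeasure \<mu> O' = (\<integral>\<^sup>+ \<zeta>. (SUP j. ennreal (\<phi> j \<zeta>)) \<partial>\<mu>)"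
    proof -
      have "(SUP j. ennreal (\<phi> j \<zeta>)) = indicator O' \<zeta>" for \<zeta>
      proof (cases "\<zeta> \<in> O'")
        case True
        then have "0 < infdist \<zeta> (- O')"
          using in_closed_iff_infdist_zero[of "- O'" \<zeta>] O ne infdist_nonneg[of \<zeta> "- O'"] by (auto simp: less_le)
        then obtain j :: nat where "1 < real j * infdist \<zeta> (- O')" using reals_Archimedean3 by blast
        then have "\<phi> j \<zeta> = 1" by (simp add: \<phi>_def)
        then have "1 \<le> (SUP j. ennreal (\<phi> j \<zeta>))" by (metis SUP_upper UNIV_I ennreal_1)
        moreover have "(SUP j. ennreal (\<phi> j \<zeta>)) \<le> 1"
          using ph(4) by (intro SUP_least) (simp add: ennreal_le_1)
        ultimately show ?thesis using True by simp
      next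
        case False
        then have "\<phi> j \<zeta> = 0" for j using ph(3) by blast
        then show ?thesis using False by simp
      qed
      then show ?thesis using O by simp
    qed
    also have "\<dots> = (SUP j. \<integral>\<^sup>+ \<zeta>. ennreal (\<phi> j \<zeta>) \<partial>\<mu>)"
    proof (rule nn_integral_monotone_convergence_SUP)
      show "incseq (\<lambda>j \<zeta>. ennreal (\<phi> j \<zeta>))"
        unfolding incseq_Suc_iff le_fun_def \<phi>_def
        by (intro allI ennreal_leI min.mono order_refl mult_right_mono infdist_nonneg) auto
      show "(\<lambda>\<zeta>. ennreal (\<phi> j \<zeta>)) \<in> borel_measurable \<mu>" for j
        using borel_measurable_continuous_onI[OF ph(1)[of j]] by measurable
    qed
    also have "\<dots> \<le> ennreal d" by (rule SUP_least) (rule step)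
    finally have O1: "emeasure \<mu> O' \<le> ennreal d" .
    have "emeasure \<mu> (ball \<xi> (\<epsilon>/2)) \<le> emeasure \<mu> (O' \<union> - N)"
      using O U N by (intro emeasure_mono) (auto simp: O'_def)
    also have "\<dots> \<le> emeasure \<mu> O' + emeasure \<mu> (- N)"
      using O N by (intro emeasure_subadditive) auto
    finally show ?thesis using O1 N by simp
  qed
  have "emeasure \<mu> (ball \<xi> (\<epsilon>/2)) \<le> 0"
    by (rule ennreal_le_epsilon) (use small in auto)
  then have "emeasure \<mu> (ball \<xi> (\<epsilon>/2)) = 0" by simp
  moreover have "\<epsilon>/2 > 0" using e by simp
  ultimately show False using \<xi> unfolding msupport_def by blast
qed

lemma support_norm: assumes "\<xi> \<in> msupport \<mu>" shows "norm \<xi> = 1"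
proof (rule ccontr)
  assume "norm \<xi> \<noteq> 1"
  then have "\<xi> \<in> - sphere 0 1" by simp
  moreover have "open (- sphere (0::complex) 1)" by (simp add: open_Compl)
  ultimately obtain e where e: "e > 0" "ball \<xi> e \<subseteq> - sphere 0 1" by (meson open_contains_ball)
  have "emeasure \<mu> (ball \<xi> e) \<le> emeasure \<mu> (- sphere 0 1)" using e by (intro emeasure_mono) auto
  then have "emeasure \<mu> (ball \<xi> e) = 0" using singular by (simp add: singular_circle_measure_def)
  then show False using assms e by (auto simp: msupport_def)
qed

definition near_support :: "real \<Rightarrow> real set" where
  "near_support \<delta> = {t. \<exists>\<xi>\<in>msupport \<mu>. norm (cis t - \<xi>) < \<delta>}"

lemma near_support_measurable [measurable]: "near_support \<delta> \<in> sets borel"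
proof -
  have "near_support \<delta> = cis -` (\<Union>\<xi>\<in>msupport \<mu>. ball \<xi> \<delta>)"
    by (auto simp: near_support_def dist_norm norm_minus_commute)
  moreover have "open (cis -` (\<Union>\<xi>\<in>msupport \<mu>. ball \<xi> \<delta>))"
    by (intro open_vimage open_UN) (auto intro!: continuous_intros)
  ultimately show ?thesis by simp
qed

lemma eventually_not_near_support:
  assumes "cis t \<notin> msupport \<mu>"
  shows "eventually (\<lambda>n. t \<notin> near_support (K * (1 - rseq n))) sequentially"
proof -
  have "open (- msupport \<mu>)" using closed_support by auto
  then obtain e where e: "e > 0" "ball (cis t) e \<subseteq> - msupport \<mu>" using assms by (meson ComplI open_contains_ball)
  have "(\<lambda>n. K * (1 - rseq n)) \<longlonglongrightarrow> K * (1 - 1)" by (intro tendsto_intros rseq_lim)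
  then have "eventually (\<lambda>n. K * (1 - rseq n) < e) sequentially" using e by (intro order_tendstoD(2)) auto
  then show ?thesis
  proof eventually_elim
    case (elim n)
    show ?case
    proof
      assume "t \<in> near_support (K * (1 - rseq n))"
      then obtain \<xi> where "\<xi> \<in> msupport \<mu>" "norm (cis t - \<xi>) < K * (1 - rseq n)" by (auto simp: near_support_def)
      then have "\<xi> \<in> ball (cis t) e" using elim by (simp add: dist_norm)
      then show False using e \<open>\<xi> \<in> msupport \<mu>\<close> by auto
    qed
  qed
qed

text \<open>
  At distance \<open>\<delta> = K * (1 - r)\<close> or more from the support, the kernel at radius \<open>r\<close> is of size \<open>(1
  - r) / dist^2\<close> and the one at radius \<open>1 - \<delta>\<close> of size \<open>\<delta> / dist^2\<close>. The gain \<open>1 / K\<close> is what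
  makes the potential negligible away from the support.
\<close>

lemma potential_off_support:
  assumes K: "K \<ge> 2" and r: "0 < r" "r < 1" "K * (1 - r) \<le> 1" and t: "t \<notin> near_support (K * (1 - r))"
  shows "potential (polar r t) \<le> 32 / K * potential (complex_of_real (1 - K * (1 - r)) * cis t)"
proof -
  define \<delta> where "\<delta> = K * (1 - r)"
  define \<rho> where "\<rho> = 1 - \<delta>"
  have d: "0 < \<delta>" "\<delta> \<le> 1" "2 * (1 - r) \<le> \<delta>" using K r mult_right_mono[of 2 K "1 - r"] by (auto simp: \<delta>_def)
  have \<rho>: "0 \<le> \<rho>" "\<rho> < 1" using d by (auto simp: \<rho>_def)
  have nr: "norm (polar r t) < 1" "norm (polar \<rho> t) < 1" using r \<rho> by (auto simp: norm_mult)
  have pt: "poisson (polar r t) \<zeta> \<le> 32 / K * poisson (polar \<rho> t) \<zeta>"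
    if z: "norm \<zeta> = 1" "\<zeta> \<in> msupport \<mu>" for \<zeta>
  proof -
    have far: "\<delta> \<le> norm (\<zeta> - cis t)" using t z(2) unfolding near_support_def \<delta>_def by (force simp: norm_minus_commute not_less)
    have P1: "poisson (polar r t) \<zeta> \<le> 8 * (1 - r) / (norm (\<zeta> - cis t))^2"
      by (rule poisson_far) (use r z far d in auto)
    have pos: "0 < norm (\<zeta> - cis t)" using far d by linarith
    have e1: "norm (cis t - polar \<rho> t) = \<delta>"
    proof -
      have "cis t - polar \<rho> t = polar \<delta> t" by (simp add: \<rho>_def algebra_simps)
      then show ?thesis using d by (simp add: norm_mult del: of_real_diff)
    qed
    have "norm (\<zeta> - polar \<rho> t) \<le> norm (\<zeta> - cis t) + norm (cis t - polar \<rho> t)"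
      using norm_triangle_ineq[of "\<zeta> - cis t" "cis t - polar \<rho> t"] by simp
    then have le2: "norm (\<zeta> - polar \<rho> t) \<le> 2 * norm (\<zeta> - cis t)" using e1 far by linarith
    have "norm (\<zeta> - polar \<rho> t) \<ge> 1 - \<rho>"
      using norm_triangle_ineq2[of \<zeta> "polar \<rho> t"] z \<rho> by (simp add: norm_mult)
    then have pos2: "0 < norm (\<zeta> - polar \<rho> t)" using \<rho> by linarith
    have sq: "(norm (\<zeta> - polar \<rho> t))^2 \<le> 4 * (norm (\<zeta> - cis t))^2"
      using power_mono[OF le2, of 2] by (simp add: power_mult_distrib)
    have "\<delta> \<le> 1 - \<rho>^2" using \<rho> mult_left_mono[of \<rho> 1 \<rho>] by (simp add: \<rho>_def power2_eq_square algebra_simps)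
    then have P2: "\<delta> / (4 * (norm (\<zeta> - cis t))^2) \<le> poisson (polar \<rho> t) \<zeta>"
      unfolding poisson_def using sq pos2 \<rho> d by (intro frac_le) (auto simp: norm_mult)
    have "8 * (1 - r) / (norm (\<zeta> - cis t))^2 = 32 / K * (\<delta> / (4 * (norm (\<zeta> - cis t))^2))"
      using K pos by (simp add: \<delta>_def field_simps)
    also have "\<dots> \<le> 32 / K * poisson (polar \<rho> t) \<zeta>" using P2 K by (intro mult_left_mono) auto
    finally show ?thesis using P1 by linarith
  qed
  have i: "integrable \<mu> (\<lambda>\<zeta>. poisson z \<zeta>)" if "norm z < 1" for z using sd.integrable_rho_poisson[OF that] by simp
  have "potential (polar r t) \<le> (LINT \<zeta>|\<mu>. 32 / K * poisson (polar \<rho> t) \<zeta>)"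
    unfolding potential_eq[OF nr(1)]
  proof (rule integral_mono_AE)
    show "AE \<zeta> in \<mu>. poisson (polar r t) \<zeta> \<le> 32 / K * poisson (polar \<rho> t) \<zeta>"
      using AE_norm AE_support by eventually_elim (rule pt)
  qed (use i nr in auto)
  also have "\<dots> = 32 / K * potential (polar \<rho> t)" by (simp add: potential_eq[OF nr(2)])
  finally show ?thesis by (simp add: \<rho>_def \<delta>_def)
qed

lemma potential_mean:
  assumes "0 \<le> r" "r < 1"
  shows "integrable circ (\<lambda>t. potential (polar r t))"
    "(LINT t|circ. potential (polar r t)) = measure \<mu> UNIV"
  using sd.herglotz_mean[OF assms] by (simp_all add: potential_def)

end

section \<open>The estimate at the singular part\<close>

context singular_measure
begin

text \<open>
  The singular factor forces \<open>g\<close> to vanish, in the sense of a limit along some sequence, at each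
  point of the support.
\<close>

lemma zero_near_support:
  assumes \<psi>: "integrable circ \<psi>" "\<And>t. 0 \<le> \<psi> t"
    and g: "\<And>z. norm z < 1 \<Longrightarrow> norm (g z :: complex) \<le> exp (Re (herglotz circ cis \<psi> z) - potential z)"
    and \<xi>: "\<xi> \<in> msupport \<mu>" and e: "e > 0"
  shows "\<exists>z. norm z < 1 \<and> norm (z - \<xi>) < e \<and> norm (g z) < e"
proof -
  obtain z where z: "norm z < 1" "norm (z - \<xi>) < e" "potential z > Re (herglotz circ cis \<psi> z) + (- ln e)"
    using not_dominated_near_support[OF \<psi> \<xi> e] by blast
  have "norm (g z) \<le> exp (Re (herglotz circ cis \<psi> z) - potential z)" by (rule g[OF z(1)])
  also have "\<dots> < exp (ln e)" using z(3) by (subst exp_less_cancel_iff) linarith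
  finally show ?thesis using z e by auto
qed

text \<open>
  The angles at which, seen from radius \<open>rseq n\<close>, the support of \<open>\<mu>\<close> is within \<open>K\<close> times the
  distance to the circle.
\<close>

definition support_nbhd :: "real \<Rightarrow> nat \<Rightarrow> real set" where
  "support_nbhd K n = near_support (K * (1 - rseq n))"

lemma support_nbhd_measurable [measurable]: "support_nbhd K n \<in> sets borel"
  by (simp add: support_nbhd_def)

lemma eventually_scale:
  assumes "K > 0" shows "eventually (\<lambda>n. 1/2 \<le> rseq n \<and> K * (1 - rseq n) \<le> 1) sequentially"
proof -
  have "(\<lambda>n. K * (1 - rseq n)) \<longlonglongrightarrow> K * (1 - 1)" by (intro tendsto_intros rseq_lim)
  then have "eventually (\<lambda>n. K * (1 - rseq n) < 1) sequentially" by (intro order_tendstoD(2)) auto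
  moreover have "eventually (\<lambda>n. 1/2 < rseq n) sequentially" by (rule order_tendstoD(1)[OF rseq_lim]) simp
  ultimately show ?thesis by eventually_elim auto
qed

lemma measure_support_nbhd: "measure circ (support_nbhd K n) = (LINT t|circ. indicator (support_nbhd K n) t)"
  by simp

text \<open>
  Near the support, \<open>boundary_zero_decay\<close> gives \<open>|g| \<le> D * (1 - r) * u\<close> on the circle, where \<open>u\<close>
  is \<open>Re A\<close> at radius \<open>r\<close> and has mean \<open>Re (A 0)\<close>. On the support itself this forces \<open>g = 0\<close>, so
  the support is a null set. Taking logarithms and integrating over the neighbourhood, with \<open>ln u
  \<le> u / c + ln c\<close> for a large constant \<open>c\<close>, bounds \<open>ln (1 / (1 - r))\<close> times its measure by the
  integral of \<open>ln (1 / |g|)\<close> over it, which tends to 0, and an arbitrarily small remainder.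
\<close>

lemma carleson_condition:
  assumes \<psi>0: "integrable circ \<psi>0" "\<And>t. 0 \<le> \<psi>0 t"
    and g: "g holomorphic_on ball 0 1" and g1: "\<And>z. norm z < 1 \<Longrightarrow> norm (g z) \<le> 1"
    and z1: "norm z1 < 1" "g z1 \<noteq> 0"
    and dom: "\<And>z. norm z < 1 \<Longrightarrow> norm (g z) \<le> exp (Re (herglotz circ cis \<psi>0 z) - potential z)"
    and A: "A holomorphic_on ball 0 1" and le: "\<And>z. norm z < 1 \<Longrightarrow> norm (deriv g z) \<le> Re (A z)"
    and K: "K \<ge> 1"
  shows "AE t in circ. cis t \<notin> msupport \<mu>"
    and "(\<lambda>n. measure circ (support_nbhd K n)) \<longlonglongrightarrow> 0"
    and "(\<lambda>n. measure circ (support_nbhd K n) * ln (1 / (1 - rseq n))) \<longlonglongrightarrow> 0"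
proof -
  obtain \<psi> where \<psi>: "integrable circ \<psi>" "\<And>t. \<psi> t \<ge> 0" "AE t in circ. norm (radial_limit g t) = exp (- \<psi> t)"
    by (rule boundary_log[OF g g1 z1]) (assumption | rule that)+
  have [measurable]: "\<psi> \<in> borel_measurable borel" using borel_measurable_integrable[OF \<psi>(1)] unfolding measurable_circ .
  define D where "D = 24 * (8*K+5)^2"
  have D: "D > 0" using K by (simp add: D_def)
  have A0: "0 \<le> Re (A z)" if "norm z < 1" for z using order_trans[OF norm_ge_zero le[OF that]] .
  have Ac: "continuous_on (ball 0 1) (\<lambda>z. Re (A z))" by (intro continuous_intros holomorphic_on_imp_continuous_on A)
  define u where "u = (\<lambda>n t. Re (A (polar (rseq n) t)))"
  have u0: "0 \<le> u n t" for n t unfolding u_def by (rule A0) (simp add: norm_mult)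
  have iu: "integrable circ (u n)" for n unfolding u_def
  proof (rule integrable_circ_continuous[of "\<lambda>w. Re (A (complex_of_real (rseq n) * w))"])
    show "continuous_on (sphere 0 1) (\<lambda>w. Re (A (complex_of_real (rseq n) * w)))"
      by (rule continuous_on_compose2[OF Ac]) (auto intro!: continuous_intros simp: norm_mult)
  qed
  have [measurable]: "u n \<in> borel_measurable borel" for n using borel_measurable_integrable[OF iu] unfolding measurable_circ .
  have mu: "(LINT t|circ. u n t) = Re (A 0)" for n
  proof -
    have "(LINT t|circ. poisson 0 (cis t) * Re (A (polar (rseq n) t))) = Re (A (complex_of_real (rseq n) * 0))"
      by (rule poisson_formula_Re[OF dilate_holomorphic[OF A, of "rseq n"]]) auto
    then show ?thesis by (simp add: poisson_def u_def)
  qed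
  define good where "good = (\<lambda>n. 1/2 \<le> rseq n \<and> K * (1 - rseq n) \<le> 1)"
  have ev: "eventually good sequentially" unfolding good_def by (rule eventually_scale) (use K in simp)
  have lg: "AE t in circ. ((\<lambda>r. g (polar r t)) \<longlongrightarrow> radial_limit g t) (at_left 1)"
    by (rule AE_radial_limit[OF g g1])
  have decay: "AE t in circ. t \<in> support_nbhd K n \<longrightarrow> exp (- \<psi> t) \<le> D * (1 - rseq n) * u n t" if gn: "good n" for n
    using lg \<psi>(3)
  proof eventually_elim
    case (elim t)
    show ?case
    proof
      assume "t \<in> support_nbhd K n"
      then obtain \<xi> where \<xi>: "\<xi> \<in> msupport \<mu>" "norm (cis t - \<xi>) < K * (1 - rseq n)" by (auto simp: support_nbhd_def near_support_def)
      have "norm (g (polar R t)) \<le> 24 * ((8*K+5)^2 * (1 - rseq n) * Re (A (polar (rseq n) t)))"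
        if R: "rseq n \<le> R" "R < 1" for R
        by (rule boundary_zero_decay[OF g A le _ _ K _ _ support_norm[OF \<xi>(1)] \<xi>(2) zero_near_support[OF \<psi>0 dom \<xi>(1)] R])
           (use gn in \<open>auto simp: good_def\<close>)
      then have b: "norm (g (polar R t)) \<le> D * (1 - rseq n) * u n t" if "R \<in> {rseq n<..<1}" for R
        using that by (simp add: D_def u_def mult.assoc)
      have "norm (radial_limit g t) \<le> D * (1 - rseq n) * u n t"
      proof (rule tendsto_upperbound[OF tendsto_norm[OF elim(1)]])
        show "\<forall>\<^sub>F R in at_left 1. norm (g (polar R t)) \<le> D * (1 - rseq n) * u n t"
          by (rule eventually_mono[OF eventually_at_left_real[OF rseq_range(2)[of n]]]) (rule b)
      qed simp
      then show "exp (- \<psi> t) \<le> D * (1 - rseq n) * u n t" using elim(2) by simp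
    qed
  qed
  have l0: "(\<lambda>n. D * (1 - rseq n) * Re (A 0)) \<longlonglongrightarrow> D * (1 - 1) * Re (A 0)" by (intro tendsto_intros rseq_lim)
  define E where "E = {t. cis t \<in> msupport \<mu>}"
  have [measurable]: "E \<in> sets borel"
  proof -
    have "closed (cis -` msupport \<mu>)" by (intro closed_vimage closed_support) (auto intro!: continuous_intros)
    then show ?thesis by (simp add: E_def vimage_def)
  qed
  have iexp: "integrable circ (\<lambda>t. indicator E t * exp (- \<psi> t))"
    by (rule integrable_circ_bounded[where B=1]) (use \<psi>(2) in \<open>auto simp: indicator_def\<close>)
  have Eb: "(LINT t|circ. indicator E t * exp (- \<psi> t)) \<le> D * (1 - rseq n) * Re (A 0)" if gn: "good n" for n
  proof -
    have "(LINT t|circ. indicator E t * exp (- \<psi> t)) \<le> (LINT t|circ. D * (1 - rseq n) * u n t)"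
    proof (rule integral_mono_AE[OF iexp])
      show "integrable circ (\<lambda>t. D * (1 - rseq n) * u n t)" by (intro integrable_mult_right iu)
      show "AE t in circ. indicator E t * exp (- \<psi> t) \<le> D * (1 - rseq n) * u n t"
        using decay[OF gn]
      proof eventually_elim
        case (elim t)
        have pos: "0 \<le> D * (1 - rseq n) * u n t" using D u0 by (intro mult_nonneg_nonneg) (auto simp: less_imp_le)
        have "t \<in> support_nbhd K n" if "t \<in> E"
          using that K unfolding support_nbhd_def near_support_def E_def by (auto intro!: bexI[of _ "cis t"])
        then show ?case using elim pos by (auto simp: indicator_def)
      qed
    qed
    also have "\<dots> = D * (1 - rseq n) * Re (A 0)" by (simp add: mu)
    finally show ?thesis .
  qed
  have "(LINT t|circ. indicator E t * exp (- \<psi> t)) \<le> D * (1 - 1) * Re (A 0)"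
    by (rule tendsto_lowerbound[OF l0]) (use ev in \<open>auto elim!: eventually_mono intro: Eb\<close>)
  then have "(LINT t|circ. indicator E t * exp (- \<psi> t)) \<le> 0" by simp
  moreover have "0 \<le> (LINT t|circ. indicator E t * exp (- \<psi> t))" by (intro Bochner_Integration.integral_nonneg) auto
  ultimately have "(LINT t|circ. indicator E t * exp (- \<psi> t)) = 0" by linarith
  then have "AE t in circ. indicator E t * exp (- \<psi> t) = 0"
    by (subst (asm) integral_nonneg_eq_0_iff_AE[OF iexp]) auto
  then show a: "AE t in circ. cis t \<notin> msupport \<mu>"
    by eventually_elim (auto simp: E_def indicator_def split: if_splits)
  have ind0: "AE t in circ. (\<lambda>n. indicator (support_nbhd K n) t :: real) \<longlonglongrightarrow> 0"
    using a
  proof eventually_elim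
    case (elim t)
    from eventually_not_near_support[OF this, of K]
    show ?case by (intro tendsto_eventually) (auto simp: support_nbhd_def elim!: eventually_mono)
  qed
  have "(\<lambda>n. LINT t|circ. indicator (support_nbhd K n) t :: real) \<longlonglongrightarrow> (LINT t|circ. 0)"
    by (rule integral_dominated_convergence[where w="\<lambda>_. 1"]) (use ind0 in \<open>auto simp: indicator_def\<close>)
  then show b: "(\<lambda>n. measure circ (support_nbhd K n)) \<longlonglongrightarrow> 0" unfolding measure_support_nbhd by simp
  have psiV: "(\<lambda>n. LINT t|circ. indicator (support_nbhd K n) t * \<psi> t) \<longlonglongrightarrow> (LINT t|circ. 0)"
  proof (rule integral_dominated_convergence[where w=\<psi>])
    show "AE t in circ. (\<lambda>n. indicator (support_nbhd K n) t * \<psi> t) \<longlonglongrightarrow> 0"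
      using ind0 by eventually_elim (rule tendsto_mult_left_zero)
    show "AE t in circ. norm (indicator (support_nbhd K n) t * \<psi> t) \<le> \<psi> t" for n
      using \<psi>(2) by (intro AE_I2) (auto simp: indicator_def)
  qed (use \<psi>(1) in auto)
  show "(\<lambda>n. measure circ (support_nbhd K n) * ln (1 / (1 - rseq n))) \<longlonglongrightarrow> 0"
  proof (rule LIMSEQ_I)
    fix e :: real assume e: "e > 0"
    (* Large enough for the term u / c, of mean Re (A 0) / c, to stay below e / 2. *)
    define c where "c = max 1 (2 * Re (A 0) / e + 1)"
    have c: "c \<ge> 1" "Re (A 0) / c < e/2"
    proof -
      show "c \<ge> 1" by (simp add: c_def)
      have "2 * Re (A 0) / e < c" by (simp add: c_def less_max_iff_disj)
      then show "Re (A 0) / c < e/2" using e \<open>c \<ge> 1\<close> by (simp add: field_simps)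
    qed
    define y where "y = (\<lambda>n. (\<bar>ln D\<bar> + ln c) * measure circ (support_nbhd K n) + (LINT t|circ. indicator (support_nbhd K n) t * \<psi> t))"
    have "y \<longlonglongrightarrow> (\<bar>ln D\<bar> + ln c) * 0 + (LINT t|circ. 0)" unfolding y_def by (intro tendsto_intros b psiV)
    then have "eventually (\<lambda>n. y n < e/2) sequentially" using e by (intro order_tendstoD(2)) auto
    then have "eventually (\<lambda>n. norm (measure circ (support_nbhd K n) * ln (1 / (1 - rseq n)) - 0) < e) sequentially"
      using ev
    proof eventually_elim
      case (elim n)
      let ?l = "ln (1 / (1 - rseq n))"
      have l0: "0 \<le> ?l" by (simp add: ln_div)
      have iV: "integrable circ (\<lambda>t. indicator (support_nbhd K n) t * f t)" if "integrable circ f" for f :: "real \<Rightarrow> real"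
        by (rule Bochner_Integration.integrable_bound[OF that]) (use borel_measurable_integrable[OF that] in \<open>auto simp: indicator_def\<close>)
      have "measure circ (support_nbhd K n) * ?l = (LINT t|circ. indicator (support_nbhd K n) t * ?l)" by simp
      also have "\<dots> \<le> (LINT t|circ. (\<bar>ln D\<bar> + ln c) * indicator (support_nbhd K n) t + u n t / c + indicator (support_nbhd K n) t * \<psi> t)"
      proof (rule integral_mono_AE)
        show "AE t in circ. indicator (support_nbhd K n) t * ?l \<le> (\<bar>ln D\<bar> + ln c) * indicator (support_nbhd K n) t + u n t / c + indicator (support_nbhd K n) t * \<psi> t"
          using decay[OF elim(2)]
        proof eventually_elim
          case (elim t)
          show ?case
          proof (cases "t \<in> support_nbhd K n")
            case True
            with elim have le1: "exp (- \<psi> t) \<le> D * (1 - rseq n) * u n t" by simp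
            have up: "u n t > 0"
            proof (rule ccontr)
              assume "\<not> u n t > 0"
              then have "u n t = 0" using u0[of n t] by linarith
              then show False using le1 by (simp add: not_le[symmetric])
            qed
            have "- \<psi> t = ln (exp (- \<psi> t))" by simp
            also have "\<dots> \<le> ln (D * (1 - rseq n) * u n t)"
              using le1 D up by (subst ln_le_cancel_iff) auto
            also have "\<dots> = ln D + ln (1 - rseq n) + ln (u n t)" using D up less_imp_neq[OF rseq_range(2)[of n]] by (simp add: ln_mult)
            also have "ln (u n t) = ln (u n t / c) + ln c" using up c by (simp add: ln_div)
            also have "ln (u n t / c) \<le> u n t / c" using up c ln_le_minus_one[of "u n t / c"] by simp
            finally have "- \<psi> t \<le> ln D + ln (1 - rseq n) + (u n t / c + ln c)" by simp
            moreover have "?l = - ln (1 - rseq n)" using less_imp_neq[OF rseq_range(2)[of n]] by (simp add: ln_div)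
            ultimately have "?l \<le> \<bar>ln D\<bar> + ln c + u n t / c + \<psi> t" using abs_ge_self[of "ln D"] by linarith
            then show ?thesis using True by simp
          next
            case False
            then show ?thesis using u0[of n t] c by simp
          qed
        qed
        show "integrable circ (\<lambda>t. indicator (support_nbhd K n) t * ?l)" by (rule iV) simp
        show "integrable circ (\<lambda>t. (\<bar>ln D\<bar> + ln c) * indicator (support_nbhd K n) t + u n t / c + indicator (support_nbhd K n) t * \<psi> t)"
          using iV[of "\<lambda>_. 1"] by (intro Bochner_Integration.integrable_add integrable_mult_right integrable_divide_zero iu iV \<psi>) auto
      qed
      also have "\<dots> = (\<bar>ln D\<bar> + ln c) * measure circ (support_nbhd K n) + Re (A 0) / c + (LINT t|circ. indicator (support_nbhd K n) t * \<psi> t)"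
      proof -
        have i1: "integrable circ (\<lambda>t. (\<bar>ln D\<bar> + ln c) * indicator (support_nbhd K n) t)" using iV[of "\<lambda>_. 1"] by (intro integrable_mult_right) auto
        have i2: "integrable circ (\<lambda>t. u n t / c)" by (intro integrable_divide_zero iu)
        show ?thesis
          by (subst Bochner_Integration.integral_add[OF Bochner_Integration.integrable_add[OF i1 i2] iV[OF \<psi>(1)]],
              subst Bochner_Integration.integral_add[OF i1 i2]) (simp add: mu)
      qed
      also have "\<dots> = y n + Re (A 0) / c" by (simp add: y_def)
      finally have "measure circ (support_nbhd K n) * ?l < e" using elim c by linarith
      moreover have "0 \<le> measure circ (support_nbhd K n) * ?l" using l0 by (intro mult_nonneg_nonneg) auto
      ultimately show ?case by simp
    qed
    then show "\<exists>no. \<forall>n\<ge>no. norm (measure circ (support_nbhd K n) * ln (1 / (1 - rseq n)) - 0) < e"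
      by (simp add: eventually_sequentially)
  qed
qed

text \<open>
  Split \<open>\<psi>\<close> into its part below a level \<open>B\<close>, whose Poisson integral is at most \<open>B\<close>, and a rest of
  small mean.
\<close>

lemma herglotz_small_near_support:
  assumes \<psi>: "integrable circ \<psi>" "\<And>t. 0 \<le> \<psi> t" and V0: "(\<lambda>n. measure circ (support_nbhd K n)) \<longlonglongrightarrow> 0"
  shows "(\<lambda>n. LINT t|circ. indicator (support_nbhd K n) t * Re (herglotz circ cis \<psi> (polar (rseq n) t))) \<longlonglongrightarrow> 0"
proof (rule LIMSEQ_I)
  fix e :: real assume e: "e > 0"
  interpret cd: circle_density circ cis \<psi> by (rule circle_density_circ[OF \<psi>(1)])
  have [measurable]: "\<psi> \<in> borel_measurable borel" using borel_measurable_integrable[OF \<psi>(1)] unfolding measurable_circ .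
  define w where "w = (\<lambda>(B::nat) t. max 0 (\<psi> t - real B))"
  have iw: "integrable circ (w B)" for B
    by (rule Bochner_Integration.integrable_bound[OF \<psi>(1)]) (use \<psi>(2) in \<open>auto simp: w_def\<close>)
  have "(\<lambda>B. LINT t|circ. w B t) \<longlonglongrightarrow> (LINT t|circ. 0)"
  proof (rule integral_dominated_convergence[where w=\<psi>])
    show "AE t in circ. (\<lambda>B. w B t) \<longlonglongrightarrow> 0"
    proof (rule AE_I2, rule tendsto_eventually)
      fix t
      obtain k :: nat where "\<psi> t \<le> real k" using real_arch_simple by blast
      then show "\<forall>\<^sub>F B in sequentially. w B t = 0" by (intro eventually_sequentiallyI[of k]) (auto simp: w_def)
    qed
    show "AE t in circ. norm (w B t) \<le> \<psi> t" for B using \<psi>(2) by (intro AE_I2) (auto simp: w_def)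
    show "w B \<in> borel_measurable circ" for B using borel_measurable_integrable[OF iw] .
  qed (use \<psi>(1) in auto)
  then have "eventually (\<lambda>B. (LINT t|circ. w B t) < e/2) sequentially" using e by (intro order_tendstoD(2)) auto
  then obtain B where B: "(LINT t|circ. w B t) < e/2" by (auto simp: eventually_sequentially)
  interpret wd: circle_density circ cis "w B" by (rule circle_density_circ[OF iw])
  have w0: "0 \<le> w B t" for t by (simp add: w_def)
  have split: "Re (herglotz circ cis \<psi> z) \<le> real B + Re (herglotz circ cis (w B) z)" if z: "norm z < 1" for z
  proof -
    have P0: "0 \<le> poisson z x" for x by (intro poisson_nonneg less_imp_le[OF z])
    have "Re (herglotz circ cis \<psi> z) \<le> (LINT t|circ. real B * poisson z (cis t) + w B t * poisson z (cis t))"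
      unfolding cd.Re_herglotz[OF z]
    proof (rule integral_mono)
      show "integrable circ (\<lambda>t. real B * poisson z (cis t) + w B t * poisson z (cis t))"
        by (intro Bochner_Integration.integrable_add integrable_mult_right integrable_poisson z wd.integrable_rho_poisson)
      show "\<psi> t * poisson z (cis t) \<le> real B * poisson z (cis t) + w B t * poisson z (cis t)" for t
        unfolding distrib_right[symmetric] by (intro mult_right_mono P0) (simp add: w_def)
    qed (rule cd.integrable_rho_poisson[OF z])
    also have "\<dots> = real B + Re (herglotz circ cis (w B) z)"
      unfolding wd.Re_herglotz[OF z]
      by (subst Bochner_Integration.integral_add) (auto intro!: integrable_poisson z wd.integrable_rho_poisson simp: integral_poisson[OF z])
    finally show ?thesis .
  qed
  define v where "v = (\<lambda>n t. Re (herglotz circ cis \<psi> (polar (rseq n) t)))"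
  define vw where "vw = (\<lambda>n t. Re (herglotz circ cis (w B) (polar (rseq n) t)))"
  have nz: "norm (polar (rseq n) t) < 1" for n t by (simp add: norm_mult)
  have v0: "0 \<le> v n t" "0 \<le> vw n t" for n t
    unfolding v_def vw_def by (rule cd.Re_herglotz_nonneg[OF nz \<psi>(2)], rule wd.Re_herglotz_nonneg[OF nz w0])
  have iv: "integrable circ (v n)" "integrable circ (vw n)" for n
    unfolding v_def vw_def by (rule cd.herglotz_mean(1)[OF _ _ \<psi>(2)], auto) (rule wd.herglotz_mean(1)[OF _ _ w0], auto)
  have mvw: "(LINT t|circ. vw n t) = (LINT t|circ. w B t)" for n
    unfolding vw_def by (rule wd.herglotz_mean(2)[OF _ _ w0]) auto
  have iV: "integrable circ (\<lambda>t. indicator (support_nbhd K n) t * f t)" if "integrable circ f" for f :: "real \<Rightarrow> real" and n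
    by (rule Bochner_Integration.integrable_bound[OF that]) (use borel_measurable_integrable[OF that] in \<open>auto simp: indicator_def\<close>)
  have bound: "(LINT t|circ. indicator (support_nbhd K n) t * v n t) \<le> real B * measure circ (support_nbhd K n) + (LINT t|circ. w B t)" for n
  proof -
    have i1: "integrable circ (\<lambda>t. real B * indicator (support_nbhd K n) t)" using iV[of "\<lambda>_. 1"] by (intro integrable_mult_right) auto
    have "(LINT t|circ. indicator (support_nbhd K n) t * v n t) \<le> (LINT t|circ. real B * indicator (support_nbhd K n) t + vw n t)"
    proof (rule integral_mono)
      show "indicator (support_nbhd K n) t * v n t \<le> real B * indicator (support_nbhd K n) t + vw n t" for t
        using split[OF nz[of n t]] v0(2)[of n t] by (auto simp: indicator_def v_def vw_def)
    qed (intro iV iv Bochner_Integration.integrable_add i1)+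
    also have "\<dots> = real B * measure circ (support_nbhd K n) + (LINT t|circ. vw n t)"
      by (subst Bochner_Integration.integral_add[OF i1 iv(2)]) simp
    finally show ?thesis by (simp add: mvw)
  qed
  have "(\<lambda>n. real B * measure circ (support_nbhd K n)) \<longlonglongrightarrow> real B * 0" by (intro tendsto_intros V0)
  then have "eventually (\<lambda>n. real B * measure circ (support_nbhd K n) < e/2) sequentially" using e by (intro order_tendstoD(2)) auto
  then have "eventually (\<lambda>n. norm ((LINT t|circ. indicator (support_nbhd K n) t * v n t) - 0) < e) sequentially"
  proof eventually_elim
    case (elim n)
    have "0 \<le> (LINT t|circ. indicator (support_nbhd K n) t * v n t)" using v0 by (intro Bochner_Integration.integral_nonneg mult_nonneg_nonneg) auto
    then show ?case using bound[of n] elim B by simp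
  qed
  then show "\<exists>no. \<forall>n\<ge>no. norm ((LINT t|circ. indicator (support_nbhd K n) t * Re (herglotz circ cis \<psi> (polar (rseq n) t))) - 0) < e"
    by (simp add: eventually_sequentially v_def)
qed

text \<open>
  Integrates \<open>potential_off_support\<close> over the circle; the mean of the potential is the total mass
  at every radius.
\<close>

lemma potential_small_off_support:
  assumes K: "K \<ge> 2" and n: "K * (1 - rseq n) \<le> 1"
  shows "integrable circ (\<lambda>t. indicator (- support_nbhd K n) t * potential (polar (rseq n) t))"
    "(LINT t|circ. indicator (- support_nbhd K n) t * potential (polar (rseq n) t)) \<le> 32 / K * measure \<mu> UNIV"
proof -
  define \<rho> where "\<rho> = 1 - K * (1 - rseq n)"
  have \<rho>: "0 \<le> \<rho>" "\<rho> < 1" using n K by (auto simp: \<rho>_def)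
  note p1 = potential_mean[OF rseq_nonneg rseq_range(2)] and p2 = potential_mean[OF \<rho>]
  show i: "integrable circ (\<lambda>t. indicator (- support_nbhd K n) t * potential (polar (rseq n) t))"
    by (rule Bochner_Integration.integrable_bound[OF p1(1)])
       (use borel_measurable_integrable[OF p1(1)] in \<open>auto simp: indicator_def\<close>)
  have "(LINT t|circ. indicator (- support_nbhd K n) t * potential (polar (rseq n) t)) \<le> (LINT t|circ. 32 / K * potential (polar \<rho> t))"
  proof (rule integral_mono[OF i])
    show "integrable circ (\<lambda>t. 32 / K * potential (polar \<rho> t))" by (intro integrable_mult_right p2)
    fix t
    have "0 \<le> potential (polar \<rho> t)" using \<rho> by (intro potential_nonneg) (simp add: norm_mult)
    then have pos: "0 \<le> 32 / K * potential (polar \<rho> t)" using K by simp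
    show "indicator (- support_nbhd K n) t * potential (polar (rseq n) t) \<le> 32 / K * potential (polar \<rho> t)"
    proof (cases "t \<in> support_nbhd K n")
      case False
      then show ?thesis using potential_off_support[OF K rseq_range(1) rseq_range(2) n, of t] by (simp add: support_nbhd_def \<rho>_def)
    qed (use pos in simp)
  qed
  also have "\<dots> = 32 / K * measure \<mu> UNIV" by (simp add: p2)
  finally show "(LINT t|circ. indicator (- support_nbhd K n) t * potential (polar (rseq n) t)) \<le> 32 / K * measure \<mu> UNIV" .
qed

text \<open>
  Jensen's inequality for \<open>Q = q * exp H\<close>, where \<open>Re H\<close> is the potential, on the circles of radius
  \<open>rseq n\<close>. Since \<open>b\<close> is almost unimodular there, \<open>|q|\<close> may be replaced by \<open>|h|\<close>. Near the support
  of \<open>\<mu>\<close> the assumed bound for \<open>h\<close> cancels the potential, at the price of \<open>c\<close> times a Poisson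
  integral and \<open>M * ln (1 / (1 - r))\<close>; their integrals over the neighbourhood tend to 0 by
  \<open>herglotz_small_near_support\<close> and \<open>carleson_condition\<close>. Away from the support the potential
  contributes at most a multiple of \<open>1 / K\<close>, and \<open>ln |h|\<close> tends to \<open>- \<psi>\<close>. At the end \<open>K\<close> and the
  cut-off height \<open>L\<close> tend to infinity.
\<close>

theorem key_estimate:
  assumes \<psi>0: "integrable circ \<psi>0" "\<And>t. 0 \<le> \<psi>0 t"
    and g: "g holomorphic_on ball 0 1" and g1: "\<And>z. norm z < 1 \<Longrightarrow> norm (g z) \<le> 1"
    and z1: "norm z1 < 1" "g z1 \<noteq> 0"
    and dom: "\<And>z. norm z < 1 \<Longrightarrow> norm (g z) \<le> exp (Re (herglotz circ cis \<psi>0 z) - potential z)"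
    and A: "A holomorphic_on ball 0 1" and le: "\<And>z. norm z < 1 \<Longrightarrow> norm (deriv g z) \<le> Re (A z)"
    and h: "h holomorphic_on ball 0 1" and h1: "\<And>z. norm z < 1 \<Longrightarrow> norm (h z) \<le> 1"
    and c: "0 \<le> c" and hdom: "\<And>z. norm z < 1 \<Longrightarrow> norm (h z) \<le> C / (1 - norm z)^M * exp (c * Re (herglotz circ cis \<psi>0 z) - potential z)"
    and \<psi>: "integrable circ \<psi>" "\<And>t. 0 \<le> \<psi> t" "AE t in circ. norm (radial_limit h t) = exp (- \<psi> t)"
    and q: "q holomorphic_on ball 0 1" and hbq: "\<And>z. norm z < 1 \<Longrightarrow> h z = b z * q z"
    and b: "\<And>e. e > 0 \<Longrightarrow> \<exists>r0<1. \<forall>r t. r0 \<le> r \<longrightarrow> r < 1 \<longrightarrow> exp (- e) \<le> norm (b (polar r t))"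
    and z: "norm z < 1"
  shows "norm (q z) \<le> exp (- potential z - (LINT t|circ. poisson z (cis t) * \<psi> t))"
proof -
  interpret cd: circle_density circ cis \<psi>0 by (rule circle_density_circ[OF \<psi>0(1)])
  have [measurable]: "\<psi> \<in> borel_measurable borel" using borel_measurable_integrable[OF \<psi>(1)] unfolding measurable_circ .
  define H where "H = herglotz \<mu> (\<lambda>\<zeta>. \<zeta>) (\<lambda>_. 1)"
  define Q where "Q = (\<lambda>z. q z * exp (H z))"
  have Qh: "Q holomorphic_on ball 0 1" unfolding Q_def H_def by (intro holomorphic_intros q sd.herglotz_holomorphic)
  have nQ: "norm (Q w) = norm (q w) * exp (potential w)" for w by (simp add: Q_def H_def norm_mult potential_def)
  define C0 where "C0 = 2 / (1 - norm z)"
  have P: "0 \<le> poisson z (cis t)" "poisson z (cis t) \<le> C0" for t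
    using z by (auto simp: C0_def intro!: poisson_nonneg poisson_upper)
  have C00: "0 \<le> C0" using P[of 0] by linarith
  have nz: "norm (polar (rseq n) t) < 1" "norm (polar (rseq n) t) = rseq n" for n t by (auto simp: norm_mult)
  define hn where "hn = (\<lambda>n t. norm (h (polar (rseq n) t)))"
  define pn where "pn = (\<lambda>n t. potential (polar (rseq n) t))"
  define vn where "vn = (\<lambda>n t. Re (herglotz circ cis \<psi>0 (polar (rseq n) t)))"
  have [measurable]: "hn n \<in> borel_measurable borel" for n
  proof -
    have "(\<lambda>t. h (polar (rseq n) t)) \<in> borel_measurable borel" by (rule circle_measurable[OF h]) auto
    then show ?thesis unfolding hn_def by (rule measurable_compose[OF _ borel_measurable_norm])
  qed
  have hn1: "0 \<le> hn n t" "hn n t \<le> 1" for n t unfolding hn_def by (simp, rule h1[OF nz(1)])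
  have pn0: "0 \<le> pn n t" for n t unfolding pn_def by (rule potential_nonneg[OF nz(1)])
  have vn0: "0 \<le> vn n t" for n t unfolding vn_def by (rule cd.Re_herglotz_nonneg[OF nz(1) \<psi>0(2)])
  have ivn: "integrable circ (vn n)" for n unfolding vn_def by (rule cd.herglotz_mean(1)[OF _ _ \<psi>0(2)]) auto
  define C1 where "C1 = max C 1"
  have C1: "1 \<le> C1" "C \<le> C1" by (auto simp: C1_def)
  have lh: "AE t in circ. ((\<lambda>r. h (polar r t)) \<longlongrightarrow> radial_limit h t) (at_left 1)"
    by (rule AE_radial_limit[OF h h1])
  have hlim: "AE t in circ. (\<lambda>n. hn n t) \<longlonglongrightarrow> exp (- \<psi> t)"
    using lh \<psi>(3)
  proof eventually_elim
    case (elim t)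
    have "(\<lambda>n. hn n t) \<longlonglongrightarrow> norm (radial_limit h t)"
      unfolding hn_def by (rule tendsto_norm, rule filterlim_compose[OF elim(1) rseq_at_left])
    then show ?case using elim by simp
  qed
  have main: "norm (Q z) \<le> exp (e + C0 * (32 / K * measure \<mu> UNIV) - (LINT t|circ. poisson z (cis t) * tlog (real L) (exp (- \<psi> t))))"
    if e: "e > 0" and K: "K \<ge> 2" for e K L
  proof -
    have K1: "K \<ge> 1" using K by simp
    have cc3: "AE t in circ. cis t \<notin> msupport \<mu>" "(\<lambda>n. measure circ (support_nbhd K n)) \<longlonglongrightarrow> 0"
      "(\<lambda>n. measure circ (support_nbhd K n) * ln (1 / (1 - rseq n))) \<longlonglongrightarrow> 0"
      by (rule carleson_condition[OF \<psi>0 g g1 z1 dom A le K1]; assumption)+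
    obtain r0 where r0: "r0 < 1" "\<And>r t. r0 \<le> r \<Longrightarrow> r < 1 \<Longrightarrow> exp (- e) \<le> norm (b (polar r t))"
      using b[OF e] by blast
    have ev: "eventually (\<lambda>n. r0 \<le> rseq n \<and> K * (1 - rseq n) \<le> 1) sequentially"
    proof -
      have "eventually (\<lambda>n. r0 < rseq n) sequentially" by (rule order_tendstoD(1)[OF rseq_lim r0(1)])
      moreover have "eventually (\<lambda>n. 1/2 \<le> rseq n \<and> K * (1 - rseq n) \<le> 1) sequentially" by (rule eventually_scale) (use K in simp)
      ultimately show ?thesis by eventually_elim auto
    qed
    (* On the circle of radius rseq n, ln |Q| is at most e + W + Y - Z: W collects the cost of the
       assumed bound for h near the support, Y the potential away from it, and - Z is ln |h| there. *)
    define \<kappa> where "\<kappa> = (\<lambda>n. ln C1 + real M * ln (1 / (1 - rseq n)))"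
    have k0: "0 \<le> \<kappa> n" for n unfolding \<kappa>_def using C1 by (intro add_nonneg_nonneg mult_nonneg_nonneg) (auto simp: ln_div)
    define W where "W = (\<lambda>n t. indicator (support_nbhd K n) t * (\<kappa> n + c * vn n t))"
    define Y where "Y = (\<lambda>n t. indicator (- support_nbhd K n) t * pn n t)"
    define Z where "Z = (\<lambda>n t. indicator (- support_nbhd K n) t * tlog (real L) (hn n t))"
    have iV: "integrable circ (\<lambda>t. indicator (support_nbhd K n) t * f t)" if "integrable circ f" for f :: "real \<Rightarrow> real" and n
      by (rule Bochner_Integration.integrable_bound[OF that]) (use borel_measurable_integrable[OF that] in \<open>auto simp: indicator_def\<close>)
    have iW: "integrable circ (W n)" for n
      unfolding W_def by (intro iV Bochner_Integration.integrable_add integrable_mult_right ivn) auto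
    have tl: "0 \<le> tlog (real L) (hn n t)" "tlog (real L) (hn n t) \<le> real L" for n t by (intro tlog_bounds hn1; simp)+
    have Zb: "0 \<le> Z n t" "Z n t \<le> real L" for n t using tl[of n t] by (auto simp: Z_def indicator_def)
    have [measurable]: "Z n \<in> borel_measurable borel" for n unfolding Z_def by measurable
    have iZ: "integrable circ (Z n)" for n by (rule integrable_circ_bounded[where B="real L"]) (use Zb in auto)
    have iPZ: "integrable circ (\<lambda>t. poisson z (cis t) * Z n t)" for n
      by (rule integrable_circ_bounded[where B="C0 * real L"]) (auto intro!: norm_mult_le_nonneg[unfolded real_norm_def] P Zb)
    have step: "norm (Q (complex_of_real (rseq n) * z))
        \<le> exp (e + C0 * (\<kappa> n * measure circ (support_nbhd K n) + c * (LINT t|circ. indicator (support_nbhd K n) t * vn n t)) + C0 * (32 / K * measure \<mu> UNIV)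
           - (LINT t|circ. poisson z (cis t) * Z n t))"
      if n: "r0 \<le> rseq n" "K * (1 - rseq n) \<le> 1" for n
    proof -
      note po = potential_small_off_support[OF K n(2)]
      have iY: "integrable circ (Y n)" "(LINT t|circ. Y n t) \<le> 32 / K * measure \<mu> UNIV"
        using po by (simp_all add: Y_def pn_def)
      define \<phi> where "\<phi> = (\<lambda>t. e + W n t + Y n t - Z n t)"
      have i\<phi>: "integrable circ \<phi>" unfolding \<phi>_def
        by (intro Bochner_Integration.integrable_diff Bochner_Integration.integrable_add iW iY iZ) auto
      have ptw: "norm (Q (polar (rseq n) t)) \<le> exp (\<phi> t)" for t
      proof -
        let ?w = "polar (rseq n) t"
        have b0: "exp (- e) \<le> norm (b ?w)" by (rule r0(2)[OF n(1) rseq_range(2)])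
        have "exp (- e) * norm (q ?w) \<le> hn n t"
          unfolding hn_def hbq[OF nz(1)] norm_mult by (intro mult_right_mono b0) auto
        then have "exp e * (exp (- e) * norm (q ?w)) \<le> exp e * hn n t" by (intro mult_left_mono) auto
        moreover have "exp e * (exp (- e) * norm (q ?w)) = norm (q ?w)" by (simp add: exp_minus)
        ultimately have qh: "norm (q ?w) \<le> exp e * hn n t" by (simp only:)
        have "norm (Q ?w) \<le> exp e * hn n t * exp (pn n t)"
          unfolding nQ pn_def by (intro mult_right_mono qh) auto
        also have "\<dots> \<le> exp (\<phi> t)"
        proof (cases "t \<in> support_nbhd K n")
          case True
          have "hn n t \<le> C / (1 - rseq n)^M * exp (c * vn n t - pn n t)"
            using hdom[OF nz(1)[of n t]] unfolding hn_def vn_def pn_def nz(2) .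
          also have "\<dots> \<le> C1 / (1 - rseq n)^M * exp (c * vn n t - pn n t)"
            using C1 by (intro mult_right_mono divide_right_mono) (auto simp: less_imp_le)
          also have "C1 / (1 - rseq n)^M = exp (\<kappa> n)"
          proof -
            have "exp (\<kappa> n) = C1 * (exp (ln (1 / (1 - rseq n))))^M" using C1 by (simp add: \<kappa>_def exp_add exp_of_nat_mult)
            also have "exp (ln (1 / (1 - rseq n))) = 1 / (1 - rseq n)" by (rule exp_ln) simp
            finally show ?thesis by (simp add: power_one_over)
          qed
          finally have "exp e * hn n t * exp (pn n t) \<le> exp e * (exp (\<kappa> n) * exp (c * vn n t - pn n t)) * exp (pn n t)"
            by (intro mult_right_mono mult_left_mono) auto
          also have "\<dots> = exp (e + (\<kappa> n + c * vn n t))" by (simp add: exp_add exp_diff)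
          finally show ?thesis using True by (simp add: \<phi>_def W_def Y_def Z_def)
        next
          case False
          have "hn n t \<le> exp (- tlog (real L) (hn n t))" by (intro tlog_bounds(3) hn1) simp
          then have "exp e * hn n t * exp (pn n t) \<le> exp e * exp (- tlog (real L) (hn n t)) * exp (pn n t)"
            by (intro mult_right_mono mult_left_mono) auto
          also have "\<dots> = exp (e + pn n t - tlog (real L) (hn n t))" by (simp add: exp_add[symmetric])
          finally show ?thesis using False by (simp add: \<phi>_def W_def Y_def Z_def)
        qed
        finally show ?thesis .
      qed
      have R1: "1 < 1 / rseq n" by simp
      have "norm (Q (complex_of_real (rseq n) * z)) \<le> exp (LINT t|circ. poisson z (cis t) * \<phi> t)"
        by (rule jensen_majorant[OF dilate_holomorphic[OF Qh, of "rseq n"] R1 z i\<phi>]) (use ptw in auto)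
      also have "(LINT t|circ. poisson z (cis t) * \<phi> t) \<le> (LINT t|circ. poisson z (cis t) * e + C0 * W n t + C0 * Y n t - poisson z (cis t) * Z n t)"
      proof (rule integral_mono)
        have [measurable]: "\<phi> \<in> borel_measurable borel" using borel_measurable_integrable[OF i\<phi>] unfolding measurable_circ .
        show "integrable circ (\<lambda>t. poisson z (cis t) * \<phi> t)"
        proof (rule Bochner_Integration.integrable_bound)
          show "integrable circ (\<lambda>t. C0 * \<bar>\<phi> t\<bar>)" by (intro integrable_mult_right integrable_abs i\<phi>)
          show "AE t in circ. norm (poisson z (cis t) * \<phi> t) \<le> norm (C0 * \<bar>\<phi> t\<bar>)"
            using P C00 by (intro AE_I2) (simp add: abs_mult mult_right_mono)
        qed measurable
        show "integrable circ (\<lambda>t. poisson z (cis t) * e + C0 * W n t + C0 * Y n t - poisson z (cis t) * Z n t)"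
          by (intro Bochner_Integration.integrable_diff Bochner_Integration.integrable_add integrable_mult_right integrable_mult_left iW iY iPZ integrable_poisson z)
        fix t
        have "0 \<le> W n t" "0 \<le> Y n t" using k0[of n] c vn0[of n t] pn0[of n t] by (auto simp: W_def Y_def indicator_def)
        then have "poisson z (cis t) * W n t \<le> C0 * W n t" "poisson z (cis t) * Y n t \<le> C0 * Y n t"
          using P by (auto intro!: mult_right_mono)
        then show "poisson z (cis t) * \<phi> t \<le> poisson z (cis t) * e + C0 * W n t + C0 * Y n t - poisson z (cis t) * Z n t"
          by (simp add: \<phi>_def right_diff_distrib distrib_left)
      qed
      also have "\<dots> = e + C0 * (LINT t|circ. W n t) + C0 * (LINT t|circ. Y n t) - (LINT t|circ. poisson z (cis t) * Z n t)"
      proof -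
        have j1: "integrable circ (\<lambda>t. poisson z (cis t) * e)" by (intro integrable_mult_left integrable_poisson z)
        have j2: "integrable circ (\<lambda>t. C0 * W n t)" "integrable circ (\<lambda>t. C0 * Y n t)" by (intro integrable_mult_right iW iY)+
        have je: "(LINT t|circ. poisson z (cis t) * e) = e" using integral_poisson[OF z] by simp
        show ?thesis
          by (subst Bochner_Integration.integral_diff[OF Bochner_Integration.integrable_add[OF Bochner_Integration.integrable_add[OF j1 j2(1)] j2(2)] iPZ],
              subst Bochner_Integration.integral_add[OF Bochner_Integration.integrable_add[OF j1 j2(1)] j2(2)],
              subst Bochner_Integration.integral_add[OF j1 j2(1)]) (simp add: integral_poisson[OF z])
      qed
      also have "(LINT t|circ. W n t) = \<kappa> n * measure circ (support_nbhd K n) + c * (LINT t|circ. indicator (support_nbhd K n) t * vn n t)"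
      proof -
        have j1: "integrable circ (\<lambda>t. \<kappa> n * indicator (support_nbhd K n) t)" using iV[of "\<lambda>_. 1" n] by (intro integrable_mult_right) auto
        have j2: "integrable circ (\<lambda>t. c * (indicator (support_nbhd K n) t * vn n t))" by (intro integrable_mult_right iV ivn)
        have "W n t = \<kappa> n * indicator (support_nbhd K n) t + c * (indicator (support_nbhd K n) t * vn n t)" for t by (simp add: W_def distrib_left mult_ac)
        then have "(LINT t|circ. W n t) = (LINT t|circ. \<kappa> n * indicator (support_nbhd K n) t + c * (indicator (support_nbhd K n) t * vn n t))" by simp
        also have "\<dots> = \<kappa> n * measure circ (support_nbhd K n) + c * (LINT t|circ. indicator (support_nbhd K n) t * vn n t)"
          by (subst Bochner_Integration.integral_add[OF j1 j2]) simp
        finally show ?thesis .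
      qed
      finally have "norm (Q (complex_of_real (rseq n) * z)) \<le> exp (e + C0 * (\<kappa> n * measure circ (support_nbhd K n) + c * (LINT t|circ. indicator (support_nbhd K n) t * vn n t))
          + C0 * (LINT t|circ. Y n t) - (LINT t|circ. poisson z (cis t) * Z n t))" by simp
      also have "\<dots> \<le> exp (e + C0 * (\<kappa> n * measure circ (support_nbhd K n) + c * (LINT t|circ. indicator (support_nbhd K n) t * vn n t)) + C0 * (32 / K * measure \<mu> UNIV)
           - (LINT t|circ. poisson z (cis t) * Z n t))"
        using mult_left_mono[OF iY(2) C00] by (subst exp_le_cancel_iff) linarith
      finally show ?thesis .
    qed
    have Vm: "(\<lambda>n. \<kappa> n * measure circ (support_nbhd K n)) \<longlonglongrightarrow> 0"
    proof -
      have "(\<lambda>n. ln C1 * measure circ (support_nbhd K n) + real M * (measure circ (support_nbhd K n) * ln (1 / (1 - rseq n)))) \<longlonglongrightarrow> ln C1 * 0 + real M * 0"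
        by (intro tendsto_intros cc3)
      then show ?thesis by (simp add: \<kappa>_def ring_distribs mult_ac)
    qed
    have vm: "(\<lambda>n. LINT t|circ. indicator (support_nbhd K n) t * vn n t) \<longlonglongrightarrow> 0"
      unfolding vn_def by (rule herglotz_small_near_support[OF \<psi>0 cc3(2)])
    have zl: "(\<lambda>n. LINT t|circ. poisson z (cis t) * Z n t) \<longlonglongrightarrow> (LINT t|circ. poisson z (cis t) * tlog (real L) (exp (- \<psi> t)))"
    proof (rule integral_dominated_convergence[where w="\<lambda>_. C0 * real L"])
      show "AE t in circ. (\<lambda>n. poisson z (cis t) * Z n t) \<longlonglongrightarrow> poisson z (cis t) * tlog (real L) (exp (- \<psi> t))"
        using hlim cc3(1)
      proof eventually_elim
        case (elim t)
        have "(\<lambda>n. tlog (real L) (hn n t)) \<longlonglongrightarrow> tlog (real L) (exp (- \<psi> t))"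
          by (rule isCont_tendsto_compose[OF tlog_continuous elim(1)])
        moreover have "eventually (\<lambda>n. tlog (real L) (hn n t) = Z n t) sequentially"
          using eventually_not_near_support[OF elim(2), of K] by eventually_elim (simp add: Z_def support_nbhd_def)
        ultimately have "(\<lambda>n. Z n t) \<longlonglongrightarrow> tlog (real L) (exp (- \<psi> t))" by (rule Lim_transform_eventually)
        then show ?case by (rule tendsto_mult_left)
      qed
      show "AE t in circ. norm (poisson z (cis t) * Z n t) \<le> C0 * real L" for n
        by (intro AE_I2 norm_mult_le_nonneg P Zb)
    qed auto
    have "isCont Q z" using Qh z by (intro continuous_on_interior[OF holomorphic_on_imp_continuous_on]) auto
    moreover have "(\<lambda>n. complex_of_real (rseq n) * z) \<longlonglongrightarrow> complex_of_real 1 * z" by (intro tendsto_intros rseq_lim)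
    ultimately have ql: "(\<lambda>n. norm (Q (complex_of_real (rseq n) * z))) \<longlonglongrightarrow> norm (Q z)"
      by (intro tendsto_norm isCont_tendsto_compose[where g=Q]) auto
    have rl: "(\<lambda>n. exp (e + C0 * (\<kappa> n * measure circ (support_nbhd K n) + c * (LINT t|circ. indicator (support_nbhd K n) t * vn n t)) + C0 * (32 / K * measure \<mu> UNIV)
           - (LINT t|circ. poisson z (cis t) * Z n t)))
       \<longlonglongrightarrow> exp (e + C0 * (0 + c * 0) + C0 * (32 / K * measure \<mu> UNIV) - (LINT t|circ. poisson z (cis t) * tlog (real L) (exp (- \<psi> t))))"
      by (intro tendsto_exp tendsto_diff tendsto_add tendsto_mult tendsto_const Vm vm zl)
    have "norm (Q z) \<le> exp (e + C0 * (0 + c * 0) + C0 * (32 / K * measure \<mu> UNIV) - (LINT t|circ. poisson z (cis t) * tlog (real L) (exp (- \<psi> t))))"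
    proof (rule tendsto_le[OF sequentially_bot rl ql])
      show "\<forall>\<^sub>F n in sequentially. norm (Q (complex_of_real (rseq n) * z))
        \<le> exp (e + C0 * (\<kappa> n * measure circ (support_nbhd K n) + c * (LINT t|circ. indicator (support_nbhd K n) t * vn n t)) + C0 * (32 / K * measure \<mu> UNIV)
           - (LINT t|circ. poisson z (cis t) * Z n t))"
        using ev by eventually_elim (rule step, auto)
    qed
    then show ?thesis by simp
  qed
  have main2: "norm (Q z) \<le> exp (- (LINT t|circ. poisson z (cis t) * tlog (real L) (exp (- \<psi> t))))" for L :: nat
  proof -
    let ?T = "LINT t|circ. poisson z (cis t) * tlog (real L) (exp (- \<psi> t))"
    have inv: "(\<lambda>k::nat. 1 / real (k + 2)) \<longlonglongrightarrow> 0"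
      using LIMSEQ_ignore_initial_segment[OF lim_1_over_n[where 'a=real], of 2] .
    have "(\<lambda>k::nat. exp (1 / real (k + 2) + C0 * (32 * (1 / real (k + 2)) * measure \<mu> UNIV) - ?T)) \<longlonglongrightarrow> exp (0 + C0 * (32 * 0 * measure \<mu> UNIV) - ?T)"
      by (intro tendsto_intros inv)
    moreover have "norm (Q z) \<le> exp (1 / real (k + 2) + C0 * (32 * (1 / real (k + 2)) * measure \<mu> UNIV) - ?T)" for k :: nat
      using main[of "1 / real (k + 2)" "real (k + 2)" L] by simp
    ultimately have "norm (Q z) \<le> exp (0 + C0 * (32 * 0 * measure \<mu> UNIV) - ?T)" by (intro LIMSEQ_le_const) auto
    then show ?thesis by simp
  qed
  have tll: "(\<lambda>L. LINT t|circ. poisson z (cis t) * tlog (real L) (exp (- \<psi> t))) \<longlonglongrightarrow> (LINT t|circ. poisson z (cis t) * \<psi> t)"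
  proof (rule integral_dominated_convergence[where w="\<lambda>t. C0 * \<psi> t"])
    show "integrable circ (\<lambda>t. C0 * \<psi> t)" using \<psi>(1) by simp
    show "AE t in circ. (\<lambda>L. poisson z (cis t) * tlog (real L) (exp (- \<psi> t))) \<longlonglongrightarrow> poisson z (cis t) * \<psi> t"
    proof (rule AE_I2, rule tendsto_mult_left, rule tendsto_eventually)
      fix t
      obtain k :: nat where "\<psi> t \<le> real k" using real_arch_simple by blast
      then show "\<forall>\<^sub>F L in sequentially. tlog (real L) (exp (- \<psi> t)) = \<psi> t"
        by (intro eventually_sequentiallyI[of k]) (simp add: tlog_eq_ln)
    qed
    show "AE t in circ. norm (poisson z (cis t) * tlog (real L) (exp (- \<psi> t))) \<le> C0 * \<psi> t" for L
    proof (intro AE_I2 norm_mult_le_nonneg P)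
      fix t
      show "0 \<le> tlog (real L) (exp (- \<psi> t))" by (intro tlog_bounds) (use \<psi>(2) in auto)
      show "tlog (real L) (exp (- \<psi> t)) \<le> \<psi> t" using tlog_le_ln[of "exp (- \<psi> t)" "real L"] by simp
    qed
  qed auto
  have "norm (Q z) \<le> exp (- (LINT t|circ. poisson z (cis t) * \<psi> t))"
    by (rule LIMSEQ_le_const[OF tendsto_exp[OF tendsto_minus[OF tll]]]) (use main2 in auto)
  then have "norm (q z) * exp (potential z) * exp (- potential z) \<le> exp (- (LINT t|circ. poisson z (cis t) * \<psi> t)) * exp (- potential z)"
    unfolding nQ by (intro mult_right_mono) auto
  then show ?thesis by (simp add: exp_minus exp_diff field_simps)
qed

end

section \<open>Blaschke products\<close>

lemma blaschke_denom:
  assumes "norm a < 1" "norm z < 1"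
  shows "1 - norm z \<le> norm (1 - cnj a * z)" "1 - norm a \<le> norm (1 - cnj a * z)" "1 - cnj a * z \<noteq> 0"
proof -
  have p: "norm (cnj a * z) \<le> norm z" "norm (cnj a * z) \<le> norm a"
    using mult_right_mono[of "norm a" 1 "norm z"] mult_left_mono[of "norm z" 1 "norm a"] assms by (simp_all add: norm_mult)
  have "1 - norm (cnj a * z) \<le> norm (1 - cnj a * z)" using norm_triangle_ineq2[of 1 "cnj a * z"] by simp
  then show "1 - norm z \<le> norm (1 - cnj a * z)" "1 - norm a \<le> norm (1 - cnj a * z)" using p by auto
  then show "1 - cnj a * z \<noteq> 0" using assms by auto
qed

lemma blaschke_factor_holomorphic:
  assumes "norm a < 1" shows "blaschke_factor a holomorphic_on ball 0 1"
proof (cases "a = 0")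
  case False
  have "(\<lambda>z. (complex_of_real (norm a) / a) * ((a - z) / (1 - cnj a * z))) holomorphic_on ball 0 1"
    by (intro holomorphic_intros) (use blaschke_denom(3)[OF assms] in auto)
  then show ?thesis using False by (simp add: blaschke_factor_def[abs_def])
qed (simp add: blaschke_factor_def[abs_def] holomorphic_on_ident)

lemma norm_blaschke_factor:
  assumes "norm a < 1" "norm z < 1"
  shows "norm (blaschke_factor a z) = norm (a - z) / norm (1 - cnj a * z)"
  by (cases "a = 0") (simp_all add: blaschke_factor_def norm_mult norm_divide)

lemma norm_blaschke_factor_sq:
  assumes "norm a < 1" "norm z < 1"
  shows "(norm (blaschke_factor a z))^2 = 1 - (1 - (norm a)^2) * (1 - (norm z)^2) / (norm (1 - cnj a * z))^2"
proof -
  have "(norm (a - z))^2 = (norm (1 - cnj a * z))^2 - (1 - (norm a)^2) * (1 - (norm z)^2)"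
    unfolding cmod_power2 by (simp add: power2_eq_square algebra_simps)
  moreover have "norm (1 - cnj a * z) \<noteq> 0" using blaschke_denom(3)[OF assms] by simp
  ultimately show ?thesis unfolding norm_blaschke_factor[OF assms] power_divide by (simp add: diff_divide_distrib)
qed

lemma norm_blaschke_factor_le_1:
  assumes "norm a < 1" "norm z < 1" shows "norm (blaschke_factor a z) \<le> 1"
proof (rule power2_le_imp_le)
  have "0 \<le> (1 - (norm a)^2) * (1 - (norm z)^2) / (norm (1 - cnj a * z))^2"
    using assms by (intro divide_nonneg_nonneg mult_nonneg_nonneg) (auto simp: power_le_one)
  then show "(norm (blaschke_factor a z))^2 \<le> 1^2" unfolding norm_blaschke_factor_sq[OF assms] by simp
qed simp

lemma norm_blaschke_factor_le:
  assumes a: "norm a < 1" and z: "norm z < 1"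
  shows "norm (blaschke_factor a z) \<le> norm (z - a) / (1 - norm a)"
  unfolding norm_blaschke_factor[OF assms] norm_minus_commute[of a z]
  using blaschke_denom(2,3)[OF assms] a by (intro divide_left_mono mult_pos_pos) auto

text \<open>A Blaschke factor and \<open>z - a\<close> agree up to a function without zeros in the disc.\<close>

lemma blaschke_factor_unit:
  assumes a: "norm a < 1"
  obtains u where "u holomorphic_on ball 0 1" "\<And>z. norm z < 1 \<Longrightarrow> z - a = blaschke_factor a z * u z"
proof -
  define u where "u = (\<lambda>z. if a = 0 then 1 else - (a / complex_of_real (norm a)) * (1 - cnj a * z))"
  have u: "u holomorphic_on ball 0 1" unfolding u_def by (cases "a = 0") (auto intro!: holomorphic_intros)
  have e: "z - a = blaschke_factor a z * u z" if z: "norm z < 1" for z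
    using blaschke_denom(3)[OF a z] by (simp add: u_def blaschke_factor_def field_simps)
  show thesis by (rule that[OF u e])
qed

lemma blaschke_factor_near_1:
  assumes a: "norm a < 1" and z: "norm z < 1"
  shows "norm (1 - blaschke_factor a z) \<le> 2 / (1 - norm z) * (1 - norm a)"
proof (cases "a = 0")
  case True
  have "norm (1 - z) \<le> 1 + norm z" using norm_triangle_ineq4[of 1 z] by simp
  also have "\<dots> \<le> 2" using z by simp
  also have "2 \<le> 2 / (1 - norm z)" using z by (simp add: pos_le_divide_eq)
  finally show ?thesis using True by (simp add: blaschke_factor_def)
next
  case False
  define r where "r = complex_of_real (norm a)"
  have rr: "a * cnj a = r * r" unfolding r_def by (metis complex_norm_square of_real_mult power2_eq_square)
  have d: "1 - cnj a * z \<noteq> 0" by (rule blaschke_denom(3)[OF a z])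
  have num: "a * (1 - cnj a * z) - r * (a - z) = (1 - r) * (a + r * z)"
  proof -
    have "a * (1 - cnj a * z) - r * (a - z) = a - (a * cnj a) * z - r * a + r * z" by (simp add: algebra_simps)
    also have "\<dots> = (1 - r) * (a + r * z)" unfolding rr by (simp add: algebra_simps)
    finally show ?thesis .
  qed
  have "1 - blaschke_factor a z = (a * (1 - cnj a * z) - r * (a - z)) / (a * (1 - cnj a * z))"
  proof -
    have "1 - r / a * ((a - z) / w) = (a * w - r * (a - z)) / (a * w)" if "w \<noteq> 0" for w
      using False that by (simp add: field_simps)
    from this[OF d] show ?thesis using False by (simp add: blaschke_factor_def r_def)
  qed
  then have eq: "1 - blaschke_factor a z = (1 - r) * (a + r * z) / (a * (1 - cnj a * z))" unfolding num .
  have n1: "norm (1 - r) = 1 - norm a"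
  proof -
    have "1 - r = complex_of_real (1 - norm a)" by (simp add: r_def)
    then show ?thesis using a by (simp del: of_real_diff)
  qed
  have n2: "norm (a + r * z) \<le> norm a * 2"
  proof -
    have "norm (a + r * z) \<le> norm a + norm a * norm z" using norm_triangle_ineq[of a "r * z"] by (simp add: norm_mult r_def)
    also have "\<dots> \<le> norm a + norm a * 1" using z by (intro add_left_mono mult_left_mono) auto
    finally show ?thesis by simp
  qed
  have "norm (1 - blaschke_factor a z) = (1 - norm a) * norm (a + r * z) / (norm a * norm (1 - cnj a * z))"
    unfolding eq norm_divide norm_mult n1 ..
  also have "\<dots> \<le> (1 - norm a) * (norm a * 2) / (norm a * (1 - norm z))"
    using blaschke_denom(1)[OF a z] False a z by (intro frac_le mult_left_mono n2) auto
  also have "\<dots> = 2 / (1 - norm z) * (1 - norm a)" using False by simp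
  finally show ?thesis .
qed

text \<open>
  For functions bounded by 1 this says that \<open>|b|\<close> tends to 1 uniformly at the circle. The
  exponential form makes it multiplicative.
\<close>

definition boundary_unimodular :: "(complex \<Rightarrow> complex) \<Rightarrow> bool" where
  "boundary_unimodular b \<longleftrightarrow> (\<forall>e>0. \<exists>r0<1. \<forall>z. r0 \<le> norm z \<longrightarrow> norm z < 1 \<longrightarrow> exp (- e) \<le> norm (b z))"

lemma boundary_unimodular_mult:
  assumes "boundary_unimodular f" "boundary_unimodular g"
  shows "boundary_unimodular (\<lambda>z. f z * g z)"
  unfolding boundary_unimodular_def
proof (intro allI impI)
  fix e :: real assume "e > 0"
  then have e: "e / 2 > 0" by simp
  obtain r1 where r1: "r1 < 1" "\<And>z. r1 \<le> norm z \<Longrightarrow> norm z < 1 \<Longrightarrow> exp (- (e/2)) \<le> norm (f z)"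
    using assms(1) e unfolding boundary_unimodular_def by blast
  obtain r2 where r2: "r2 < 1" "\<And>z. r2 \<le> norm z \<Longrightarrow> norm z < 1 \<Longrightarrow> exp (- (e/2)) \<le> norm (g z)"
    using assms(2) e unfolding boundary_unimodular_def by blast
  show "\<exists>r0<1. \<forall>z. r0 \<le> norm z \<longrightarrow> norm z < 1 \<longrightarrow> exp (- e) \<le> norm (f z * g z)"
  proof (intro exI[of _ "max r1 r2"] conjI allI impI)
    fix z :: complex assume z: "max r1 r2 \<le> norm z" "norm z < 1"
    have "exp (- (e/2)) * exp (- (e/2)) \<le> norm (f z) * norm (g z)"
      using z by (intro mult_mono r1(2) r2(2)) auto
    then show "exp (- e) \<le> norm (f z * g z)" by (simp add: norm_mult exp_add[symmetric])
  qed (use r1 r2 in simp)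
qed

lemma boundary_unimodular_1: "boundary_unimodular (\<lambda>_. 1)"
  unfolding boundary_unimodular_def by (auto intro: exI[of _ 0])

lemma boundary_unimodular_power: "boundary_unimodular f \<Longrightarrow> boundary_unimodular (\<lambda>z. f z ^ m)"
  by (induction m) (auto intro: boundary_unimodular_1 boundary_unimodular_mult)

lemma boundary_unimodular_prod:
  "(\<And>a. a \<in> A \<Longrightarrow> boundary_unimodular (f a)) \<Longrightarrow> boundary_unimodular (\<lambda>z. \<Prod>a\<in>A. f a z)"
  by (induction A rule: infinite_finite_induct) (auto intro: boundary_unimodular_1 boundary_unimodular_mult)

lemma boundary_unimodular_blaschke_factor:
  assumes a: "norm a < 1" shows "boundary_unimodular (blaschke_factor a)"
  unfolding boundary_unimodular_def
proof (intro allI impI)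
  fix e :: real assume e: "e > 0"
  define c where "c = 1 / (1 - norm a)^2"
  have "((\<lambda>r. 1 - c * (1 - r^2)) \<longlongrightarrow> 1 - c * (1 - 1^2)) (at_left 1)" by (intro tendsto_intros)
  moreover have "exp (- e)^2 < 1 - c * (1 - 1^2)" using e by (simp add: power_strict_decreasing exp_double[symmetric])
  ultimately have "eventually (\<lambda>r. exp (- e)^2 < 1 - c * (1 - r^2)) (at_left 1)" by (rule order_tendstoD(1))
  then obtain r0 where r0: "r0 < 1" "\<And>r. r0 < r \<Longrightarrow> r < 1 \<Longrightarrow> exp (- e)^2 < 1 - c * (1 - r^2)"
    unfolding eventually_at_left_field by blast
  show "\<exists>r0<1. \<forall>z. r0 \<le> norm z \<longrightarrow> norm z < 1 \<longrightarrow> exp (- e) \<le> norm (blaschke_factor a z)"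
  proof (intro exI[of _ "(r0 + 1)/2"] conjI allI impI)
    fix z :: complex assume z: "(r0 + 1) / 2 \<le> norm z" "norm z < 1"
    have "(1 - (norm a)^2) * (1 - (norm z)^2) / (norm (1 - cnj a * z))^2 \<le> 1 * (1 - (norm z)^2) / (1 - norm a)^2"
      using a z blaschke_denom(2)[OF a z(2)]
      by (intro frac_le mult_right_mono mult_nonneg_nonneg power_mono) (auto simp: power_le_one)
    then have "1 - c * (1 - (norm z)^2) \<le> (norm (blaschke_factor a z))^2"
      unfolding norm_blaschke_factor_sq[OF a z(2)] by (simp add: c_def)
    moreover have "exp (- e)^2 < 1 - c * (1 - (norm z)^2)" using z r0(1) by (intro r0(2)) auto
    ultimately have "exp (- e)^2 \<le> (norm (blaschke_factor a z))^2" by linarith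
    then show "exp (- e) \<le> norm (blaschke_factor a z)" by (rule power2_le_imp_le) simp
  qed (use r0 in simp)
qed

abbreviation finite_blaschke :: "(complex \<Rightarrow> nat) \<Rightarrow> complex set \<Rightarrow> complex \<Rightarrow> complex" where
  "finite_blaschke m A z \<equiv> (\<Prod>a\<in>A. blaschke_factor a z ^ m a)"

lemma finite_blaschke_holomorphic:
  "A \<subseteq> ball 0 1 \<Longrightarrow> finite_blaschke m A holomorphic_on ball 0 1"
  by (intro holomorphic_on_prod holomorphic_on_power blaschke_factor_holomorphic) auto

lemma norm_finite_blaschke_le_1:
  "A \<subseteq> ball 0 1 \<Longrightarrow> norm z < 1 \<Longrightarrow> norm (finite_blaschke m A z) \<le> 1"
  unfolding prod_norm[symmetric] by (intro prod_le_1) (auto simp: norm_power intro!: power_le_one norm_blaschke_factor_le_1)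

lemma boundary_unimodular_finite_blaschke:
  "A \<subseteq> ball 0 1 \<Longrightarrow> boundary_unimodular (finite_blaschke m A)"
  by (intro boundary_unimodular_prod boundary_unimodular_power boundary_unimodular_blaschke_factor) auto

lemma finite_blaschke_antimono:
  assumes "finite F" "A \<subseteq> F" "F \<subseteq> ball 0 1" "norm z < 1"
  shows "norm (finite_blaschke m F z) \<le> norm (finite_blaschke m A z)"
    "norm (finite_blaschke m F z - finite_blaschke m A z) \<le> (\<Sum>a\<in>F - A. norm (1 - blaschke_factor a z ^ m a))"
proof -
  have A1: "A \<subseteq> ball 0 1" and FA: "F - A \<subseteq> ball 0 1" using assms by auto
  have eq: "finite_blaschke m F z = finite_blaschke m (F - A) z * finite_blaschke m A z"
    by (rule prod.subset_diff[OF assms(2,1)])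
  have "norm (finite_blaschke m (F - A) z) * norm (finite_blaschke m A z) \<le> 1 * norm (finite_blaschke m A z)"
    by (intro mult_right_mono norm_finite_blaschke_le_1[OF FA assms(4)]) auto
  then show "norm (finite_blaschke m F z) \<le> norm (finite_blaschke m A z)" unfolding eq norm_mult by simp
  have "finite_blaschke m F z - finite_blaschke m A z = (finite_blaschke m (F - A) z - 1) * finite_blaschke m A z"
    unfolding eq by (simp add: algebra_simps)
  then have "norm (finite_blaschke m F z - finite_blaschke m A z) = norm (finite_blaschke m (F - A) z - 1) * norm (finite_blaschke m A z)"
    by (simp only: norm_mult)
  also have "\<dots> \<le> norm (finite_blaschke m (F - A) z - 1) * 1"
    by (intro mult_left_mono norm_finite_blaschke_le_1[OF A1 assms(4)]) auto
  also have "\<dots> = norm (finite_blaschke m (F - A) z - (\<Prod>a\<in>F - A. 1))" by simp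
  also have "\<dots> \<le> (\<Sum>a\<in>F - A. norm (blaschke_factor a z ^ m a - 1))"
    using FA assms(4) by (intro norm_prod_diff) (auto simp: norm_power intro!: power_le_one norm_blaschke_factor_le_1)
  finally show "norm (finite_blaschke m F z - finite_blaschke m A z) \<le> (\<Sum>a\<in>F - A. norm (1 - blaschke_factor a z ^ m a))"
    by (simp add: norm_minus_commute)
qed

lemma blaschke_summable:
  assumes m: "blaschke_zeros m" and z: "norm z < 1"
  shows "(\<lambda>a. norm (1 - blaschke_factor a z ^ m a)) summable_on {a. m a > 0}"
proof (rule summable_on_comparison_test)
  show "(\<lambda>a. 2 / (1 - norm z) * (real (m a) * (1 - norm a))) summable_on {a. m a > 0}"
    using m unfolding blaschke_zeros_def by (intro summable_on_cmult_right) auto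
  fix a assume "a \<in> {a. m a > 0}"
  then have a: "norm a < 1" using m unfolding blaschke_zeros_def by auto
  have "norm (1 ^ m a - blaschke_factor a z ^ m a) \<le> real (m a) * norm (1 - blaschke_factor a z)"
    by (intro norm_power_diff norm_blaschke_factor_le_1[OF a z]) simp
  also have "\<dots> \<le> real (m a) * (2 / (1 - norm z) * (1 - norm a))"
    by (intro mult_left_mono blaschke_factor_near_1[OF a z]) simp
  finally show "norm (1 - blaschke_factor a z ^ m a) \<le> 2 / (1 - norm z) * (real (m a) * (1 - norm a))" by (simp add: mult_ac)
qed simp

text \<open>
  The net of finite products is Cauchy: all factors are bounded by 1, so enlarging a finite set
  changes the product by at most the sum of the distances of the new factors from 1, and these
  distances are summable by the Blaschke condition.
\<close>

lemma blaschke_product_tendsto: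
  assumes m: "blaschke_zeros m" and z: "norm z < 1"
  shows "((\<lambda>A. finite_blaschke m A z) \<longlongrightarrow> blaschke_product m z) (finite_subsets_at_top {a. m a > 0})"
proof -
  define S where "S = {a. m a > 0}"
  define d where "d = (\<lambda>a. norm (1 - blaschke_factor a z ^ m a))"
  have S: "S \<subseteq> ball 0 1" using m unfolding blaschke_zeros_def S_def by auto
  have sd: "(sum d \<longlongrightarrow> infsum d S) (finite_subsets_at_top S)"
    using has_sum_infsum[OF blaschke_summable[OF m z]] by (simp add: has_sum_def d_def S_def)
  have "cauchy_filter (filtermap (\<lambda>A. finite_blaschke m A z) (finite_subsets_at_top S))"
    unfolding cauchy_filter_metric_filtermap
  proof (intro allI impI)
    fix e :: real assume "e > 0"
    then have e: "e / 4 > 0" by simp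
    obtain A0 where A0: "finite A0" "A0 \<subseteq> S" "\<And>Y. finite Y \<Longrightarrow> A0 \<subseteq> Y \<Longrightarrow> Y \<subseteq> S \<Longrightarrow> dist (sum d Y) (infsum d S) < e / 4"
      using tendstoD[OF sd e] unfolding eventually_finite_subsets_at_top by auto
    define P where "P = (\<lambda>Y. finite Y \<and> A0 \<subseteq> Y \<and> Y \<subseteq> S)"
    have near: "dist (finite_blaschke m Y z) (finite_blaschke m A0 z) < e / 2" if "P Y" for Y
    proof -
      have Y: "finite Y" "A0 \<subseteq> Y" "Y \<subseteq> S" using that by (auto simp: P_def)
      have "dist (finite_blaschke m Y z) (finite_blaschke m A0 z) \<le> sum d (Y - A0)"
        unfolding dist_norm d_def using Y S by (intro finite_blaschke_antimono z) auto
      also have "\<dots> = sum d Y - sum d A0" using Y by (intro sum_diff) auto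
      also have "\<dots> < e / 2" using A0(3)[OF Y] A0(3)[OF A0(1) order_refl A0(2)] unfolding dist_real_def by linarith
      finally show ?thesis .
    qed
    show "\<exists>P. eventually P (finite_subsets_at_top S) \<and> (\<forall>x y. P x \<and> P y \<longrightarrow> dist (finite_blaschke m x z) (finite_blaschke m y z) < e)"
    proof (intro exI[of _ P] conjI allI impI)
      show "eventually P (finite_subsets_at_top S)"
        unfolding eventually_finite_subsets_at_top P_def using A0 by (intro exI[of _ A0]) auto
      show "dist (finite_blaschke m x z) (finite_blaschke m y z) < e" if "P x \<and> P y" for x y
        using that by (intro dist_triangle_half_l[OF near near]) auto
    qed
  qed
  from cauchy_filter_complete_converges[OF this complete_UNIV]
  obtain l where "((\<lambda>A. finite_blaschke m A z) \<longlongrightarrow> l) (finite_subsets_at_top S)"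
    by (auto simp: filterlim_def filtermap_bot_iff)
  moreover from this have "blaschke_product m z = l"
    unfolding blaschke_product_def S_def[symmetric] by (intro tendsto_Lim) auto
  ultimately show ?thesis by (simp add: S_def)
qed

lemma blaschke_product_le_finite:
  assumes m: "blaschke_zeros m" and z: "norm z < 1" and A: "finite A" "A \<subseteq> {a. m a > 0}"
  shows "norm (blaschke_product m z) \<le> norm (finite_blaschke m A z)"
proof (rule tendsto_upperbound[OF tendsto_norm[OF blaschke_product_tendsto[OF m z]]])
  show "\<forall>\<^sub>F F in finite_subsets_at_top {a. m a > 0}. norm (finite_blaschke m F z) \<le> norm (finite_blaschke m A z)"
    unfolding eventually_finite_subsets_at_top
  proof (intro exI[of _ A] conjI allI impI A)
    fix F assume "finite F \<and> A \<subseteq> F \<and> F \<subseteq> {a. m a > 0}"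
    then show "norm (finite_blaschke m F z) \<le> norm (finite_blaschke m A z)"
      using m z unfolding blaschke_zeros_def by (intro finite_blaschke_antimono) auto
  qed
qed simp

text \<open>
  The Blaschke condition makes the support countable, so the net limit is a limit along one
  sequence of finite sets, the same sequence for every \<open>z\<close>.
\<close>

lemma blaschke_zeros_exhaustion:
  assumes m: "blaschke_zeros m"
  obtains A :: "nat \<Rightarrow> complex set" where "\<And>k. finite (A k)" "\<And>k. A k \<subseteq> {a. m a > 0}"
    "\<And>z. norm z < 1 \<Longrightarrow> (\<lambda>k. finite_blaschke m (A k) z) \<longlonglongrightarrow> blaschke_product m z"
proof -
  define S where "S = {a. m a > 0}"
  have "countable {a \<in> S. real (m a) * (1 - norm a) \<noteq> 0}"
    using m unfolding blaschke_zeros_def S_def by (intro summable_countable_real) auto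
  also have "{a \<in> S. real (m a) * (1 - norm a) \<noteq> 0} = S"
    using m unfolding blaschke_zeros_def S_def by auto
  finally have S: "countable S" .
  define A where "A = (\<lambda>k::nat. {a \<in> S. to_nat_on S a < k})"
  have fin: "finite (A k)" for k
  proof (rule finite_imageD)
    show "finite (to_nat_on S ` A k)" by (rule finite_subset[of _ "{..<k}"]) (auto simp: A_def)
    show "inj_on (to_nat_on S) (A k)" by (rule inj_on_subset[OF inj_on_to_nat_on[OF S]]) (auto simp: A_def)
  qed
  have "filterlim A (finite_subsets_at_top S) sequentially"
    unfolding filterlim_finite_subsets_at_top
  proof (intro allI impI)
    fix X assume X: "finite X \<and> X \<subseteq> S"
    then obtain K where K: "\<forall>i\<in>to_nat_on S ` X. i < K" using finite_nat_set_iff_bounded[of "to_nat_on S ` X"] by auto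
    show "\<forall>\<^sub>F k in sequentially. finite (A k) \<and> X \<subseteq> A k \<and> A k \<subseteq> S"
      by (rule eventually_sequentiallyI[of K]) (use fin X K in \<open>force simp: A_def\<close>)
  qed
  then have "(\<lambda>k. finite_blaschke m (A k) z) \<longlonglongrightarrow> blaschke_product m z" if "norm z < 1" for z
    using filterlim_compose[OF blaschke_product_tendsto[OF m that, folded S_def]] by blast
  with fin show thesis by (intro that[of A]) (auto simp: A_def S_def)
qed

lemma blaschke_zeros_restrict:
  assumes "blaschke_zeros m" shows "blaschke_zeros (\<lambda>a. if m a > n then m a else 0)"
proof -
  have s: "{a. (if m a > n then m a else 0) > 0} = {a. m a > n}" by auto
  have "(\<lambda>a. real (m a) * (1 - norm a)) summable_on {a. m a > n}"
    by (rule summable_on_subset_banach[of _ "{a. m a > 0}"]) (use assms in \<open>auto simp: blaschke_zeros_def\<close>)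
  then have "(\<lambda>a. real (if m a > n then m a else 0) * (1 - norm a)) summable_on {a. m a > n}"
    by (rule summable_on_cong[THEN iffD1, rotated]) auto
  then show ?thesis unfolding blaschke_zeros_def s using assms by (auto simp: blaschke_zeros_def)
qed

text \<open>
  Induction over the zeros. At a new zero \<open>a\<close> the product already divided out is bounded away from
  0, so the quotient still satisfies the bound of order \<open>m a\<close> there.
\<close>

lemma factor_finite_blaschke:
  assumes p: "p holomorphic_on ball 0 1" and A: "finite A" "A \<subseteq> ball 0 1"
    and order: "\<And>a. a \<in> A \<Longrightarrow> \<exists>q. q holomorphic_on ball 0 1 \<and> (\<forall>z. norm z < 1 \<longrightarrow> p z = (z - a)^m a * q z)"
  shows "\<exists>q. q holomorphic_on ball 0 1 \<and> (\<forall>z. norm z < 1 \<longrightarrow> p z = finite_blaschke m A z * q z)"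
  using A order
proof (induction A rule: finite_induct)
  case empty
  show ?case using p by auto
next
  case (insert a A)
  have a: "norm a < 1" using insert.prems by auto
  obtain q where q: "q holomorphic_on ball 0 1" "\<And>z. norm z < 1 \<Longrightarrow> p z = finite_blaschke m A z * q z"
    using insert.IH insert.prems by auto
  obtain s where s: "s holomorphic_on ball 0 1" "\<And>z. norm z < 1 \<Longrightarrow> p z = (z - a)^m a * s z"
    using insert.prems(2)[of a] by auto
  have bh: "finite_blaschke m A holomorphic_on ball 0 1" using insert.prems by (intro finite_blaschke_holomorphic) auto
  have "finite_blaschke m A a \<noteq> 0"
  proof -
    have "blaschke_factor b a \<noteq> 0" if "b \<in> A" for b
    proof -
      have "norm b < 1" "b \<noteq> a" using that insert.hyps insert.prems by auto
      then show ?thesis using norm_blaschke_factor[of b a] a blaschke_denom(3)[of b a]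
        by (metis divide_eq_0_iff norm_eq_zero right_minus_eq)
    qed
    then show ?thesis using insert.hyps by simp
  qed
  then have pos: "norm (finite_blaschke m A a) > 0" by simp
  have cont: "isCont (finite_blaschke m A) a" "isCont s a"
    using bh s(1) a by (auto intro!: continuous_on_interior[OF holomorphic_on_imp_continuous_on])
  define \<beta> where "\<beta> = norm (finite_blaschke m A a) / 2"
  have \<beta>: "\<beta> > 0" "\<beta> < norm (finite_blaschke m A a)" using pos by (auto simp: \<beta>_def)
  have "eventually (\<lambda>z. \<beta> < norm (finite_blaschke m A z) \<and> norm (s z) < norm (s a) + 1) (nhds a)"
  proof (rule eventually_conj)
    have l: "((\<lambda>z. norm (g z)) \<longlongrightarrow> norm (g a)) (nhds a)" if "isCont g a" for g :: "complex \<Rightarrow> complex"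
      using that unfolding isCont_def tendsto_at_iff_tendsto_nhds by (rule tendsto_norm)
    show "eventually (\<lambda>z. \<beta> < norm (finite_blaschke m A z)) (nhds a)" by (rule order_tendstoD(1)[OF l[OF cont(1)] \<beta>(2)])
    show "eventually (\<lambda>z. norm (s z) < norm (s a) + 1) (nhds a)" by (rule order_tendstoD(2)[OF l[OF cont(2)]]) simp
  qed
  then obtain \<delta> where \<delta>: "\<delta> > 0" "\<And>z. dist z a < \<delta> \<Longrightarrow> \<beta> < norm (finite_blaschke m A z) \<and> norm (s z) < norm (s a) + 1"
    unfolding eventually_nhds_metric by blast
  have "\<exists>q'. q' holomorphic_on ball 0 1 \<and> (\<forall>z. norm z < 1 \<longrightarrow> q z = (z - a)^m a * q' z)"
  proof (rule factor_from_bound[OF q(1) a \<delta>(1), where C="(norm (s a) + 1) / \<beta>"])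
    fix z assume z: "norm z < 1" "norm (z - a) < \<delta>"
    have "\<beta> * norm (q z) \<le> norm (finite_blaschke m A z) * norm (q z)"
      using \<delta>(2)[of z] z by (intro mult_right_mono) (auto simp: dist_norm)
    also have "\<dots> = norm (p z)" using q(2)[OF z(1)] by (simp only: norm_mult)
    also have "\<dots> = norm (s z) * norm (z - a)^m a" using s(2)[OF z(1)] by (simp add: norm_mult norm_power)
    also have "\<dots> \<le> (norm (s a) + 1) * norm (z - a)^m a"
      using \<delta>(2)[of z] z by (intro mult_right_mono) (auto simp: dist_norm)
    finally show "norm (q z) \<le> (norm (s a) + 1) / \<beta> * norm (z - a)^m a"
      using \<beta>(1) by (simp add: pos_le_divide_eq mult.commute)
  qed
  then obtain q' where q': "q' holomorphic_on ball 0 1" "\<And>z. norm z < 1 \<Longrightarrow> q z = (z - a)^m a * q' z" by blast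
  obtain u where u: "u holomorphic_on ball 0 1" "\<And>z. norm z < 1 \<Longrightarrow> z - a = blaschke_factor a z * u z"
    by (rule blaschke_factor_unit[OF a]) (rule that)
  show ?case
  proof (intro exI[of _ "\<lambda>z. u z ^ m a * q' z"] conjI allI impI)
    show "(\<lambda>z. u z ^ m a * q' z) holomorphic_on ball 0 1" by (intro holomorphic_intros u q')
    fix z :: complex assume z: "norm z < 1"
    have "p z = finite_blaschke m A z * ((blaschke_factor a z * u z)^m a * q' z)"
      unfolding q(2)[OF z] q'(2)[OF z] u(2)[OF z, symmetric] ..
    then show "p z = finite_blaschke m (insert a A) z * (u z ^ m a * q' z)"
      using insert.hyps by (simp add: power_mult_distrib mult_ac)
  qed
qed

section \<open>Divisibility\<close>

text \<open>
  The absolute value of \<open>ln \<phi>\<close> replaces \<open>ln \<phi>\<close>, because Harnack's inequality needs a positive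
  function. The cut-off by the indicator makes the density measurable on the whole line.
\<close>

lemma outer_function_bound:
  assumes "outer_function F"
  obtains \<psi> where "integrable circ \<psi>" "\<And>t. 0 \<le> \<psi> t"
    "\<And>z. norm z < 1 \<Longrightarrow> norm (F z) \<le> exp (Re (herglotz circ cis \<psi> z))"
proof -
  obtain c :: complex and \<phi> :: "real \<Rightarrow> real" where c: "norm c = 1"
    and \<phi>: "set_integrable lborel {0..2*pi} (\<lambda>t. ln (\<phi> t))"
    and F: "\<And>z. norm z < 1 \<Longrightarrow> F z = c * exp (1 / (2 * pi) *
        (LBINT t:{0..2*pi}. (cis t + z) / (cis t - z) * complex_of_real (ln (\<phi> t))))"
    using assms unfolding outer_function_def by auto
  define L where "L = (\<lambda>t. indicator {0..2*pi} t * ln (\<phi> t))"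
  have L1: "integrable lborel L" using \<phi> by (simp add: set_integrable_def L_def[abs_def])
  have Lm [measurable]: "L \<in> borel_measurable borel" using borel_measurable_integrable[OF L1] by simp
  have iL: "integrable circ L"
    unfolding integrable_circ_iff[OF Lm] set_integrable_def
    by (rule Bochner_Integration.integrable_cong[OF refl, THEN iffD1, OF _ L1]) (auto simp: L_def indicator_def)
  interpret L: circle_density circ cis L by (rule circle_density_circ[OF iL])
  interpret aL: circle_density circ cis "\<lambda>t. \<bar>L t\<bar>" by (intro circle_density_circ integrable_abs iL)
  have eq: "1 / (2 * pi) * (LBINT t:{0..2*pi}. (cis t + z) / (cis t - z) * complex_of_real (ln (\<phi> t))) = herglotz circ cis L z"
    if z: "norm z < 1" for z
  proof -
    have "(\<lambda>t. complex_of_real (L t) * ((cis t + z) / (cis t - z))) \<in> borel_measurable borel" by measurable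
    from integral_circ[OF this]
    have "herglotz circ cis L z = (LBINT t:{0..2*pi}. complex_of_real (L t) * ((cis t + z) / (cis t - z))) /\<^sub>R (2*pi)"
      by (simp add: herglotz_def)
    also have "(LBINT t:{0..2*pi}. complex_of_real (L t) * ((cis t + z) / (cis t - z)))
        = (LBINT t:{0..2*pi}. (cis t + z) / (cis t - z) * complex_of_real (ln (\<phi> t)))"
      by (rule set_lebesgue_integral_cong) (auto simp: L_def indicator_def)
    finally have r: "herglotz circ cis L z = (LBINT t:{0..2*pi}. (cis t + z) / (cis t - z) * complex_of_real (ln (\<phi> t))) /\<^sub>R (2*pi)" .
    have "1 / (2 * pi) * x = x /\<^sub>R (2*pi)" for x :: complex by (simp add: scaleR_conv_of_real inverse_eq_divide)
    then show ?thesis unfolding r .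
  qed
  show thesis
  proof (rule that[of "\<lambda>t. \<bar>L t\<bar>"])
    fix z :: complex assume z: "norm z < 1"
    have "Re (herglotz circ cis L z) \<le> Re (herglotz circ cis (\<lambda>t. \<bar>L t\<bar>) z)"
      unfolding L.Re_herglotz[OF z] aL.Re_herglotz[OF z]
      by (intro integral_mono L.integrable_rho_poisson aL.integrable_rho_poisson z mult_right_mono poisson_nonneg) (use z in auto)
    then show "norm (F z) \<le> exp (Re (herglotz circ cis (\<lambda>t. \<bar>L t\<bar>) z))"
      unfolding F[OF z] eq[OF z] norm_mult c by simp
  qed (auto intro: integrable_abs iL)
qed

text \<open>
  The bound transfers from \<open>g\<close> on the half disc at \<open>z\<close> to the single point \<open>z\<close>, with constants
  independent of \<open>z\<close> and \<open>B\<close>.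
\<close>

lemma diff_combo_local_bound:
  assumes g: "g holomorphic_on ball 0 1" and p: "diff_combo g k p"
  obtains C M where "0 \<le> C" "\<And>z B. norm z < 1 \<Longrightarrow> (\<And>w. norm (w - z) \<le> (1 - norm z)/2 \<Longrightarrow> norm (g w) \<le> B)
    \<Longrightarrow> norm (p z) \<le> C / (1 - norm z)^M * B"
proof -
  obtain c where c: "\<And>i. poly_growth (c i)" "\<And>z. norm z < 1 \<Longrightarrow> p z = (\<Sum>i\<le>k. c i z * (deriv ^^ i) g z)"
    using p unfolding diff_combo_def by blast
  have "\<forall>i. \<exists>C M. 0 \<le> C \<and> (\<forall>z. norm z < 1 \<longrightarrow> norm (c i z) \<le> C / (1 - norm z)^M)"
    using c(1) unfolding poly_growth_def by blast
  then obtain C' M' where C': "\<And>i. 0 \<le> C' i" "\<And>i z. norm z < 1 \<Longrightarrow> norm (c i z) \<le> C' i / (1 - norm z)^M' i"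
    by metis
  define C where "C = (\<Sum>i\<le>k. C' i * fact i * 2^i)"
  define M where "M = (\<Sum>i\<le>k. M' i + i)"
  show thesis
  proof (rule that[of C M])
    show "0 \<le> C" unfolding C_def by (intro sum_nonneg mult_nonneg_nonneg C') auto
    fix z :: complex and B assume z: "norm z < 1" and B: "\<And>w. norm (w - z) \<le> (1 - norm z)/2 \<Longrightarrow> norm (g w) \<le> B"
    define d where "d = 1 - norm z"
    have d: "0 < d" "d \<le> 1" using z by (auto simp: d_def)
    have B0: "0 \<le> B" using order_trans[OF norm_ge_zero B[of z]] z by simp
    have summand: "norm (c i z * (deriv ^^ i) g z) \<le> C' i * fact i * 2^i / d^M * B" if i: "i \<le> k" for i
    proof -
      have "norm (c i z * (deriv ^^ i) g z) \<le> (C' i / d^M' i) * (fact i * B * (2/d)^i)"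
        unfolding norm_mult d_def using C'(1)[of i] z
        by (intro mult_mono C'(2)[OF z] cauchy_half_disc[OF g z B]) auto
      also have "\<dots> = C' i * fact i * 2^i / d^(M' i + i) * B" by (simp add: power_add power_divide)
      also have "\<dots> \<le> C' i * fact i * 2^i / d^M * B"
      proof (intro mult_right_mono divide_left_mono B0)
        have "M' i + i \<le> M" unfolding M_def using i by (intro member_le_sum[where f="\<lambda>i. M' i + i"]) auto
        then show "d^M \<le> d^(M' i + i)" using d by (intro power_decreasing) auto
      qed (use C' d in auto)
      finally show ?thesis .
    qed
    have "norm (p z) \<le> (\<Sum>i\<le>k. norm (c i z * (deriv ^^ i) g z))" unfolding c(2)[OF z] by (rule norm_sum)
    also have "\<dots> \<le> (\<Sum>i\<le>k. C' i * fact i * 2^i / d^M * B)" by (intro sum_mono summand) auto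
    also have "\<dots> = C / d^M * B" unfolding C_def by (simp add: sum_distrib_right sum_divide_distrib)
    finally show "norm (p z) \<le> C / (1 - norm z)^M * B" unfolding d_def .
  qed
qed

lemma common_majorant:
  assumes "\<And>j. j \<le> (n::nat) \<Longrightarrow> f j \<in> hardy1_deriv n"
  obtains A where "A holomorphic_on ball 0 1"
    "\<And>j k z. j \<le> n \<Longrightarrow> k \<le> n \<Longrightarrow> norm z < 1 \<Longrightarrow> norm ((deriv ^^ k) (f j) z) \<le> Re (A z)"
proof -
  have "\<forall>j k. \<exists>A. j \<le> n \<longrightarrow> k \<le> n \<longrightarrow> A holomorphic_on ball 0 1 \<and> (\<forall>z. norm z < 1 \<longrightarrow> norm ((deriv ^^ k) (f j) z) \<le> Re (A z))"
    using hardy1_deriv_majorant[OF assms] by blast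
  then obtain A where A: "\<And>j k. j \<le> n \<Longrightarrow> k \<le> n \<Longrightarrow> A j k holomorphic_on ball 0 1"
    "\<And>j k z. j \<le> n \<Longrightarrow> k \<le> n \<Longrightarrow> norm z < 1 \<Longrightarrow> norm ((deriv ^^ k) (f j) z) \<le> Re (A j k z)"
    by metis
  have A0: "0 \<le> Re (A j k z)" if "j \<le> n" "k \<le> n" "norm z < 1" for j k z
    using order_trans[OF norm_ge_zero A(2)[OF that]] .
  show thesis
  proof (rule that[of "\<lambda>z. \<Sum>j\<le>n. \<Sum>k\<le>n. A j k z"])
    show "(\<lambda>z. \<Sum>j\<le>n. \<Sum>k\<le>n. A j k z) holomorphic_on ball 0 1" by (intro holomorphic_on_sum A) auto
    fix j k z assume j: "j \<le> n" "k \<le> n" and z: "norm (z::complex) < 1"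
    have "Re (A j k z) \<le> (\<Sum>k\<le>n. Re (A j k z))" using j z by (intro member_le_sum A0) auto
    also have "\<dots> \<le> (\<Sum>j\<le>n. \<Sum>k\<le>n. Re (A j k z))"
      using j z by (intro member_le_sum[where f="\<lambda>j. \<Sum>k\<le>n. Re (A j k z)"] sum_nonneg A0) auto
    finally show "norm ((deriv ^^ k) (f j) z) \<le> Re (\<Sum>j\<le>n. \<Sum>k\<le>n. A j k z)" using A(2)[OF j z] by simp
  qed
qed

text \<open>
  The Wronskian is bounded by \<open>C * (1 + Re A)^M \<le> C * exp (M * Re A)\<close>, so a constant multiple of
  the zero-free function \<open>exp (- M * A)\<close> makes it bounded by 1.
\<close>

lemma bounded_wronskian_multiple:
  assumes f: "\<And>j. j \<le> n \<Longrightarrow> f j holomorphic_on ball 0 1" and A: "A holomorphic_on ball 0 1"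
    and le: "\<And>j k z. j \<le> n \<Longrightarrow> k \<le> n \<Longrightarrow> norm z < 1 \<Longrightarrow> norm ((deriv ^^ k) (f j) z) \<le> Re (A z)"
  obtains E where "iter_wronskian n f holomorphic_on ball 0 1" "E holomorphic_on ball 0 1" "\<And>z. E z \<noteq> 0" "\<And>z. norm z < 1 \<Longrightarrow> norm (E z) \<le> 1"
    "\<And>z. norm z < 1 \<Longrightarrow> norm (iter_wronskian n f z * E z) \<le> 1"
proof -
  have A0: "0 \<le> Re (A z)" if "norm z < 1" for z using order_trans[OF norm_ge_zero le[OF _ _ that, of 0 0]] by simp
  have "controlled (\<lambda>z. Re (A z)) 0 (iter_wronskian n f)"
    by (rule controlled_iter_wronskian[OF A0]) (auto intro!: controlled_derivs f le A0)
  then obtain C M where Wh: "iter_wronskian n f holomorphic_on ball 0 1"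
    and C: "0 \<le> C" "\<And>z. norm z < 1 \<Longrightarrow> norm (iter_wronskian n f z) \<le> C * (1 + Re (A z))^M"
    by auto
  define E where "E = (\<lambda>z. complex_of_real (1 / max C 1) * exp (- of_nat M * A z))"
  have nE: "norm (E z) = 1 / max C 1 * exp (- real M * Re (A z))" for z by (simp add: E_def norm_mult norm_divide)
  show thesis
  proof (rule that[OF Wh, of E])
    show "E holomorphic_on ball 0 1" unfolding E_def by (intro holomorphic_intros A)
    show "E z \<noteq> 0" for z by (simp add: E_def)
    fix z :: complex assume z: "norm z < 1"
    have "1 / max C 1 * exp (- real M * Re (A z)) \<le> 1 * 1"
      using A0[OF z] by (intro mult_mono) auto
    then show "norm (E z) \<le> 1" unfolding nE by simp
    have "(1 + Re (A z))^M \<le> exp (Re (A z))^M" using A0[OF z] by (intro power_mono exp_ge_add_one_self) auto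
    then have "C * (1 + Re (A z))^M \<le> max C 1 * exp (Re (A z))^M" by (intro mult_mono) (use A0[OF z] in auto)
    then have "norm (iter_wronskian n f z) \<le> max C 1 * exp (real M * Re (A z))"
      using C(2)[OF z] by (simp add: exp_of_nat_mult)
    then have "norm (iter_wronskian n f z) * norm (E z) \<le> (max C 1 * exp (real M * Re (A z))) * norm (E z)"
      by (intro mult_right_mono) auto
    also have "\<dots> = 1" unfolding nE by (simp add: exp_minus)
    finally show "norm (iter_wronskian n f z * E z) \<le> 1" by (simp add: norm_mult)
  qed
qed

text \<open>
  Put \<open>h = (W * E)^N\<close>. If \<open>a\<close> is a zero of \<open>g\<close> of order \<open>m > n\<close>, then \<open>W\<close> has a zero of order at
  least \<open>m - n\<close> and \<open>h\<close> one of order at least \<open>N * (m - n) \<ge> m\<close>, because \<open>N > n\<close>. If \<open>u\<close> is the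
  potential of the singular factor of \<open>g\<close>, then Harnack's inequality gives \<open>|g| \<le> exp (12 * v - u
  / 12)\<close> on half discs, and Cauchy's estimate carries this to \<open>W\<close>; as \<open>N \<ge> 12\<close> and \<open>|W * E| \<le> 1\<close>,
  the power \<open>h\<close> recovers the full potential. So \<open>key_estimate\<close> applies to \<open>h\<close> divided by each
  finite part of the Blaschke product of \<open>K\<close>, and yields cofactors bounded by 1. Montel's theorem
  gives a cofactor for \<open>K\<close> itself. It is inner since its modulus lies between that of the inner
  function and 1.
\<close>

theorem inner_gt_divides:
  assumes g: "g holomorphic_on ball 0 1" and A: "A holomorphic_on ball 0 1"
    and le: "\<And>z. norm z < 1 \<Longrightarrow> norm (deriv g z) \<le> Re (A z)"
    and z1: "norm z1 < 1" "g z1 \<noteq> 0"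
    and I: "is_inner_factor I g" and K: "is_inner_gt n I K"
    and W: "diff_combo g n W" and E: "E holomorphic_on ball 0 1" "\<And>z. norm z < 1 \<Longrightarrow> norm (E z) \<le> 1"
    and WE: "W holomorphic_on ball 0 1" "\<And>z. norm z < 1 \<Longrightarrow> norm (W z * E z) \<le> 1"
    and N: "12 \<le> N" "n < N"
    and \<psi>: "integrable circ \<psi>" "\<And>t. \<psi> t \<ge> 0" "AE t in circ. norm (radial_limit (\<lambda>z. (W z * E z)^N) t) = exp (- \<psi> t)"
    and J: "inner_function (\<lambda>z. (W z * E z)^N * exp (herglotz circ cis \<psi> z))"
  shows "inner_divides K (\<lambda>z. (W z * E z)^N * exp (herglotz circ cis \<psi> z))"
proof -
  obtain c m \<mu> where c: "norm (c::complex) = 1" and m: "blaschke_zeros m" and \<mu>: "singular_circle_measure \<mu>"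
    and I_eq: "\<And>z. norm z < 1 \<Longrightarrow> I z = c * blaschke_product m z * singular_inner \<mu> z"
    and K_eq: "\<And>z. norm z < 1 \<Longrightarrow> K z = blaschke_product (\<lambda>a. if m a > n then m a else 0) z * singular_inner \<mu> z"
    using K unfolding is_inner_gt_def by auto
  interpret singular_measure \<mu> by unfold_locales (rule \<mu>)
  obtain F where F: "outer_function F" "\<And>z. norm z < 1 \<Longrightarrow> g z = I z * F z"
    using I unfolding is_inner_factor_def by auto
  obtain \<psi>0 where \<psi>0: "integrable circ \<psi>0" "\<And>t. 0 \<le> \<psi>0 t"
    "\<And>z. norm z < 1 \<Longrightarrow> norm (F z) \<le> exp (Re (herglotz circ cis \<psi>0 z))"
    by (rule outer_function_bound[OF F(1)]) (rule that)
  interpret v: circle_density circ cis \<psi>0 by (rule circle_density_circ[OF \<psi>0(1)])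
  interpret w: circle_density circ cis \<psi> by (rule circle_density_circ[OF \<psi>(1)])
  define v where "v = (\<lambda>z. Re (herglotz circ cis \<psi>0 z))"
  have ng: "norm (g z) \<le> norm (blaschke_product m z) * exp (v z - potential z)" if z: "norm z < 1" for z
  proof -
    have "norm (g z) = norm (blaschke_product m z) * exp (- potential z) * norm (F z)"
      unfolding F(2)[OF z] I_eq[OF z] norm_mult c norm_singular_inner by simp
    also have "\<dots> \<le> norm (blaschke_product m z) * exp (- potential z) * exp (v z)"
      unfolding v_def by (intro mult_left_mono \<psi>0(3)[OF z]) auto
    finally show ?thesis by (simp add: exp_diff exp_minus field_simps)
  qed
  have dom: "norm (g z) \<le> exp (v z - potential z)" if z: "norm z < 1" for z
  proof -
    have "norm (blaschke_product m z) \<le> 1" using blaschke_product_le_finite[OF m z, of "{}"] by simp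
    then have "norm (blaschke_product m z) * exp (v z - potential z) \<le> 1 * exp (v z - potential z)" by (intro mult_right_mono) auto
    from order_trans[OF ng[OF z] this] show ?thesis by (simp only: mult_1_left)
  qed
  define h where "h = (\<lambda>z. (W z * E z)^N)"
  have hh: "h holomorphic_on ball 0 1" unfolding h_def by (intro holomorphic_intros WE E)
  have h1: "norm (h z) \<le> 1" if "norm z < 1" for z
    unfolding h_def norm_power by (intro power_le_one WE(2) that) simp
  have hdom: "\<exists>C M. \<forall>z. norm z < 1 \<longrightarrow> norm (h z) \<le> C / (1 - norm z)^M * exp (144 * v z - potential z)"
  proof -
    obtain C M where C: "0 \<le> C" "\<And>z B. norm z < 1 \<Longrightarrow> (\<And>w. norm (w - z) \<le> (1 - norm z)/2 \<Longrightarrow> norm (g w) \<le> B)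
        \<Longrightarrow> norm (W z) \<le> C / (1 - norm z)^M * B"
      using diff_combo_local_bound[OF g W] by metis
    have "norm (h z) \<le> C^12 / (1 - norm z)^(12 * M) * exp (144 * v z - potential z)" if z: "norm z < 1" for z
    proof -
      have "norm (g x) \<le> exp (12 * v z - potential z / 12)" if x: "norm (x - z) \<le> (1 - norm z)/2" for x
      proof -
        have "v x \<le> 12 * v z" unfolding v_def by (rule v.herglotz_harnack(1)[OF z x \<psi>0(2)])
        moreover have "potential z \<le> 12 * potential x" unfolding potential_def by (rule sd.herglotz_harnack(2)[OF z x]) simp
        ultimately have "v x - potential x \<le> 12 * v z - potential z / 12" by linarith
        then show ?thesis using dom[OF half_disc(1)[OF z x]] by (meson exp_le_cancel_iff order_trans)
      qed
      from C(2)[OF z this] have Wz: "norm (W z) \<le> C / (1 - norm z)^M * exp (12 * v z - potential z / 12)" .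
      have "norm (W z * E z) \<le> norm (W z)" unfolding norm_mult using E(2)[OF z] by (simp add: mult_left_le)
      with Wz have le': "norm (W z * E z) \<le> C / (1 - norm z)^M * exp (12 * v z - potential z / 12)" by linarith
      have "norm (h z) \<le> norm (W z * E z)^12"
        unfolding h_def norm_power by (intro power_decreasing N WE(2)[OF z]) simp
      also have "\<dots> \<le> (C / (1 - norm z)^M * exp (12 * v z - potential z / 12))^12" by (intro power_mono le') simp
      also have "\<dots> = C^12 / (1 - norm z)^(12 * M) * exp (144 * v z - potential z)"
      proof -
        have "exp (12 * v z - potential z / 12)^12 = exp (144 * v z - potential z)"
          unfolding exp_of_nat_mult[symmetric] by (simp add: algebra_simps)
        then show ?thesis by (simp add: power_mult_distrib power_divide power_mult[symmetric] mult.commute)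
      qed
      finally show ?thesis .
    qed
    then show ?thesis by blast
  qed
  then obtain C M where hdom: "\<And>z. norm z < 1 \<Longrightarrow> norm (h z) \<le> C / (1 - norm z)^M * exp (144 * v z - potential z)" by blast
  have order: "\<exists>q. q holomorphic_on ball 0 1 \<and> (\<forall>z. norm z < 1 \<longrightarrow> h z = (z - a)^m a * q z)" if a: "m a > n" for a
  proof -
    have "a \<in> {a. m a > 0}" using a by simp
    then have a1: "norm a < 1" using m unfolding blaschke_zeros_def by auto
    have "\<exists>q. q holomorphic_on ball 0 1 \<and> (\<forall>z. norm z < 1 \<longrightarrow> g z = (z - a)^m a * q z)"
    proof (rule factor_from_bound[OF g a1, where \<delta>="(1 - norm a)/2" and C="exp (12 * v a) / (1 - norm a)^m a"])
      fix z assume z: "norm z < 1" "norm (z - a) < (1 - norm a)/2"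
      have "norm (blaschke_product m z) \<le> norm (finite_blaschke m {a} z)"
        by (rule blaschke_product_le_finite[OF m z(1)]) (use a in auto)
      also have "\<dots> \<le> (norm (z - a) / (1 - norm a))^m a"
        by (simp add: norm_power) (intro power_mono norm_blaschke_factor_le a1 z norm_ge_zero)
      finally have 1: "norm (blaschke_product m z) \<le> norm (z - a)^m a / (1 - norm a)^m a" by (simp add: power_divide)
      have "v z \<le> 12 * v a" unfolding v_def by (rule v.herglotz_harnack(1)[OF a1 _ \<psi>0(2)]) (use z in simp)
      then have 2: "exp (v z - potential z) \<le> exp (12 * v a)" using potential_nonneg[OF z(1)] by simp
      have "norm (g z) \<le> norm (z - a)^m a / (1 - norm a)^m a * exp (12 * v a)"
        by (rule order_trans[OF ng[OF z(1)]], rule mult_mono[OF 1 2]) (use a1 in auto)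
      then show "norm (g z) \<le> exp (12 * v a) / (1 - norm a)^m a * norm (z - a)^m a" by (simp add: mult_ac)
    qed (use a1 in simp)
    then obtain q where q: "q holomorphic_on ball 0 1" "\<And>z. norm z < 1 \<Longrightarrow> g z = (z - a)^m a * q z" by blast
    obtain q' where q': "q' holomorphic_on ball 0 1" "\<And>z. norm z < 1 \<Longrightarrow> W z = (z - a)^(m a - n) * q' z"
      using diff_combo_factor[OF q less_imp_le[OF a] W] by blast
    (* With m a = n + 1 + d and N = n + 1 + e, the product (m a - n) * N exceeds m a by n * d + e * (d + 1). *)
    obtain d where d: "m a = Suc (n + d)" using a less_iff_Suc_add by auto
    obtain e where e: "N = Suc (n + e)" using N(2) less_iff_Suc_add by auto
    have Nm: "(m a - n) * N = m a + (n * d + e * Suc d)" by (simp add: d e algebra_simps)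
    show ?thesis
    proof (intro exI[of _ "\<lambda>z. (z - a)^(n * d + e * Suc d) * (q' z * E z)^N"] conjI allI impI)
      show "(\<lambda>z. (z - a)^(n * d + e * Suc d) * (q' z * E z)^N) holomorphic_on ball 0 1"
        by (intro holomorphic_intros q' E)
      fix z :: complex assume z: "norm z < 1"
      have "h z = ((z - a)^(m a - n))^N * (q' z * E z)^N"
        unfolding h_def q'(2)[OF z] by (simp add: power_mult_distrib)
      also have "((z - a)^(m a - n))^N = (z - a)^m a * (z - a)^(n * d + e * Suc d)"
        unfolding power_mult[symmetric] Nm power_add ..
      finally show "h z = (z - a)^m a * ((z - a)^(n * d + e * Suc d) * (q' z * E z)^N)" by (simp only: mult.assoc)
    qed
  qed
  (* Dividing g by a constant B \<ge> 1 makes it bounded by 1 and spoils none of its bounds. *)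
  obtain B0 where B0: "\<And>z. norm z < 1 \<Longrightarrow> norm (g z) \<le> B0"
    by (rule bounded_primitive[OF g A le]) (assumption, rule that)
  define B where "B = max 1 B0"
  have B: "1 \<le> B" "B0 \<le> B" by (auto simp: B_def)
  define gB where "gB = (\<lambda>z. g z / complex_of_real B)"
  have gB: "gB holomorphic_on ball 0 1" unfolding gB_def by (intro holomorphic_intros g) (use B in auto)
  have ngB: "norm (gB z) = norm (g z) / B" for z using B by (simp add: gB_def norm_divide)
  have gB1: "norm (gB z) \<le> 1" if "norm z < 1" for z
    unfolding ngB using B0[OF that] B by (simp add: pos_divide_le_eq)
  have divB: "x / B \<le> x" if "0 \<le> x" for x using that B by (simp add: pos_divide_le_eq mult_left_le mult_le_cancel_left1)
  have gBz1: "gB z1 \<noteq> 0" using z1 B by (simp add: gB_def)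
  have gBdom: "norm (gB z) \<le> exp (Re (herglotz circ cis \<psi>0 z) - potential z)" if "norm z < 1" for z
    unfolding ngB using divB[OF norm_ge_zero] dom[OF that] unfolding v_def by (rule order_trans)
  have gBle: "norm (deriv gB z) \<le> Re (A z)" if z: "norm z < 1" for z
  proof -
    have "g field_differentiable at z" using z by (intro holomorphic_on_imp_differentiable_at[OF g open_ball]) simp
    then have "(g has_field_derivative deriv g z) (at z)" by (simp add: DERIV_deriv_iff_field_differentiable)
    then have "deriv gB z = deriv g z / complex_of_real B" unfolding gB_def by (intro DERIV_imp_deriv DERIV_cdivide)
    then have "norm (deriv gB z) = norm (deriv g z) / B" using B by (simp add: norm_divide)
    also have "\<dots> \<le> norm (deriv g z)" by (rule divB) simp
    also have "\<dots> \<le> Re (A z)" by (rule le[OF z])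
    finally show ?thesis .
  qed
  define m' where "m' = (\<lambda>a. if m a > n then m a else 0)"
  have m': "blaschke_zeros m'" unfolding m'_def by (rule blaschke_zeros_restrict[OF m])
  obtain S :: "nat \<Rightarrow> complex set" where S: "\<And>k. finite (S k)" "\<And>k. S k \<subseteq> {a. m' a > 0}"
    "\<And>z. norm z < 1 \<Longrightarrow> (\<lambda>k. finite_blaschke m' (S k) z) \<longlonglongrightarrow> blaschke_product m' z"
    by (rule blaschke_zeros_exhaustion[OF m']) (rule that)
  have Sd: "S k \<subseteq> ball 0 1" for k using S(2)[of k] m' unfolding blaschke_zeros_def by blast
  have "\<forall>k. \<exists>q. q holomorphic_on ball 0 1 \<and> (\<forall>z. norm z < 1 \<longrightarrow> h z = finite_blaschke m' (S k) z * q z)"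
  proof (rule allI, rule factor_finite_blaschke[OF hh S(1) Sd])
    fix k a assume "a \<in> S k"
    then have "m' a > 0" using S(2) by blast
    then have "m a > n" "m' a = m a" by (auto simp: m'_def split: if_splits)
    then show "\<exists>q. q holomorphic_on ball 0 1 \<and> (\<forall>z. norm z < 1 \<longrightarrow> h z = (z - a)^m' a * q z)" using order by simp
  qed
  then obtain q where q: "\<And>k. q k holomorphic_on ball 0 1"
    "\<And>k z. norm z < 1 \<Longrightarrow> h z = finite_blaschke m' (S k) z * q k z" by metis
  have \<psi>h: "AE t in circ. norm (radial_limit h t) = exp (- \<psi> t)" using \<psi>(3) unfolding h_def .
  have qle: "norm (q k z) \<le> exp (- potential z - (LINT t|circ. poisson z (cis t) * \<psi> t))" if z: "norm z < 1" for k z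
  proof (rule key_estimate[OF \<psi>0(1,2) gB gB1 z1(1) gBz1 gBdom A gBle hh h1 _ _ \<psi>(1,2) \<psi>h q(1) q(2) _ z])
    show "norm (h z) \<le> C / (1 - norm z)^M * exp (144 * Re (herglotz circ cis \<psi>0 z) - potential z)" if "norm z < 1" for z
      using hdom[OF that] unfolding v_def .
    fix e :: real assume e: "e > 0"
    obtain r0 where r0: "r0 < 1" "\<And>z. r0 \<le> norm z \<Longrightarrow> norm z < 1 \<Longrightarrow> exp (- e) \<le> norm (finite_blaschke m' (S k) z)"
      using boundary_unimodular_finite_blaschke[OF Sd, of m' k] e unfolding boundary_unimodular_def by blast
    show "\<exists>r0<1. \<forall>r t. r0 \<le> r \<longrightarrow> r < 1 \<longrightarrow> exp (- e) \<le> norm (finite_blaschke m' (S k) (polar r t))"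
    proof (intro exI[of _ "max 0 r0"] conjI allI impI)
      fix r t assume "max 0 r0 \<le> r" "r < (1::real)"
      then show "exp (- e) \<le> norm (finite_blaschke m' (S k) (polar r t))"
        by (intro r0(2)) (auto simp: norm_mult)
    qed (use r0 in simp)
  qed auto
  define Q where "Q = (\<lambda>k z. q k z * exp (herglotz circ cis \<psi> z) * exp (herglotz \<mu> (\<lambda>\<zeta>. \<zeta>) (\<lambda>_. 1) z))"
  have Qh: "Q k holomorphic_on ball 0 1" for k
    unfolding Q_def by (intro holomorphic_intros q w.herglotz_holomorphic sd.herglotz_holomorphic)
  have Q1: "norm (Q k z) \<le> 1" if z: "norm z < 1" for k z
  proof -
    have "Re (herglotz circ cis \<psi> z) = (LINT t|circ. poisson z (cis t) * \<psi> t)"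
      unfolding w.Re_herglotz[OF z] by (simp only: mult.commute)
    then have "norm (Q k z) = norm (q k z) * (exp (LINT t|circ. poisson z (cis t) * \<psi> t) * exp (potential z))"
      by (simp add: Q_def norm_mult potential_def)
    also have "\<dots> \<le> exp (- potential z - (LINT t|circ. poisson z (cis t) * \<psi> t)) * (exp (LINT t|circ. poisson z (cis t) * \<psi> t) * exp (potential z))"
      by (intro mult_right_mono qle z) auto
    also have "\<dots> = 1" by (simp add: exp_add[symmetric])
    finally show ?thesis .
  qed
  define J where "J = (\<lambda>z. h z * exp (herglotz circ cis \<psi> z))"
  have Ji: "inner_function J" using J by (simp add: J_def h_def)
  have JQ: "J z = finite_blaschke m' (S k) z * singular_inner \<mu> z * Q k z" if z: "norm z < 1" for k z
    unfolding J_def q(2)[OF z, of k] Q_def singular_inner_eq by (simp add: exp_minus)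
  obtain Q\<^sub>0 r where Q\<^sub>0: "Q\<^sub>0 holomorphic_on ball 0 1" "strict_mono (r :: nat \<Rightarrow> nat)"
    "\<And>z. z \<in> ball 0 1 \<Longrightarrow> (\<lambda>k. Q (r k) z) \<longlonglongrightarrow> Q\<^sub>0 z"
  proof (rule Montel[of "ball 0 1" "range Q" Q])
    show "\<exists>B. \<forall>h\<in>range Q. \<forall>z\<in>X. norm (h z) \<le> B" if "compact X" "X \<subseteq> ball 0 1" for X
      using that Q1 by (intro exI[of _ 1]) auto
  qed (use Qh in auto)
  have Q01: "norm (Q\<^sub>0 z) \<le> 1" if z: "norm z < 1" for z
    by (rule LIMSEQ_le_const2[OF tendsto_norm[OF Q\<^sub>0(3)]]) (use z Q1 in auto)
  have JK: "J z = K z * Q\<^sub>0 z" if z: "norm z < 1" for z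
  proof -
    have "(\<lambda>k. finite_blaschke m' (S (r k)) z * singular_inner \<mu> z * Q (r k) z) \<longlonglongrightarrow> blaschke_product m' z * singular_inner \<mu> z * Q\<^sub>0 z"
      using LIMSEQ_subseq_LIMSEQ[OF S(3)[OF z] Q\<^sub>0(2)] Q\<^sub>0(3)[of z] z by (intro tendsto_mult tendsto_const) (auto simp: o_def)
    then have "(\<lambda>k::nat. J z) \<longlonglongrightarrow> blaschke_product m' z * singular_inner \<mu> z * Q\<^sub>0 z" unfolding JQ[OF z, symmetric] .
    then have "J z = blaschke_product m' z * singular_inner \<mu> z * Q\<^sub>0 z" by (simp add: LIMSEQ_const_iff)
    then show ?thesis unfolding K_eq[OF z] m'_def .
  qed
  have K1: "norm (K z) \<le> 1" if z: "norm z < 1" for z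
  proof -
    have "norm (blaschke_product m' z) \<le> 1" using blaschke_product_le_finite[OF m' z, of "{}"] by simp
    then have "norm (blaschke_product m' z) * exp (- potential z) \<le> 1 * 1"
      using potential_nonneg[OF z] by (intro mult_mono) auto
    then show ?thesis unfolding K_eq[OF z] m'_def[symmetric] norm_mult norm_singular_inner by simp
  qed
  have JQ0: "norm (J z) \<le> norm (Q\<^sub>0 z)" if z: "norm z < 1" for z
    unfolding JK[OF z] norm_mult using K1[OF z] by (intro mult_left_le_one_le) auto
  have Jb: "AE t in circ. \<exists>w. norm w = 1 \<and> ((\<lambda>r. J (polar r t)) \<longlongrightarrow> w) (at_left 1)"
    by (rule AE_lborel_imp_AE_circ) (use Ji in \<open>simp add: inner_function_def\<close>)
  have lQ: "AE t in circ. ((\<lambda>r. Q\<^sub>0 (polar r t)) \<longlongrightarrow> radial_limit Q\<^sub>0 t) (at_left 1)"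
    by (rule AE_radial_limit[OF Q\<^sub>0(1) Q01])
  have "inner_function Q\<^sub>0"
  proof (rule inner_functionI[OF Q\<^sub>0(1) Q01])
    show "AE t in circ. \<exists>w. norm w = 1 \<and> ((\<lambda>r. Q\<^sub>0 (polar r t)) \<longlongrightarrow> w) (at_left 1)"
      using Jb lQ
    proof eventually_elim
      case (elim t)
      then obtain x where x: "norm x = 1" "((\<lambda>r. J (polar r t)) \<longlongrightarrow> x) (at_left 1)" by blast
      have "norm x \<le> norm (radial_limit Q\<^sub>0 t)"
      proof (rule tendsto_le[OF _ tendsto_norm[OF elim(2)] tendsto_norm[OF x(2)]])
        show "\<forall>\<^sub>F r in at_left 1. norm (J (polar r t)) \<le> norm (Q\<^sub>0 (polar r t))"
          by (rule eventually_mono[OF eventually_at_left_real[OF zero_less_one]]) (auto intro!: JQ0 simp: norm_mult)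
      qed simp
      moreover have "norm (radial_limit Q\<^sub>0 t) \<le> 1" by (rule radial_limit_norm_le[OF elim(2) Q01])
      ultimately show ?case using elim(2) x(1) by (intro exI[of _ "radial_limit Q\<^sub>0 t"]) auto
    qed
  qed auto
  then show ?thesis unfolding inner_divides_def using JK by (intro exI[of _ Q\<^sub>0]) (auto simp: J_def h_def)
qed

theorem theorem4p1:
  fixes n :: nat and f :: "nat \<Rightarrow> complex \<Rightarrow> complex"
  assumes "n > 0"
    and "\<forall>j\<le>n. f j \<in> hardy1_deriv n"
    and "lin_indep_on_disk n f"
  shows "\<exists>J. inner_function J \<and>
    (\<forall>(l :: nat \<Rightarrow> complex) I K. (\<Sum>j\<le>n. norm (l j)) > 0 \<longrightarrow>
       is_inner_factor I (\<lambda>z. \<Sum>j\<le>n. l j * f j z) \<longrightarrow> is_inner_gt n I K \<longrightarrow>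
       inner_divides K J)"
proof -
  have f: "f j \<in> hardy1_deriv n" if "j \<le> n" for j using assms(2) that by blast
  have fh: "f j holomorphic_on ball 0 1" if "j \<le> n" for j using f[OF that] by (simp add: hardy1_deriv_def)
  obtain A where A: "A holomorphic_on ball 0 1"
    "\<And>j k z. j \<le> n \<Longrightarrow> k \<le> n \<Longrightarrow> norm z < 1 \<Longrightarrow> norm ((deriv ^^ k) (f j) z) \<le> Re (A z)"
    by (rule common_majorant[OF f]) (assumption, rule that)
  have deriv_f: "norm (deriv (f j) z) \<le> Re (A z)" if "j \<le> n" "norm z < 1" for j z
    using A(2)[OF that(1) _ that(2), of 1] assms(1) by simp
  let ?W = "iter_wronskian n f"
  obtain E where Wh: "?W holomorphic_on ball 0 1" and E: "E holomorphic_on ball 0 1" "\<And>z. E z \<noteq> 0" "\<And>z. norm z < 1 \<Longrightarrow> norm (E z) \<le> 1"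
    "\<And>z. norm z < 1 \<Longrightarrow> norm (?W z * E z) \<le> 1"
    by (rule bounded_wronskian_multiple[of n f A, OF fh A]) (assumption | rule that)+
  obtain z1 where z1: "norm z1 < 1" "?W z1 \<noteq> 0"
    using iter_wronskian_nonzero[OF fh assms(3)] by blast
  have pg: "poly_growth (f j)" if j: "j \<le> n" for j
  proof -
    obtain B where "\<And>z. norm z < 1 \<Longrightarrow> norm (f j z) \<le> B"
      by (rule bounded_primitive[OF fh[OF j] A(1) deriv_f[OF j]]) (assumption, rule that)
    then show ?thesis by (rule poly_growth_bounded[OF fh[OF j]])
  qed
  (* Above n for the multiplicities, and at least 12 for Harnack's constant. *)
  define N where "N = n + 12"
  define h where "h = (\<lambda>z. (?W z * E z)^N)"
  have hh: "h holomorphic_on ball 0 1" unfolding h_def by (intro holomorphic_intros Wh E)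
  have h1: "norm (h z) \<le> 1" if "norm z < 1" for z
    unfolding h_def norm_power by (intro power_le_one E(4) that) simp
  have hz1: "h z1 \<noteq> 0" using z1 E(2) by (simp add: h_def)
  obtain \<psi> where \<psi>: "integrable circ \<psi>" "\<And>t. \<psi> t \<ge> 0" "AE t in circ. norm (radial_limit h t) = exp (- \<psi> t)"
    "inner_function (\<lambda>z. h z * exp (herglotz circ cis \<psi> z))"
    by (rule inner_part[OF hh h1 z1(1) hz1]) (assumption, rule that)
  show ?thesis
  proof (intro exI conjI allI impI)
    show "inner_function (\<lambda>z. h z * exp (herglotz circ cis \<psi> z))" by (rule \<psi>(4))
    fix l :: "nat \<Rightarrow> complex" and I K
    define g where "g = (\<lambda>z. \<Sum>j\<le>n. l j * f j z)"
    assume l: "(\<Sum>j\<le>n. norm (l j)) > 0"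
    assume "is_inner_factor I (\<lambda>z. \<Sum>j\<le>n. l j * f j z)"
    then have I: "is_inner_factor I g" unfolding g_def .
    assume K: "is_inner_gt n I K"
    have gh: "g holomorphic_on ball 0 1" unfolding g_def by (intro holomorphic_intros fh) auto
    have lj: "\<exists>j\<le>n. l j \<noteq> 0"
    proof (rule ccontr)
      assume "\<not> (\<exists>j\<le>n. l j \<noteq> 0)"
      then show False using l by simp
    qed
    then obtain z2 where z2: "norm z2 < 1" "g z2 \<noteq> 0"
      using assms(3) unfolding lin_indep_on_disk_def g_def by (metis mem_ball_0)
    define L where "L = (\<Sum>j\<le>n. norm (l j))"
    have gle: "norm (deriv g z) \<le> Re (complex_of_real L * A z)" if z: "norm z < 1" for z
    proof -
      have "(f j has_field_derivative deriv (f j) z) (at z)" if "j \<le> n" for j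
        using holomorphic_on_imp_differentiable_at[OF fh[OF that] open_ball, of z] z
        by (simp add: DERIV_deriv_iff_field_differentiable)
      then have "(g has_field_derivative (\<Sum>j\<le>n. l j * deriv (f j) z)) (at z)"
        unfolding g_def by (intro DERIV_sum DERIV_cmult) auto
      then have "norm (deriv g z) \<le> (\<Sum>j\<le>n. norm (l j * deriv (f j) z))" by (simp add: DERIV_imp_deriv norm_sum)
      also have "\<dots> \<le> (\<Sum>j\<le>n. norm (l j) * Re (A z))"
        unfolding norm_mult by (intro sum_mono mult_left_mono deriv_f z) auto
      also have "\<dots> = Re (complex_of_real L * A z)" by (simp add: L_def sum_distrib_right)
      finally show ?thesis .
    qed
    have dc: "diff_combo g n ?W" by (rule iter_wronskian_combo[where f=f and l=l and g=g, OF pg _ lj gh]) (assumption | rule fun_cong[OF g_def])+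
    show "inner_divides K (\<lambda>z. h z * exp (herglotz circ cis \<psi> z))"
      unfolding h_def
      by (rule inner_gt_divides[where A="\<lambda>z. complex_of_real L * A z", OF gh _ gle z2 I K dc E(1,3) Wh E(4) _ _ \<psi>(1,2) \<psi>(3)[unfolded h_def] \<psi>(4)[unfolded h_def]])
         (auto simp: N_def intro!: holomorphic_intros A)
  qed
qed

end
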